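(* Let $\mathbb K\in\{\mathbb R,\mathbb C\}$ and let $X$ be a $\mathbb K$-Banach space with $\dim_{\mathbb K}X>1$. (a) The $\mathbb K$-Banach submanifold $\mathcal I(X)$ of $\mathcal L(X)$ can be identified with a disjoint union of homogeneous spaces of the form $GL(X)/GL(X)^Q$ for some $Q\in\mathcal I(X)$, via the maps $\Sigma_Q:GL(X)/GL(X)^Q\to\mathcal I(X)$ given by $\Sigma_Q([W]_Q):=WQW^{-1}$. (b) The $\mathbb K$-Banach manifold $\mathscr G(X)$ can be identified with a disjoint union of homogeneous spaces of the form $GL(X)/GL(X)^E$ for some $E\in\mathscr G(X)$, via the maps $\Sigma^E:GL(X)/GL(X)^E\to\mathscr G(X)$ given by $\Sigma^E([W]_E):=W(E)$. (c) Let $Q\in\mathcal I(X)$. The assignment $\upsilon_0:[W]_Q\mapsto[W]_{Q(X)}$ is a well-defined $\mathbb K$-analytic map from $GL(X)/GL(X)^Q$ to $GL(X)/GL(X)^{Q(X)}$ such that $\kappa\circ\Sigma_Q=\Sigma^{Q(X)}\circ\upsilon_0$.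
   Context: $\mathcal L(X,Y)$ is the Banach space of bounded $\mathbb K$-linear operators, $\mathcal L(X)=\mathcal L(X,X)$, and $GL(X)$ is the Banach Lie group of invertible elements of $\mathcal L(X)$. $\mathscr G(X)$ is the set of all non-zero proper closed complemented subspaces of $X$. For $F\in\mathscr G(X)$, $\mathcal C_F$ is the set of closed complements of $F$ in $X$. For $E\in\mathcal C_F$ the map $q_{E,F}:\mathcal L(E,F)\to\mathcal C_F$, $q_{E,F}(T)=(I+T)(E)$, is a bijection with inverse $p_{E,F}$. $\mathscr G(X)$ carries a Hausdorff metrizable topology in which each $\mathcal C_F$ is open and each $p_{E,F}$ is a homeomorphism, and the charts $(\mathcal C_F,p_{E,F},\mathcal L(E,F))$ form a $\mathbb K$-analytic atlas for $\mathscr G(X)$. $\mathcal I(X)=\{Q\in\mathcal L(X)\setminus\{0,I\}:Q^2=Q\}$, with the $\mathbb K$-analytic Banach submanifold structure induced from $\mathcal L(X)$, and $\kappa:\mathcal I(X)\to\mathscr G(X)$ is $\kappa(Q)=Q(X)$. For $Q\in\mathcal I(X)$ and $E\in\mathscr G(X)$, $GL(X)^Q:=\{W\in GL(X):WQW^{-1}=Q\}$ and $GL(X)^E:=\{W\in GL(X):W(E)=E\}$ (these are Banach Lie subgroups, and the quotients carry the usual analytic homogeneous space structure); $[W]_Q$ and $[W]_E$ denote the images of $W\in GL(X)$ in $GL(X)/GL(X)^Q$ and $GL(X)/GL(X)^E$. "Identified with a disjoint union via the maps $\Sigma$" means: choosing one representative in each $GL(X)$-orbit (for the actions $Q\mapsto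 WQW^{-1}$, resp. $E\mapsto W(E)$), the corresponding maps $\Sigma$ are $\mathbb K$-bi-analytic onto the orbits, which are clopen and partition the manifold. *)

theory Defs
  imports "HOL-Analysis.Analysis"
begin

section \<open>Banach spaces over \<open>\<K>\<close>\<close>

(* The scalar field is a type of sort {real_normed_field, banach}: a complete normed field over the
   reals with multiplicative norm.  Both real and complex are instances and, by Gelfand-Mazur, every
   instance is isometrically isomorphic to one of them.  The real scalar multiplication that 'x
   carries as a type is the restriction of sc. *)

locale banach_space_over = vector_space sc
  for sc :: "'k::{real_normed_field,banach} \<Rightarrow> 'x::banach \<Rightarrow> 'x" +
  assumes norm_scale: "norm (sc a x) = norm a * norm x"
    and scale_of_real: "sc (of_real r) x = r *\<^sub>R x"

text \<open>
  Functions with \<open>\<parallel>f x\<parallel> \<le> C \<parallel>x\<parallel>\<close>, normed by the operator norm.  This type only serves to hold the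
  spaces \<open>\<L>(E,F)\<close> for subspaces \<open>E\<close> and \<open>F\<close>, which are not types: an operator on \<open>E\<close> is
  extended by zero outside \<open>E\<close>, which does not change its norm.
\<close>

typedef (overloaded) ('a, 'b) lbfun =
  "{f :: 'a::real_normed_vector \<Rightarrow> 'b::real_normed_vector. \<exists>C. \<forall>x. norm (f x) \<le> C * norm x}"
  morphisms lbfun_apply Lbfun
  by (rule exI[of _ "\<lambda>x. 0"]) (auto intro: exI[of _ 0])

setup_lifting type_definition_lbfun

lemma lbfun_bdd_above:
  assumes "\<forall>x. norm (f x) \<le> C * norm x"
  shows "bdd_above (range (\<lambda>x. norm (f x) / norm x))"
proof (rule bdd_aboveI2)
  fix x show "norm (f x) / norm x \<le> \<bar>C\<bar>"
  proof (cases "x = 0")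
    case False
    then show ?thesis
      using assms[rule_format, of x]
      by (simp add: divide_le_eq) (smt (verit) mult_right_mono norm_ge_zero)
  qed simp
qed

lemma lbfun_onorm:
  assumes "\<exists>C. \<forall>x. norm (f x) \<le> C * norm x"
  shows "norm (f x) \<le> onorm f * norm x"
proof -
  obtain C where C: "\<forall>x. norm (f x) \<le> C * norm x" using assms by blast
  show ?thesis
  proof (cases "x = 0")
    case True
    then show ?thesis using C[rule_format, of x] by simp
  next
    case False
    have "norm (f x) / norm x \<le> onorm f"
      unfolding onorm_def by (rule cSUP_upper[OF _ lbfun_bdd_above[OF C]]) simp
    then show ?thesis using False by (simp add: divide_le_eq)
  qed
qed

lemma onorm_nonneg_le:
  assumes "0 \<le> C" "\<And>x. norm (f x) \<le> C * norm x"
  shows "onorm f \<le> C"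
  unfolding onorm_def
proof (rule cSUP_least)
  fix x show "norm (f x) / norm x \<le> C"
    using assms(1) assms(2)[of x] by (cases "x = 0") (auto simp: divide_le_eq)
qed simp

lemma onorm_nonneg:
  assumes "\<exists>C. \<forall>x. norm (f x) \<le> C * norm x"
  shows "0 \<le> onorm f"
proof -
  obtain C where C: "\<forall>x. norm (f x) \<le> C * norm x" using assms by blast
  have "norm (f 0) / norm (0::'a) \<le> onorm f"
    unfolding onorm_def by (rule cSUP_upper[OF _ lbfun_bdd_above[OF C]]) simp
  then show ?thesis by simp
qed

instantiation lbfun :: (real_normed_vector, real_normed_vector) real_normed_vector
begin

lift_definition norm_lbfun :: "('a, 'b) lbfun \<Rightarrow> real" is onorm .

lift_definition zero_lbfun :: "('a, 'b) lbfun" is "\<lambda>x. 0"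
  by (auto intro: exI[of _ 0])

lift_definition uminus_lbfun :: "('a, 'b) lbfun \<Rightarrow> ('a, 'b) lbfun" is "\<lambda>f x. - f x"
  by simp

lift_definition plus_lbfun :: "('a, 'b) lbfun \<Rightarrow> ('a, 'b) lbfun \<Rightarrow> ('a, 'b) lbfun"
  is "\<lambda>f g x. f x + g x"
proof -
  fix f g :: "'a \<Rightarrow> 'b"
  assume "\<exists>C. \<forall>x. norm (f x) \<le> C * norm x" "\<exists>C. \<forall>x. norm (g x) \<le> C * norm x"
  then obtain C D where "\<forall>x. norm (f x) \<le> C * norm x" "\<forall>x. norm (g x) \<le> D * norm x" by blast
  then have "\<forall>x. norm (f x + g x) \<le> (C + D) * norm x"
    by (auto simp: distrib_right intro: norm_triangle_le add_mono)
  then show "\<exists>C. \<forall>x. norm (f x + g x) \<le> C * norm x" ..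
qed

lift_definition scaleR_lbfun :: "real \<Rightarrow> ('a, 'b) lbfun \<Rightarrow> ('a, 'b) lbfun"
  is "\<lambda>r f x. r *\<^sub>R f x"
proof -
  fix r and f :: "'a \<Rightarrow> 'b"
  assume "\<exists>C. \<forall>x. norm (f x) \<le> C * norm x"
  then obtain C where "\<forall>x. norm (f x) \<le> C * norm x" by blast
  then have "\<forall>x. norm (r *\<^sub>R f x) \<le> (\<bar>r\<bar> * C) * norm x"
    by (simp add: mult.assoc mult_left_mono)
  then show "\<exists>C. \<forall>x. norm (r *\<^sub>R f x) \<le> C * norm x" ..
qed

definition minus_lbfun :: "('a, 'b) lbfun \<Rightarrow> ('a, 'b) lbfun \<Rightarrow> ('a, 'b) lbfun"
  where "minus_lbfun f g = f + - g"

definition dist_lbfun :: "('a, 'b) lbfun \<Rightarrow> ('a, 'b) lbfun \<Rightarrow> real"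
  where "dist_lbfun f g = norm (f - g)"

definition sgn_lbfun :: "('a, 'b) lbfun \<Rightarrow> ('a, 'b) lbfun"
  where "sgn_lbfun f = scaleR (inverse (norm f)) f"

definition [code del]:
  "(uniformity :: (('a, 'b) lbfun \<times> ('a, 'b) lbfun) filter) =
    (INF e\<in>{0<..}. principal {(x, y). dist x y < e})"

definition open_lbfun :: "('a, 'b) lbfun set \<Rightarrow> bool"
  where [code del]: "open_lbfun S =
    (\<forall>x\<in>S. \<forall>\<^sub>F (x', y) in uniformity. x' = x \<longrightarrow> y \<in> S)"

instance
proof
  fix f g h :: "('a, 'b) lbfun" and r s :: real
  show "f - g = f + - g" by (rule minus_lbfun_def)
  show "f + g + h = f + (g + h)" by transfer (simp add: add.assoc)
  show "f + g = g + f" by transfer (simp add: add.commute)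
  show "0 + f = f" by transfer simp
  show "- f + f = 0" by transfer simp
  show "r *\<^sub>R (f + g) = r *\<^sub>R f + r *\<^sub>R g" by transfer (simp add: scaleR_add_right)
  show "(r + s) *\<^sub>R f = r *\<^sub>R f + s *\<^sub>R f" by transfer (simp add: scaleR_add_left)
  show "r *\<^sub>R s *\<^sub>R f = (r * s) *\<^sub>R f" by transfer simp
  show "1 *\<^sub>R f = f" by transfer simp
  show "dist f g = norm (f - g)" by (rule dist_lbfun_def)
  show "sgn f = inverse (norm f) *\<^sub>R f" by (rule sgn_lbfun_def)
  show "(uniformity :: (('a, 'b) lbfun \<times> ('a, 'b) lbfun) filter) =
    (INF e\<in>{0<..}. principal {(x, y). dist x y < e})" by (rule uniformity_lbfun_def)
  show "open S = (\<forall>x\<in>S. \<forall>\<^sub>F (x', y) in uniformity. x' = x \<longrightarrow> y \<in> S)"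
    for S :: "('a, 'b) lbfun set" by (rule open_lbfun_def)
  show "(norm f = 0) = (f = 0)"
  proof
    assume "norm f = 0"
    then show "f = 0"
    proof transfer
      fix f :: "'a \<Rightarrow> 'b"
      assume "\<exists>C. \<forall>x. norm (f x) \<le> C * norm x" "onorm f = 0"
      then show "f = (\<lambda>x. 0)" using lbfun_onorm[of f] by auto
    qed
  next
    assume "f = 0"
    then show "norm f = 0" by transfer (simp add: onorm_zero)
  qed
  show "norm (f + g) \<le> norm f + norm g"
  proof transfer
    fix f g :: "'a \<Rightarrow> 'b"
    assume f: "\<exists>C. \<forall>x. norm (f x) \<le> C * norm x" and g: "\<exists>C. \<forall>x. norm (g x) \<le> C * norm x"
    show "onorm (\<lambda>x. f x + g x) \<le> onorm f + onorm g"
    proof (rule onorm_nonneg_le)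
      show "0 \<le> onorm f + onorm g" using onorm_nonneg[OF f] onorm_nonneg[OF g] by simp
      show "norm (f x + g x) \<le> (onorm f + onorm g) * norm x" for x
        using lbfun_onorm[OF f, of x] lbfun_onorm[OF g, of x]
        by (auto simp: distrib_right intro: norm_triangle_le)
    qed
  qed
  show "norm (r *\<^sub>R f) = \<bar>r\<bar> * norm f"
  proof transfer
    fix r and f :: "'a \<Rightarrow> 'b"
    assume f: "\<exists>C. \<forall>x. norm (f x) \<le> C * norm x"
    have le: "onorm (\<lambda>x. r *\<^sub>R g x) \<le> \<bar>r\<bar> * onorm g"
      if g: "\<exists>C. \<forall>x. norm (g x) \<le> C * norm x" for r and g :: "'a \<Rightarrow> 'b"
      by (rule onorm_nonneg_le)
        (use onorm_nonneg[OF g] lbfun_onorm[OF g] in \<open>auto simp: mult.assoc intro: mult_left_mono\<close>)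
    show "onorm (\<lambda>x. r *\<^sub>R f x) = \<bar>r\<bar> * onorm f"
    proof (cases "r = 0")
      case True
      then show ?thesis by (simp add: onorm_zero)
    next
      case False
      obtain C where C: "\<forall>x. norm (f x) \<le> C * norm x" using f by blast
      have "\<forall>x. norm (r *\<^sub>R f x) \<le> (\<bar>r\<bar> * C) * norm x"
        using C by (simp add: mult.assoc mult_left_mono)
      then have "onorm (\<lambda>x. inverse r *\<^sub>R r *\<^sub>R f x) \<le> \<bar>inverse r\<bar> * onorm (\<lambda>x. r *\<^sub>R f x)"
        by (intro le) blast
      then have "onorm f \<le> inverse \<bar>r\<bar> * onorm (\<lambda>x. r *\<^sub>R f x)"
        using False by simp
      then have "\<bar>r\<bar> * onorm f \<le> onorm (\<lambda>x. r *\<^sub>R f x)"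
        using False by (simp add: field_simps)
      then show ?thesis using le[OF f, of r] by simp
    qed
  qed
qed

end

definition scale_lbfun :: "('k \<Rightarrow> 'b \<Rightarrow> 'b) \<Rightarrow> 'k \<Rightarrow> ('a::real_normed_vector, 'b::real_normed_vector) lbfun \<Rightarrow> ('a, 'b) lbfun"
  where "scale_lbfun sc a T = Lbfun (\<lambda>x. sc a (lbfun_apply T x))"

definition scale_blinfun :: "('k \<Rightarrow> 'b \<Rightarrow> 'b) \<Rightarrow> 'k \<Rightarrow> ('a::real_normed_vector \<Rightarrow>\<^sub>L 'b::real_normed_vector) \<Rightarrow> ('a \<Rightarrow>\<^sub>L 'b)"
  where "scale_blinfun sc a T = Blinfun (\<lambda>x. sc a (blinfun_apply T x))"

definition banach_subspace ::
    "('k::comm_ring_1 \<Rightarrow> 'v::real_normed_vector \<Rightarrow> 'v) \<Rightarrow> 'v set \<Rightarrow> bool"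
  where "banach_subspace s V \<longleftrightarrow> module.subspace s V \<and> complete V"

section \<open>Analytic maps between Banach spaces\<close>

(* V^n is the set of lists of length n over V. *)

definition multilinear_on ::
    "('k \<Rightarrow> 'v \<Rightarrow> 'v) \<Rightarrow> 'v::real_normed_vector set \<Rightarrow>
     ('k \<Rightarrow> 'w \<Rightarrow> 'w) \<Rightarrow> 'w::real_normed_vector set \<Rightarrow> nat \<Rightarrow> ('v list \<Rightarrow> 'w) \<Rightarrow> bool"
  where "multilinear_on s V s' V' n A \<longleftrightarrow>
    (\<forall>hs\<in>lists V. length hs = n \<longrightarrow>
       A hs \<in> V' \<and>
       (\<forall>i<n. \<forall>x\<in>V. \<forall>y\<in>V. A (hs[i := x + y]) = A (hs[i := x]) + A (hs[i := y])) \<and>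
       (\<forall>i<n. \<forall>a. \<forall>x\<in>V. A (hs[i := s a x]) = s' a (A (hs[i := x]))))"

text \<open>
  \<open>f\<close> is analytic on \<open>U\<close>, an open subset of \<open>V\<close>, with values in \<open>V'\<close>: near each point \<open>x\<close> of \<open>U\<close>,
  \<open>f (x + h) = \<Sum>n. A n (h, \<dots>, h)\<close> with continuous multilinear \<open>A n\<close> such that
  \<open>\<parallel>A n\<parallel> * r ^ n\<close> is bounded in \<open>n\<close>.  Openness of \<open>U\<close> in \<open>V\<close> is part of the definition.
\<close>

definition analytic_between ::
    "('k \<Rightarrow> 'v \<Rightarrow> 'v) \<Rightarrow> 'v::real_normed_vector set \<Rightarrow>
     ('k \<Rightarrow> 'w \<Rightarrow> 'w) \<Rightarrow> 'w::real_normed_vector set \<Rightarrow> 'v set \<Rightarrow> ('v \<Rightarrow> 'w) \<Rightarrow> bool"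
  where "analytic_between s V s' V' U f \<longleftrightarrow>
    U \<subseteq> V \<and> f ` U \<subseteq> V' \<and>
    (\<forall>x\<in>U. \<exists>r>0. \<exists>C A.
       (\<forall>n. multilinear_on s V s' V' n (A n)) \<and>
       (\<forall>n. \<forall>hs\<in>lists V. length hs = n \<longrightarrow>
          norm (A n hs) * r ^ n \<le> C * prod_list (map norm hs)) \<and>
       (\<forall>h\<in>V. norm h < r \<longrightarrow> x + h \<in> U \<and> (\<lambda>n. A n (replicate n h)) sums f (x + h)))"

section \<open>Analytic Banach manifolds\<close>

text \<open>
  A chart is a triple of its domain, the chart map and its model space, a complete subspace of the
  type \<open>'v\<close>.  The model spaces of different charts may differ.
\<close>

type_synonym ('m, 'v) chart = "'m set \<times> ('m \<Rightarrow> 'v) \<times> 'v set"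

record ('m, 'k, 'v) mfd =
  mtop :: "'m topology"
  mscale :: "'k \<Rightarrow> 'v \<Rightarrow> 'v"
  atlas :: "('m, 'v) chart set"

definition banach_manifold ::
    "('m, 'k::comm_ring_1, 'v::real_normed_vector) mfd \<Rightarrow> bool"
  where "banach_manifold M \<longleftrightarrow>
    Hausdorff_space (mtop M) \<and>
    (\<forall>(U, \<phi>, V)\<in>atlas M.
       openin (mtop M) U \<and> banach_subspace (mscale M) V \<and> openin (top_of_set V) (\<phi> ` U) \<and>
       homeomorphic_map (subtopology (mtop M) U) (top_of_set (\<phi> ` U)) \<phi>) \<and>
    (\<Union>(U, \<phi>, V)\<in>atlas M. U) = topspace (mtop M) \<and>
    (\<forall>(U, \<phi>, V)\<in>atlas M. \<forall>(U', \<psi>, V')\<in>atlas M.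
       analytic_between (mscale M) V (mscale M) V' (\<phi> ` (U \<inter> U')) (\<psi> \<circ> inv_into U \<phi>))"

definition analytic_map ::
    "('m, 'k::comm_ring_1, 'v::real_normed_vector) mfd \<Rightarrow>
     ('n, 'k, 'w::real_normed_vector) mfd \<Rightarrow> ('m \<Rightarrow> 'n) \<Rightarrow> bool"
  where "analytic_map M N f \<longleftrightarrow>
    banach_manifold M \<and> banach_manifold N \<and> continuous_map (mtop M) (mtop N) f \<and>
    (\<forall>(U, \<phi>, V)\<in>atlas M. \<forall>(U', \<psi>, V')\<in>atlas N.
       analytic_between (mscale M) V (mscale N) V' (\<phi> ` (U \<inter> f -` U')) (\<psi> \<circ> f \<circ> inv_into U \<phi>))"

definition bianalytic ::
    "('m, 'k::comm_ring_1, 'v::real_normed_vector) mfd \<Rightarrow>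
     ('n, 'k, 'w::real_normed_vector) mfd \<Rightarrow> ('m \<Rightarrow> 'n) \<Rightarrow> bool"
  where "bianalytic M N f \<longleftrightarrow>
    bij_betw f (topspace (mtop M)) (topspace (mtop N)) \<and> analytic_map M N f \<and>
    analytic_map N M (inv_into (topspace (mtop M)) f)"

definition open_submanifold :: "('m, 'k, 'v) mfd \<Rightarrow> 'm set \<Rightarrow> ('m, 'k, 'v) mfd"
  where "open_submanifold M S =
    \<lparr> mtop = subtopology (mtop M) S, mscale = mscale M,
      atlas = {(U \<inter> S, \<phi>, V) | U \<phi> V. (U, \<phi>, V) \<in> atlas M} \<rparr>"

text \<open>
  The structure induced on a subset \<open>S\<close> by a Banach space \<open>B\<close>: its charts are the restrictions of
  those bi-analytic maps \<open>\<phi>\<close> between open subsets of \<open>B\<close> that carry \<open>S\<close> locally to a complemented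
  closed subspace \<open>V\<close>.  Thus \<open>S\<close> is a (split) submanifold of \<open>B\<close> iff \<^const>\<open>banach_manifold\<close>
  holds of the result.
\<close>

definition induced_submanifold ::
    "('k::comm_ring_1 \<Rightarrow> 'v \<Rightarrow> 'v) \<Rightarrow> 'v::real_normed_vector set \<Rightarrow> 'v set \<Rightarrow> ('v, 'k, 'v) mfd"
  where "induced_submanifold s B S =
    \<lparr> mtop = top_of_set S, mscale = s,
      atlas = {(U \<inter> S, \<phi>, V) | U \<phi> V.
        inj_on \<phi> U \<and> analytic_between s B s B U \<phi> \<and>
        analytic_between s B s B (\<phi> ` U) (inv_into U \<phi>) \<and>
        banach_subspace s V \<and>
        (\<exists>V'. banach_subspace s V' \<and> V \<inter> V' = {0} \<and> {v + v' | v v'. v \<in> V \<and> v' \<in> V'} = B) \<and>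
        \<phi> ` (U \<inter> S) = \<phi> ` U \<inter> V} \<rparr>"

section \<open>\<open>\<L>(X)\<close>, \<open>GL(X)\<close> and its homogeneous spaces\<close>

definition LX :: "('k \<Rightarrow> 'x \<Rightarrow> 'x) \<Rightarrow> ('x::real_normed_vector \<Rightarrow>\<^sub>L 'x) set"
  where "LX sc = {T. \<forall>a x. blinfun_apply T (sc a x) = sc a (blinfun_apply T x)}"

definition GL :: "('k \<Rightarrow> 'x \<Rightarrow> 'x) \<Rightarrow> ('x::real_normed_vector \<Rightarrow>\<^sub>L 'x) set"
  where "GL sc =
    {W \<in> LX sc. \<exists>V\<in>LX sc. W o\<^sub>L V = id_blinfun \<and> V o\<^sub>L W = id_blinfun}"

definition op_inv :: "('x::real_normed_vector \<Rightarrow>\<^sub>L 'x) \<Rightarrow> ('x \<Rightarrow>\<^sub>L 'x)"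
  where "op_inv W = (THE V. W o\<^sub>L V = id_blinfun \<and> V o\<^sub>L W = id_blinfun)"

definition lcoset :: "('x::real_normed_vector \<Rightarrow>\<^sub>L 'x) \<Rightarrow> ('x \<Rightarrow>\<^sub>L 'x) set \<Rightarrow> ('x \<Rightarrow>\<^sub>L 'x) set"
  where "lcoset W H = (\<lambda>S. W o\<^sub>L S) ` H"

definition lcosets :: "('k \<Rightarrow> 'x \<Rightarrow> 'x) \<Rightarrow> ('x::real_normed_vector \<Rightarrow>\<^sub>L 'x) set \<Rightarrow> ('x \<Rightarrow>\<^sub>L 'x) set set"
  where "lcosets sc H = (\<lambda>W. lcoset W H) ` GL sc"

definition quotient_topology ::
    "('k \<Rightarrow> 'x \<Rightarrow> 'x) \<Rightarrow> ('x::real_normed_vector \<Rightarrow>\<^sub>L 'x) set \<Rightarrow> ('x \<Rightarrow>\<^sub>L 'x) set topology"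
  where "quotient_topology sc H = topology (\<lambda>U. U \<subseteq> lcosets sc H \<and>
    openin (top_of_set (GL sc)) {W \<in> GL sc. lcoset W H \<in> U})"

text \<open>
  \<open>GL(X)/H\<close> carries the unique analytic structure for which the projection \<open>W \<mapsto> [W]\<close> is an analytic
  submersion, i.e. is analytic and has an analytic local section through every \<open>W\<close>.  The atlas
  consists of all charts for which this is true; any two of them are compatible, because a change
  of charts is locally the composition of \<open>\<psi> [_]\<close> with a section.
\<close>

definition homogeneous_space ::
    "('k::comm_ring_1 \<Rightarrow> 'x \<Rightarrow> 'x) \<Rightarrow> ('x::real_normed_vector \<Rightarrow>\<^sub>L 'x) set \<Rightarrow>
     (('x \<Rightarrow>\<^sub>L 'x) set, 'k, 'x \<Rightarrow>\<^sub>L 'x) mfd"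
  where "homogeneous_space sc H =
    \<lparr> mtop = quotient_topology sc H, mscale = scale_blinfun sc,
      atlas = {(U, \<phi>, V).
        openin (quotient_topology sc H) U \<and>
        V \<subseteq> LX sc \<and> banach_subspace (scale_blinfun sc) V \<and>
        inj_on \<phi> U \<and> openin (top_of_set V) (\<phi> ` U) \<and>
        analytic_between (scale_blinfun sc) (LX sc) (scale_blinfun sc) V
          {W \<in> GL sc. lcoset W H \<in> U} (\<lambda>W. \<phi> (lcoset W H)) \<and>
        (\<forall>W\<in>GL sc. lcoset W H \<in> U \<longrightarrow>
          (\<exists>N \<sigma>. \<phi> (lcoset W H) \<in> N \<and> N \<subseteq> \<phi> ` U \<and> \<sigma> (\<phi> (lcoset W H)) = W \<and>
             analytic_between (scale_blinfun sc) V (scale_blinfun sc) (LX sc) N \<sigma> \<and>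
             (\<forall>v\<in>N. \<sigma> v \<in> GL sc \<and> lcoset (\<sigma> v) H \<in> U \<and> \<phi> (lcoset (\<sigma> v) H) = v)))} \<rparr>"

section \<open>Idempotents and complemented subspaces\<close>

definition idempotents :: "('k \<Rightarrow> 'x \<Rightarrow> 'x) \<Rightarrow> ('x::real_normed_vector \<Rightarrow>\<^sub>L 'x) set"
  where "idempotents sc = {Q \<in> LX sc. Q \<noteq> 0 \<and> Q \<noteq> id_blinfun \<and> Q o\<^sub>L Q = Q}"

definition idempotent_manifold ::
    "('k::comm_ring_1 \<Rightarrow> 'x \<Rightarrow> 'x) \<Rightarrow> ('x::real_normed_vector \<Rightarrow>\<^sub>L 'x, 'k, 'x \<Rightarrow>\<^sub>L 'x) mfd"
  where "idempotent_manifold sc =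
    induced_submanifold (scale_blinfun sc) (LX sc) (idempotents sc)"

definition complements ::
    "('k::comm_ring_1 \<Rightarrow> 'x \<Rightarrow> 'x) \<Rightarrow> 'x::real_normed_vector set \<Rightarrow> 'x set set"
  where "complements sc F =
    {E. module.subspace sc E \<and> closed E \<and> E \<inter> F = {0} \<and> {e + f | e f. e \<in> E \<and> f \<in> F} = UNIV}"

definition grassmannian ::
    "('k::comm_ring_1 \<Rightarrow> 'x \<Rightarrow> 'x) \<Rightarrow> 'x::real_normed_vector set set"
  where "grassmannian sc =
    {E. module.subspace sc E \<and> closed E \<and> E \<noteq> {0} \<and> E \<noteq> UNIV \<and> complements sc E \<noteq> {}}"

definition Lop ::
    "('k \<Rightarrow> 'x \<Rightarrow> 'x) \<Rightarrow> 'x set \<Rightarrow> 'x set \<Rightarrow> ('x::real_normed_vector, 'x) lbfun set"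
  where "Lop sc E F = {T.
    (\<forall>x\<in>E. lbfun_apply T x \<in> F) \<and>
    (\<forall>x\<in>E. \<forall>y\<in>E. lbfun_apply T (x + y) = lbfun_apply T x + lbfun_apply T y) \<and>
    (\<forall>a. \<forall>x\<in>E. lbfun_apply T (sc a x) = sc a (lbfun_apply T x)) \<and>
    (\<forall>x. x \<notin> E \<longrightarrow> lbfun_apply T x = 0)}"

definition q_chart :: "'x set \<Rightarrow> ('x::real_normed_vector, 'x) lbfun \<Rightarrow> 'x set"
  where "q_chart E T = (\<lambda>x. x + lbfun_apply T x) ` E"

definition p_chart ::
    "('k \<Rightarrow> 'x \<Rightarrow> 'x) \<Rightarrow> 'x set \<Rightarrow> 'x set \<Rightarrow> 'x set \<Rightarrow> ('x::real_normed_vector, 'x) lbfun"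
  where "p_chart sc E F = inv_into (Lop sc E F) (q_chart E)"

text \<open>
  The topology for which all \<open>\<C>\<^sub>F\<close> are open and all \<open>p\<^sub>E\<^sub>,\<^sub>F\<close> are homeomorphisms is the final topology
  with respect to all \<open>q\<^sub>E\<^sub>,\<^sub>F\<close>.
\<close>

definition grassmannian_topology ::
    "('k::comm_ring_1 \<Rightarrow> 'x \<Rightarrow> 'x) \<Rightarrow> 'x::real_normed_vector set topology"
  where "grassmannian_topology sc = topology (\<lambda>U. U \<subseteq> grassmannian sc \<and>
    (\<forall>F\<in>grassmannian sc. \<forall>E\<in>complements sc F.
       openin (top_of_set (Lop sc E F)) {T \<in> Lop sc E F. q_chart E T \<in> U}))"

definition grassmannian_manifold ::
    "('k::comm_ring_1 \<Rightarrow> 'x \<Rightarrow> 'x) \<Rightarrow> ('x::real_normed_vector set, 'k, ('x, 'x) lbfun) mfd"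
  where "grassmannian_manifold sc =
    \<lparr> mtop = grassmannian_topology sc, mscale = scale_lbfun sc,
      atlas = {(complements sc F, p_chart sc E F, Lop sc E F) | E F.
        F \<in> grassmannian sc \<and> E \<in> complements sc F} \<rparr>"

definition kappa :: "('x::real_normed_vector \<Rightarrow>\<^sub>L 'x) \<Rightarrow> 'x set"
  where "kappa Q = range (blinfun_apply Q)"

section \<open>The actions of \<open>GL(X)\<close> and the maps \<open>\<Sigma>\<close>\<close>

definition conj_act :: "('x::real_normed_vector \<Rightarrow>\<^sub>L 'x) \<Rightarrow> ('x \<Rightarrow>\<^sub>L 'x) \<Rightarrow> ('x \<Rightarrow>\<^sub>L 'x)"
  where "conj_act W Q = W o\<^sub>L Q o\<^sub>L op_inv W"

definition image_act :: "('x::real_normed_vector \<Rightarrow>\<^sub>L 'x) \<Rightarrow> 'x set \<Rightarrow> 'x set"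
  where "image_act W E = blinfun_apply W ` E"

definition stabilizer ::
    "('k \<Rightarrow> 'x \<Rightarrow> 'x) \<Rightarrow> (('x::real_normed_vector \<Rightarrow>\<^sub>L 'x) \<Rightarrow> 'p \<Rightarrow> 'p) \<Rightarrow> 'p \<Rightarrow> ('x \<Rightarrow>\<^sub>L 'x) set"
  where "stabilizer sc act p = {W \<in> GL sc. act W p = p}"

definition orbit ::
    "('k \<Rightarrow> 'x \<Rightarrow> 'x) \<Rightarrow> (('x::real_normed_vector \<Rightarrow>\<^sub>L 'x) \<Rightarrow> 'p \<Rightarrow> 'p) \<Rightarrow> 'p \<Rightarrow> 'p set"
  where "orbit sc act p = (\<lambda>W. act W p) ` GL sc"

abbreviation GL_fix_op :: "('k \<Rightarrow> 'x \<Rightarrow> 'x) \<Rightarrow> ('x::real_normed_vector \<Rightarrow>\<^sub>L 'x) \<Rightarrow> ('x \<Rightarrow>\<^sub>L 'x) set"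
  where "GL_fix_op sc Q \<equiv> stabilizer sc conj_act Q"

abbreviation GL_fix_sp :: "('k \<Rightarrow> 'x \<Rightarrow> 'x) \<Rightarrow> 'x::real_normed_vector set \<Rightarrow> ('x \<Rightarrow>\<^sub>L 'x) set"
  where "GL_fix_sp sc E \<equiv> stabilizer sc image_act E"

(* A map [W] |-> g W on cosets.  It takes the only element of g ` [W]; that this is a singleton,
   i.e. well-definedness, is the equation induced g (lcoset W H) = g W for all W in GL(X). *)

definition induced :: "(('x::real_normed_vector \<Rightarrow>\<^sub>L 'x) \<Rightarrow> 'q) \<Rightarrow> ('x \<Rightarrow>\<^sub>L 'x) set \<Rightarrow> 'q"
  where "induced g C = the_elem (g ` C)"

definition Sigma_op :: "('x::real_normed_vector \<Rightarrow>\<^sub>L 'x) \<Rightarrow> ('x \<Rightarrow>\<^sub>L 'x) set \<Rightarrow> ('x \<Rightarrow>\<^sub>L 'x)"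
  where "Sigma_op Q = induced (\<lambda>W. conj_act W Q)"

definition Sigma_sp :: "'x::real_normed_vector set \<Rightarrow> ('x \<Rightarrow>\<^sub>L 'x) set \<Rightarrow> 'x set"
  where "Sigma_sp E = induced (\<lambda>W. image_act W E)"

definition upsilon0 ::
    "('k \<Rightarrow> 'x \<Rightarrow> 'x) \<Rightarrow> ('x::real_normed_vector \<Rightarrow>\<^sub>L 'x) \<Rightarrow> ('x \<Rightarrow>\<^sub>L 'x) set \<Rightarrow> ('x \<Rightarrow>\<^sub>L 'x) set"
  where "upsilon0 sc Q = induced (\<lambda>W. lcoset W (GL_fix_sp sc (kappa Q)))"

definition orbit_representatives ::
    "('k \<Rightarrow> 'x \<Rightarrow> 'x) \<Rightarrow> (('x::real_normed_vector \<Rightarrow>\<^sub>L 'x) \<Rightarrow> 'p \<Rightarrow> 'p) \<Rightarrow> 'p set \<Rightarrow> 'p set \<Rightarrow> bool"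
  where "orbit_representatives sc act P R \<longleftrightarrow>
    R \<subseteq> P \<and> (\<forall>p\<in>P. \<exists>!r. r \<in> R \<and> r \<in> orbit sc act p)"

definition identified_with_disjoint_union ::
    "('m, 'k::comm_ring_1, 'v::real_normed_vector) mfd \<Rightarrow> 'i set \<Rightarrow>
     ('i \<Rightarrow> ('n, 'k, 'w::real_normed_vector) mfd) \<Rightarrow> ('i \<Rightarrow> 'n \<Rightarrow> 'm) \<Rightarrow> ('i \<Rightarrow> 'm set) \<Rightarrow> bool"
  where "identified_with_disjoint_union M R N f S \<longleftrightarrow>
    banach_manifold M \<and>
    (\<forall>r\<in>R. openin (mtop M) (S r) \<and> closedin (mtop M) (S r) \<and>
       bianalytic (N r) (open_submanifold M (S r)) (f r)) \<and>
    disjoint_family_on S R \<and> (\<Union>r\<in>R. S r) = topspace (mtop M)"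

text \<open>The two families of sets used above as open sets are topologies.\<close>

lemma openin_quotient_topology:
  "openin (quotient_topology sc H) U \<longleftrightarrow> U \<subseteq> lcosets sc H \<and>
    openin (top_of_set (GL sc)) {W \<in> GL sc. lcoset W H \<in> U}"
proof -
  have "istopology (\<lambda>U. U \<subseteq> lcosets sc H \<and>
      openin (top_of_set (GL sc)) {W \<in> GL sc. lcoset W H \<in> U})" (is "istopology ?P")
    unfolding istopology_def
  proof (intro conjI allI impI)
    fix S T assume "?P S" "?P T"
    moreover have "{W \<in> GL sc. lcoset W H \<in> S \<inter> T} =
        {W \<in> GL sc. lcoset W H \<in> S} \<inter> {W \<in> GL sc. lcoset W H \<in> T}" by blast
    ultimately show "S \<inter> T \<subseteq> lcosets sc H"
      and "openin (top_of_set (GL sc)) {W \<in> GL sc. lcoset W H \<in> S \<inter> T}"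
      by (auto intro: openin_Int)
  next
    fix \<S> assume a: "\<forall>S\<in>\<S>. ?P S"
    have "{W \<in> GL sc. lcoset W H \<in> \<Union>\<S>} = (\<Union>S\<in>\<S>. {W \<in> GL sc. lcoset W H \<in> S})" by blast
    with a show "\<Union>\<S> \<subseteq> lcosets sc H"
      and "openin (top_of_set (GL sc)) {W \<in> GL sc. lcoset W H \<in> \<Union>\<S>}"
      by (auto intro!: openin_Union)
  qed
  then show ?thesis unfolding quotient_topology_def by (simp add: topology_inverse')
qed

lemma openin_grassmannian_topology:
  "openin (grassmannian_topology sc) U \<longleftrightarrow> U \<subseteq> grassmannian sc \<and>
    (\<forall>F\<in>grassmannian sc. \<forall>E\<in>complements sc F.
       openin (top_of_set (Lop sc E F)) {T \<in> Lop sc E F. q_chart E T \<in> U})"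
proof -
  have "istopology (\<lambda>U. U \<subseteq> grassmannian sc \<and>
    (\<forall>F\<in>grassmannian sc. \<forall>E\<in>complements sc F.
       openin (top_of_set (Lop sc E F)) {T \<in> Lop sc E F. q_chart E T \<in> U}))"
    (is "istopology ?P")
    unfolding istopology_def
  proof (rule conjI; intro allI impI)
    fix A B assume "?P A" "?P B"
    moreover have "{T \<in> Lop sc E F. q_chart E T \<in> A \<inter> B} =
        {T \<in> Lop sc E F. q_chart E T \<in> A} \<inter> {T \<in> Lop sc E F. q_chart E T \<in> B}" for E F
      by blast
    ultimately show "?P (A \<inter> B)" by (auto intro: openin_Int)
  next
    fix \<S> assume a: "\<forall>S\<in>\<S>. ?P S"
    have "{T \<in> Lop sc E F. q_chart E T \<in> \<Union>\<S>} =
        (\<Union>S\<in>\<S>. {T \<in> Lop sc E F. q_chart E T \<in> S})" for E F by blast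
    with a show "?P (\<Union>\<S>)" by (auto intro!: openin_Union)
  qed
  then show ?thesis unfolding grassmannian_topology_def by (simp add: topology_inverse')
qed

end

theory Submission
  imports Defs
begin

text \<open>
  Both statements are instances of one fact about an action of \<open>GL(X)\<close> on a Banach manifold \<open>M\<close>: if
  the orbit maps \<open>W \<mapsto> W p\<close> are analytic and every point \<open>p\<close> has a local analytic section \<open>g\<close>, that
  is \<open>g(q) p = q\<close> for \<open>q\<close> near \<open>p\<close> and \<open>g(p) = 1\<close>, then the orbits are clopen and each orbit map
  factors through a bi-analytic map from the homogeneous space.  For idempotents the section is
  \<open>A \<mapsto> A Q + (1 - A) (1 - Q)\<close>; for the Grassmannian it is \<open>T \<mapsto> (1 + T) (1 + T\<^sub>0)\<^sup>-\<^sup>1\<close> in the chart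
  of operators \<open>T : E \<rightarrow> F\<close>.  Explicit rational charts replace the inverse function theorem
  throughout, and the open mapping theorem is only used for the boundedness of the projections
  that belong to closed complements.
\<close>

text \<open>Analyticity means power series whose coefficients, not only whose sums, lie in the model
  of the target chart, and models vary from chart to chart. So everything rests on composing such
  series, and one obstacle recurs: a map into a closed subspace \<open>U\<close> of \<open>B\<close>
  may come with coefficients in \<open>B\<close> only. A bounded projection onto \<open>U\<close>
  repairs this, which is why complements of models matter. A local section of the action does three
  jobs. It makes the orbit map open, so that the quotient topology is that of the orbit; it makes
  the inverse of the induced map analytic; and, multiplied by \<open>W\<close> from the right, it is
  a section of the projection of GL(X) through \<open>W\<close>, as a chart of the homogeneous space
  requires. A chart of the idempotents has to straighten them inside an open set of L(X). Block
  elimination does this: near \<open>Q\<close> an idempotent is determined by its block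
  \<open>b\<close> and the slope \<open>t\<close> of its range, while its Schur complement is again
  an idempotent and is forced to be 0 by requiring that 1 minus it be invertible.\<close>

instance lbfun :: (real_normed_vector, banach) banach
proof
  fix X :: "nat \<Rightarrow> ('a, 'b) lbfun"
  assume X: "Cauchy X"
  have bd: "norm (lbfun_apply f x) \<le> norm f * norm x" for f :: "('a, 'b) lbfun" and x
    by transfer (rule lbfun_onorm)
  have dif: "lbfun_apply (f - g) x = lbfun_apply f x - lbfun_apply g x" for f g :: "('a, 'b) lbfun" and x
    by (simp only: minus_lbfun_def plus_lbfun.rep_eq uminus_lbfun.rep_eq) simp
  have "Cauchy (\<lambda>n. lbfun_apply (X n) x)" for x
  proof (rule CauchyI)
    fix e :: real assume "0 < e"
    then have "0 < e / (norm x + 1)" by (simp add: add_nonneg_pos)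
    then obtain M where M: "\<And>m n. M \<le> m \<Longrightarrow> M \<le> n \<Longrightarrow> norm (X m - X n) < e / (norm x + 1)"
      using CauchyD[OF X] by meson
    have "norm (lbfun_apply (X m) x - lbfun_apply (X n) x) < e" if "M \<le> m" "M \<le> n" for m n
    proof -
      have "norm (lbfun_apply (X m) x - lbfun_apply (X n) x) \<le> norm (X m - X n) * norm x"
        using bd[of "X m - X n" x] by (simp add: dif)
      also have "\<dots> \<le> e / (norm x + 1) * norm x"
        using M[OF that] by (intro mult_right_mono) auto
      also have "\<dots> < e"
        using \<open>0 < e\<close> by (simp add: pos_divide_less_eq add_nonneg_pos distrib_left)
      finally show ?thesis .
    qed
    then show "\<exists>M. \<forall>m\<ge>M. \<forall>n\<ge>M. norm (lbfun_apply (X m) x - lbfun_apply (X n) x) < e" by blast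
  qed
  then have "\<exists>l. (\<lambda>n. lbfun_apply (X n) x) \<longlonglongrightarrow> l" for x
    by (simp add: Cauchy_convergent_iff convergent_def)
  then obtain g where g: "\<And>x. (\<lambda>n. lbfun_apply (X n) x) \<longlonglongrightarrow> g x" by metis
  \<comment> \<open>The Cauchy estimate passes to the pointwise limit in \<open>m\<close>. With
    bound 1 it shows that \<open>g\<close> is bounded, with bound \<open>e / 2\<close> that
    \<open>X\<close> converges to it in operator norm. Additivity does not enter: elements of this
    type are merely bounded.\<close>
  have lim: "norm (lbfun_apply (X n) x - g x) \<le> e * norm x"
    if "\<And>m. n \<le> m \<Longrightarrow> norm (X n - X m) \<le> e" for n e x
  proof (rule Lim_bounded)
    show "(\<lambda>m. norm (lbfun_apply (X n) x - lbfun_apply (X m) x)) \<longlonglongrightarrow> norm (lbfun_apply (X n) x - g x)"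
      by (intro tendsto_intros g)
    show "\<forall>m\<ge>n. norm (lbfun_apply (X n) x - lbfun_apply (X m) x) \<le> e * norm x"
    proof (intro allI impI)
      fix m assume "n \<le> m"
      have "norm (lbfun_apply (X n) x - lbfun_apply (X m) x) \<le> norm (X n - X m) * norm x"
        using bd[of "X n - X m" x] by (simp add: dif)
      also have "\<dots> \<le> e * norm x" using that[OF \<open>n \<le> m\<close>] by (simp add: mult_right_mono)
      finally show "norm (lbfun_apply (X n) x - lbfun_apply (X m) x) \<le> e * norm x" .
    qed
  qed
  obtain M where M: "\<And>m n. M \<le> m \<Longrightarrow> M \<le> n \<Longrightarrow> norm (X m - X n) < 1"
    using CauchyD[OF X zero_less_one] by meson
  have "norm (g x) \<le> (norm (X M) + 1) * norm x" for x
  proof -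
    have "norm (lbfun_apply (X M) x - g x) \<le> 1 * norm x"
      using M by (intro lim) (simp add: less_imp_le)
    then show ?thesis
      using bd[of "X M" x] norm_triangle_ineq2[of "g x" "lbfun_apply (X M) x"]
      by (simp add: algebra_simps norm_minus_commute)
  qed
  then have gin: "\<exists>C. \<forall>x. norm (g x) \<le> C * norm x" by blast
  define G where "G = Lbfun g"
  have G: "lbfun_apply G = g" unfolding G_def using gin by (simp add: Lbfun_inverse)
  have "X \<longlonglongrightarrow> G"
  proof (rule LIMSEQ_I)
    fix e :: real assume "0 < e"
    then obtain N where N: "\<And>m n. N \<le> m \<Longrightarrow> N \<le> n \<Longrightarrow> norm (X m - X n) < e / 2"
      using CauchyD[OF X, of "e / 2"] half_gt_zero by meson
    have "norm (X n - G) \<le> e / 2" if "N \<le> n" for n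
    proof -
      have "norm (lbfun_apply (X n - G) x) \<le> (e / 2) * norm x" for x
        unfolding dif G using N that by (intro lim) (auto intro!: less_imp_le)
      then show ?thesis 
        unfolding norm_lbfun.rep_eq using \<open>0 < e\<close> by (intro onorm_nonneg_le) (assumption | simp)+
    qed
    moreover have "e / 2 < e" using \<open>0 < e\<close> by simp
    ultimately show "\<exists>N. \<forall>n\<ge>N. norm (X n - G) < e" by (meson le_less_trans)
  qed
  then show "convergent X" by (auto simp: convergent_def)
qed

context banach_space_over
begin

text \<open>In a complete type a subspace is complete iff it is closed, and closedness of the spaces
  below is read off from their defining equations.\<close>

lemma subspace_iff:
  "banach_subspace sc V \<longleftrightarrow>
    0 \<in> V \<and> (\<forall>x\<in>V. \<forall>y\<in>V. x + y \<in> V) \<and> (\<forall>a. \<forall>x\<in>V. sc a x \<in> V) \<and> closed V"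
  unfolding banach_subspace_def subspace_def by (simp add: complete_eq_closed conj_ac)

lemma subspaceD:
  assumes "banach_subspace sc V"
  shows "0 \<in> V" "x \<in> V \<Longrightarrow> y \<in> V \<Longrightarrow> x + y \<in> V" "x \<in> V \<Longrightarrow> sc a x \<in> V" "closed V"
    "x \<in> V \<Longrightarrow> r *\<^sub>R x \<in> V" "x \<in> V \<Longrightarrow> - x \<in> V" "x \<in> V \<Longrightarrow> y \<in> V \<Longrightarrow> x - y \<in> V"
    "(\<And>i. i \<in> I \<Longrightarrow> z i \<in> V) \<Longrightarrow> sum z I \<in> V"
proof -
  show 1: "0 \<in> V" "x \<in> V \<Longrightarrow> y \<in> V \<Longrightarrow> x + y \<in> V" "x \<in> V \<Longrightarrow> sc a x \<in> V" "closed V" for x y a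
    using assms unfolding subspace_iff by auto
  show "x \<in> V \<Longrightarrow> r *\<^sub>R x \<in> V" for r x
    using 1(3)[of x "of_real r"] by (simp add: scale_of_real)
  from this[of x "-1"] show 2: "x \<in> V \<Longrightarrow> - x \<in> V" for x
    using \<open>\<And>x r. x \<in> V \<Longrightarrow> r *\<^sub>R x \<in> V\<close>[of x "-1"] by simp
  show "x \<in> V \<Longrightarrow> y \<in> V \<Longrightarrow> x - y \<in> V" using 1(2)[of x "-y"] 2[of y] by simp
  show "(\<And>i. i \<in> I \<Longrightarrow> z i \<in> V) \<Longrightarrow> sum z I \<in> V"
    by (induction I rule: infinite_finite_induct) (auto intro: 1)
qed

lemma scale_scaleR: "sc a (r *\<^sub>R x) = r *\<^sub>R sc a x"
  by (metis scale_left_commute scale_of_real)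

lemma bounded_linear_scale: "bounded_linear (sc a)"
  by (rule bounded_linear_intro[where K = "norm a"])
    (auto simp: scale_right_distrib scale_scaleR norm_scale)

end

section \<open>Power series between Banach spaces\<close>

definition analytic_pt ::
    "('k \<Rightarrow> 'v \<Rightarrow> 'v) \<Rightarrow> 'v::real_normed_vector set \<Rightarrow>
     ('k \<Rightarrow> 'w \<Rightarrow> 'w) \<Rightarrow> 'w::real_normed_vector set \<Rightarrow> ('v \<Rightarrow> 'w) \<Rightarrow> 'v \<Rightarrow> bool"
  where "analytic_pt s V s' V' f x \<longleftrightarrow>
    (\<exists>r>0. \<exists>C A.
       (\<forall>n. multilinear_on s V s' V' n (A n)) \<and>
       (\<forall>n. \<forall>hs\<in>lists V. length hs = n \<longrightarrow>
          norm (A n hs) * r ^ n \<le> C * prod_list (map norm hs)) \<and>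
       (\<forall>h\<in>V. norm h < r \<longrightarrow> (\<lambda>n. A n (replicate n h)) sums f (x + h)))"

text \<open>Neighbourhoods of \<open>x\<close> in \<open>x + V\<close>, expressed by increments
  because power series are.\<close>

definition nbhd_on :: "'v::real_normed_vector set \<Rightarrow> 'v \<Rightarrow> ('v \<Rightarrow> bool) \<Rightarrow> bool"
  where "nbhd_on V x P \<longleftrightarrow> (\<exists>e>0. \<forall>h\<in>V. norm h < e \<longrightarrow> P (x + h))"

lemma nbhd_onI: "0 < e \<Longrightarrow> (\<And>h. h \<in> V \<Longrightarrow> norm h < e \<Longrightarrow> P (x + h)) \<Longrightarrow> nbhd_on V x P"
  unfolding nbhd_on_def by blast

lemma nbhd_on_conj: "nbhd_on V x P \<Longrightarrow> nbhd_on V x Q \<Longrightarrow> nbhd_on V x (\<lambda>y. P y \<and> Q y)"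
  unfolding nbhd_on_def
proof (elim exE conjE)
  fix d e :: real
  assume "0 < d" "0 < e" "\<forall>h\<in>V. norm h < d \<longrightarrow> P (x + h)" "\<forall>h\<in>V. norm h < e \<longrightarrow> Q (x + h)"
  then show "\<exists>e>0. \<forall>h\<in>V. norm h < e \<longrightarrow> P (x + h) \<and> Q (x + h)"
    by (intro exI[of _ "min d e"]) auto
qed

lemma nbhd_on_mono: "nbhd_on V x P \<Longrightarrow> (\<And>h. h \<in> V \<Longrightarrow> P (x + h) \<Longrightarrow> Q (x + h)) \<Longrightarrow> nbhd_on V x Q"
  unfolding nbhd_on_def by blast

text \<open>The quantity \<open>norm (A n hs) * r ^ n\<close> decreases with \<open>r\<close>, so
  the same coefficients serve on every smaller ball. This is how two series, or a series and an open
  domain, get a common radius.\<close>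

lemma analytic_pt_radius:
  assumes "analytic_pt s V s' V' f x" "0 < e"
  shows "\<exists>r>0. r \<le> e \<and> (\<exists>C A.
       (\<forall>n. multilinear_on s V s' V' n (A n)) \<and>
       (\<forall>n. \<forall>hs\<in>lists V. length hs = n \<longrightarrow>
          norm (A n hs) * r ^ n \<le> C * prod_list (map norm hs)) \<and>
       (\<forall>h\<in>V. norm h < r \<longrightarrow> (\<lambda>n. A n (replicate n h)) sums f (x + h)))"
proof -
  from assms(1) obtain r C A where r: "0 < r" and m: "\<forall>n. multilinear_on s V s' V' n (A n)"
    and b: "\<forall>n. \<forall>hs\<in>lists V. length hs = n \<longrightarrow>
        norm (A n hs) * r ^ n \<le> C * prod_list (map norm hs)"
    and c: "\<forall>h\<in>V. norm h < r \<longrightarrow> (\<lambda>n. A n (replicate n h)) sums f (x + h)"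
    unfolding analytic_pt_def by blast
  have "norm (A n hs) * min r e ^ n \<le> C * prod_list (map norm hs)"
    if "hs \<in> lists V" "length hs = n" for n hs
  proof (rule order_trans)
    show "norm (A n hs) * min r e ^ n \<le> norm (A n hs) * r ^ n"
      using r assms(2) by (intro mult_left_mono power_mono) auto
    show "norm (A n hs) * r ^ n \<le> C * prod_list (map norm hs)" using b that by blast
  qed
  moreover have "0 < min r e" "min r e \<le> e" using r assms(2) by auto
  moreover have "\<forall>h\<in>V. norm h < min r e \<longrightarrow> (\<lambda>n. A n (replicate n h)) sums f (x + h)"
    using c by simp
  ultimately show ?thesis using m by blast
qed

lemma analytic_between_iff:
  "analytic_between s V s' V' U f \<longleftrightarrow>
    U \<subseteq> V \<and> f ` U \<subseteq> V' \<and> (\<forall>x\<in>U. nbhd_on V x (\<lambda>y. y \<in> U)) \<and> (\<forall>x\<in>U. analytic_pt s V s' V' f x)"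
proof -
  have "(\<exists>r>0. \<exists>C A.
       (\<forall>n. multilinear_on s V s' V' n (A n)) \<and>
       (\<forall>n. \<forall>hs\<in>lists V. length hs = n \<longrightarrow>
          norm (A n hs) * r ^ n \<le> C * prod_list (map norm hs)) \<and>
       (\<forall>h\<in>V. norm h < r \<longrightarrow> x + h \<in> U \<and> (\<lambda>n. A n (replicate n h)) sums f (x + h)))
    \<longleftrightarrow> nbhd_on V x (\<lambda>y. y \<in> U) \<and> analytic_pt s V s' V' f x" (is "?L \<longleftrightarrow> ?R") for x
  proof
    assume ?L
    then obtain r C A where *: "0 < r" "\<forall>n. multilinear_on s V s' V' n (A n)"
        "\<forall>n. \<forall>hs\<in>lists V. length hs = n \<longrightarrow>
          norm (A n hs) * r ^ n \<le> C * prod_list (map norm hs)"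
        and c: "\<forall>h\<in>V. norm h < r \<longrightarrow> x + h \<in> U \<and> (\<lambda>n. A n (replicate n h)) sums f (x + h)"
      by blast
    show ?R
    proof
      show "nbhd_on V x (\<lambda>y. y \<in> U)" using c \<open>0 < r\<close> unfolding nbhd_on_def by blast
      have "\<forall>h\<in>V. norm h < r \<longrightarrow> (\<lambda>n. A n (replicate n h)) sums f (x + h)" using c by blast
      with * show "analytic_pt s V s' V' f x" unfolding analytic_pt_def by blast
    qed
  next
    assume R: ?R
    then obtain e where e: "0 < e" "\<And>h. h \<in> V \<Longrightarrow> norm h < e \<Longrightarrow> x + h \<in> U"
      unfolding nbhd_on_def by blast
    from R analytic_pt_radius[OF _ \<open>0 < e\<close>] obtain r C A
      where "0 < r" "r \<le> e" and *: "\<forall>n. multilinear_on s V s' V' n (A n)"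
        "\<forall>n. \<forall>hs\<in>lists V. length hs = n \<longrightarrow>
          norm (A n hs) * r ^ n \<le> C * prod_list (map norm hs)"
      and c: "\<forall>h\<in>V. norm h < r \<longrightarrow> (\<lambda>n. A n (replicate n h)) sums f (x + h)"
      by blast
    have "\<forall>h\<in>V. norm h < r \<longrightarrow> x + h \<in> U \<and> (\<lambda>n. A n (replicate n h)) sums f (x + h)"
      using c e \<open>r \<le> e\<close> by simp
    with * \<open>0 < r\<close> show ?L by blast
  qed
  then show ?thesis by (simp only: analytic_between_def ball_conj_distrib)
qed

lemma analytic_pt_cong:
  assumes "analytic_pt s V s' V' f x" "nbhd_on V x (\<lambda>y. f y = g y)"
  shows "analytic_pt s V s' V' g x"
proof -
  obtain e where "0 < e" and e: "\<forall>h\<in>V. norm h < e \<longrightarrow> f (x + h) = g (x + h)"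
    using assms(2) unfolding nbhd_on_def by blast
  from analytic_pt_radius[OF assms(1) \<open>0 < e\<close>] obtain r C A
    where "0 < r" "r \<le> e" and *: "\<forall>n. multilinear_on s V s' V' n (A n)"
      "\<forall>n. \<forall>hs\<in>lists V. length hs = n \<longrightarrow>
        norm (A n hs) * r ^ n \<le> C * prod_list (map norm hs)"
    and c: "\<forall>h\<in>V. norm h < r \<longrightarrow> (\<lambda>n. A n (replicate n h)) sums f (x + h)"
    by blast
  have "\<forall>h\<in>V. norm h < r \<longrightarrow> (\<lambda>n. A n (replicate n h)) sums g (x + h)"
    using c e \<open>r \<le> e\<close> by (simp add: order_less_le_trans)
  with * \<open>0 < r\<close> show ?thesis unfolding analytic_pt_def by blast
qed

lemma multilinear_onD:
  assumes "multilinear_on s V s' V' n A" "hs \<in> lists V" "length hs = n"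
  shows "A hs \<in> V'"
    "i < n \<Longrightarrow> x \<in> V \<Longrightarrow> y \<in> V \<Longrightarrow> A (hs[i := x + y]) = A (hs[i := x]) + A (hs[i := y])"
    "i < n \<Longrightarrow> x \<in> V \<Longrightarrow> A (hs[i := s a x]) = s' a (A (hs[i := x]))"
  using assms unfolding multilinear_on_def by blast+

lemma multilinear_onI:
  assumes "\<And>hs. hs \<in> lists V \<Longrightarrow> length hs = n \<Longrightarrow> A hs \<in> V'"
    "\<And>hs i x y. hs \<in> lists V \<Longrightarrow> length hs = n \<Longrightarrow> i < n \<Longrightarrow> x \<in> V \<Longrightarrow> y \<in> V \<Longrightarrow>
       A (hs[i := x + y]) = A (hs[i := x]) + A (hs[i := y])"
    "\<And>hs i x a. hs \<in> lists V \<Longrightarrow> length hs = n \<Longrightarrow> i < n \<Longrightarrow> x \<in> V \<Longrightarrow>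
       A (hs[i := s a x]) = s' a (A (hs[i := x]))"
  shows "multilinear_on s V s' V' n A"
  using assms unfolding multilinear_on_def by blast

lemma multilinear_Cons:
  assumes A: "multilinear_on s V s' V' (Suc m) A" and y: "y \<in> V"
  shows "multilinear_on s V s' V' m (\<lambda>ys. A (y # ys))"
proof (rule multilinear_onI)
  fix hs assume hs: "hs \<in> lists V" "length hs = m"
  then have y: "y # hs \<in> lists V" "length (y # hs) = Suc m" using y by auto
  note D = multilinear_onD[OF A y]
  show "A (y # hs) \<in> V'" by (rule D(1))
  fix i u assume i: "i < m" and u: "u \<in> V"
  show "A (y # hs[i := s a u]) = s' a (A (y # hs[i := u]))" for a
    using D(3)[of "Suc i" u a] i u by simp
  show "A (y # hs[i := u + v]) = A (y # hs[i := u]) + A (y # hs[i := v])" if "v \<in> V" for v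
    using D(2)[of "Suc i" u v] i u that by simp
qed

lemma multilinear_sum:
  assumes bs: "banach_space_over s'" "banach_subspace s' V'"
    and A: "\<And>l. l \<in> I \<Longrightarrow> multilinear_on s V s' V' n (A l)"
  shows "multilinear_on s V s' V' n (\<lambda>hs. \<Sum>l\<in>I. A l hs)"
proof -
  interpret banach_space_over s' by fact
  show ?thesis
  proof (rule multilinear_onI)
    fix hs assume hs: "hs \<in> lists V" "length hs = n"
    note D = multilinear_onD[OF A hs]
    show "(\<Sum>l\<in>I. A l hs) \<in> V'" by (rule subspaceD[OF bs(2)]) (rule D(1))
    fix i x assume i: "i < n" and x: "x \<in> V"
    show "(\<Sum>l\<in>I. A l (hs[i := s a x])) = s' a (\<Sum>l\<in>I. A l (hs[i := x]))" for a
      using D(3)[OF _ i x] by (simp add: scale_sum_right)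
    show "(\<Sum>l\<in>I. A l (hs[i := x + y])) = (\<Sum>l\<in>I. A l (hs[i := x])) + (\<Sum>l\<in>I. A l (hs[i := y]))"
      if "y \<in> V" for y
      using D(2)[OF _ i x that] by (simp add: sum.distrib)
  qed
qed

section \<open>Composition of analytic maps\<close>

text \<open>
  The coefficients of a composite series are indexed by compositions of the degree into positive
  parts.  A list \<open>l\<close> of naturals encodes the composition whose parts are the successors of its
  entries, so that no side condition on the entries is needed.
\<close>

fun blocks :: "(nat \<Rightarrow> 'v list \<Rightarrow> 'w) \<Rightarrow> nat list \<Rightarrow> 'v list \<Rightarrow> 'w list" where
  "blocks A [] hs = []"
| "blocks A (n # l) hs = A (Suc n) (take (Suc n) hs) # blocks A l (drop (Suc n) hs)"

abbreviation degree_of :: "nat list \<Rightarrow> nat" where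
  "degree_of l \<equiv> sum_list (map Suc l)"

lemma length_blocks: "length (blocks A l hs) = length l"
  by (induction l arbitrary: hs) auto

lemma blocks_replicate:
  "blocks A l (replicate (degree_of l) h) = map (\<lambda>n. A (Suc n) (replicate (Suc n) h)) l"
  by (induction l) (auto simp: take_Cons' min_def)

lemma blocks_lists:
  assumes A: "\<And>n. multilinear_on s V s' V' n (A n)"
  shows "hs \<in> lists V \<Longrightarrow> length hs = degree_of l \<Longrightarrow> blocks A l hs \<in> lists V'"
proof (induction l arbitrary: hs)
  case (Cons n l)
  have "take (Suc n) hs \<in> lists V" "drop (Suc n) hs \<in> lists V"
    using Cons.prems(1) by (auto simp: in_lists_conv_set dest: in_set_takeD in_set_dropD)
  then show ?case using Cons by (simp add: multilinear_onD(1)[OF A])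
qed simp

text \<open>Induction on \<open>l\<close> with \<open>G\<close> arbitrary: once the first block has
  the value \<open>w\<close>, the rest is the claim for \<open>G\<close> with \<open>w\<close>
  frozen in its first slot. A changed argument lies either in the first block, where linearity of
  \<open>A\<close> meets linearity of \<open>G\<close> in slot 0, or in the tail.\<close>

lemma multilinear_blocks:
  assumes A: "\<And>n. multilinear_on s V s' V' n (A n)"
  shows "multilinear_on s' V' s'' V'' (length l) G \<Longrightarrow>
    multilinear_on s V s'' V'' (degree_of l) (\<lambda>hs. G (blocks A l hs))"
proof (induction l arbitrary: G)
  case Nil
  then show ?case unfolding multilinear_on_def by simp
next
  case (Cons n l)
  show ?case
  proof (rule multilinear_onI)
    fix hs assume hs: "hs \<in> lists V" "length hs = degree_of (n # l)"
    have t: "take (Suc n) hs \<in> lists V" "length (take (Suc n) hs) = Suc n"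
      and d: "drop (Suc n) hs \<in> lists V" "length (drop (Suc n) hs) = degree_of l"
      using hs by (auto simp: in_lists_conv_set dest: in_set_takeD in_set_dropD)
    let ?w = "A (Suc n) (take (Suc n) hs)" and ?ws = "blocks A l (drop (Suc n) hs)"
    have w: "?w \<in> V'" by (rule multilinear_onD(1)[OF A t])
    have ws: "?ws \<in> lists V'" by (rule blocks_lists[OF A d])
    have wws: "?w # ?ws \<in> lists V'" "length (?w # ?ws) = length (n # l)"
      using w ws by (auto simp: length_blocks)
    note G = multilinear_onD[OF Cons.prems wws]
    have "multilinear_on s V s'' V'' (degree_of l) (\<lambda>hs. G (?w # blocks A l hs))"
      using Cons.IH[OF multilinear_Cons[OF _ w]] Cons.prems by simp
    note IH = multilinear_onD[OF this d]
    note At = multilinear_onD[OF A t]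
    show "G (blocks A (n # l) hs) \<in> V''" using G(1) by simp
    fix i x assume i: "i < degree_of (n # l)" and x: "x \<in> V"
    have upd: "blocks A (n # l) (hs[i := z]) =
      (if i < Suc n then (?w # ?ws)[0 := A (Suc n) ((take (Suc n) hs)[i := z])]
       else ?w # blocks A l ((drop (Suc n) hs)[i - Suc n := z]))" for z
      using i hs(2) by (simp add: take_update_swap drop_update_swap list_update_beyond)
    have val: "A (Suc n) ((take (Suc n) hs)[i := z]) \<in> V'" if "z \<in> V" for z
    proof (rule multilinear_onD(1)[OF A])
      show "(take (Suc n) hs)[i := z] \<in> lists V"
        using t(1) that set_update_subsetI[of "take (Suc n) hs" V z i] by auto
    qed (use t in simp)
    show "G (blocks A (n # l) (hs[i := s a x])) = s'' a (G (blocks A (n # l) (hs[i := x])))" for a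
    proof (cases "i < Suc n")
      case True
      show ?thesis unfolding upd
        using True At(3)[OF True x] G(3)[of 0 "A (Suc n) ((take (Suc n) hs)[i := x])"] val[OF x]
        by simp
    next
      case False
      then show ?thesis unfolding upd using IH(3)[of "i - Suc n" x] i x by simp
    qed
    show "G (blocks A (n # l) (hs[i := x + y])) =
        G (blocks A (n # l) (hs[i := x])) + G (blocks A (n # l) (hs[i := y]))"
      if y: "y \<in> V" for y
    proof (cases "i < Suc n")
      case True
      show ?thesis unfolding upd
        using True At(2)[OF True x y] G(2)[of 0 "A (Suc n) ((take (Suc n) hs)[i := x])"
          "A (Suc n) ((take (Suc n) hs)[i := y])"] val[OF x] val[OF y]
        by simp
    next
      case False
      then show ?thesis unfolding upd using IH(2)[of "i - Suc n" x y] i x y by simp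
    qed
  qed
qed

lemma prod_list_norm_nonneg: "0 \<le> prod_list (map norm hs)"
  by (induction hs) auto

text \<open>Each block costs one factor \<open>C\<close>, and the powers of \<open>r\<close>
  multiply to \<open>r ^ degree_of l\<close> because the block sizes add up to the degree.\<close>

lemma norm_blocks_le:
  assumes A: "\<And>n hs. hs \<in> lists V \<Longrightarrow> length hs = n \<Longrightarrow>
      norm (A n hs) * r ^ n \<le> C * prod_list (map norm hs)"
    and "0 < r" "0 \<le> C"
  shows "hs \<in> lists V \<Longrightarrow> length hs = degree_of l \<Longrightarrow>
    prod_list (map norm (blocks A l hs)) * r ^ degree_of l \<le> C ^ length l * prod_list (map norm hs)"
proof (induction l arbitrary: hs)
  case (Cons n l)
  have t: "take (Suc n) hs \<in> lists V" "length (take (Suc n) hs) = Suc n"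
    and d: "drop (Suc n) hs \<in> lists V" "length (drop (Suc n) hs) = degree_of l"
    using Cons.prems by (auto simp: in_lists_conv_set dest: in_set_takeD in_set_dropD)
  have "(norm (A (Suc n) (take (Suc n) hs)) * r ^ Suc n) *
      (prod_list (map norm (blocks A l (drop (Suc n) hs))) * r ^ degree_of l)
    \<le> (C * prod_list (map norm (take (Suc n) hs))) *
      (C ^ length l * prod_list (map norm (drop (Suc n) hs)))"
    using assms(2,3) by (intro mult_mono A t Cons.IH d mult_nonneg_nonneg prod_list_norm_nonneg) auto
  also have "\<dots> = C ^ length (n # l) *
      (prod_list (map norm (take (Suc n) hs)) * prod_list (map norm (drop (Suc n) hs)))"
    by (simp add: mult_ac)
  also have "prod_list (map norm (take (Suc n) hs)) * prod_list (map norm (drop (Suc n) hs)) =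
      prod_list (map norm hs)"
    by (metis append_take_drop_id map_append prod_list.append)
  finally show ?case by (simp add: power_add mult_ac)
qed simp

lemma sum_prod_list_length:
  fixes a :: "nat \<Rightarrow> real"
  assumes "finite N"
  shows "(\<Sum>l | set l \<subseteq> N \<and> length l = m. prod_list (map a l)) = sum a N ^ m"
proof (induction m)
  case 0
  have "{l. set l \<subseteq> N \<and> length l = 0} = {[]}" by auto
  then show ?case by simp
next
  case (Suc m)
  have eq: "{l. set l \<subseteq> N \<and> length l = Suc m} =
      (\<lambda>(n, l). n # l) ` (N \<times> {l. set l \<subseteq> N \<and> length l = m})"
    by (auto simp: length_Suc_conv image_iff)
  have "(\<Sum>l | set l \<subseteq> N \<and> length l = Suc m. prod_list (map a l)) =
      (\<Sum>(n, l)\<in>N \<times> {l. set l \<subseteq> N \<and> length l = m}. a n * prod_list (map a l))"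
    unfolding eq by (subst sum.reindex) (auto simp: inj_on_def case_prod_beta)
  also have "\<dots> = sum a N * (\<Sum>l | set l \<subseteq> N \<and> length l = m. prod_list (map a l))"
    by (simp add: sum_product sum.cartesian_product)
  finally show ?case using Suc by simp
qed

text \<open>A finite set of words sits among all words of length less than \<open>K\<close> over a
  finite alphabet \<open>N\<close>; these contribute a geometric sum with ratio
  \<open>sum a N\<close>, which is at most 1/2. This is the majorant for composite series.\<close>

lemma sum_prod_list_le:
  fixes a :: "nat \<Rightarrow> real"
  assumes a: "\<And>n. 0 \<le> a n" "\<And>N. finite N \<Longrightarrow> sum a N \<le> 1 / 2" and F: "finite F"
  shows "(\<Sum>l\<in>F. prod_list (map a l)) \<le> 2"
proof -
  define N where "N = (\<Union>l\<in>F. set l)"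
  define K where "K = Suc (Max (length ` F \<union> {0}))"
  have N: "finite N" using F by (auto simp: N_def)
  have fin: "finite {l. set l \<subseteq> N \<and> length l = m}" for m
    using N by (rule finite_lists_length_eq)
  have "F \<subseteq> (\<Union>m\<in>{..<K}. {l. set l \<subseteq> N \<and> length l = m})"
  proof
    fix l assume "l \<in> F"
    then have "length l < K" unfolding K_def less_Suc_eq_le using F by (intro Max_ge) auto
    with \<open>l \<in> F\<close> show "l \<in> (\<Union>m\<in>{..<K}. {l. set l \<subseteq> N \<and> length l = m})"
      by (auto simp: N_def)
  qed
  then have "(\<Sum>l\<in>F. prod_list (map a l)) \<le>
      (\<Sum>l\<in>(\<Union>m\<in>{..<K}. {l. set l \<subseteq> N \<and> length l = m}). prod_list (map a l))"
    using fin by (intro sum_mono2) (auto intro!: prod_list_nonneg a)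
  also have "\<dots> = (\<Sum>m<K. sum a N ^ m)"
    by (subst sum.UNION_disjoint) (use fin in \<open>auto simp: sum_prod_list_length[OF N]\<close>)
  also have "\<dots> \<le> (\<Sum>m<K. (1 / 2) ^ m)"
    using a N by (intro sum_mono power_mono) (auto intro: sum_nonneg)
  also have "\<dots> \<le> (\<Sum>m. (1 / 2) ^ m)"
    by (intro sum_le_suminf) auto
  also have "\<dots> = 2" by (subst suminf_geometric) auto
  finally show ?thesis .
qed

text \<open>\<open>L\<close> need not be additive off \<open>V\<close>, so the argument is run on
  the partial sums, which stay in \<open>V\<close>.\<close>

lemma additive_on_sums:
  fixes y :: "nat \<Rightarrow> 'w::real_normed_vector" and L :: "'w \<Rightarrow> 'u::real_normed_vector"
  assumes add: "\<And>x y. x \<in> V \<Longrightarrow> y \<in> V \<Longrightarrow> L (x + y) = L x + L y"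
    and bnd: "\<And>x. x \<in> V \<Longrightarrow> norm (L x) \<le> c * norm x"
    and V: "0 \<in> V" "\<And>x y. x \<in> V \<Longrightarrow> y \<in> V \<Longrightarrow> x + y \<in> V" "\<And>x y. x \<in> V \<Longrightarrow> y \<in> V \<Longrightarrow> x - y \<in> V"
    and y: "\<And>n. y n \<in> V" "y sums k" "k \<in> V"
  shows "(\<lambda>n. L (y n)) sums L k"
proof -
  have L0: "L 0 = 0" using add[OF V(1) V(1)] by simp
  have part: "(\<Sum>i<n. y i) \<in> V \<and> L (\<Sum>i<n. y i) = (\<Sum>i<n. L (y i))" for n
    by (induction n) (auto simp: L0 V y add)
  have dif: "L (u - v) = L u - L v" if "u \<in> V" "v \<in> V" for u v
    using add[OF V(3)[OF that] that(2)] by (simp add: algebra_simps)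
  have "(\<lambda>n. (\<Sum>i<n. L (y i)) - L k) \<longlonglongrightarrow> 0"
  proof (rule Lim_null_comparison)
    show "\<forall>\<^sub>F n in sequentially. norm ((\<Sum>i<n. L (y i)) - L k) \<le> c * norm ((\<Sum>i<n. y i) - k)"
    proof (rule always_eventually, rule allI)
      fix n
      have "(\<Sum>i<n. L (y i)) - L k = L ((\<Sum>i<n. y i) - k)"
        using part[of n] y(3) by (simp add: dif)
      then show "norm ((\<Sum>i<n. L (y i)) - L k) \<le> c * norm ((\<Sum>i<n. y i) - k)"
        using bnd V(3) part[of n] y(3) by simp
    qed
    have "(\<lambda>n. (\<Sum>i<n. y i) - k) \<longlonglongrightarrow> 0" using y(2) by (simp add: sums_def LIM_zero)
    then show "(\<lambda>n. c * norm ((\<Sum>i<n. y i) - k)) \<longlonglongrightarrow> 0"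
      by (intro tendsto_mult_right_zero tendsto_norm_zero)
  qed
  then show ?thesis unfolding sums_def by (rule LIM_zero_cancel)
qed

text \<open>Multiplies out \<open>B\<close> at \<open>k\<close> in every slot, with \<open>k\<close>
  the sum of the \<open>y n\<close>. Slot by slot this gives an iterated sum; the summability
  hypothesis over all index lists turns it into a single unordered one.\<close>

lemma multilinear_has_sum:
  fixes B :: "'w::banach list \<Rightarrow> 'u::banach"
  assumes bs: "banach_space_over s'" "banach_subspace s' V'"
    and B: "multilinear_on s' V' s'' V'' m B"
    and bound: "\<And>ws. ws \<in> lists V' \<Longrightarrow> length ws = m \<Longrightarrow> norm (B ws) \<le> c * prod_list (map norm ws)"
    and y: "\<And>n. y n \<in> V'" "y sums k" "k \<in> V'" "summable (\<lambda>n. norm (y n))"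
    and summ: "(\<lambda>l. B (map y l)) summable_on {l. length l = m}"
  shows "((\<lambda>l. B (map y l)) has_sum B (replicate m k)) {l. length l = m}"
proof -
  interpret banach_space_over s' by fact
  note sub = subspaceD[OF bs(2)]
  \<comment> \<open>The prefix \<open>p\<close> holds the indices already chosen, and the last
    \<open>j\<close> slots still contain \<open>k\<close>. Expanding one slot lowers
    \<open>j\<close> and lengthens \<open>p\<close>.\<close>
  have "length p + j = m \<Longrightarrow>
      ((\<lambda>l. B (map y (p @ l))) has_sum B (map y p @ replicate j k)) {l. length l = j}" for p j
  proof (induction j arbitrary: p)
    case 0
    have "{l :: nat list. length l = 0} = {[]}" by auto
    then show ?case using has_sum_finite[of "{[]}" "\<lambda>l. B (map y (p @ l))"] by simp
  next
    case (Suc j)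
    have IH: "((\<lambda>l. B (map y (p @ n # l))) has_sum B (map y p @ y n # replicate j k)) {l. length l = j}"
      for n using Suc.IH[of "p @ [n]"] Suc.prems by simp
    define L where "L w = B (map y p @ w # replicate j k)" for w
    have mem: "map y p @ w # replicate j k \<in> lists V'" if "w \<in> V'" for w
      using y that by auto
    have len: "length (map y p @ w # replicate j k) = m" for w using Suc.prems by simp
    have upd: "(map y p @ w # replicate j k)[length p := v] = map y p @ v # replicate j k" for v w
      by (simp add: list_update_append)
    have bnd: "norm (L w) \<le> (c * (prod_list (map norm (map y p)) * norm k ^ j)) * norm w" if "w \<in> V'" for w
      using bound[OF mem[OF that] len] unfolding L_def by (simp add: mult_ac)
    have "(\<lambda>n. L (y n)) sums L k"
    proof (rule additive_on_sums[where V = V', OF _ bnd])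
      show "L (u + v) = L u + L v" if "u \<in> V'" "v \<in> V'" for u v
        using multilinear_onD(2)[OF B mem[OF y(3)] len, of "length p" u v] that Suc.prems
        unfolding upd L_def by simp
    qed (use y sub in auto)
    moreover have "summable (\<lambda>n. norm (L (y n)))"
      by (rule summable_comparison_test'[OF summable_mult[OF y(4)]]) (use bnd[OF y(1)] in auto)
    ultimately have outer: "((\<lambda>n. L (y n)) has_sum L k) UNIV" by (simp add: norm_summable_imp_has_sum)
    let ?f = "\<lambda>(n, l). n # l"
    have bij: "bij_betw ?f (UNIV \<times> {l. length l = j}) {l. length l = Suc j}"
      by (rule bij_betwI[where g = "\<lambda>l. (hd l, tl l)"]) (auto simp: length_Suc_conv)
    have "(\<lambda>l. B (map y (p @ l))) summable_on {l. length l = Suc j}"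
    proof -
      have "inj_on (\<lambda>l. p @ l) {l. length l = Suc j}" by (auto simp: inj_on_def)
      moreover have "(\<lambda>l. B (map y l)) summable_on (\<lambda>l. p @ l) ` {l. length l = Suc j}"
        by (rule summable_on_subset_banach[OF summ]) (use Suc.prems in auto)
      ultimately show ?thesis by (simp add: summable_on_reindex o_def)
    qed
    then have "(\<lambda>x. B (map y (p @ ?f x))) summable_on (UNIV \<times> {l. length l = j})"
      using summable_on_reindex_bij_betw[OF bij, of "\<lambda>l. B (map y (p @ l))"] by simp
    then have "((\<lambda>x. B (map y (p @ ?f x))) has_sum L k) (UNIV \<times> {l. length l = j})"
      by (intro has_sum_SigmaI[OF _ outer]) (use IH in \<open>auto simp: L_def\<close>)
    then show ?case
      using has_sum_reindex_bij_betw[OF bij, of "\<lambda>l. B (map y (p @ l))"] by (simp add: L_def)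
  qed
  from this[of "[]" m] show ?thesis by simp
qed

lemma replicate_lists: "h \<in> V \<Longrightarrow> replicate n h \<in> lists V"
  by (simp add: in_lists_conv_set)

text \<open>At \<open>h = 0\<close> the coefficient bound kills every term of positive degree and
  leaves \<open>A 0 []\<close>. Without that term the series represents the increment of
  \<open>f\<close>, which is what gets substituted into another series. The bound in degree 0 shows
  \<open>0 \<le> C\<close>.\<close>

lemma analytic_pt_value:
  assumes bs: "banach_space_over s" "banach_subspace s V"
    and m: "\<And>n. multilinear_on s V s' V' n (A n)" and r: "0 < r"
    and b: "\<forall>n. \<forall>hs\<in>lists V. length hs = n \<longrightarrow>
          norm (A n hs) * r ^ n \<le> C * prod_list (map norm hs)"
    and c: "\<forall>h\<in>V. norm h < r \<longrightarrow> (\<lambda>n. A n (replicate n h)) sums f (x + h)"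
  shows "A 0 [] = f x" "0 \<le> C"
    "h \<in> V \<Longrightarrow> norm h < r \<Longrightarrow> (\<lambda>n. A (Suc n) (replicate (Suc n) h)) sums (f (x + h) - f x)"
proof -
  have 0: "0 \<in> V" using banach_space_over.subspaceD(1)[OF bs] .
  have "A n (replicate n 0) = 0" if "n \<noteq> 0" for n
  proof -
    have "norm (A n (replicate n 0)) * r ^ n \<le> 0"
      using b[rule_format, of "replicate n 0" n] replicate_lists[OF 0, of n] that
      by (simp add: prod_list_replicate power_0_left)
    then show ?thesis using zero_less_power[OF r, of n] by (auto simp: mult_le_0_iff)
  qed
  then have "(\<lambda>n. A n (replicate n 0)) = (\<lambda>n. if n = 0 then A 0 [] else 0)" by auto
  then have "(\<lambda>n. A n (replicate n 0)) sums A 0 []"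
    using sums_single[of 0 "\<lambda>_. A 0 []"] by simp
  moreover have "(\<lambda>n. A n (replicate n 0)) sums f (x + 0)" using c 0 r norm_zero by metis
  ultimately show A0: "A 0 [] = f x" using sums_unique2 by fastforce
  show "0 \<le> C" using b[rule_format, of "[]" 0] norm_ge_zero[of "A 0 []"] by (simp del: norm_ge_zero)
  show "(\<lambda>n. A (Suc n) (replicate (Suc n) h)) sums (f (x + h) - f x)" if "h \<in> V" "norm h < r"
    using c[rule_format, OF that] sums_Suc_iff[of "\<lambda>n. A n (replicate n h)" "f (x + h) - f x"]
    by (simp add: A0)
qed

text \<open>The expansion of \<open>g (f (x + h))\<close> is one family indexed by all lists,
  absolutely summable on a small ball. Grouping it in two ways identifies the outer series at the
  increment of \<open>f\<close> with the series of the homogeneous parts \<open>K N\<close>.\<close>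

lemma analytic_pt_compose:
  fixes f :: "'v::banach \<Rightarrow> 'w::banach" and g :: "'w \<Rightarrow> 'u::banach"
  assumes bs: "banach_space_over s" "banach_subspace s V"
    and bs': "banach_space_over s'" "banach_subspace s' V'"
    and bs'': "banach_space_over s''" "banach_subspace s'' V''"
    and f: "analytic_pt s V s' V' f x" and g: "analytic_pt s' V' s'' V'' g (f x)"
  shows "analytic_pt s V s'' V'' (\<lambda>x. g (f x)) x"
proof -
  from f obtain r C A where r: "0 < r" and Am: "\<And>n. multilinear_on s V s' V' n (A n)"
    and Ab0: "\<forall>n. \<forall>hs\<in>lists V. length hs = n \<longrightarrow>
          norm (A n hs) * r ^ n \<le> C * prod_list (map norm hs)"
    and Ac0: "\<forall>h\<in>V. norm h < r \<longrightarrow> (\<lambda>n. A n (replicate n h)) sums f (x + h)"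
    unfolding analytic_pt_def by blast
  from g obtain \<sigma> D B where \<sigma>: "0 < \<sigma>" and Bm: "\<And>n. multilinear_on s' V' s'' V'' n (B n)"
    and Bb0: "\<forall>n. \<forall>hs\<in>lists V'. length hs = n \<longrightarrow>
          norm (B n hs) * \<sigma> ^ n \<le> D * prod_list (map norm hs)"
    and Bc0: "\<forall>h\<in>V'. norm h < \<sigma> \<longrightarrow> (\<lambda>n. B n (replicate n h)) sums g (f x + h)"
    unfolding analytic_pt_def by blast
  note Av = analytic_pt_value[OF bs Am r Ab0 Ac0] and Bv = analytic_pt_value[OF bs' Bm \<sigma> Bb0 Bc0]
  note Ab = Ab0[rule_format] and Bb = Bb0[rule_format] and Bc = Bc0[rule_format]
  note C = Av(2) and D = Bv(2)
  \<comment> \<open>With \<open>q = C / \<sigma>\<close> this choice makes the sum of all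
    \<open>a n\<close> equal to \<open>q / (1 + 2 * q)\<close>, hence at most 1/2. On the ball of
    radius \<open>t\<close> the term of degree \<open>n + 1\<close> of the increment of
    \<open>f\<close> is bounded by \<open>\<sigma> * a n\<close>.\<close>
  define \<tau> where "\<tau> = 1 / (2 + 2 * C / \<sigma>)"
  define t where "t = \<tau> * r"
  define a where "a n = C / \<sigma> * \<tau> ^ Suc n" for n
  have den: "1 < 2 + 2 * C / \<sigma>" using C \<sigma> by (simp add: add_strict_increasing)
  have \<tau>: "0 < \<tau>" "\<tau> < 1" unfolding \<tau>_def using den by (auto simp: divide_simps)
  have t: "0 < t" "t < r" using \<tau> r by (auto simp: t_def)
  have a0: "0 \<le> a n" for n unfolding a_def using C \<sigma> \<tau> by simp
  have "(\<lambda>n. C / \<sigma> * \<tau> * \<tau> ^ n) sums (C / \<sigma> * \<tau> * (1 / (1 - \<tau>)))"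
    using \<tau> by (intro sums_mult geometric_sums) simp
  moreover have "C / \<sigma> * \<tau> * (1 / (1 - \<tau>)) \<le> 1 / 2"
  proof -
    define q where "q = C / \<sigma>"
    have "0 \<le> q" using C \<sigma> by (simp add: q_def)
    then have "\<tau> * (2 + 2 * q) = 1" "0 < 1 + 2 * q" by (auto simp: \<tau>_def q_def)
    then have "1 - \<tau> = (1 + 2 * q) * \<tau>" "0 < 1 + 2 * q" by (auto simp: algebra_simps)
    then have "q * \<tau> * (1 / (1 - \<tau>)) = q / (1 + 2 * q)" using \<tau> by simp
    also have "\<dots> \<le> 1 / 2" using \<open>0 \<le> q\<close> by (simp add: divide_simps)
    finally show ?thesis by (simp add: q_def)
  qed
  ultimately have a_sum: "summable a" "suminf a \<le> 1 / 2"
    by (auto simp: a_def[abs_def] sums_iff mult.assoc)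
  have a_le: "sum a N \<le> 1 / 2" if "finite N" for N
    using sum_le_suminf[OF a_sum(1) that] a0 a_sum(2) by force
  note a_lists = sum_prod_list_le[OF a0 a_le]
  have prod_a: "prod_list (map a l) * \<sigma> ^ length l * r ^ degree_of l = C ^ length l * t ^ degree_of l" for l
    by (induction l) (use \<sigma> in \<open>auto simp: a_def t_def power_add power_mult_distrib field_simps\<close>)
  \<comment> \<open>Both coefficient bounds carry powers on their left-hand sides, so the claim is
    first multiplied by \<open>\<sigma> ^ length l * r ^ degree_of l\<close>, which is cancelled at
    the end.\<close>
  have coeff_le: "norm (B (length l) (blocks A l hs)) * t ^ degree_of l \<le>
      D * prod_list (map a l) * prod_list (map norm hs)"
    if hs: "hs \<in> lists V" "length hs = degree_of l" for l hs
  proof -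
    let ?b = "blocks A l hs"
    have "norm (B (length l) ?b) * t ^ degree_of l * (\<sigma> ^ length l * r ^ degree_of l) =
        (norm (B (length l) ?b) * \<sigma> ^ length l) * r ^ degree_of l * t ^ degree_of l" by (simp add: mult_ac)
    also have "\<dots> \<le> D * prod_list (map norm ?b) * r ^ degree_of l * t ^ degree_of l"
      using r t by (intro mult_right_mono Bb blocks_lists[OF Am hs]) (auto simp: length_blocks)
    also have "\<dots> = D * (prod_list (map norm ?b) * r ^ degree_of l) * t ^ degree_of l" by simp
    also have "\<dots> \<le> D * (C ^ length l * prod_list (map norm hs)) * t ^ degree_of l"
      using t D by (intro mult_right_mono mult_left_mono norm_blocks_le[OF Ab r C]) (use hs in auto)
    also have "\<dots> = D * prod_list (map norm hs) * (C ^ length l * t ^ degree_of l)" by simp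
    also have "\<dots> = D * prod_list (map a l) * prod_list (map norm hs) * (\<sigma> ^ length l * r ^ degree_of l)"
      unfolding prod_a[symmetric] by simp
    finally show ?thesis using \<sigma> r by (simp add: mult_le_cancel_right)
  qed
  define comps where "comps N = {l. degree_of l = N}" for N
  \<comment> \<open>All parts are positive, so the degree bounds both the length and the
    entries.\<close>
  have fin: "finite (comps N)" for N
  proof (rule finite_subset)
    have "length l \<le> degree_of l" "n \<in> set l \<Longrightarrow> n \<le> degree_of l" for n l
      by (induction l) auto
    then show "comps N \<subseteq> {l. set l \<subseteq> {..N} \<and> length l \<le> N}"
      unfolding comps_def by (auto simp: subset_iff)
  qed (rule finite_lists_length_le, simp)
  define K where "K N hs = (\<Sum>l\<in>comps N. B (length l) (blocks A l hs))" for N hs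
  have "multilinear_on s V s'' V'' N (K N)" for N
    unfolding K_def using multilinear_blocks[OF Am Bm]
    by (intro multilinear_sum[OF bs'']) (auto simp: comps_def)
  moreover have "norm (K N hs) * t ^ N \<le> (D * 2) * prod_list (map norm hs)"
    if hs: "hs \<in> lists V" "length hs = N" for N hs
  proof -
    have "norm (K N hs) * t ^ N \<le> (\<Sum>l\<in>comps N. norm (B (length l) (blocks A l hs))) * t ^ N"
      unfolding K_def using t by (intro mult_right_mono norm_sum) auto
    also have "\<dots> = (\<Sum>l\<in>comps N. norm (B (length l) (blocks A l hs)) * t ^ degree_of l)"
      by (simp add: sum_distrib_right comps_def)
    also have "\<dots> \<le> (\<Sum>l\<in>comps N. D * prod_list (map a l) * prod_list (map norm hs))"
      using hs by (intro sum_mono coeff_le) (auto simp: comps_def)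
    also have "\<dots> = D * prod_list (map norm hs) * (\<Sum>l\<in>comps N. prod_list (map a l))"
      by (simp add: sum_distrib_left mult_ac)
    also have "\<dots> \<le> D * prod_list (map norm hs) * 2"
      using D by (intro mult_left_mono a_lists fin mult_nonneg_nonneg prod_list_norm_nonneg)
    finally show ?thesis by (simp add: mult_ac)
  qed
  moreover have "(\<lambda>N. K N (replicate N h)) sums g (f (x + h))" if h: "h \<in> V" "norm h < t" for h
  proof -
    define y where "y n = A (Suc n) (replicate (Suc n) h)" for n
    define k where "k = f (x + h) - f x"
    have hr: "norm h < r" using h t by simp
    have yk: "y sums k" using Av(3)[OF h(1) hr] by (simp add: y_def[abs_def] k_def)
    have yV: "y n \<in> V'" for n unfolding y_def
      by (rule multilinear_onD(1)[OF Am replicate_lists[OF h(1)]]) simp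
    have yn: "norm (y n) \<le> \<sigma> * a n" for n
    proof -
      have "norm (y n) * r ^ Suc n \<le> C * norm h ^ Suc n"
        unfolding y_def using Ab[of "replicate (Suc n) h" "Suc n"] replicate_lists[OF h(1), of "Suc n"]
        by (simp add: prod_list_replicate del: replicate_Suc)
      also have "\<dots> \<le> C * t ^ Suc n"
        using C h(2) by (intro mult_left_mono power_mono) auto
      also have "\<dots> = \<sigma> * a n * r ^ Suc n"
        using \<sigma> by (simp add: a_def t_def power_mult_distrib)
      finally show ?thesis using r by (simp add: mult_le_cancel_right)
    qed
    have sy: "summable (\<lambda>n. norm (y n))"
      by (rule summable_comparison_test'[OF summable_mult[OF a_sum(1)]]) (use yn in auto)
    \<comment> \<open>The series of \<open>g\<close> is only known for increments in
      \<open>V'\<close>; \<open>k\<close> is one, being a limit of partial sums in the closed set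
      \<open>V'\<close>.\<close>
    have kV: "k \<in> V'"
    proof -
      have "(\<Sum>i<n. y i) \<in> V'" for n by (rule banach_space_over.subspaceD[OF bs']) (rule yV)
      moreover have "closed V'" by (rule banach_space_over.subspaceD[OF bs'])
      ultimately show ?thesis using yk unfolding sums_def by (meson closed_sequentially)
    qed
    have "norm k \<le> (\<Sum>n. norm (y n))"
      using yk sy summable_norm[OF sy] by (simp add: sums_iff)
    also have "\<dots> \<le> (\<Sum>n. \<sigma> * a n)" using sy a_sum yn by (intro suminf_le summable_mult) auto
    also have "\<dots> \<le> \<sigma> * (1 / 2)"
      using a_sum \<sigma> by (subst suminf_mult) (auto intro: mult_left_mono)
    also have "\<dots> < \<sigma>" using \<sigma> by simp
    finally have Bk: "(\<lambda>n. B n (replicate n k)) sums g (f (x + h))"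
      using Bc[OF kV] by (simp add: k_def)
    define F where "F l = B (length l) (map y l)" for l
    have Fb: "F l = B (length l) (blocks A l (replicate N h))" if "l \<in> comps N" for l N
      using that blocks_replicate[of A l h] unfolding comps_def F_def y_def by auto
    have Fn: "norm (F l) \<le> D * prod_list (map a l)" for l
    proof -
      have "norm (F l) * t ^ degree_of l \<le> D * prod_list (map a l) * norm h ^ degree_of l"
        using coeff_le[OF replicate_lists[OF h(1)], of "degree_of l" l] Fb[of l "degree_of l"]
        by (simp add: comps_def prod_list_replicate)
      also have "\<dots> \<le> D * prod_list (map a l) * t ^ degree_of l"
        using h(2) D a0 by (intro mult_left_mono power_mono mult_nonneg_nonneg prod_list_nonneg) auto
      finally show ?thesis using t by (simp add: mult_le_cancel_right)
    qed
    have "F abs_summable_on UNIV"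
    proof (rule nonneg_bdd_above_summable_on)
      show "bdd_above (sum (\<lambda>x. norm (F x)) ` {F. F \<subseteq> UNIV \<and> finite F})"
      proof (rule bdd_aboveI2)
        fix S :: "nat list set" assume "S \<in> {F. F \<subseteq> UNIV \<and> finite F}"
        then have "finite S" by simp
        have "(\<Sum>l\<in>S. norm (F l)) \<le> (\<Sum>l\<in>S. D * prod_list (map a l))" by (rule sum_mono) (rule Fn)
        also have "\<dots> = D * (\<Sum>l\<in>S. prod_list (map a l))" by (simp add: sum_distrib_left)
        also have "\<dots> \<le> D * 2" using D by (intro mult_left_mono a_lists \<open>finite S\<close>)
        finally show "(\<Sum>l\<in>S. norm (F l)) \<le> D * 2" .
      qed
    qed simp
    then have Fs: "F summable_on UNIV" by (rule abs_summable_summable)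
    then obtain S where S: "(F has_sum S) UNIV" by (auto simp: summable_on_def)
    \<comment> \<open>An unconditional sum may be grouped by any label \<open>d\<close> of the
      lists. The label is \<open>length\<close> for the outer series and \<open>degree_of\<close>
      for the composite one.\<close>
    have grouped: "(\<lambda>n. G n) sums S" if G: "\<And>n. (F has_sum G n) {l. d l = n}" for d :: "nat list \<Rightarrow> nat" and G
    proof -
      have bij: "bij_betw snd (SIGMA n:UNIV. {l. d l = n}) UNIV"
        by (rule bij_betwI[where g = "\<lambda>l. (d l, l)"]) auto
      have "((\<lambda>x. F (snd x)) has_sum S) (SIGMA n:UNIV. {l. d l = n})"
        using has_sum_reindex_bij_betw[OF bij, of F] S by simp
      then have "(G has_sum S) UNIV" by (rule has_sum_SigmaD) (use G in simp)
      then show ?thesis by (rule has_sum_imp_sums)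
    qed
    have "(\<lambda>n. B n (replicate n k)) sums S"
    proof (rule grouped[of length])
      fix m
      have "((\<lambda>l. B m (map y l)) has_sum B m (replicate m k)) {l. length l = m}"
      proof (rule multilinear_has_sum[OF bs' Bm _ yV yk kV sy])
        show "norm (B m ws) \<le> D / \<sigma> ^ m * prod_list (map norm ws)"
          if "ws \<in> lists V'" "length ws = m" for ws
          using Bb[OF that] \<sigma> by (simp add: field_simps)
        have "F summable_on {l. length l = m}" by (rule summable_on_subset_banach[OF Fs]) simp
        then show "(\<lambda>l. B m (map y l)) summable_on {l. length l = m}"
          by (rule summable_on_cong[THEN iffD1, rotated]) (simp add: F_def)
      qed
      then show "(F has_sum B m (replicate m k)) {l. length l = m}"
        by (rule has_sum_cong[THEN iffD1, rotated]) (simp add: F_def)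
    qed
    with Bk have "S = g (f (x + h))" using sums_unique2 by blast
    moreover have "(\<lambda>N. K N (replicate N h)) sums S"
    proof (rule grouped[of degree_of])
      fix N
      have "(F has_sum (\<Sum>l\<in>comps N. F l)) (comps N)" by (rule has_sum_finite[OF fin])
      also have "(\<Sum>l\<in>comps N. F l) = K N (replicate N h)"
        unfolding K_def by (rule sum.cong) (use Fb in auto)
      finally show "(F has_sum K N (replicate N h)) {l. degree_of l = N}" by (simp add: comps_def)
    qed
    ultimately show ?thesis by simp
  qed
  ultimately show ?thesis unfolding analytic_pt_def using t(1) by blast
qed

section \<open>Continuity of germs, affine and bilinear maps, change of the target space\<close>

lemma analytic_pt_cont:
  fixes f :: "'v::banach \<Rightarrow> 'w::banach"
  assumes bs: "banach_space_over s" "banach_subspace s V"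
    and f: "analytic_pt s V s' V' f x" and "0 < e"
  shows "nbhd_on V x (\<lambda>y. norm (f y - f x) < e)"
proof -
  from f obtain r C A where r: "0 < r" and Am: "\<And>n. multilinear_on s V s' V' n (A n)"
    and Ab0: "\<forall>n. \<forall>hs\<in>lists V. length hs = n \<longrightarrow>
          norm (A n hs) * r ^ n \<le> C * prod_list (map norm hs)"
    and Ac0: "\<forall>h\<in>V. norm h < r \<longrightarrow> (\<lambda>n. A n (replicate n h)) sums f (x + h)"
    unfolding analytic_pt_def by blast
  note Av = analytic_pt_value[OF bs Am r Ab0 Ac0]
  note Ab = Ab0[rule_format]
  \<comment> \<open>The bound \<open>r / 2\<close> makes the tail geometric with ratio at most 1/2,
    so the increment is at most \<open>2 * C * norm h / r\<close>; the second bound brings this down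
    to \<open>e / 2\<close>. Using \<open>C + 1\<close> in the denominator allows
    \<open>C = 0\<close>.\<close>
  define d where "d = min (r / 2) (r * e / (4 * (C + 1)))"
  have d: "0 < d" using r \<open>0 < e\<close> Av(2) by (auto simp: d_def)
  show ?thesis
  proof (rule nbhd_onI[OF d])
    fix h assume h: "h \<in> V" "norm h < d"
    then have hr: "norm h < r" "norm h / r \<le> 1 / 2" using r by (auto simp: d_def field_simps)
    let ?y = "\<lambda>n. A (Suc n) (replicate (Suc n) h)" and ?q = "norm h / r"
    have y: "norm (?y n) \<le> C * ?q * (1 / 2) ^ n" for n
    proof -
      have "norm (?y n) \<le> C * ?q ^ Suc n"
        using Ab[of "replicate (Suc n) h" "Suc n"] replicate_lists[OF h(1), of "Suc n"] r
        by (simp add: prod_list_replicate power_divide pos_le_divide_eq mult_ac del: replicate_Suc)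
      also have "\<dots> = C * ?q * ?q ^ n" by simp
      also have "\<dots> \<le> C * ?q * (1 / 2) ^ n"
        using hr Av(2) r by (intro mult_left_mono power_mono) auto
      finally show ?thesis .
    qed
    have s: "(\<lambda>n. C * ?q * (1 / 2) ^ n) sums (C * ?q * 2)"
      using sums_mult[OF geometric_sums[of "1 / 2 :: real"], of "C * ?q"] by simp
    have "norm (f (x + h) - f x) \<le> C * ?q * 2"
      by (rule norm_sums_le[OF Av(3)[OF h(1) hr(1)] s y])
    also have "\<dots> = 2 * C * norm h / r" by simp
    also have "\<dots> \<le> 2 * C * (r * e / (4 * (C + 1))) / r"
      using h(2) Av(2) r by (intro divide_right_mono mult_left_mono) (auto simp: d_def)
    also have "\<dots> = (C / (C + 1)) * (e / 2)"
    proof -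
      have "2 * C * (r * e / (4 * c)) / r = (C / c) * (e / 2)" for c
        using r by (cases "c = 0") (auto simp: field_simps)
      then show ?thesis .
    qed
    also have "\<dots> \<le> 1 * (e / 2)" using Av(2) \<open>0 < e\<close> by (intro mult_right_mono) auto
    also have "\<dots> < e" using \<open>0 < e\<close> by simp
    finally show "norm (f (x + h) - f x) < e" .
  qed
qed

lemma analytic_ptI:
  assumes "0 < r" "\<And>n. multilinear_on s V s' V' n (A n)"
    "\<And>n hs. hs \<in> lists V \<Longrightarrow> length hs = n \<Longrightarrow>
      norm (A n hs) * r ^ n \<le> C * prod_list (map norm hs)"
    "\<And>h. h \<in> V \<Longrightarrow> norm h < r \<Longrightarrow> (\<lambda>n. A n (replicate n h)) sums f (x + h)"
  shows "analytic_pt s V s' V' f x"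
  using assms unfolding analytic_pt_def by blast

text \<open>A series with terms of degree 0 and 1 only. The map has to be affine merely along
  \<open>V\<close>, which covers restrictions of operators to subspaces; the maximum serves as a
  common bound for both degrees.\<close>

lemma analytic_pt_affine:
  assumes bs': "banach_space_over s'" "banach_subspace s' V'"
    and fx: "f x \<in> V'" "\<And>h. h \<in> V \<Longrightarrow> f (x + h) = f x + L h"
    and L: "\<And>h. h \<in> V \<Longrightarrow> L h \<in> V'" "\<And>h k. h \<in> V \<Longrightarrow> k \<in> V \<Longrightarrow> L (h + k) = L h + L k"
      "\<And>a h. h \<in> V \<Longrightarrow> L (s a h) = s' a (L h)"
      "\<And>h. h \<in> V \<Longrightarrow> norm (L h) \<le> K * norm h"
  shows "analytic_pt s V s' V' f x"
proof -
  interpret banach_space_over s' by fact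
  define A where "A n hs = (if n = 0 then f x else if n = 1 then L (hd hs) else 0)" for n :: nat and hs
  have "multilinear_on s V s' V' n (A n)" for n
  proof (rule multilinear_onI)
    fix hs assume hs: "hs \<in> lists V" "length hs = n"
    have n1: "\<exists>h\<in>V. hs = [h]" if "n = 1" using hs that by (auto simp: length_Suc_conv)
    show "A n hs \<in> V'" unfolding A_def using fx(1) L(1) subspaceD(1)[OF bs'(2)] n1 by auto
    fix i x assume i: "i < n" and x: "x \<in> V"
    show "A n (hs[i := s a x]) = s' a (A n (hs[i := x]))" for a
      unfolding A_def using n1 i L(3)[OF x] by auto
    show "A n (hs[i := x + y]) = A n (hs[i := x]) + A n (hs[i := y])" if "y \<in> V" for y
      unfolding A_def using n1 i L(2)[OF x that] by auto
  qed
  moreover have "norm (A n hs) * 1 ^ n \<le> max (norm (f x)) K * prod_list (map norm hs)"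
    if hs: "hs \<in> lists V" "length hs = n" for n hs
  proof -
    consider "n = 0" "hs = []" | h where "n = 1" "hs = [h]" "h \<in> V" | "1 < n"
      using hs by (cases hs; cases n) (auto simp: length_Suc_conv Suc_lessI)
    then show ?thesis
    proof cases
      case 2
      have "norm (L h) \<le> max (norm (f x)) K * norm h"
        using L(4)[OF 2(3)] by (rule order_trans) (simp add: mult_right_mono)
      then show ?thesis using 2 by (simp add: A_def)
    next
      case 3
      have "0 \<le> max (norm (f x)) K" by (simp add: le_max_iff_disj)
      then show ?thesis using 3 by (simp add: A_def prod_list_norm_nonneg)
    qed (simp add: A_def)
  qed
  moreover have "(\<lambda>n. A n (replicate n h)) sums f (x + h)" if "h \<in> V" for h
  proof -
    have "(\<lambda>n. A n (replicate n h)) sums (\<Sum>n\<in>{0, 1}. A n (replicate n h))"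
      by (rule sums_finite) (auto simp: A_def)
    then show ?thesis by (simp add: A_def fx(2)[OF that])
  qed
  ultimately show ?thesis
    by (intro analytic_ptI[where r = 1 and C = "max (norm (f x)) K" and A = A]) auto
qed

lemma analytic_pt_linear:
  assumes "banach_space_over s'" "banach_subspace s' V'" "x \<in> V"
    "\<And>h. h \<in> V \<Longrightarrow> L h \<in> V'" "\<And>h k. h \<in> V \<Longrightarrow> k \<in> V \<Longrightarrow> L (h + k) = L h + L k"
    "\<And>a h. h \<in> V \<Longrightarrow> L (s a h) = s' a (L h)"
    "\<And>h. h \<in> V \<Longrightarrow> norm (L h) \<le> K * norm h"
  shows "analytic_pt s V s' V' L x"
  by (rule analytic_pt_affine[where L = L and K = K]) (use assms in auto)

lemma analytic_pt_const:
  assumes bs': "banach_space_over s'" "banach_subspace s' V'" and "c \<in> V'"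
  shows "analytic_pt s V s' V' (\<lambda>_. c) x"
proof -
  interpret banach_space_over s' by fact
  show ?thesis
    by (rule analytic_pt_affine[OF bs', where L = "\<lambda>_. 0" and K = 0])
      (use assms subspaceD(1)[OF bs'(2)] in auto)
qed

lemma analytic_pt_id:
  assumes bs: "banach_space_over s" "banach_subspace s V" and "x \<in> V"
  shows "analytic_pt s V s V (\<lambda>x. x) x"
  by (rule analytic_pt_linear[OF bs, where K = 1]) (use assms in auto)

text \<open>Coefficients restrict to a smaller source and stay valid in a larger target. Shrinking
  the target is the problem that \<open>analytic_pt_proj\<close> solves.\<close>

lemma analytic_pt_mono:
  assumes f: "analytic_pt s V s' V' f x" and sub: "U \<subseteq> V" "V' \<subseteq> U'"
  shows "analytic_pt s U s' U' f x"
proof -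
  have "multilinear_on s U s' U' n A" if "multilinear_on s V s' V' n A" for n A
    using that sub lists_mono[OF sub(1)] unfolding multilinear_on_def by (meson subsetD)
  moreover have "lists U \<subseteq> lists V" using sub(1) by (rule lists_mono)
  ultimately show ?thesis using f sub(1) unfolding analytic_pt_def by (meson subsetD)
qed

definition scale_prod :: "('k \<Rightarrow> 'v \<Rightarrow> 'v) \<Rightarrow> ('k \<Rightarrow> 'w \<Rightarrow> 'w) \<Rightarrow> 'k \<Rightarrow> 'v \<times> 'w \<Rightarrow> 'v \<times> 'w" where
  "scale_prod s s' a = (\<lambda>(x, y). (s a x, s' a y))"

lemma scale_prod_simps [simp]:
  "scale_prod s s' a (x, y) = (s a x, s' a y)"
  "fst (scale_prod s s' a z) = s a (fst z)" "snd (scale_prod s s' a z) = s' a (snd z)"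
  by (auto simp: scale_prod_def case_prod_beta)

lemma banach_space_over_prod:
  assumes "banach_space_over s" "banach_space_over s'"
  shows "banach_space_over (scale_prod s s')"
proof -
  interpret A: banach_space_over s by fact
  interpret B: banach_space_over s' by fact
  show ?thesis
    by unfold_locales
      (auto simp: scale_prod_def A.scale_right_distrib B.scale_right_distrib A.scale_left_distrib
        B.scale_left_distrib A.norm_scale B.norm_scale A.scale_of_real B.scale_of_real norm_prod_def
        power_mult_distrib real_sqrt_mult simp flip: distrib_left)
qed

lemma banach_subspace_prod:
  assumes "banach_space_over s" "banach_subspace s V" "banach_space_over s'" "banach_subspace s' V'"
  shows "banach_subspace (scale_prod s s') (V \<times> V')"
proof -
  interpret A: banach_space_over s by fact
  interpret B: banach_space_over s' by fact
  interpret C: banach_space_over "scale_prod s s'" using assms by (intro banach_space_over_prod)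
  show ?thesis using assms(2,4) unfolding A.subspace_iff B.subspace_iff C.subspace_iff
    by (auto simp: zero_prod_def closed_Times)
qed

lemma analytic_pt_Pair:
  fixes f :: "'v::banach \<Rightarrow> 'w::banach" and g :: "'v \<Rightarrow> 'u::banach"
  assumes f: "analytic_pt s V s' V' f x" and g: "analytic_pt s V s'' V'' g x"
  shows "analytic_pt s V (scale_prod s' s'') (V' \<times> V'') (\<lambda>x. (f x, g x)) x"
proof -
  from f obtain r C A where r: "0 < r" and Am: "\<And>n. multilinear_on s V s' V' n (A n)"
    and Ab: "\<forall>n. \<forall>hs\<in>lists V. length hs = n \<longrightarrow>
          norm (A n hs) * r ^ n \<le> C * prod_list (map norm hs)"
    and Ac: "\<forall>h\<in>V. norm h < r \<longrightarrow> (\<lambda>n. A n (replicate n h)) sums f (x + h)"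
    unfolding analytic_pt_def by blast
  from analytic_pt_radius[OF g r] obtain t D B where t: "0 < t" "t \<le> r"
    and Bm: "\<And>n. multilinear_on s V s'' V'' n (B n)"
    and Bb: "\<forall>n. \<forall>hs\<in>lists V. length hs = n \<longrightarrow>
          norm (B n hs) * t ^ n \<le> D * prod_list (map norm hs)"
    and Bc: "\<forall>h\<in>V. norm h < t \<longrightarrow> (\<lambda>n. B n (replicate n h)) sums g (x + h)"
    by blast
  define P where "P n hs = (A n hs, B n hs)" for n hs
  have "multilinear_on s V (scale_prod s' s'') (V' \<times> V'') n (P n)" for n
    using multilinear_onD[OF Am] multilinear_onD[OF Bm] unfolding P_def
    by (intro multilinear_onI) auto
  moreover have "norm (P n hs) * t ^ n \<le> (C + D) * prod_list (map norm hs)"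
    if hs: "hs \<in> lists V" "length hs = n" for n hs
  proof -
    have "norm (P n hs) * t ^ n \<le> (norm (A n hs) + norm (B n hs)) * t ^ n"
      using t unfolding P_def by (intro mult_right_mono norm_Pair_le) auto
    also have "\<dots> \<le> norm (A n hs) * r ^ n + norm (B n hs) * t ^ n"
      using t by (auto simp: distrib_right intro!: mult_left_mono power_mono)
    also have "\<dots> \<le> (C + D) * prod_list (map norm hs)"
      using Ab Bb hs by (auto simp: distrib_right intro!: add_mono)
    finally show ?thesis .
  qed
  moreover have "(\<lambda>n. P n (replicate n h)) sums (f (x + h), g (x + h))" if "h \<in> V" "norm h < t" for h
  proof -
    have "(\<Sum>i<n. P i (replicate i h)) = (\<Sum>i<n. A i (replicate i h), \<Sum>i<n. B i (replicate i h))" for n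
      by (induction n) (auto simp: P_def zero_prod_def)
    then show ?thesis using Ac Bc that t unfolding sums_def by (auto intro!: tendsto_Pair)
  qed
  ultimately show ?thesis unfolding analytic_pt_def using t(1) by blast
qed

lemma analytic_pt_bilinear:
  fixes f :: "'v::banach \<Rightarrow> 'w::banach" and g :: "'v \<Rightarrow> 'u::banach" and b :: "'w \<Rightarrow> 'u \<Rightarrow> 'z::banach"
  assumes bs: "banach_space_over s" "banach_subspace s V"
    and bs': "banach_space_over s'" "banach_subspace s' V'"
    and bs'': "banach_space_over s''" "banach_subspace s'' V''"
    and bt: "banach_space_over t" "banach_subspace t T"
    and b: "\<And>x y. x \<in> V' \<Longrightarrow> y \<in> V'' \<Longrightarrow> b x y \<in> T"
      "\<And>x x' y. x \<in> V' \<Longrightarrow> x' \<in> V' \<Longrightarrow> y \<in> V'' \<Longrightarrow> b (x + x') y = b x y + b x' y"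
      "\<And>x y y'. x \<in> V' \<Longrightarrow> y \<in> V'' \<Longrightarrow> y' \<in> V'' \<Longrightarrow> b x (y + y') = b x y + b x y'"
      "\<And>a x y. x \<in> V' \<Longrightarrow> y \<in> V'' \<Longrightarrow> b (s' a x) y = t a (b x y)"
      "\<And>a x y. x \<in> V' \<Longrightarrow> y \<in> V'' \<Longrightarrow> b x (s'' a y) = t a (b x y)"
      "\<And>x y. x \<in> V' \<Longrightarrow> y \<in> V'' \<Longrightarrow> norm (b x y) \<le> K * norm x * norm y" and "0 \<le> K"
    and f: "analytic_pt s V s' V' f x" "f x \<in> V'" and g: "analytic_pt s V s'' V'' g x" "g x \<in> V''"
  shows "analytic_pt s V t T (\<lambda>x. b (f x) (g x)) x"
proof -
  interpret T: banach_space_over t by fact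
  let ?s = "scale_prod s' s''" and ?V = "V' \<times> V''"
  let ?u = "f x" and ?v = "g x"
  \<comment> \<open>The exact Taylor expansion of \<open>b\<close> at \<open>(?u, ?v)\<close>. The
    quadratic coefficient is not symmetrised: slot 0 feeds the first argument and slot 1 the second.
    The constant \<open>C\<close> adds up the bounds of the three degrees.\<close>
  define A where "A n hs = (if n = 0 then b ?u ?v
     else if n = 1 then b ?u (snd (hs ! 0)) + b (fst (hs ! 0)) ?v
     else if n = 2 then b (fst (hs ! 0)) (snd (hs ! 1)) else 0)" for n :: nat and hs
  define C where "C = K * norm ?u * norm ?v + K * (norm ?u + norm ?v) + K"
  have C: "K * norm ?u * norm ?v \<le> C" "K * (norm ?u + norm ?v) \<le> C" "K \<le> C" "0 \<le> C"
    using \<open>0 \<le> K\<close> by (auto simp: C_def)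
  have "analytic_pt ?s ?V t T (\<lambda>z. b (fst z) (snd z)) (f x, g x)"
  proof -
    have cases2: "(n = 0 \<and> hs = []) \<or> (\<exists>h\<in>?V. n = 1 \<and> hs = [h]) \<or>
        (\<exists>h\<in>?V. \<exists>k\<in>?V. n = 2 \<and> hs = [h, k]) \<or> 2 < n"
      if hs: "hs \<in> lists ?V" "length hs = n" for n hs
    proof (cases hs)
      case (Cons h l)
      then show ?thesis using hs by (cases l) (auto simp: length_Suc_conv numeral_2_eq_2 Suc_lessI)
    qed (use hs in simp)
    have "multilinear_on ?s ?V t T n (A n)" for n
    proof (rule multilinear_onI)
      fix hs assume hs: "hs \<in> lists ?V" "length hs = n"
      show "A n hs \<in> T"
        using cases2[OF hs] f(2) g(2) T.subspaceD[OF bt(2)]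
        by (auto simp: A_def intro!: T.subspaceD(2)[OF bt(2)] b(1))
      fix i z assume i: "i < n" and z: "z \<in> ?V"
      show "A n (hs[i := ?s a z]) = t a (A n (hs[i := z]))" for a
        using cases2[OF hs] i z f(2) g(2)
        by (auto simp: A_def b less_Suc_eq numeral_2_eq_2 T.scale_right_distrib)
      show "A n (hs[i := z + z']) = A n (hs[i := z]) + A n (hs[i := z'])" if "z' \<in> ?V" for z'
        using cases2[OF hs] i z that f(2) g(2)
        by (auto simp: A_def b less_Suc_eq numeral_2_eq_2)
    qed
    moreover have "norm (A n hs) * 1 ^ n \<le> C * prod_list (map norm hs)"
      if hs: "hs \<in> lists ?V" "length hs = n" for n hs
    proof -
      have fs: "norm (fst z) \<le> norm z" "norm (snd z) \<le> norm z" for z :: "'w \<times> 'u"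
        by (metis norm_fst_le prod.collapse, metis norm_snd_le prod.collapse)
      consider "n = 0" "hs = []" | h where "n = 1" "hs = [h]" "h \<in> ?V"
        | h k where "n = 2" "hs = [h, k]" "h \<in> ?V" "k \<in> ?V" | "2 < n"
        using cases2[OF hs] by blast
      then show ?thesis
      proof cases
        case 1
        then show ?thesis using b(6)[OF f(2) g(2)] C(1) by (simp add: A_def)
      next
        case 2
        have "norm (A n hs) \<le> norm (b ?u (snd h)) + norm (b (fst h) ?v)"
          using 2 by (simp add: A_def norm_triangle_ineq)
        also have "\<dots> \<le> K * norm ?u * norm (snd h) + K * norm (fst h) * norm ?v"
          using 2 f(2) g(2) by (intro add_mono b(6)) auto
        also have "\<dots> \<le> K * norm ?u * norm h + K * norm h * norm ?v"
          using \<open>0 \<le> K\<close> fs by (intro add_mono mult_mono) auto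
        also have "\<dots> = K * (norm ?u + norm ?v) * norm h" by (simp add: algebra_simps)
        also have "\<dots> \<le> C * norm h" using C by (intro mult_right_mono) auto
        finally show ?thesis using 2 by simp
      next
        case 3
        have "norm (A n hs) \<le> K * norm (fst h) * norm (snd k)"
          using 3 by (auto simp: A_def intro!: b(6))
        also have "\<dots> \<le> K * norm h * norm k"
          using \<open>0 \<le> K\<close> fs by (intro mult_mono) auto
        also have "\<dots> \<le> C * norm h * norm k" using C by (intro mult_right_mono) auto
        finally show ?thesis using 3 by (simp add: mult.assoc)
      next
        case 4
        then show ?thesis using C by (simp add: A_def prod_list_norm_nonneg)
      qed
    qed
    moreover have "(\<lambda>n. A n (replicate n h)) sums b (fst ((f x, g x) + h)) (snd ((f x, g x) + h))"
      if h: "h \<in> ?V" for h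
    proof -
      have "(\<lambda>n. A n (replicate n h)) sums (\<Sum>n\<in>{0, 1, 2}. A n (replicate n h))"
        by (rule sums_finite) (auto simp: A_def)
      also have "(\<Sum>n\<in>{0, 1, 2}. A n (replicate n h)) = b (fst ((f x, g x) + h)) (snd ((f x, g x) + h))"
        using h f(2) g(2)
        by (auto simp: A_def b banach_space_over.subspaceD(2)[OF bs'] banach_space_over.subspaceD(2)[OF bs''])
      finally show ?thesis .
    qed
    ultimately show ?thesis
      by (intro analytic_ptI[where r = 1 and C = C and A = A]) auto
  qed
  from analytic_pt_compose[OF bs banach_space_over_prod[OF bs'(1) bs''(1)]
      banach_subspace_prod[OF bs' bs''] bt analytic_pt_Pair[OF f(1) g(1)] this]
  show ?thesis by simp
qed

lemma analytic_pt_add: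
  fixes f g :: "'v::banach \<Rightarrow> 'w::banach"
  assumes bs: "banach_space_over s" "banach_subspace s V"
    and bs': "banach_space_over s'" "banach_subspace s' V'"
    and f: "analytic_pt s V s' V' f x" "f x \<in> V'" and g: "analytic_pt s V s' V' g x" "g x \<in> V'"
  shows "analytic_pt s V s' V' (\<lambda>x. f x + g x) x"
proof -
  interpret banach_space_over s' by fact
  have "analytic_pt (scale_prod s' s') (V' \<times> V') s' V' (\<lambda>z. fst z + snd z) (f x, g x)"
  proof (rule analytic_pt_linear[OF bs', where K = 2])
    fix h :: "'w \<times> 'w"
    show "norm (fst h + snd h) \<le> 2 * norm h"
      using norm_fst_le[of "fst h" "snd h"] norm_snd_le[of "snd h" "fst h"]
      by (intro norm_triangle_le) simp
  qed (use f g subspaceD[OF bs'(2)] in \<open>auto simp: scale_right_distrib\<close>)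
  from analytic_pt_compose[OF bs banach_space_over_prod[OF bs'(1) bs'(1)]
      banach_subspace_prod[OF bs' bs'] bs' analytic_pt_Pair[OF f(1) g(1)] this]
  show ?thesis by simp
qed

text \<open>That the values near \<open>x\<close> lie in \<open>U\<close> does not place the given
  coefficients there. Composing with a bounded linear \<open>P\<close> that is the identity on
  \<open>U\<close> does, and leaves the function near \<open>x\<close> unchanged.\<close>

lemma analytic_pt_proj:
  fixes f :: "'v::banach \<Rightarrow> 'w::banach"
  assumes bs: "banach_space_over s" "banach_subspace s V"
    and bs': "banach_space_over s'" "banach_subspace s' V'" "banach_subspace s' U"
    and f: "analytic_pt s V s' V' f x" "f x \<in> V'" "nbhd_on V x (\<lambda>y. f y \<in> U)"
    and P: "\<And>h. h \<in> V' \<Longrightarrow> P h \<in> U" "\<And>h k. h \<in> V' \<Longrightarrow> k \<in> V' \<Longrightarrow> P (h + k) = P h + P k"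
      "\<And>a h. h \<in> V' \<Longrightarrow> P (s' a h) = s' a (P h)"
      "\<And>h. h \<in> V' \<Longrightarrow> norm (P h) \<le> K * norm h" "\<And>h. h \<in> U \<Longrightarrow> P h = h"
  shows "analytic_pt s V s' U f x"
proof -
  have "analytic_pt s' V' s' U P (f x)"
    by (rule analytic_pt_linear[OF bs'(1,3) f(2)]) (use P in auto)
  from analytic_pt_compose[OF bs bs'(1,2) bs'(1,3) f(1) this]
  have "analytic_pt s V s' U (\<lambda>x. P (f x)) x" .
  then show ?thesis
    by (rule analytic_pt_cong) (rule nbhd_on_mono[OF f(3)], use P(5) in auto)
qed

section \<open>Operators\<close>

lemma blinfun_compose_assoc: "A o\<^sub>L B o\<^sub>L C = A o\<^sub>L (B o\<^sub>L C)"
  by (rule blinfun_eqI) simp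

lemma blinfun_compose_id [simp]: "id_blinfun o\<^sub>L A = A" "A o\<^sub>L id_blinfun = A"
  by (rule blinfun_eqI; simp)+

lemmas blinfun_compose_algebra =
  bounded_bilinear.add_left[OF bounded_bilinear_blinfun_compose]
  bounded_bilinear.add_right[OF bounded_bilinear_blinfun_compose]
  bounded_bilinear.diff_left[OF bounded_bilinear_blinfun_compose]
  bounded_bilinear.diff_right[OF bounded_bilinear_blinfun_compose]
  bounded_bilinear.minus_left[OF bounded_bilinear_blinfun_compose]
  bounded_bilinear.minus_right[OF bounded_bilinear_blinfun_compose]
  blinfun_compose_assoc

lemma op_inv_eq:
  assumes "W o\<^sub>L V = id_blinfun" "V o\<^sub>L W = id_blinfun"
  shows "op_inv W = V"
  unfolding op_inv_def
proof (rule the_equality)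
  fix V' assume "W o\<^sub>L V' = id_blinfun \<and> V' o\<^sub>L W = id_blinfun"
  then show "V' = V" using assms by (metis blinfun_compose_assoc blinfun_compose_id)
qed (use assms in simp)

context banach_space_over
begin

lemma bounded_linear_scale_blinfun:
  fixes T :: "'a::real_normed_vector \<Rightarrow>\<^sub>L 'x"
  shows "bounded_linear (\<lambda>x. sc a (T x))"
  by (rule bounded_linear_compose[OF bounded_linear_scale]) (rule blinfun.bounded_linear_right)

lemma scale_blinfun_apply [simp]:
  fixes T :: "'a::real_normed_vector \<Rightarrow>\<^sub>L 'x"
  shows "blinfun_apply (scale_blinfun sc a T) x = sc a (T x)"
  unfolding scale_blinfun_def by (simp add: bounded_linear_Blinfun_apply bounded_linear_scale_blinfun)

lemma banach_space_over_blinfun: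
  "banach_space_over (scale_blinfun sc :: 'k \<Rightarrow> ('a::real_normed_vector \<Rightarrow>\<^sub>L 'x) \<Rightarrow> _)"
proof
  fix a b :: 'k and S T :: "'a \<Rightarrow>\<^sub>L 'x" and r
  show "scale_blinfun sc a (S + T) = scale_blinfun sc a S + scale_blinfun sc a T"
    "scale_blinfun sc (a + b) T = scale_blinfun sc a T + scale_blinfun sc b T"
    "scale_blinfun sc a (scale_blinfun sc b T) = scale_blinfun sc (a * b) T"
    "scale_blinfun sc 1 T = T" "scale_blinfun sc (of_real r) T = r *\<^sub>R T"
    by (auto intro!: blinfun_eqI simp: blinfun.bilinear_simps scale_right_distrib scale_left_distrib
        scale_of_real)
  \<comment> \<open>The same inequality for \<open>inverse a\<close> yields the converse
    estimate.\<close>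
  have le: "norm (scale_blinfun sc a T) \<le> norm a * norm T" for a and T :: "'a \<Rightarrow>\<^sub>L 'x"
    by (rule norm_blinfun_bound)
      (auto simp: norm_scale mult.assoc intro!: mult_left_mono norm_blinfun)
  show "norm (scale_blinfun sc a T) = norm a * norm T"
  proof (cases "a = 0")
    case False
    have "scale_blinfun sc (inverse a) (scale_blinfun sc a T) = T"
      using False by (auto intro!: blinfun_eqI)
    then have "norm T \<le> norm (inverse a) * norm (scale_blinfun sc a T)"
      using le[of "inverse a" "scale_blinfun sc a T"] by simp
    then have "norm a * norm T \<le> norm a * (norm (inverse a) * norm (scale_blinfun sc a T))"
      by (rule mult_left_mono) simp
    also have "\<dots> = norm (scale_blinfun sc a T)"
      using False by (simp add: norm_inverse)
    finally have "norm a * norm T \<le> norm (scale_blinfun sc a T)" .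
    with le[of a T] show ?thesis by simp
  qed (use le[of 0 T] in simp)
qed

interpretation op: banach_space_over "scale_blinfun sc :: 'k \<Rightarrow> ('x \<Rightarrow>\<^sub>L 'x) \<Rightarrow> _"
  by (rule banach_space_over_blinfun)

lemma LX_D: "T \<in> LX sc \<Longrightarrow> blinfun_apply T (sc a x) = sc a (T x)"
  by (simp add: LX_def)

lemma LX_subspace: "banach_subspace (scale_blinfun sc) (LX sc)"
  unfolding op.subspace_iff
proof (intro conjI)
  have "LX sc = (\<Inter>a x. {T. blinfun_apply T (sc a x) = sc a (T x)})" by (auto simp: LX_def)
  also have "closed \<dots>"
  proof (intro closed_INT ballI)
    fix a x
    have "continuous_on UNIV (\<lambda>T :: 'x \<Rightarrow>\<^sub>L 'x. sc a (T x))"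
      by (intro bounded_linear.continuous_on[OF bounded_linear_scale] continuous_intros)
    then show "closed {T. blinfun_apply T (sc a x) = sc a (T x)}"
      by (intro closed_Collect_eq continuous_intros)
  qed
  finally show "closed (LX sc)" .
qed (auto simp: LX_def blinfun.bilinear_simps scale_right_distrib scale_left_commute)

lemma LX_id: "id_blinfun \<in> LX sc" and LX_comp: "S \<in> LX sc \<Longrightarrow> T \<in> LX sc \<Longrightarrow> S o\<^sub>L T \<in> LX sc"
  by (auto simp: LX_def)

lemmas LX_closed = op.subspaceD[OF LX_subspace] LX_id LX_comp

lemma GL_I:
  "W \<in> LX sc \<Longrightarrow> V \<in> LX sc \<Longrightarrow> W o\<^sub>L V = id_blinfun \<Longrightarrow> V o\<^sub>L W = id_blinfun \<Longrightarrow> W \<in> GL sc"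
  unfolding GL_def by blast

text \<open>The last two equations are cancellation rules inside products nested to the right, the
  normal form used for all operator identities below.\<close>

lemma GL_inv:
  assumes "W \<in> GL sc"
  shows "W \<in> LX sc" "op_inv W \<in> LX sc" "op_inv W \<in> GL sc" "W o\<^sub>L op_inv W = id_blinfun"
    "op_inv W o\<^sub>L W = id_blinfun" "op_inv (op_inv W) = W"
    "W o\<^sub>L (op_inv W o\<^sub>L A) = A" "op_inv W o\<^sub>L (W o\<^sub>L A) = A"
proof -
  obtain V where W: "W \<in> LX sc" "V \<in> LX sc" "W o\<^sub>L V = id_blinfun" "V o\<^sub>L W = id_blinfun"
    using assms unfolding GL_def by blast
  then have "op_inv W = V" "op_inv V = W" by (auto intro: op_inv_eq)
  with W show "W \<in> LX sc" "op_inv W \<in> LX sc" "op_inv W \<in> GL sc" "W o\<^sub>L op_inv W = id_blinfun"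
    "op_inv W o\<^sub>L W = id_blinfun" "op_inv (op_inv W) = W"
    by (auto intro: GL_I)
  then show "W o\<^sub>L (op_inv W o\<^sub>L A) = A" "op_inv W o\<^sub>L (W o\<^sub>L A) = A"
    by (simp_all flip: blinfun_compose_assoc)
qed

lemma GL_id: "id_blinfun \<in> GL sc" "op_inv id_blinfun = id_blinfun"
  by (rule GL_I[OF LX_id LX_id]; simp) (rule op_inv_eq; simp)

lemma GL_comp:
  assumes "W \<in> GL sc" "V \<in> GL sc"
  shows "W o\<^sub>L V \<in> GL sc" "op_inv (W o\<^sub>L V) = op_inv V o\<^sub>L op_inv W"
proof -
  have "(W o\<^sub>L V) o\<^sub>L (op_inv V o\<^sub>L op_inv W) = id_blinfun"
    "(op_inv V o\<^sub>L op_inv W) o\<^sub>L (W o\<^sub>L V) = id_blinfun"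
    using assms by (simp_all add: blinfun_compose_assoc GL_inv)
  then show "W o\<^sub>L V \<in> GL sc" "op_inv (W o\<^sub>L V) = op_inv V o\<^sub>L op_inv W"
    using GL_I[OF LX_comp[OF GL_inv(1)[OF assms(1)] GL_inv(1)[OF assms(2)]]
        LX_comp[OF GL_inv(2)[OF assms(2)] GL_inv(2)[OF assms(1)]]] op_inv_eq by blast+
qed

lemma GL_apply:
  assumes "W \<in> GL sc"
  shows "blinfun_apply W (op_inv W x) = x" "blinfun_apply (op_inv W) (W x) = x"
  using GL_inv(4,5)[OF assms] by (metis blinfun_apply_blinfun_compose blinfun_apply_id_blinfun)+

section \<open>Products of operators, the Neumann series and inversion\<close>

lemma analytic_pt_comp_op:
  fixes f g :: "'v::banach \<Rightarrow> 'x \<Rightarrow>\<^sub>L 'x"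
  assumes "banach_space_over s" "banach_subspace s V"
    and "analytic_pt s V (scale_blinfun sc) (LX sc) f x" "f x \<in> LX sc"
    and "analytic_pt s V (scale_blinfun sc) (LX sc) g x" "g x \<in> LX sc"
  shows "analytic_pt s V (scale_blinfun sc) (LX sc) (\<lambda>x. f x o\<^sub>L g x) x"
  by (rule analytic_pt_bilinear[OF assms(1,2) banach_space_over_blinfun LX_subspace
        banach_space_over_blinfun LX_subspace banach_space_over_blinfun LX_subspace _ _ _ _ _ _ _ assms(3-6),
        where K = 1])
    (auto simp: LX_comp blinfun_compose_algebra LX_D norm_blinfun_compose intro!: blinfun_eqI)

text \<open>On \<open>[h1, ..., hn]\<close> this is \<open>(-1)^n h1 ... hn\<close>, the coefficient
  of degree \<open>n\<close> of inversion at the identity; one function on lists serves for every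
  degree.\<close>

fun neumann :: "('x \<Rightarrow>\<^sub>L 'x) list \<Rightarrow> 'x \<Rightarrow>\<^sub>L 'x" where
  "neumann [] = id_blinfun"
| "neumann (h # hs) = - (h o\<^sub>L neumann hs)"

lemma neumann_LX: "hs \<in> lists (LX sc) \<Longrightarrow> neumann hs \<in> LX sc"
  by (induction hs) (auto intro: LX_closed)

lemma norm_neumann: "norm (neumann hs) \<le> prod_list (map norm hs)"
proof (induction hs)
  case Nil
  have "norm (id_blinfun :: 'x \<Rightarrow>\<^sub>L 'x) \<le> 1" by (rule norm_blinfun_bound) auto
  then show ?case by simp
next
  case (Cons h hs)
  have "norm (h o\<^sub>L neumann hs) \<le> norm h * norm (neumann hs)" by (rule norm_blinfun_compose)
  also have "\<dots> \<le> norm h * prod_list (map norm hs)" using Cons by (intro mult_left_mono) auto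
  finally show ?case by simp
qed

lemma multilinear_neumann:
  "multilinear_on (scale_blinfun sc) (LX sc) (scale_blinfun sc) (LX sc) n neumann"
proof (rule multilinear_onI)
  fix hs i x assume "hs \<in> lists (LX sc)" "i < n" and len: "length hs = n"
  then have hs: "hs \<in> lists (LX sc)" "i < length hs" by auto
  then show "neumann (hs[i := scale_blinfun sc a x]) = scale_blinfun sc a (neumann (hs[i := x]))" for a
  proof (induction hs arbitrary: i)
    case (Cons h hs)
    then show ?case
      by (cases i) (auto intro!: blinfun_eqI simp: blinfun.bilinear_simps LX_D)
  qed simp
  show "neumann (hs[i := x + y]) = neumann (hs[i := x]) + neumann (hs[i := y])" for y
    using hs
  proof (induction hs arbitrary: i)
    case (Cons h hs)
    then show ?case
      by (cases i) (auto simp: blinfun_compose_algebra)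
  qed simp
qed (rule neumann_LX)

lemma neumann_inverse:
  assumes h: "h \<in> LX sc" "norm h < 1"
  shows "id_blinfun + h \<in> GL sc" "(\<lambda>n. neumann (replicate n h)) sums op_inv (id_blinfun + h)"
proof -
  let ?p = "\<lambda>n. neumann (replicate n h)"
  \<comment> \<open>\<open>neumann\<close> adds factors on the left, so one of the two one-sided
    inverse equations needs \<open>h\<close> to commute with the terms.\<close>
  have com: "h o\<^sub>L ?p n = ?p n o\<^sub>L h" for n
  proof (induction n)
    case (Suc n)
    have "h o\<^sub>L ?p (Suc n) = - (h o\<^sub>L (h o\<^sub>L ?p n))" by (simp add: blinfun_compose_algebra)
    also have "\<dots> = - (h o\<^sub>L (?p n o\<^sub>L h))" by (simp only: Suc.IH)
    also have "\<dots> = ?p (Suc n) o\<^sub>L h" by (simp add: blinfun_compose_algebra)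
    finally show ?case .
  qed simp
  have "norm (?p n) \<le> norm h ^ n" for n
    using norm_neumann[of "replicate n h"] by (simp add: prod_list_replicate)
  then have "summable ?p"
    using h by (intro summable_comparison_test'[OF summable_geometric[of "norm h"]]) auto
  then obtain S where S: "?p sums S" by (auto simp: summable_def)
  have SL: "S \<in> LX sc"
  proof -
    have "(\<Sum>i<n. ?p i) \<in> LX sc" for n
      by (rule LX_closed(8)) (use h in \<open>auto intro!: neumann_LX simp: in_lists_conv_set\<close>)
    then show ?thesis using S LX_closed(4) unfolding sums_def by (meson closed_sequentially)
  qed
  have "(\<lambda>n. ?p (Suc n)) sums (S - id_blinfun)"
    using S sums_Suc_iff[of ?p "S - id_blinfun"] by simp
  moreover have "(\<lambda>n. ?p (Suc n)) sums (- (h o\<^sub>L S))"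
    using bounded_linear.sums[OF bounded_bilinear.bounded_linear_right
        [OF bounded_bilinear_blinfun_compose] S, of h] sums_minus by fastforce
  moreover have "(\<lambda>n. ?p (Suc n)) sums (- (S o\<^sub>L h))"
    using bounded_linear.sums[OF bounded_bilinear.bounded_linear_left
        [OF bounded_bilinear_blinfun_compose] S, of h] sums_minus by (fastforce simp: com)
  ultimately have eq: "S - id_blinfun = - (h o\<^sub>L S)" "S - id_blinfun = - (S o\<^sub>L h)"
    using sums_unique2 by blast+
  then have inv: "(id_blinfun + h) o\<^sub>L S = id_blinfun" "S o\<^sub>L (id_blinfun + h) = id_blinfun"
    by (simp_all add: blinfun_compose_algebra algebra_simps)
  then show "id_blinfun + h \<in> GL sc" by (intro GL_I[OF _ SL] LX_closed h)
  show "?p sums op_inv (id_blinfun + h)" using S op_inv_eq[OF inv] by simp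
qed

text \<open>\<open>W + h\<close> is \<open>W\<close> times \<open>1 + W^-1 h\<close>, and the second
  factor is invertible by the Neumann series. The summand 1 in the radius avoids a division by
  zero.\<close>

lemma GL_nbhd:
  assumes W: "W \<in> GL sc"
  shows "nbhd_on (LX sc) W (\<lambda>V. V \<in> GL sc)"
proof -
  have "0 < 1 / (norm (op_inv W) + 1)" by (simp add: add_nonneg_pos)
  then show ?thesis
  proof (rule nbhd_onI)
    fix h assume h: "h \<in> LX sc" "norm h < 1 / (norm (op_inv W) + 1)"
    have "norm (op_inv W o\<^sub>L h) \<le> norm (op_inv W) * norm h" by (rule norm_blinfun_compose)
    also have "\<dots> \<le> (norm (op_inv W) + 1) * norm h" by (intro mult_right_mono) auto
    also have "\<dots> < 1" using h(2) by (simp add: pos_less_divide_eq add_nonneg_pos mult.commute)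
    finally have "W o\<^sub>L (id_blinfun + (op_inv W o\<^sub>L h)) \<in> GL sc"
      by (intro GL_comp(1) W neumann_inverse LX_closed GL_inv h)
    then show "W + h \<in> GL sc" using W by (simp add: blinfun_compose_algebra GL_inv)
  qed
qed

text \<open>Reduced to inversion at the identity by \<open>V^-1 = (W^-1 V)^-1 W^-1\<close>.\<close>

lemma analytic_pt_op_inv:
  assumes W: "W \<in> GL sc"
  shows "analytic_pt (scale_blinfun sc) (LX sc) (scale_blinfun sc) (LX sc) op_inv W"
proof -
  note bs = banach_space_over_blinfun LX_subspace
  note bs4 = bs bs bs
  have id: "analytic_pt (scale_blinfun sc) (LX sc) (scale_blinfun sc) (LX sc) op_inv (op_inv W o\<^sub>L W)"
    unfolding GL_inv(5)[OF W]
    by (rule analytic_ptI[where A = "\<lambda>_. neumann" and r = 1 and C = 1])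
      (use multilinear_neumann norm_neumann neumann_inverse in auto)
  have lin: "analytic_pt (scale_blinfun sc) (LX sc) (scale_blinfun sc) (LX sc) (\<lambda>V. op_inv W o\<^sub>L V) W"
    by (intro analytic_pt_comp_op analytic_pt_const analytic_pt_id bs GL_inv W)
  have "analytic_pt (scale_blinfun sc) (LX sc) (scale_blinfun sc) (LX sc)
      (\<lambda>V. op_inv (op_inv W o\<^sub>L V) o\<^sub>L op_inv W) W"
    by (intro analytic_pt_comp_op analytic_pt_const bs GL_inv W GL_comp
        analytic_pt_compose[OF bs4 lin id])
  then show ?thesis
    by (rule analytic_pt_cong, intro nbhd_on_mono[OF GL_nbhd[OF W]])
      (use W in \<open>simp add: GL_comp GL_inv blinfun_compose_assoc\<close>)
qed

lemma analytic_pt_inv: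
  fixes f :: "'v::banach \<Rightarrow> 'x \<Rightarrow>\<^sub>L 'x"
  assumes bs: "banach_space_over s" "banach_subspace s V"
    and f: "analytic_pt s V (scale_blinfun sc) (LX sc) f x" "f x \<in> GL sc"
  shows "analytic_pt s V (scale_blinfun sc) (LX sc) (\<lambda>x. op_inv (f x)) x"
  by (rule analytic_pt_compose[OF bs banach_space_over_blinfun LX_subspace
      banach_space_over_blinfun LX_subspace f(1) analytic_pt_op_inv[OF f(2)]])

lemma analytic_pt_nbhd_GL:
  fixes f :: "'v::banach \<Rightarrow> 'x \<Rightarrow>\<^sub>L 'x"
  assumes bs: "banach_space_over s" "banach_subspace s V"
    and f: "analytic_pt s V (scale_blinfun sc) (LX sc) f x" "f x \<in> GL sc"
    and LX: "nbhd_on V x (\<lambda>y. f y \<in> LX sc)"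
  shows "nbhd_on V x (\<lambda>y. f y \<in> GL sc)"
proof -
  obtain e where e: "0 < e" "\<And>h. h \<in> LX sc \<Longrightarrow> norm h < e \<Longrightarrow> f x + h \<in> GL sc"
    using GL_nbhd[OF f(2)] unfolding nbhd_on_def by blast
  show ?thesis
  proof (rule nbhd_on_mono[OF nbhd_on_conj[OF analytic_pt_cont[OF bs f(1) e(1)] LX]])
    fix h assume "norm (f (x + h) - f x) < e \<and> f (x + h) \<in> LX sc"
    then show "f (x + h) \<in> GL sc"
      using e(2)[of "f (x + h) - f x"] f(2) by (simp add: LX_closed GL_inv(1))
  qed
qed

end

section \<open>Complemented subspaces\<close>

text \<open>The Baire half of the open mapping theorem for the addition map from \<open>V\<close>
  times \<open>V'\<close> onto \<open>B\<close>: the closures of the sets \<open>S n\<close> of sums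
  with bounded components cover \<open>B\<close>, so one of them contains a ball of
  \<open>B\<close>. This gives approximate decompositions only; \<open>complemented_bounded\<close>
  removes the error by iteration.\<close>

lemma complemented_approx:
  fixes s :: "'k::{real_normed_field,banach} \<Rightarrow> 'x::banach \<Rightarrow> 'x"
  assumes bs: "banach_space_over s" and V: "banach_subspace s V" and V': "banach_subspace s V'"
    and B: "banach_subspace s B" and sum: "{v + v' | v v'. v \<in> V \<and> v' \<in> V'} = B"
  obtains M where "0 \<le> M" "\<And>y \<delta>. y \<in> B \<Longrightarrow> 0 < \<delta> \<Longrightarrow>
    \<exists>v\<in>V. \<exists>v'\<in>V'. norm v \<le> M * norm y \<and> norm v' \<le> M * norm y \<and> norm (y - v - v') < \<delta>"
proof -
  interpret banach_space_over s by fact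
  note V = subspaceD[OF V] and V' = subspaceD[OF V'] and B = subspaceD[OF B]
  define S where "S r = {v + v' | v v'. v \<in> V \<and> v' \<in> V' \<and> norm v \<le> r \<and> norm v' \<le> r}" for r :: real
  have SB: "S r \<subseteq> B" for r using sum by (auto simp: S_def)
  have diff: "a - b \<in> S (2 * r)" if ab: "a \<in> S r" "b \<in> S r" for a b r
  proof -
    obtain v v' w w' where *: "v \<in> V" "v' \<in> V'" "norm v \<le> r" "norm v' \<le> r" "a = v + v'"
      "w \<in> V" "w' \<in> V'" "norm w \<le> r" "norm w' \<le> r" "b = w + w'"
      using ab unfolding S_def by blast
    have "norm (v - w) \<le> 2 * r" "norm (v' - w') \<le> 2 * r"
      using * norm_triangle_ineq4[of v w] norm_triangle_ineq4[of v' w'] by linarith+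
    moreover have "a - b = (v - w) + (v' - w')" using * by simp
    moreover have "v - w \<in> V" "v' - w' \<in> V'" using * V(7) V'(7) by auto
    ultimately show ?thesis unfolding S_def by blast
  qed
  have "\<exists>n::nat. top_of_set B interior_of closure (S n) \<noteq> {}"
  proof (rule ccontr)
    assume none: "\<not> ?thesis"
    have "completely_metrizable_space (top_of_set B)"
      using completely_metrizable_space_closedin completely_metrizable_space_euclidean B(4)
      by (metis closed_closedin)
    moreover have "closedin (top_of_set B) (closure (S n))" for n
      using SB B(4) by (intro closed_subset closure_minimal) auto
    ultimately have "top_of_set B interior_of \<Union>(range (\<lambda>n::nat. closure (S n))) = {}"
      using none by (intro Baire_category_alt) auto
    moreover have "\<Union>(range (\<lambda>n::nat. closure (S n))) = B"
    proof
      show "\<Union>(range (\<lambda>n::nat. closure (S n))) \<subseteq> B"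
        using SB B(4) closure_minimal by blast
      show "B \<subseteq> \<Union>(range (\<lambda>n::nat. closure (S n)))"
      proof
        fix y assume "y \<in> B"
        then obtain v v' where "y = v + v'" "v \<in> V" "v' \<in> V'" using sum by blast
        moreover obtain n :: nat where "max (norm v) (norm v') \<le> n" using real_arch_simple by blast
        ultimately have "y \<in> S n" unfolding S_def by auto
        then show "y \<in> \<Union>(range (\<lambda>n::nat. closure (S n)))" using closure_subset by blast
      qed
    qed
    moreover have "top_of_set B interior_of B = B"
      using interior_of_topspace[of "top_of_set B"] by simp
    ultimately show False using B(1) by auto
  qed
  then obtain n :: nat and x0 where "x0 \<in> top_of_set B interior_of closure (S n)" by blast
  then obtain G where G: "openin (top_of_set B) G" "x0 \<in> G" "G \<subseteq> closure (S n)"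
    unfolding interior_of_def by blast
  then obtain e where e: "0 < e" "ball x0 e \<inter> B \<subseteq> G" and x0: "x0 \<in> B"
    using openin_contains_ball by (metis openin_imp_subset subsetD)
  \<comment> \<open>\<open>y\<close> is the difference of \<open>x0 + y\<close> and
    \<open>x0\<close>, both in the closure of \<open>S n\<close>. This moves the ball to the origin
    at the price of doubling the bound on the components.\<close>
  have approx: "\<exists>z\<in>S (2 * real n). norm (y - z) < \<delta>" if y: "y \<in> B" "norm y < e" "0 < \<delta>" for y \<delta>
  proof -
    have "x0 + y \<in> ball x0 e \<inter> B" using y x0 B(2) by (auto simp: dist_norm)
    then have "x0 + y \<in> closure (S n)" using e G by blast
    then obtain a where a: "a \<in> S n" "dist a (x0 + y) < \<delta> / 2"
      using half_gt_zero[OF y(3)] unfolding closure_approachable by blast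
    have "x0 \<in> closure (S n)" using G by blast
    then obtain b where b: "b \<in> S n" "dist b x0 < \<delta> / 2"
      using half_gt_zero[OF y(3)] unfolding closure_approachable by blast
    have "norm (y - (a - b)) = norm ((b - x0) - (a - (x0 + y)))" by (simp add: algebra_simps)
    also have "\<dots> \<le> norm (b - x0) + norm (a - (x0 + y))" by (rule norm_triangle_ineq4)
    also have "\<dots> < \<delta>" using a b by (simp add: dist_norm)
    finally show ?thesis using diff[OF a(1) b(1)] by blast
  qed
  \<comment> \<open>\<open>y\<close> is rescaled to norm \<open>e / 2\<close>, where components of
    norm at most \<open>2 * real n\<close> are available; undoing the scaling multiplies them by
    \<open>2 * norm y / e\<close>.\<close>
  define M where "M = 2 * (2 * real n) / e"
  have M0: "0 \<le> M" using e by (simp add: M_def)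
  have "\<exists>v\<in>V. \<exists>v'\<in>V'. norm v \<le> M * norm y \<and> norm v' \<le> M * norm y \<and> norm (y - v - v') < \<delta>"
    if y: "y \<in> B" "0 < \<delta>" for y \<delta>
  proof (cases "y = 0")
    case True
    then show ?thesis using V(1) V'(1) y by (intro bexI[of _ 0]) auto
  next
    case False
    define c where "c = e / (2 * norm y)"
    have c: "0 < c" using False e by (simp add: c_def)
    have "norm (c *\<^sub>R y) < e" using False e by (simp add: c_def)
    then obtain z where z: "z \<in> S (2 * real n)" "norm (c *\<^sub>R y - z) < c * \<delta>"
      using approx[of "c *\<^sub>R y" "c * \<delta>"] y c B(5) by auto
    from z(1) obtain v v' where v: "z = v + v'" "v \<in> V" "v' \<in> V'" "norm v \<le> 2 * real n" "norm v' \<le> 2 * real n"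
      unfolding S_def by auto
    have sc: "norm (w /\<^sub>R c) \<le> M * norm y" if "norm w \<le> 2 * real n" for w :: 'x
      using that False e by (simp add: c_def M_def field_simps)
    have "y - v /\<^sub>R c - v' /\<^sub>R c = (c *\<^sub>R y - z) /\<^sub>R c"
      using c v by (simp add: scaleR_diff_right scaleR_add_right)
    moreover have "norm ((c *\<^sub>R y - z) /\<^sub>R c) < \<delta>"
      using z(2) c by (simp add: pos_divide_less_eq mult.commute divide_inverse_commute[symmetric])
    ultimately have "norm (y - v /\<^sub>R c - v' /\<^sub>R c) < \<delta>" by simp
    then show ?thesis using sc v V(5) V'(5) by blast
  qed
  with M0 that show ?thesis by blast
qed

text \<open>Successive approximation: the remainder is decomposed again and again, with a tolerance
  that halves each time. The components sum to a decomposition of \<open>v + v'\<close> whose part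
  in \<open>V\<close> has norm at most \<open>2 * M * norm (v + v')\<close>, and by uniqueness of
  decompositions that part is \<open>v\<close>.\<close>

lemma complemented_bounded:
  fixes s :: "'k::{real_normed_field,banach} \<Rightarrow> 'x::banach \<Rightarrow> 'x"
  assumes bs: "banach_space_over s" and V: "banach_subspace s V" and V': "banach_subspace s V'"
    and B: "banach_subspace s B" and int: "V \<inter> V' = {0}"
    and sum: "{v + v' | v v'. v \<in> V \<and> v' \<in> V'} = B"
  shows "\<exists>K\<ge>0. \<forall>v\<in>V. \<forall>v'\<in>V'. norm v \<le> K * norm (v + v')"
proof -
  interpret banach_space_over s by fact
  obtain M where M: "0 \<le> M" "\<And>y \<delta>. y \<in> B \<Longrightarrow> 0 < \<delta> \<Longrightarrow>
    \<exists>v\<in>V. \<exists>v'\<in>V'. norm v \<le> M * norm y \<and> norm v' \<le> M * norm y \<and> norm (y - v - v') < \<delta>"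
    using complemented_approx[OF bs V V' B sum] by blast
  note V = subspaceD[OF V] and V' = subspaceD[OF V'] and B = subspaceD[OF B]
  have "\<forall>y \<delta>. \<exists>v v'. y \<in> B \<longrightarrow> 0 < \<delta> \<longrightarrow> v \<in> V \<and> v' \<in> V' \<and>
      norm v \<le> M * norm y \<and> norm v' \<le> M * norm y \<and> norm (y - v - v') < \<delta>"
    using M(2) by meson
  then obtain f f' where f: "\<And>y \<delta>. y \<in> B \<Longrightarrow> 0 < \<delta> \<Longrightarrow> f y \<delta> \<in> V \<and> f' y \<delta> \<in> V' \<and>
      norm (f y \<delta>) \<le> M * norm y \<and> norm (f' y \<delta>) \<le> M * norm y \<and> norm (y - f y \<delta> - f' y \<delta>) < \<delta>"
    by metis
  have "norm v \<le> 2 * M * norm (v + v')" if v: "v \<in> V" "v' \<in> V'" for v v'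
  proof (cases "v + v' = 0")
    case True
    then have "v = - v'" by (simp add: eq_neg_iff_add_eq_0)
    then have "v \<in> V \<inter> V'" using v V'(6) by auto
    then show ?thesis using int M(1) by simp
  next
    case False
    define y where "y = v + v'"
    have y: "0 < norm y" "y \<in> B" using False v sum unfolding y_def by auto
    define d where "d k = norm y / 2 ^ Suc k" for k :: nat
    have d: "0 < d k" for k using y by (simp add: d_def)
    define r where "r = rec_nat y (\<lambda>k z. z - f z (d k) - f' z (d k))"
    have r_simps: "r 0 = y" "\<And>k. r (Suc k) = r k - f (r k) (d k) - f' (r k) (d k)"
      by (auto simp: r_def)
    have rB: "r k \<in> B \<and> norm (r k) \<le> norm y / 2 ^ k" for k
    proof (induction k)
      case (Suc k)
      have fk: "f (r k) (d k) \<in> V" "f' (r k) (d k) \<in> V'"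
        "norm (r k - f (r k) (d k) - f' (r k) (d k)) < d k"
        using f[of "r k" "d k"] Suc d by auto
      then have "f (r k) (d k) + f' (r k) (d k) \<in> B" using sum by blast
      then have "r (Suc k) \<in> B"
        using B(7)[of "r k" "f (r k) (d k) + f' (r k) (d k)"] Suc by (simp add: r_simps diff_diff_eq)
      then show ?case using fk(3) by (simp add: r_simps d_def)
    qed (simp add: r_simps y)
    define p p' where "p k = f (r k) (d k)" and "p' k = f' (r k) (d k)" for k
    have p: "p k \<in> V" "p' k \<in> V'" "norm (p k) \<le> M * norm y * (1 / 2) ^ k"
      "norm (p' k) \<le> M * norm y * (1 / 2) ^ k" for k
    proof -
      have *: "p k \<in> V" "p' k \<in> V'" "norm (p k) \<le> M * norm (r k)" "norm (p' k) \<le> M * norm (r k)"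
        using f[of "r k" "d k"] rB[of k] d by (auto simp: p_def p'_def)
      have "M * norm (r k) \<le> M * (norm y / 2 ^ k)" using rB M(1) by (intro mult_left_mono) auto
      also have "\<dots> = M * norm y * (1 / 2) ^ k" by (simp add: power_divide)
      finally show "p k \<in> V" "p' k \<in> V'" "norm (p k) \<le> M * norm y * (1 / 2) ^ k"
        "norm (p' k) \<le> M * norm y * (1 / 2) ^ k" using * by auto
    qed
    have geo: "(\<lambda>k. M * norm y * (1 / 2) ^ k) sums (M * norm y * 2)"
      using sums_mult[OF geometric_sums[of "1 / 2 :: real"], of "M * norm y"] by simp
    have "summable p" "summable p'"
      by (rule summable_comparison_test'[OF sums_summable[OF geo]]; use p in auto)+
    then obtain u u' where u: "p sums u" "p' sums u'" by (auto simp: summable_def)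
    have "norm u \<le> M * norm y * 2" by (rule norm_sums_le[OF u(1) geo p(3)])
    have uV: "u \<in> V" "u' \<in> V'"
      using u V(4,8) V'(4,8) p(1,2) unfolding sums_def by (meson closed_sequentially)+
    have "(\<Sum>k<n. p k + p' k) = y - r n" for n
      by (induction n) (auto simp: r_simps p_def p'_def)
    moreover have r0: "r \<longlonglongrightarrow> 0"
    proof (rule Lim_null_comparison)
      show "\<forall>\<^sub>F n in sequentially. norm (r n) \<le> norm y * (1 / 2) ^ n"
        using rB by (simp add: power_divide)
      show "(\<lambda>n. norm y * (1 / 2) ^ n) \<longlonglongrightarrow> 0"
        by (intro tendsto_mult_right_zero LIMSEQ_power_zero) simp
    qed
    ultimately have "(\<lambda>k. p k + p' k) sums (y - 0)"
      using tendsto_diff[OF tendsto_const r0, of y] unfolding sums_def by simp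
    with sums_add[OF u] have "u + u' = y" using sums_unique2 by fastforce
    then have "v - u = u' - v'" unfolding y_def by (simp add: algebra_simps)
    then have "v - u \<in> V \<inter> V'" using V(7)[OF v(1) uV(1)] V'(7)[OF uV(2) v(2)] by simp
    then have "v = u" using int by simp
    then show ?thesis using \<open>norm u \<le> M * norm y * 2\<close> by (simp add: y_def mult_ac)
  qed
  then show ?thesis using M(1) by (intro exI[of _ "2 * M"]) simp
qed

lemma complement_projection:
  fixes s :: "'k::{real_normed_field,banach} \<Rightarrow> 'x::banach \<Rightarrow> 'x"
  assumes bs: "banach_space_over s" and V: "banach_subspace s V" and V': "banach_subspace s V'"
    and B: "banach_subspace s B" and int: "V \<inter> V' = {0}"
    and sum: "{v + v' | v v'. v \<in> V \<and> v' \<in> V'} = B"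
  shows "\<exists>P K. (\<forall>h\<in>B. P h \<in> V \<and> h - P h \<in> V' \<and> norm (P h) \<le> K * norm h) \<and>
    (\<forall>h\<in>B. \<forall>k\<in>B. P (h + k) = P h + P k) \<and> (\<forall>a. \<forall>h\<in>B. P (s a h) = s a (P h)) \<and>
    (\<forall>h\<in>V. P h = h) \<and> (\<forall>h\<in>V'. P h = 0)"
proof -
  interpret banach_space_over s by fact
  from complemented_bounded[OF assms] obtain K
    where K: "\<forall>v\<in>V. \<forall>v'\<in>V'. norm v \<le> K * norm (v + v')"
    by (elim exE conjE)
  note V = subspaceD[OF V] and V' = subspaceD[OF V'] and B = subspaceD[OF B]
  define P where "P h = (SOME v. v \<in> V \<and> h - v \<in> V')" for h
  have uniq: "P (v + v') = v" if v: "v \<in> V" "v' \<in> V'" for v v'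
    unfolding P_def
  proof (rule some_equality)
    fix w assume w: "w \<in> V \<and> v + v' - w \<in> V'"
    then have "w - v \<in> V" using V(7)[of w v] v by simp
    moreover have "w - v \<in> V'" using w V'(7)[OF v(2), of "v + v' - w"] by simp
    ultimately have "w - v \<in> V \<inter> V'" by simp
    then show "w = v" unfolding int by simp
  qed (use v in simp)
  have split: "\<exists>v\<in>V. \<exists>v'\<in>V'. h = v + v'" if "h \<in> B" for h using sum that by blast
  show ?thesis
  proof (intro exI conjI ballI allI)
    show "P h \<in> V" "h - P h \<in> V'" if "h \<in> B" for h
      using split[OF that] by (auto simp: uniq)
    show "norm (P h) \<le> K * norm h" if "h \<in> B" for h
      using split[OF that] K by (auto simp: uniq)
    show "P (s a h) = s a (P h)" if "h \<in> B" for a h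
      using split[OF that] uniq[OF V(3) V'(3)] by (auto simp: scale_right_distrib uniq)
    show "P (h + k) = P h + P k" if hk: "h \<in> B" "k \<in> B" for h k
    proof -
      obtain v v' w w' where *: "v \<in> V" "v' \<in> V'" "h = v + v'" "w \<in> V" "w' \<in> V'" "k = w + w'"
        using split[OF hk(1)] split[OF hk(2)] by auto
      have "h + k = (v + w) + (v' + w')" using * by simp
      then have "P (h + k) = v + w"
        using uniq[OF V(2)[OF *(1,4)] V'(2)[OF *(2,5)]] by simp
      then show ?thesis using * by (simp add: uniq)
    qed
    show "P h = h" if "h \<in> V" for h using uniq[OF that V'(1)] by simp
    show "P h = 0" if "h \<in> V'" for h using uniq[OF V(1) that] by simp
  qed
qed

text \<open>Here the complement demanded of the model of a split submanifold is used: it supplies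
  the bounded projection that moves the coefficients into \<open>U\<close>.\<close>

lemma analytic_pt_complemented:
  fixes f :: "'v::banach \<Rightarrow> 'w::banach"
  assumes bs: "banach_space_over s" "banach_subspace s V"
    and bs': "banach_space_over s'" "banach_subspace s' B"
    and U: "banach_subspace s' U" "banach_subspace s' U'" "U \<inter> U' = {0}"
      "{u + u' | u u'. u \<in> U \<and> u' \<in> U'} = B"
    and f: "analytic_pt s V s' B f x" "f x \<in> B" "nbhd_on V x (\<lambda>y. f y \<in> U)"
  shows "analytic_pt s V s' U f x"
proof -
  from complement_projection[OF bs'(1) U(1,2) bs'(2) U(3,4)] obtain P K
    where "(\<forall>h\<in>B. P h \<in> U \<and> h - P h \<in> U' \<and> norm (P h) \<le> K * norm h) \<and>
      (\<forall>h\<in>B. \<forall>k\<in>B. P (h + k) = P h + P k) \<and> (\<forall>a. \<forall>h\<in>B. P (s' a h) = s' a (P h)) \<and>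
      (\<forall>h\<in>U. P h = h) \<and> (\<forall>h\<in>U'. P h = 0)" by (elim exE)
  then show ?thesis
    by (intro analytic_pt_proj[OF bs bs' U(1) f, of P K]) simp_all
qed

context banach_space_over
begin

lemma complementsD:
  assumes "E \<in> complements sc F"
  shows "banach_subspace sc E" "E \<inter> F = {0}" "\<exists>e\<in>E. \<exists>f\<in>F. x = e + f"
proof -
  show "banach_subspace sc E" "E \<inter> F = {0}"
    using assms unfolding complements_def banach_subspace_def by (auto simp: complete_eq_closed)
  have "x \<in> {e + f |e f. e \<in> E \<and> f \<in> F}" using assms unfolding complements_def by auto
  then show "\<exists>e\<in>E. \<exists>f\<in>F. x = e + f" by blast
qed

lemma complementsI:
  assumes "banach_subspace sc E" "E \<inter> F = {0}" "\<And>x. \<exists>e\<in>E. \<exists>f\<in>F. x = e + f"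
  shows "E \<in> complements sc F"
proof -
  have "x \<in> {e + f |e f. e \<in> E \<and> f \<in> F}" for x using assms(3)[of x] by blast
  then have "{e + f |e f. e \<in> E \<and> f \<in> F} = UNIV" by (rule UNIV_eq_I[symmetric])
  then show ?thesis
    using assms(1,2) unfolding complements_def banach_subspace_def by (simp add: complete_eq_closed)
qed

lemma complements_commute: "banach_subspace sc F \<Longrightarrow> E \<in> complements sc F \<Longrightarrow> F \<in> complements sc E"
  by (rule complementsI) (use complementsD in \<open>blast, metis inf_commute, metis add.commute\<close>)

text \<open>Meant for closed complementary subspaces. That a bounded operator of this kind exists is
  the open mapping argument; it is then determined, since \<open>E\<close> and \<open>F\<close> span
  the space.\<close>

definition proj :: "'x set \<Rightarrow> 'x set \<Rightarrow> 'x \<Rightarrow>\<^sub>L 'x" where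
  "proj E F = (SOME P. P \<in> LX sc \<and> (\<forall>x\<in>E. P x = x) \<and> (\<forall>x\<in>F. P x = 0))"

lemma proj:
  assumes E: "E \<in> complements sc F" and F: "banach_subspace sc F"
  shows "proj E F \<in> LX sc" "x \<in> E \<Longrightarrow> proj E F x = x" "x \<in> F \<Longrightarrow> proj E F x = 0"
    "proj E F x \<in> E" "x - proj E F x \<in> F" "proj E F o\<^sub>L proj E F = proj E F"
    "proj E F x = x \<longleftrightarrow> x \<in> E" "proj E F x = 0 \<longleftrightarrow> x \<in> F"
proof -
  have U: "banach_subspace sc UNIV" by (simp add: subspace_iff)
  have "{v + v' | v v'. v \<in> E \<and> v' \<in> F} = UNIV" using complementsD(3)[OF E] by blast
  from complement_projection[OF banach_space_over_axioms complementsD(1)[OF E] F U complementsD(2)[OF E] this]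
  obtain P K where P0: "(\<forall>h\<in>UNIV. P h \<in> E \<and> h - P h \<in> F \<and> norm (P h) \<le> K * norm h) \<and>
    (\<forall>h\<in>UNIV. \<forall>k\<in>UNIV. P (h + k) = P h + P k) \<and> (\<forall>a. \<forall>h\<in>UNIV. P (sc a h) = sc a (P h)) \<and>
    (\<forall>h\<in>E. P h = h) \<and> (\<forall>h\<in>F. P h = 0)"
    by (elim exE)
  then have P: "P (h + k) = P h + P k" "P (sc a h) = sc a (P h)"
    "norm (P h) \<le> K * norm h" "h \<in> E \<Longrightarrow> P h = h" "h \<in> F \<Longrightarrow> P h = 0" for h k a
    by simp_all
  have "bounded_linear P"
    by (rule bounded_linear_intro[where K = K])
      (use P in \<open>auto simp: mult.commute simp flip: scale_of_real\<close>)
  then have "Blinfun P \<in> LX sc \<and> (\<forall>x\<in>E. Blinfun P x = x) \<and> (\<forall>x\<in>F. Blinfun P x = 0)"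
    using P by (simp add: bounded_linear_Blinfun_apply LX_def)
  then have *: "proj E F \<in> LX sc \<and> (\<forall>x\<in>E. proj E F x = x) \<and> (\<forall>x\<in>F. proj E F x = 0)"
    unfolding proj_def by (rule someI)
  then show "proj E F \<in> LX sc" and id: "x \<in> E \<Longrightarrow> proj E F x = x" and 0: "x \<in> F \<Longrightarrow> proj E F x = 0" for x
    by auto
  show mem: "proj E F x \<in> E" "x - proj E F x \<in> F" for x
    using complementsD(3)[OF E, of x] by (auto simp: blinfun.bilinear_simps id 0)
  show "proj E F o\<^sub>L proj E F = proj E F" by (rule blinfun_eqI) (simp add: id mem)
  show "proj E F x = x \<longleftrightarrow> x \<in> E" "proj E F x = 0 \<longleftrightarrow> x \<in> F" using id 0 mem[of x] by auto
qed

lemma grassmannianD: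
  assumes "F \<in> grassmannian sc"
  shows "banach_subspace sc F" "F \<noteq> {0}" "F \<noteq> UNIV" "complements sc F \<noteq> {}"
  using assms unfolding grassmannian_def banach_subspace_def by (auto simp: complete_eq_closed)

lemma grassmannianI:
  assumes "banach_subspace sc F" "F \<noteq> {0}" "F \<noteq> UNIV" "E \<in> complements sc F"
  shows "F \<in> grassmannian sc"
  using assms unfolding grassmannian_def banach_subspace_def by (auto simp: complete_eq_closed)

lemma complements_grassmannian:
  assumes F: "F \<in> grassmannian sc" and E: "E \<in> complements sc F"
  shows "E \<in> grassmannian sc"
proof (rule grassmannianI)
  note F' = grassmannianD[OF F] and E' = complementsD[OF E]
  show "banach_subspace sc E" by (rule E')
  show "F \<in> complements sc E" by (rule complements_commute) fact+
  show "E \<noteq> {0}"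
  proof
    assume "E = {0}"
    then have "x \<in> F" for x using E'(3)[of x] by auto
    then show False using F'(3) by blast
  qed
  show "E \<noteq> UNIV" using E'(2) F'(2) by auto
qed

end

section \<open>Homogeneous spaces\<close>

text \<open>Dictionary between relative topologies and increments: for \<open>x\<close> in the
  subspace \<open>V\<close>, a ball of \<open>V\<close> around \<open>x\<close> is \<open>x\<close>
  plus a ball of \<open>V\<close> around 0.\<close>

lemma openin_iff_nbhd_on:
  fixes V :: "'v::banach set"
  assumes "banach_space_over s" "banach_subspace s V"
  shows "openin (top_of_set V) W \<longleftrightarrow> W \<subseteq> V \<and> (\<forall>x\<in>W. nbhd_on V x (\<lambda>y. y \<in> W))"
proof -
  interpret banach_space_over s by fact
  note V = subspaceD[OF assms(2)]
  have "(\<exists>e>0. ball x e \<inter> V \<subseteq> W) \<longleftrightarrow> nbhd_on V x (\<lambda>y. y \<in> W)" if x: "x \<in> V" for x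
    unfolding nbhd_on_def
  proof (intro ex_cong1 conj_cong refl iffI ballI impI subsetI)
    fix e h assume "ball x e \<inter> V \<subseteq> W" "h \<in> V" "norm h < e"
    then show "x + h \<in> W" using V(2)[OF x] by (auto simp: dist_norm)
  next
    fix e y assume "\<forall>h\<in>V. norm h < e \<longrightarrow> x + h \<in> W" "y \<in> ball x e \<inter> V"
    then show "y \<in> W"
      using V(7)[of y x] x by (auto simp: dist_norm norm_minus_commute dest!: bspec[where x = "y - x"])
  qed
  then show ?thesis unfolding openin_contains_ball by blast
qed

text \<open>Continuity of a germ, tested on relatively open sets. That nearby values lie in
  \<open>V'\<close> makes the increment of \<open>f\<close> an admissible direction for the
  neighbourhood \<open>W\<close>.\<close>

lemma analytic_pt_nbhd_open:
  fixes f :: "'v::banach \<Rightarrow> 'w::banach"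
  assumes bs: "banach_space_over s" "banach_subspace s V"
    and bs': "banach_space_over s'" "banach_subspace s' V'"
    and f: "analytic_pt s V s' V' f x" "f x \<in> W" "W \<subseteq> V'" "nbhd_on V' (f x) (\<lambda>y. y \<in> W)"
    and V': "nbhd_on V x (\<lambda>y. f y \<in> V')"
  shows "nbhd_on V x (\<lambda>y. f y \<in> W)"
proof -
  interpret banach_space_over s' by fact
  obtain e where e: "0 < e" "\<And>h. h \<in> V' \<Longrightarrow> norm h < e \<Longrightarrow> f x + h \<in> W"
    using f(4) unfolding nbhd_on_def by blast
  show ?thesis
  proof (rule nbhd_on_mono[OF nbhd_on_conj[OF analytic_pt_cont[OF bs f(1) e(1)] V']])
    fix h assume "norm (f (x + h) - f x) < e \<and> f (x + h) \<in> V'"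
    then show "f (x + h) \<in> W"
      using e(2)[of "f (x + h) - f x"] f(2,3) subspaceD(7)[OF bs'(2)] by auto
  qed
qed

definition linear_between ::
    "('k \<Rightarrow> 'v \<Rightarrow> 'v) \<Rightarrow> 'v::real_normed_vector set \<Rightarrow>
     ('k \<Rightarrow> 'w \<Rightarrow> 'w) \<Rightarrow> 'w::real_normed_vector set \<Rightarrow> ('v \<Rightarrow> 'w) \<Rightarrow> bool"
  where "linear_between s V s' V' L \<longleftrightarrow>
    (\<forall>h\<in>V. L h \<in> V') \<and> (\<forall>h\<in>V. \<forall>k\<in>V. L (h + k) = L h + L k) \<and>
    (\<forall>a. \<forall>h\<in>V. L (s a h) = s' a (L h)) \<and> (\<exists>K. \<forall>h\<in>V. norm (L h) \<le> K * norm h)"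

lemma linear_between_analytic:
  assumes "banach_space_over s'" "banach_subspace s' V'" "linear_between s V s' V' L" "x \<in> V"
  shows "analytic_pt s V s' V' L x"
proof -
  obtain K where "\<forall>h\<in>V. norm (L h) \<le> K * norm h"
    using assms(3) unfolding linear_between_def by blast
  then show ?thesis
    using assms unfolding linear_between_def by (intro analytic_pt_linear[where K = K]) auto
qed

text \<open>Phrases continuity and openness relative to the model \<open>V\<close> instead of the
  image of \<open>U\<close>, the form in which they are obtained for each atlas below.\<close>

lemma homeomorphic_chart:
  fixes V :: "'v::real_normed_vector set"
  assumes U: "openin X U" "inj_on \<phi> U" "\<phi> ` U \<subseteq> V"
    and cont: "\<And>T. openin (top_of_set V) T \<Longrightarrow> openin X {x \<in> U. \<phi> x \<in> T}"
    and op: "\<And>S. openin X S \<Longrightarrow> S \<subseteq> U \<Longrightarrow> openin (top_of_set V) (\<phi> ` S)"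
  shows "homeomorphic_map (subtopology X U) (top_of_set (\<phi> ` U)) \<phi>"
proof (rule bijective_open_imp_homeomorphic_map)
  have UX: "U \<subseteq> topspace X" using U(1) by (rule openin_subset)
  show "continuous_map (subtopology X U) (top_of_set (\<phi> ` U)) \<phi>"
    unfolding continuous_map
  proof (intro conjI allI impI)
    fix T assume "openin (top_of_set (\<phi> ` U)) T"
    then obtain T' where "open T'" "T = \<phi> ` U \<inter> T'" by (auto simp: openin_open)
    moreover have "openin (top_of_set V) (V \<inter> T')" using \<open>open T'\<close> by blast
    ultimately have "openin X {x \<in> U. \<phi> x \<in> V \<inter> T'}" by (intro cont)
    moreover have "{x \<in> U. \<phi> x \<in> V \<inter> T'} = {x \<in> topspace (subtopology X U). \<phi> x \<in> T}"
      using UX U(3) \<open>T = _\<close> by auto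
    ultimately show "openin (subtopology X U) {x \<in> topspace (subtopology X U). \<phi> x \<in> T}"
      using U(1) by (auto simp: openin_open_subtopology)
  qed auto
  show "open_map (subtopology X U) (top_of_set (\<phi> ` U)) \<phi>"
    unfolding open_map_def
  proof (intro allI impI)
    fix S assume "openin (subtopology X U) S"
    then have S: "openin X S" "S \<subseteq> U" using U(1) by (auto simp: openin_open_subtopology)
    show "openin (top_of_set (\<phi> ` U)) (\<phi> ` S)"
      using op[OF S] S(2) U(3) by (metis image_mono openin_subset_trans)
  qed
qed (use U openin_subset[OF U(1)] in \<open>auto simp: Int_absorb1 intro: inj_on_subset\<close>)

locale banach_chart =
  fixes M :: "('m, 'k::{real_normed_field,banach}, 'v::banach) mfd" and U \<phi> V
  assumes mfd: "banach_manifold M" and scale: "banach_space_over (mscale M)"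
    and chart: "(U, \<phi>, V) \<in> atlas M"
begin

lemma chart_simps:
  "openin (mtop M) U" "banach_subspace (mscale M) V" "openin (top_of_set V) (\<phi> ` U)"
  "homeomorphic_map (subtopology (mtop M) U) (top_of_set (\<phi> ` U)) \<phi>" "\<phi> ` U \<subseteq> V"
  using mfd chart openin_imp_subset unfolding banach_manifold_def by fast+

lemma inj: "inj_on \<phi> U"
proof -
  have "U \<subseteq> topspace (mtop M)" using chart_simps(1) by (rule openin_subset)
  then show ?thesis
    using homeomorphic_imp_injective_map[OF chart_simps(4)] by (simp add: Int_absorb1)
qed

lemma inv_chart: "p \<in> U \<Longrightarrow> inv_into U \<phi> (\<phi> p) = p"
  by (rule inv_into_f_f[OF inj])

lemma openin_image:
  assumes "openin (mtop M) S" "S \<subseteq> U"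
  shows "openin (top_of_set V) (\<phi> ` S)"
proof -
  have "openin (top_of_set (\<phi> ` U)) (\<phi> ` S)"
    using homeomorphic_imp_open_map[OF chart_simps(4)] assms chart_simps(1)
    unfolding open_map_def by (auto simp: openin_open_subtopology)
  then show ?thesis using chart_simps(3) openin_trans by blast
qed

lemma openin_preimage:
  assumes "openin (top_of_set V) T"
  shows "openin (mtop M) {p \<in> U. \<phi> p \<in> T}"
proof -
  have UX: "U \<subseteq> topspace (mtop M)" using chart_simps(1) by (rule openin_subset)
  have "openin (top_of_set (\<phi> ` U)) (\<phi> ` U \<inter> T)"
    using assms chart_simps(5) by (metis inf.absorb_iff2 inf_le1 openin_Int openin_subtopology_self openin_subset_trans chart_simps(3))
  then have "openin (subtopology (mtop M) U) {p \<in> topspace (subtopology (mtop M) U). \<phi> p \<in> \<phi> ` U \<inter> T}"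
    using homeomorphic_imp_continuous_map[OF chart_simps(4)] unfolding continuous_map by blast
  moreover have "{p \<in> topspace (subtopology (mtop M) U). \<phi> p \<in> \<phi> ` U \<inter> T} = {p \<in> U. \<phi> p \<in> T}"
    using UX by auto
  ultimately show ?thesis using chart_simps(1) by (simp add: openin_open_subtopology)
qed

lemma nbhd_image:
  assumes "openin (mtop M) S" "p \<in> S" "S \<subseteq> U"
  shows "nbhd_on V (\<phi> p) (\<lambda>v. v \<in> \<phi> ` S)"
  using openin_image[OF assms(1,3)] assms(2) openin_iff_nbhd_on[OF scale chart_simps(2)] by blast

end

lemma analytic_betweenI:
  assumes "banach_space_over s" "banach_subspace s V" "openin (top_of_set V) U"
    "\<And>x. x \<in> U \<Longrightarrow> f x \<in> V'" "\<And>x. x \<in> U \<Longrightarrow> analytic_pt s V s' V' f x"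
  shows "analytic_between s V s' V' U f"
  using assms(3-5) unfolding openin_iff_nbhd_on[OF assms(1,2)] analytic_between_iff by blast

lemma analytic_betweenD:
  assumes "analytic_between s V s' V' U f"
  shows "U \<subseteq> V" "x \<in> U \<Longrightarrow> f x \<in> V'" "x \<in> U \<Longrightarrow> analytic_pt s V s' V' f x"
    "x \<in> U \<Longrightarrow> nbhd_on V x (\<lambda>y. y \<in> U)"
  using assms unfolding analytic_between_iff by blast+

lemma analytic_between_open:
  assumes "banach_space_over s" "banach_subspace s V" "analytic_between s V s' V' U f"
  shows "openin (top_of_set V) U"
  using analytic_betweenD[OF assms(3)] unfolding openin_iff_nbhd_on[OF assms(1,2)] by blast

section \<open>Charts of the quotients of GL(X)\<close>

context banach_space_over
begin

abbreviation scb :: "'k \<Rightarrow> ('x \<Rightarrow>\<^sub>L 'x) \<Rightarrow> 'x \<Rightarrow>\<^sub>L 'x" where "scb \<equiv> scale_blinfun sc"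

lemmas LX_space = banach_space_over_blinfun[where 'a = 'x] LX_subspace

text \<open>GL(X) is open in L(X), so openness relative to GL(X) can be tested by increments in
  L(X).\<close>

lemma openin_GL_iff:
  assumes "A \<subseteq> GL sc"
  shows "openin (top_of_set (GL sc)) A \<longleftrightarrow> (\<forall>W\<in>A. nbhd_on (LX sc) W (\<lambda>V. V \<in> A))"
proof -
  have "openin (top_of_set (LX sc)) (GL sc)"
    unfolding openin_iff_nbhd_on[OF LX_space] using GL_nbhd GL_inv(1) by blast
  then have "openin (top_of_set (GL sc)) A \<longleftrightarrow> openin (top_of_set (LX sc)) A"
    using assms by (metis openin_imp_subset openin_subset_trans openin_trans)
  then show ?thesis unfolding openin_iff_nbhd_on[OF LX_space] using assms GL_inv(1) by blast
qed

lemma topspace_quotient: "topspace (quotient_topology sc H) = lcosets sc H"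
proof
  have "{W \<in> GL sc. lcoset W H \<in> lcosets sc H} = GL sc" by (auto simp: lcosets_def)
  then have "openin (quotient_topology sc H) (lcosets sc H)"
    unfolding openin_quotient_topology by simp
  then show "lcosets sc H \<subseteq> topspace (quotient_topology sc H)" by (rule openin_subset)
  show "topspace (quotient_topology sc H) \<subseteq> lcosets sc H"
    using openin_quotient_topology[of sc H "topspace (quotient_topology sc H)"] by simp
qed

lemma homogeneous_space_simps [simp]:
  "mtop (homogeneous_space sc H) = quotient_topology sc H"
  "mscale (homogeneous_space sc H) = scb"
  by (auto simp: homogeneous_space_def)

lemma homogeneous_atlasD:
  assumes "(U, \<phi>, V) \<in> atlas (homogeneous_space sc H)"
  shows "openin (quotient_topology sc H) U" "banach_subspace scb V" "V \<subseteq> LX sc"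
    "inj_on \<phi> U" "openin (top_of_set V) (\<phi> ` U)" "U \<subseteq> lcosets sc H" "\<phi> ` U \<subseteq> V"
    "analytic_between scb (LX sc) scb V {W \<in> GL sc. lcoset W H \<in> U} (\<lambda>W. \<phi> (lcoset W H))"
    "W \<in> GL sc \<Longrightarrow> lcoset W H \<in> U \<Longrightarrow>
      \<exists>N \<sigma>. \<phi> (lcoset W H) \<in> N \<and> N \<subseteq> \<phi> ` U \<and> \<sigma> (\<phi> (lcoset W H)) = W \<and>
             analytic_between scb V scb (LX sc) N \<sigma> \<and>
             (\<forall>v\<in>N. \<sigma> v \<in> GL sc \<and> lcoset (\<sigma> v) H \<in> U \<and> \<phi> (lcoset (\<sigma> v) H) = v)"
  using assms openin_subset[of "quotient_topology sc H" U] openin_imp_subset[of _ V "\<phi> ` U"]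
  by (auto simp: homogeneous_space_def topspace_quotient)

text \<open>Near the point, \<open>inv_into U \<phi>\<close> is the coset of the local section
  \<open>\<sigma>\<close>, so a map on cosets is analytic in a chart as soon as its pullback to
  GL(X) is. This is the universal property of a submersion.\<close>

lemma homogeneous_chart_local:
  fixes g :: "('x \<Rightarrow>\<^sub>L 'x) set \<Rightarrow> 'w::banach"
  assumes chart: "(U, \<phi>, V) \<in> atlas (homogeneous_space sc H)" and W: "W \<in> GL sc" "lcoset W H \<in> U"
    and bs': "banach_space_over s'" "banach_subspace s' V'"
    and g: "analytic_pt scb (LX sc) s' V' (\<lambda>W. g (lcoset W H)) W"
  shows "analytic_pt scb V s' V' (g \<circ> inv_into U \<phi>) (\<phi> (lcoset W H))"
proof -
  note C = homogeneous_atlasD[OF chart]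
  obtain N \<sigma> where N: "\<phi> (lcoset W H) \<in> N" "N \<subseteq> \<phi> ` U" "\<sigma> (\<phi> (lcoset W H)) = W"
    "analytic_between scb V scb (LX sc) N \<sigma>"
    "\<forall>v\<in>N. \<sigma> v \<in> GL sc \<and> lcoset (\<sigma> v) H \<in> U \<and> \<phi> (lcoset (\<sigma> v) H) = v"
    using C(9)[OF W] by blast
  have "analytic_pt scb V s' V' (\<lambda>v. g (lcoset (\<sigma> v) H)) (\<phi> (lcoset W H))"
    by (rule analytic_pt_compose[OF LX_space(1) C(2) LX_space bs' analytic_betweenD(3)[OF N(4,1)]])
      (use g N(3) in simp)
  then show ?thesis
  proof (rule analytic_pt_cong)
    show "nbhd_on V (\<phi> (lcoset W H)) (\<lambda>v. g (lcoset (\<sigma> v) H) = (g \<circ> inv_into U \<phi>) v)"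
    proof (rule nbhd_on_mono[OF analytic_betweenD(4)[OF N(4,1)]])
      fix h assume "\<phi> (lcoset W H) + h \<in> N" (is "?v \<in> N")
      then have "inv_into U \<phi> ?v = lcoset (\<sigma> ?v) H" using N(5) inv_into_f_f[OF C(4)] by metis
      then show "g (lcoset (\<sigma> ?v) H) = (g \<circ> inv_into U \<phi>) ?v" by simp
    qed
  qed
qed

text \<open>The section \<open>\<sigma>\<close> is continuous and maps a neighbourhood of
  \<open>v\<close> into the open preimage of \<open>S\<close> in GL(X); each point of that
  neighbourhood is the coordinate of the coset of its value under \<open>\<sigma>\<close>.\<close>

lemma homogeneous_chart_open:
  assumes chart: "(U, \<phi>, V) \<in> atlas (homogeneous_space sc H)"
    and S: "openin (quotient_topology sc H) S" "S \<subseteq> U"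
  shows "openin (top_of_set V) (\<phi> ` S)"
  unfolding openin_iff_nbhd_on[OF LX_space(1) homogeneous_atlasD(2)[OF chart]]
proof (intro conjI ballI)
  note C = homogeneous_atlasD[OF chart]
  show "\<phi> ` S \<subseteq> V" using C(7) S(2) by blast
  fix v assume "v \<in> \<phi> ` S"
  then obtain W where W: "W \<in> GL sc" "lcoset W H \<in> S" "v = \<phi> (lcoset W H)"
    using S(2) C(6) unfolding lcosets_def by blast
  obtain N \<sigma> where N: "v \<in> N" "\<sigma> v = W"
    "analytic_between scb V scb (LX sc) N \<sigma>"
    "\<forall>v\<in>N. \<sigma> v \<in> GL sc \<and> lcoset (\<sigma> v) H \<in> U \<and> \<phi> (lcoset (\<sigma> v) H) = v"
    using C(9)[OF W(1)] W S(2) by blast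
  let ?A = "{W \<in> GL sc. lcoset W H \<in> S}"
  have "openin (top_of_set (GL sc)) ?A" using S(1) by (simp add: openin_quotient_topology)
  then have A: "nbhd_on (LX sc) (\<sigma> v) (\<lambda>W. W \<in> ?A)"
    using W openin_GL_iff[of ?A] N(2) by auto
  have "nbhd_on V v (\<lambda>v. \<sigma> v \<in> ?A)"
  proof (rule analytic_pt_nbhd_open[OF LX_space(1) C(2) LX_space analytic_betweenD(3)[OF N(3,1)] _ _ A])
    show "nbhd_on V v (\<lambda>v. \<sigma> v \<in> LX sc)"
      by (rule nbhd_on_mono[OF analytic_betweenD(4)[OF N(3,1)]]) (rule analytic_betweenD(2)[OF N(3)])
  qed (use N(2) W GL_inv(1) in auto)
  then show "nbhd_on V v (\<lambda>v. v \<in> \<phi> ` S)"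
    by (rule nbhd_on_mono[OF nbhd_on_conj[OF analytic_betweenD(4)[OF N(3,1)]]])
      (use N(4) in \<open>auto intro!: image_eqI\<close>)
qed

text \<open>Homeomorphy and compatibility hold for all charts with local sections, whatever
  \<open>H\<close> is. Only the Hausdorff property and the existence of enough such charts are left
  as hypotheses.\<close>

lemma homogeneous_manifold:
  assumes haus: "Hausdorff_space (quotient_topology sc H)"
    and cover: "\<And>W. W \<in> GL sc \<Longrightarrow> \<exists>(U, \<phi>, V)\<in>atlas (homogeneous_space sc H). lcoset W H \<in> U"
  shows "banach_manifold (homogeneous_space sc H)"
proof -
  let ?M = "homogeneous_space sc H"
  have charts: "openin (quotient_topology sc H) U \<and> banach_subspace scb V \<and>
      openin (top_of_set V) (\<phi> ` U) \<and>
      homeomorphic_map (subtopology (quotient_topology sc H) U) (top_of_set (\<phi> ` U)) \<phi>"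
    if chart: "(U, \<phi>, V) \<in> atlas ?M" for U \<phi> V
  proof (intro conjI homeomorphic_chart)
    note C = homogeneous_atlasD[OF chart]
    show "openin (quotient_topology sc H) U" "banach_subspace scb V" "openin (top_of_set V) (\<phi> ` U)"
      "openin (quotient_topology sc H) U" "inj_on \<phi> U" "\<phi> ` U \<subseteq> V" by (fact C)+
    fix T assume T: "openin (top_of_set V) T"
    let ?A = "{W \<in> GL sc. lcoset W H \<in> {C \<in> U. \<phi> C \<in> T}}"
    have "openin (top_of_set (GL sc)) ?A"
    proof (subst openin_GL_iff)
      show "\<forall>W\<in>?A. nbhd_on (LX sc) W (\<lambda>W. W \<in> ?A)"
      proof
        fix W assume "W \<in> ?A"
        then have W: "W \<in> {W \<in> GL sc. lcoset W H \<in> U}" "\<phi> (lcoset W H) \<in> T" by auto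
        note D = analytic_betweenD[OF C(8)]
        have "nbhd_on (LX sc) W (\<lambda>W. \<phi> (lcoset W H) \<in> T)"
        proof (rule analytic_pt_nbhd_open[OF LX_space LX_space(1) C(2) D(3)[OF W(1)] W(2)])
          show "T \<subseteq> V" "nbhd_on V (\<phi> (lcoset W H)) (\<lambda>v. v \<in> T)"
            using T W(2) unfolding openin_iff_nbhd_on[OF LX_space(1) C(2)] by blast+
          show "nbhd_on (LX sc) W (\<lambda>W. \<phi> (lcoset W H) \<in> V)"
            by (rule nbhd_on_mono[OF D(4)[OF W(1)]]) (rule D(2))
        qed
        then show "nbhd_on (LX sc) W (\<lambda>W. W \<in> ?A)"
          by (rule nbhd_on_mono[OF nbhd_on_conj[OF D(4)[OF W(1)]]]) auto
      qed
    qed auto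
    then show "openin (quotient_topology sc H) {C \<in> U. \<phi> C \<in> T}"
      using C(6) by (auto simp: openin_quotient_topology)
  qed (rule homogeneous_chart_open[OF chart])
  moreover have "analytic_between scb V scb V' (\<phi> ` (U \<inter> U')) (\<psi> \<circ> inv_into U \<phi>)"
    if chart: "(U, \<phi>, V) \<in> atlas ?M" and chart': "(U', \<psi>, V') \<in> atlas ?M" for U \<phi> V U' \<psi> V'
  proof (rule analytic_betweenI)
    note C = homogeneous_atlasD[OF chart] and C' = homogeneous_atlasD[OF chart']
    show "banach_space_over scb" "banach_subspace scb V" by (fact LX_space(1), fact C(2))
    show "openin (top_of_set V) (\<phi> ` (U \<inter> U'))"
      by (rule homogeneous_chart_open[OF chart]) (auto intro: C(1) C'(1))
    fix v assume "v \<in> \<phi> ` (U \<inter> U')"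
    then obtain W where W: "W \<in> GL sc" "lcoset W H \<in> U" "lcoset W H \<in> U'" "v = \<phi> (lcoset W H)"
      using C(6) unfolding lcosets_def by blast
    then show "(\<psi> \<circ> inv_into U \<phi>) v \<in> V'" using C(4) C'(7) by auto
    show "analytic_pt scb V scb V' (\<psi> \<circ> inv_into U \<phi>) v" unfolding W(4)
      by (rule homogeneous_chart_local[OF chart W(1,2) LX_space(1) C'(2)])
        (use W in \<open>auto intro: analytic_betweenD(3)[OF C'(8)]\<close>)
  qed
  moreover have "(\<Union>(U, \<phi>, V)\<in>atlas ?M. U) = lcosets sc H"
  proof
    show "(\<Union>(U, \<phi>, V)\<in>atlas ?M. U) \<subseteq> lcosets sc H" using homogeneous_atlasD(6) by blast
    show "lcosets sc H \<subseteq> (\<Union>(U, \<phi>, V)\<in>atlas ?M. U)" using cover unfolding lcosets_def by blast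
  qed
  ultimately show ?thesis unfolding banach_manifold_def using haus
    by (simp only: homogeneous_space_simps topspace_quotient) blast
qed

end

lemma banach_manifoldI:
  assumes "Hausdorff_space (mtop M)" "(\<Union>(U, \<phi>, V)\<in>atlas M. U) = topspace (mtop M)"
    and "\<And>U \<phi> V. (U, \<phi>, V) \<in> atlas M \<Longrightarrow>
       openin (mtop M) U \<and> banach_subspace (mscale M) V \<and> openin (top_of_set V) (\<phi> ` U) \<and>
       homeomorphic_map (subtopology (mtop M) U) (top_of_set (\<phi> ` U)) \<phi>"
    and "\<And>U \<phi> V U' \<psi> V'. (U, \<phi>, V) \<in> atlas M \<Longrightarrow> (U', \<psi>, V') \<in> atlas M \<Longrightarrow>
      analytic_between (mscale M) V (mscale M) V' (\<phi> ` (U \<inter> U')) (\<psi> \<circ> inv_into U \<phi>)"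
  shows "banach_manifold M"
  unfolding banach_manifold_def
proof (intro conjI ballI)
  show "Hausdorff_space (mtop M)" "(\<Union>(U, \<phi>, V)\<in>atlas M. U) = topspace (mtop M)" by (fact assms)+
next
  fix c assume "c \<in> atlas M"
  then show "case c of (U, \<phi>, V) \<Rightarrow>
       openin (mtop M) U \<and> banach_subspace (mscale M) V \<and> openin (top_of_set V) (\<phi> ` U) \<and>
       homeomorphic_map (subtopology (mtop M) U) (top_of_set (\<phi> ` U)) \<phi>"
    using assms(3)[of "fst c" "fst (snd c)" "snd (snd c)"] by (simp add: case_prod_beta)
next
  fix c assume "c \<in> atlas M"
  then show "case c of (U, \<phi>, V) \<Rightarrow> \<forall>(U', \<psi>, V')\<in>atlas M.
      analytic_between (mscale M) V (mscale M) V' (\<phi> ` (U \<inter> U')) (\<psi> \<circ> inv_into U \<phi>)"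
    using assms(4)[of "fst c" "fst (snd c)" "snd (snd c)"] by (auto simp: case_prod_beta)
qed

lemma banach_manifoldD:
  assumes "banach_manifold M"
  shows "Hausdorff_space (mtop M)" "(\<Union>(U, \<phi>, V)\<in>atlas M. U) = topspace (mtop M)"
    "(U, \<phi>, V) \<in> atlas M \<Longrightarrow> (U', \<psi>, V') \<in> atlas M \<Longrightarrow>
      analytic_between (mscale M) V (mscale M) V' (\<phi> ` (U \<inter> U')) (\<psi> \<circ> inv_into U \<phi>)"
proof -
  note * = assms[unfolded banach_manifold_def]
  from * show "Hausdorff_space (mtop M)" by (elim conjE)
  from * show "(\<Union>(U, \<phi>, V)\<in>atlas M. U) = topspace (mtop M)" by (elim conjE)
  from * have "\<forall>(U, \<phi>, V)\<in>atlas M. \<forall>(U', \<psi>, V')\<in>atlas M.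
       analytic_between (mscale M) V (mscale M) V' (\<phi> ` (U \<inter> U')) (\<psi> \<circ> inv_into U \<phi>)"
    by (elim conjE)
  then show "(U, \<phi>, V) \<in> atlas M \<Longrightarrow> (U', \<psi>, V') \<in> atlas M \<Longrightarrow>
      analytic_between (mscale M) V (mscale M) V' (\<phi> ` (U \<inter> U')) (\<psi> \<circ> inv_into U \<phi>)"
    by fastforce
qed

text \<open>The chart maps are kept, but \<open>inv_into\<close> is now taken over
  \<open>U \<inter> S\<close>. It agrees with the old inverse on the image of
  \<open>U \<inter> S\<close>, so the new transition maps have the germs of the old ones.\<close>

lemma open_submanifold_manifold:
  fixes M :: "('m, 'k::{real_normed_field,banach}, 'v::banach) mfd"
  assumes mfd: "banach_manifold M" and scale: "banach_space_over (mscale M)"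
    and S: "openin (mtop M) S"
  shows "banach_manifold (open_submanifold M S)"
proof -
  let ?N = "open_submanifold M S" and ?X = "subtopology (mtop M) S"
  have simps: "mtop ?N = ?X" "mscale ?N = mscale M"
    "atlas ?N = (\<lambda>(U, \<phi>, V). (U \<inter> S, \<phi>, V)) ` atlas M"
    unfolding open_submanifold_def by (simp, simp, force)
  have SX: "S \<subseteq> topspace (mtop M)" using S by (rule openin_subset)
  have "Hausdorff_space ?X"
    by (intro Hausdorff_space_subtopology banach_manifoldD mfd)
  moreover have "openin ?X (U \<inter> S) \<and> banach_subspace (mscale M) V \<and>
      openin (top_of_set V) (\<phi> ` (U \<inter> S)) \<and>
      homeomorphic_map (subtopology ?X (U \<inter> S)) (top_of_set (\<phi> ` (U \<inter> S))) \<phi>"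
    if chart: "(U, \<phi>, V) \<in> atlas M" for U \<phi> V
  proof -
    interpret banach_chart M U \<phi> V by (rule banach_chart.intro) fact+
    have US: "openin (mtop M) (U \<inter> S)" using chart_simps(1) S by (rule openin_Int)
    have "homeomorphic_map (subtopology (mtop M) (U \<inter> S)) (top_of_set (\<phi> ` (U \<inter> S))) \<phi>"
    proof (rule homeomorphic_chart[OF US])
      show "inj_on \<phi> (U \<inter> S)" using inj by (rule inj_on_subset) simp
      show "\<phi> ` (U \<inter> S) \<subseteq> V" using chart_simps(5) by auto
      fix T assume "openin (top_of_set V) T"
      then have "openin (mtop M) ({x \<in> U. \<phi> x \<in> T} \<inter> S)" using S by (intro openin_Int openin_preimage)
      moreover have "{x \<in> U. \<phi> x \<in> T} \<inter> S = {x \<in> U \<inter> S. \<phi> x \<in> T}" by auto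
      ultimately show "openin (mtop M) {x \<in> U \<inter> S. \<phi> x \<in> T}" by simp
    qed (auto intro: openin_image)
    moreover have "subtopology ?X (U \<inter> S) = subtopology (mtop M) (U \<inter> S)"
      by (simp add: subtopology_subtopology) (metis inf.left_idem inf_commute)
    moreover have "openin ?X (U \<inter> S)" using US S by (simp add: openin_open_subtopology)
    moreover have "openin (top_of_set V) (\<phi> ` (U \<inter> S))" using US by (rule openin_image) simp
    ultimately show ?thesis using chart_simps(2) by simp
  qed
  moreover have "(\<Union>(U, \<phi>, V)\<in>atlas ?N. U) = topspace ?X"
  proof -
    have "(\<Union>(U, \<phi>, V)\<in>atlas M. U) = topspace (mtop M)" by (rule banach_manifoldD[OF mfd])
    moreover have "(\<Union>(U, \<phi>, V)\<in>atlas ?N. U) = (\<Union>(U, \<phi>, V)\<in>atlas M. U) \<inter> S"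
      unfolding simps(3) by (simp add: case_prod_beta)
    ultimately show ?thesis by simp
  qed
  moreover have "analytic_between (mscale M) V (mscale M) V' (\<phi> ` ((U \<inter> S) \<inter> (U' \<inter> S)))
      (\<psi> \<circ> inv_into (U \<inter> S) \<phi>)"
    if chart: "(U, \<phi>, V) \<in> atlas M" and chart': "(U', \<psi>, V') \<in> atlas M" for U \<phi> V U' \<psi> V'
  proof -
    interpret C: banach_chart M U \<phi> V by (rule banach_chart.intro) fact+
    interpret C': banach_chart M U' \<psi> V' by (rule banach_chart.intro) fact+
    have an: "analytic_between (mscale M) V (mscale M) V' (\<phi> ` (U \<inter> U')) (\<psi> \<circ> inv_into U \<phi>)"
      by (rule banach_manifoldD(3)[OF mfd chart chart'])
    have W: "openin (mtop M) ((U \<inter> S) \<inter> (U' \<inter> S))"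
      using C.chart_simps(1) C'.chart_simps(1) S by (intro openin_Int)
    have inv: "inv_into (U \<inter> S) \<phi> v = inv_into U \<phi> v" if "v \<in> \<phi> ` (U \<inter> S)" for v
    proof -
      have "inj_on \<phi> (U \<inter> S)" using C.inj by (rule inj_on_subset) simp
      with that show ?thesis using C.inv_chart by (auto simp: inv_into_f_f)
    qed
    show ?thesis
    proof (rule analytic_betweenI[OF scale C.chart_simps(2)])
      show op: "openin (top_of_set V) (\<phi> ` ((U \<inter> S) \<inter> (U' \<inter> S)))"
        using W by (rule C.openin_image) blast
      fix v assume v: "v \<in> \<phi> ` ((U \<inter> S) \<inter> (U' \<inter> S))"
      then have v': "v \<in> \<phi> ` (U \<inter> U')" by blast
      have eq: "(\<psi> \<circ> inv_into U \<phi>) w = (\<psi> \<circ> inv_into (U \<inter> S) \<phi>) w"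
        if "w \<in> \<phi> ` ((U \<inter> S) \<inter> (U' \<inter> S))" for w
        using inv[of w] that by auto
      show "(\<psi> \<circ> inv_into (U \<inter> S) \<phi>) v \<in> V'"
        using analytic_betweenD(2)[OF an v'] eq[OF v] by simp
      have "nbhd_on V v (\<lambda>w. w \<in> \<phi> ` ((U \<inter> S) \<inter> (U' \<inter> S)))"
        using op v openin_iff_nbhd_on[OF scale C.chart_simps(2)] by blast
      then show "analytic_pt (mscale M) V (mscale M) V' (\<psi> \<circ> inv_into (U \<inter> S) \<phi>) v"
        by (intro analytic_pt_cong[OF analytic_betweenD(3)[OF an v']]) (erule nbhd_on_mono, rule eq)
    qed
  qed
  moreover have "\<exists>U. V = U \<inter> S \<and> (U, \<phi>, E) \<in> atlas M" if "(V, \<phi>, E) \<in> atlas ?N" for V \<phi> E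
    using that unfolding simps(3) by auto
  ultimately show ?thesis by (intro banach_manifoldI) (metis simps(1,2))+
qed

text \<open>Orbit maps and sections are described in coordinates, for every chart of the atlas.
  Normalising \<open>g\<close> to the identity at the base point lets \<open>g\<close> times
  \<open>W\<close> pass through any prescribed \<open>W\<close>. The copy \<open>E'\<close> of the
  model inside L(X) is asked for because the charts of \<open>homogeneous_space\<close> take their
  values there, whereas the models of \<open>M\<close> live in a type of their own.\<close>

locale homogeneous_action = banach_space_over sc
  for sc :: "'k::{real_normed_field,banach} \<Rightarrow> 'x::banach \<Rightarrow> 'x" +
  fixes M :: "('m, 'k, 'v::banach) mfd" and act :: "('x \<Rightarrow>\<^sub>L 'x) \<Rightarrow> 'm \<Rightarrow> 'm"
  assumes mfd: "banach_manifold M" and scale: "banach_space_over (mscale M)"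
    and act_closed: "W \<in> GL sc \<Longrightarrow> p \<in> topspace (mtop M) \<Longrightarrow> act W p \<in> topspace (mtop M)"
    and act_id: "p \<in> topspace (mtop M) \<Longrightarrow> act id_blinfun p = p"
    and act_comp: "W \<in> GL sc \<Longrightarrow> V \<in> GL sc \<Longrightarrow> p \<in> topspace (mtop M) \<Longrightarrow>
      act (W o\<^sub>L V) p = act W (act V p)"
    and orbit_map: "(U, \<phi>, E) \<in> atlas M \<Longrightarrow> p \<in> topspace (mtop M) \<Longrightarrow> W \<in> GL sc \<Longrightarrow> act W p \<in> U \<Longrightarrow>
      nbhd_on (LX sc) W (\<lambda>W. act W p \<in> U) \<and>
      analytic_pt (scale_blinfun sc) (LX sc) (mscale M) E (\<lambda>W. \<phi> (act W p)) W"
    and local_section: "(U, \<phi>, E) \<in> atlas M \<Longrightarrow> p \<in> U \<Longrightarrow>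
      \<exists>N g. \<phi> p \<in> N \<and> N \<subseteq> \<phi> ` U \<and> g (\<phi> p) = id_blinfun \<and>
        analytic_between (mscale M) E (scale_blinfun sc) (LX sc) N g \<and>
        (\<forall>v\<in>N. g v \<in> GL sc \<and> act (g v) p = inv_into U \<phi> v)"
    and model: "p \<in> topspace (mtop M) \<Longrightarrow> \<exists>U \<phi> E E' J K. (U, \<phi>, E) \<in> atlas M \<and> p \<in> U \<and>
      E' \<subseteq> LX sc \<and> banach_subspace (scale_blinfun sc) E' \<and>
      linear_between (mscale M) E (scale_blinfun sc) E' J \<and>
      linear_between (scale_blinfun sc) E' (mscale M) E K \<and>
      (\<forall>v\<in>E. K (J v) = v) \<and> (\<forall>w\<in>E'. J (K w) = w)"
begin

section \<open>Orbit maps, cosets of stabilizers and the induced map\<close>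

abbreviation P where "P \<equiv> topspace (mtop M)"
abbreviation Stab where "Stab \<equiv> stabilizer sc act"
abbreviation Sig where "Sig p \<equiv> induced (\<lambda>W. act W p)"

text \<open>The cosets of the stabilizer are the fibres of the orbit map, which yields both
  well-definedness and injectivity of the induced map.\<close>

lemma lcoset_stabilizer:
  assumes "W \<in> GL sc" "p \<in> P"
  shows "lcoset W (Stab p) = {W' \<in> GL sc. act W' p = act W p}"
proof (intro set_eqI iffI)
  fix W' assume "W' \<in> lcoset W (Stab p)"
  then show "W' \<in> {W' \<in> GL sc. act W' p = act W p}"
    using assms by (auto simp: lcoset_def stabilizer_def GL_comp act_comp)
next
  fix W' assume W': "W' \<in> {W' \<in> GL sc. act W' p = act W p}"
  then have "act (op_inv W o\<^sub>L W') p = act (op_inv W) (act W p)"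
    using assms by (simp add: act_comp GL_inv)
  also have "\<dots> = act (op_inv W o\<^sub>L W) p" by (rule act_comp[symmetric]) (use assms GL_inv in auto)
  also have "\<dots> = p" using assms by (simp add: GL_inv act_id)
  finally have "op_inv W o\<^sub>L W' \<in> Stab p"
    using W' assms by (simp add: stabilizer_def GL_comp GL_inv)
  then show "W' \<in> lcoset W (Stab p)"
    unfolding lcoset_def using assms by (intro image_eqI[of _ _ "op_inv W o\<^sub>L W'"]) (simp_all add: GL_inv)
qed

lemma Sig_lcoset:
  assumes "W \<in> GL sc" "p \<in> P"
  shows "Sig p (lcoset W (Stab p)) = act W p"
proof -
  have "(\<lambda>W. act W p) ` lcoset W (Stab p) = {act W p}"
    unfolding lcoset_stabilizer[OF assms] using assms by auto
  then show ?thesis by (simp add: induced_def)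
qed

lemma lcoset_eq_iff:
  assumes "W \<in> GL sc" "W' \<in> GL sc" "p \<in> P"
  shows "lcoset W (Stab p) = lcoset W' (Stab p) \<longleftrightarrow> act W p = act W' p"
proof
  assume "lcoset W (Stab p) = lcoset W' (Stab p)"
  then show "act W p = act W' p"
    using Sig_lcoset[OF assms(1,3)] Sig_lcoset[OF assms(2,3)] by simp
next
  assume "act W p = act W' p"
  then show "lcoset W (Stab p) = lcoset W' (Stab p)"
    unfolding lcoset_stabilizer[OF assms(1,3)] lcoset_stabilizer[OF assms(2,3)] by simp
qed

lemma Sig_inj: "p \<in> P \<Longrightarrow> inj_on (Sig p) (lcosets sc (Stab p))"
  unfolding lcosets_def by (rule inj_onI) (elim imageE, simp add: Sig_lcoset lcoset_eq_iff)

lemma Sig_image: "p \<in> P \<Longrightarrow> Sig p ` lcosets sc (Stab p) = orbit sc act p"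
  unfolding lcosets_def orbit_def by (auto simp: Sig_lcoset image_image)

lemma chart: "(U, \<phi>, E) \<in> atlas M \<Longrightarrow> banach_chart M U \<phi> E"
  by (rule banach_chart.intro[OF mfd scale])

lemma chart_at:
  assumes "p \<in> P"
  obtains U \<phi> E where "(U, \<phi>, E) \<in> atlas M" "p \<in> U"
  using model[OF assms] by blast

text \<open>Continuity of the orbit map. Since it is controlled in coordinates only,
  \<open>S\<close> is transported into a chart and back, using that the chart map is
  injective.\<close>

lemma openin_orbit_preimage:
  assumes S: "openin (mtop M) S" and p: "p \<in> P"
  shows "openin (top_of_set (GL sc)) {W \<in> GL sc. act W p \<in> S}"
proof (subst openin_GL_iff)
  show "\<forall>W\<in>{W \<in> GL sc. act W p \<in> S}. nbhd_on (LX sc) W (\<lambda>W. W \<in> {W \<in> GL sc. act W p \<in> S})"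
  proof
    fix W assume W: "W \<in> {W \<in> GL sc. act W p \<in> S}"
    then obtain U \<phi> E where at: "(U, \<phi>, E) \<in> atlas M" "act W p \<in> U"
      using chart_at act_closed p by blast
    interpret C: banach_chart M U \<phi> E by (rule chart) fact
    have om: "nbhd_on (LX sc) W (\<lambda>W. act W p \<in> U)"
      "analytic_pt scb (LX sc) (mscale M) E (\<lambda>W. \<phi> (act W p)) W"
      using orbit_map[OF at(1) p _ at(2)] W by blast+
    have US: "openin (mtop M) (U \<inter> S)" using C.chart_simps(1) S by (rule openin_Int)
    have "nbhd_on (LX sc) W (\<lambda>W. \<phi> (act W p) \<in> \<phi> ` (U \<inter> S))"
    proof (rule analytic_pt_nbhd_open[OF LX_space scale C.chart_simps(2) om(2)])
      show "\<phi> (act W p) \<in> \<phi> ` (U \<inter> S)" using W at by blast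
      show "\<phi> ` (U \<inter> S) \<subseteq> E" using C.chart_simps(5) by blast
      show "nbhd_on E (\<phi> (act W p)) (\<lambda>v. v \<in> \<phi> ` (U \<inter> S))"
        by (rule C.nbhd_image[OF US]) (use W at in auto)
      show "nbhd_on (LX sc) W (\<lambda>W. \<phi> (act W p) \<in> E)"
        by (rule nbhd_on_mono[OF om(1)]) (use C.chart_simps(5) in auto)
    qed
    moreover have "nbhd_on (LX sc) W (\<lambda>W. W \<in> GL sc)" using W by (intro GL_nbhd) simp
    ultimately show "nbhd_on (LX sc) W (\<lambda>W. W \<in> {W \<in> GL sc. act W p \<in> S})"
    proof (rule nbhd_on_mono[OF nbhd_on_conj[OF om(1) nbhd_on_conj]])
      fix h assume h: "act (W + h) p \<in> U \<and> \<phi> (act (W + h) p) \<in> \<phi> ` (U \<inter> S) \<and> W + h \<in> GL sc"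
      then obtain q where "q \<in> U" "q \<in> S" "\<phi> (act (W + h) p) = \<phi> q" by blast
      then have "act (W + h) p = q" using h C.inj by (auto dest: inj_onD)
      then show "W + h \<in> {W \<in> GL sc. act W p \<in> S}" using h \<open>q \<in> S\<close> by simp
    qed
  qed
qed auto

text \<open>Openness of the orbit map: a point \<open>r\<close> near \<open>q = act W p\<close> is
  the image of \<open>p\<close> under \<open>g (\<phi> r)\<close> times \<open>W\<close>, and this
  product is close to \<open>W\<close>, hence in \<open>A\<close>.\<close>

lemma openin_orbit_image:
  assumes A: "openin (top_of_set (GL sc)) A" and p: "p \<in> P"
  shows "openin (mtop M) ((\<lambda>W. act W p) ` A)"
proof (subst openin_subopen, intro ballI)
  have AG: "A \<subseteq> GL sc" using A by (rule openin_imp_subset)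
  fix q assume "q \<in> (\<lambda>W. act W p) ` A"
  then obtain W where W: "W \<in> A" "q = act W p" by blast
  then have WG: "W \<in> GL sc" and q: "q \<in> P" using AG act_closed p by auto
  obtain U \<phi> E where at: "(U, \<phi>, E) \<in> atlas M" "q \<in> U" using chart_at q by blast
  interpret C: banach_chart M U \<phi> E by (rule chart) fact
  obtain N g where N: "\<phi> q \<in> N" "N \<subseteq> \<phi> ` U" "g (\<phi> q) = id_blinfun"
    "analytic_between (mscale M) E scb (LX sc) N g"
    "\<forall>v\<in>N. g v \<in> GL sc \<and> act (g v) q = inv_into U \<phi> v"
    using local_section[OF at] by blast
  note ND = analytic_betweenD[OF N(4)]
  define T where "T = {v \<in> N. g v o\<^sub>L W \<in> A}"
  have "openin (top_of_set E) T"
    unfolding openin_iff_nbhd_on[OF scale C.chart_simps(2)]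
  proof (intro conjI ballI)
    show "T \<subseteq> E" using ND(1) by (auto simp: T_def)
    fix v assume v: "v \<in> T"
    then have vN: "v \<in> N" "g v o\<^sub>L W \<in> A" by (auto simp: T_def)
    have an: "analytic_pt (mscale M) E scb (LX sc) (\<lambda>v. g v o\<^sub>L W) v"
      using ND(2,3)[OF vN(1)] WG
      by (intro analytic_pt_comp_op[OF scale C.chart_simps(2)] analytic_pt_const LX_space GL_inv(1)[OF WG])
    have "nbhd_on E v (\<lambda>v. g v o\<^sub>L W \<in> A)"
    proof (rule analytic_pt_nbhd_open[OF scale C.chart_simps(2) LX_space an vN(2)])
      show "A \<subseteq> LX sc" using AG GL_inv(1) by blast
      show "nbhd_on (LX sc) (g v o\<^sub>L W) (\<lambda>V. V \<in> A)"
        using A vN(2) unfolding openin_GL_iff[OF AG] by blast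
      show "nbhd_on E v (\<lambda>v. g v o\<^sub>L W \<in> LX sc)"
        by (rule nbhd_on_mono[OF ND(4)[OF vN(1)]]) (intro LX_comp ND(2) GL_inv(1)[OF WG])
    qed
    then show "nbhd_on E v (\<lambda>v. v \<in> T)"
      by (rule nbhd_on_mono[OF nbhd_on_conj[OF ND(4)[OF vN(1)]]]) (simp add: T_def)
  qed
  then have "openin (mtop M) {r \<in> U. \<phi> r \<in> T}" by (rule C.openin_preimage)
  moreover have "q \<in> {r \<in> U. \<phi> r \<in> T}" using at N W by (simp add: T_def)
  moreover have "{r \<in> U. \<phi> r \<in> T} \<subseteq> (\<lambda>W. act W p) ` A"
  proof
    fix r assume r: "r \<in> {r \<in> U. \<phi> r \<in> T}"
    then have "\<phi> r \<in> N" "g (\<phi> r) o\<^sub>L W \<in> A" by (auto simp: T_def)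
    moreover have "act (g (\<phi> r) o\<^sub>L W) p = r"
      using r N(5) \<open>\<phi> r \<in> N\<close> C.inv_chart[of r] WG p by (simp add: act_comp W(2))
    ultimately show "r \<in> (\<lambda>W. act W p) ` A" by (metis image_eqI)
  qed
  ultimately show "\<exists>T. openin (mtop M) T \<and> q \<in> T \<and> T \<subseteq> (\<lambda>W. act W p) ` A" by blast
qed

text \<open>The orbit map is continuous and open, so the quotient topology is the topology of the
  orbit, transported to the cosets.\<close>

lemma openin_quotient_iff:
  assumes p: "p \<in> P"
  shows "openin (quotient_topology sc (Stab p)) U \<longleftrightarrow>
    U \<subseteq> lcosets sc (Stab p) \<and> openin (mtop M) (Sig p ` U)"
proof -
  have "openin (top_of_set (GL sc)) {W \<in> GL sc. lcoset W (Stab p) \<in> U} \<longleftrightarrow> openin (mtop M) (Sig p ` U)"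
    if U: "U \<subseteq> lcosets sc (Stab p)"
  proof -
    have eq1: "{W \<in> GL sc. lcoset W (Stab p) \<in> U} = {W \<in> GL sc. act W p \<in> Sig p ` U}"
    proof -
      have "lcoset W (Stab p) \<in> U \<longleftrightarrow> act W p \<in> Sig p ` U" if W: "W \<in> GL sc" for W
      proof -
        have "lcoset W (Stab p) \<in> lcosets sc (Stab p)" using W by (simp add: lcosets_def)
        then show ?thesis
          using inj_on_image_mem_iff[OF Sig_inj[OF p] _ U] Sig_lcoset[OF W p] by metis
      qed
      then show ?thesis by blast
    qed
    have eq2: "Sig p ` U = (\<lambda>W. act W p) ` {W \<in> GL sc. lcoset W (Stab p) \<in> U}"
      using U unfolding lcosets_def by (force simp: Sig_lcoset p)
    show ?thesis
    proof
      show "openin (mtop M) (Sig p ` U)"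
        if "openin (top_of_set (GL sc)) {W \<in> GL sc. lcoset W (Stab p) \<in> U}"
        unfolding eq2 using that p by (rule openin_orbit_image)
      show "openin (top_of_set (GL sc)) {W \<in> GL sc. lcoset W (Stab p) \<in> U}"
        if "openin (mtop M) (Sig p ` U)"
        unfolding eq1 using that p by (rule openin_orbit_preimage)
    qed
  qed
  then show ?thesis unfolding openin_quotient_topology by blast
qed

lemma openin_orbit: "p \<in> P \<Longrightarrow> openin (mtop M) (orbit sc act p)"
  unfolding orbit_def by (rule openin_orbit_image) simp_all

lemma openin_Sig_preimage:
  assumes "p \<in> P" "openin (mtop M) S"
  shows "openin (quotient_topology sc (Stab p)) {C \<in> lcosets sc (Stab p). Sig p C \<in> S}"
proof -
  have "Sig p ` {C \<in> lcosets sc (Stab p). Sig p C \<in> S} = orbit sc act p \<inter> S"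
    using Sig_image[OF assms(1)] by auto
  then show ?thesis unfolding openin_quotient_iff[OF assms(1)]
    using openin_orbit[OF assms(1)] assms(2) by auto
qed

lemma Sig_continuous:
  assumes "p \<in> P"
  shows "continuous_map (quotient_topology sc (Stab p)) (mtop M) (Sig p)"
  unfolding continuous_map topspace_quotient
proof (intro conjI allI impI)
  show "Sig p ` lcosets sc (Stab p) \<subseteq> P"
    unfolding Sig_image[OF assms] by (rule openin_subset[OF openin_orbit[OF assms]])
qed (rule openin_Sig_preimage[OF assms])

text \<open>A chart of \<open>M\<close> is pulled back along the induced map and moved into L(X) by
  \<open>J\<close>. Its section through \<open>W\<close> is the local section of the action, read in
  the coordinates \<open>K w\<close> and multiplied by \<open>W\<close>.\<close>

lemma homogeneous_chart_exists:
  assumes p: "p \<in> P" and W0: "W0 \<in> GL sc"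
  shows "\<exists>(U, \<phi>, V)\<in>atlas (homogeneous_space sc (Stab p)). lcoset W0 (Stab p) \<in> U"
proof -
  have q0: "act W0 p \<in> P" using W0 p by (rule act_closed)
  from model[OF q0] obtain U \<phi> E E' J K where at: "(U, \<phi>, E) \<in> atlas M" "act W0 p \<in> U"
    and E': "E' \<subseteq> LX sc" "banach_subspace scb E'"
    and J: "linear_between (mscale M) E scb E' J" and K: "linear_between scb E' (mscale M) E K"
    and JK: "\<forall>v\<in>E. K (J v) = v" "\<forall>w\<in>E'. J (K w) = w" by blast
  interpret C: banach_chart M U \<phi> E by (rule chart) fact
  note E = C.chart_simps(2)
  have JE: "J v \<in> E'" if "v \<in> E" for v using J that unfolding linear_between_def by blast
  have KE: "K w \<in> E" if "w \<in> E'" for w using K that unfolding linear_between_def by blast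
  have Ja: "analytic_pt (mscale M) E scb E' J v" if "v \<in> E" for v
    by (rule linear_between_analytic[OF LX_space(1) E'(2) J that])
  have Ka: "analytic_pt scb E' (mscale M) E K w" if "w \<in> E'" for w
    by (rule linear_between_analytic[OF scale E K that])
  have E'_nb: "nbhd_on E' w (\<lambda>w. w \<in> E')" if "w \<in> E'" for w
    unfolding nbhd_on_def
    using that banach_space_over.subspaceD(2)[OF LX_space(1) E'(2)] by (intro exI[of _ 1]) simp
  have K_open: "openin (top_of_set E') {w \<in> E'. K w \<in> T}" if T: "openin (top_of_set E) T" for T
    unfolding openin_iff_nbhd_on[OF LX_space(1) E'(2)]
  proof (intro conjI ballI)
    fix w assume w: "w \<in> {w \<in> E'. K w \<in> T}"
    then have w': "w \<in> E'" "K w \<in> T" by auto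
    have "nbhd_on E' w (\<lambda>w. K w \<in> T)"
    proof (rule analytic_pt_nbhd_open[OF LX_space(1) E'(2) scale E Ka[OF w'(1)] w'(2)])
      show "T \<subseteq> E" "nbhd_on E (K w) (\<lambda>v. v \<in> T)"
        using T w'(2) unfolding openin_iff_nbhd_on[OF scale E] by blast+
      show "nbhd_on E' w (\<lambda>w. K w \<in> E)" by (rule nbhd_on_mono[OF E'_nb[OF w'(1)]]) (rule KE)
    qed
    then show "nbhd_on E' w (\<lambda>w. w \<in> {w \<in> E'. K w \<in> T})"
      by (rule nbhd_on_mono[OF nbhd_on_conj[OF E'_nb[OF w'(1)]]]) simp
  qed auto
  let ?H = "Stab p"
  define X where "X = {C \<in> lcosets sc ?H. Sig p C \<in> U}"
  define \<theta> where "\<theta> C = J (\<phi> (Sig p C))" for C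
  have mem: "lcoset W ?H \<in> X \<longleftrightarrow> act W p \<in> U" and \<theta>: "\<theta> (lcoset W ?H) = J (\<phi> (act W p))"
    if "W \<in> GL sc" for W
    using that by (auto simp: X_def \<theta>_def Sig_lcoset p lcosets_def)
  have \<phi>E: "\<phi> q \<in> E" if "q \<in> U" for q using C.chart_simps(5) that by blast
  have orb: "Sig p ` X = U \<inter> orbit sc act p" using Sig_image[OF p] by (auto simp: X_def)
  have "(X, \<theta>, E') \<in> atlas (homogeneous_space sc ?H)"
    unfolding homogeneous_space_def mfd.simps mem_Collect_eq case_prod_conv
  proof (intro conjI ballI impI)
    show "openin (quotient_topology sc ?H) X"
      unfolding X_def by (rule openin_Sig_preimage[OF p C.chart_simps(1)])
    show "E' \<subseteq> LX sc" "banach_subspace scb E'" by (fact E')+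
    show "inj_on \<theta> X"
    proof (rule inj_onI)
      fix C D assume CD: "C \<in> X" "D \<in> X" "\<theta> C = \<theta> D"
      have "K (\<theta> C) = \<phi> (Sig p C)" if "C \<in> X" for C
        using JK(1) \<phi>E that by (simp add: \<theta>_def X_def)
      then have "\<phi> (Sig p C) = \<phi> (Sig p D)" using CD by metis
      then have "Sig p C = Sig p D" using CD C.inj by (auto simp: X_def dest: inj_onD)
      then show "C = D" using CD Sig_inj[OF p] by (auto simp: X_def dest: inj_onD)
    qed
    have op: "openin (top_of_set E) (\<phi> ` (U \<inter> orbit sc act p))"
      by (intro C.openin_image openin_Int C.chart_simps openin_orbit p) simp
    \<comment> \<open>\<open>J\<close> and \<open>K\<close> are inverse to each other, so the image
      under the chart is a preimage under the continuous map \<open>K\<close>; openness of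
      \<open>J\<close> need not be discussed.\<close>
    have "\<theta> ` X = {w \<in> E'. K w \<in> \<phi> ` (U \<inter> orbit sc act p)}"
    proof (intro set_eqI iffI)
      fix w assume "w \<in> \<theta> ` X"
      then obtain C where C: "C \<in> X" "w = \<theta> C" by blast
      then have "Sig p C \<in> U \<inter> orbit sc act p" using orb by blast
      then show "w \<in> {w \<in> E'. K w \<in> \<phi> ` (U \<inter> orbit sc act p)}"
        using C \<phi>E JE JK(1) by (simp add: \<theta>_def)
    next
      fix w assume w: "w \<in> {w \<in> E'. K w \<in> \<phi> ` (U \<inter> orbit sc act p)}"
      then obtain C where "C \<in> X" "K w = \<phi> (Sig p C)" unfolding orb[symmetric] by blast
      then have "w = \<theta> C" using w JK(2) by (metis (no_types, lifting) \<theta>_def mem_Collect_eq)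
      then show "w \<in> \<theta> ` X" using \<open>C \<in> X\<close> by blast
    qed
    then show "openin (top_of_set E') (\<theta> ` X)" using K_open[OF op] by simp
    let ?A = "{W \<in> GL sc. lcoset W ?H \<in> X}"
    have A: "?A = {W \<in> GL sc. act W p \<in> U}" using mem by blast
    have Aopen: "\<forall>W\<in>?A. nbhd_on (LX sc) W (\<lambda>W. W \<in> ?A)"
      using openin_orbit_preimage[OF C.chart_simps(1) p] openin_GL_iff[of ?A] unfolding A by blast
    show "analytic_between scb (LX sc) scb E' ?A (\<lambda>W. \<theta> (lcoset W ?H))"
      unfolding analytic_between_iff
    proof (intro conjI ballI subsetI)
      show "W \<in> LX sc" if "W \<in> ?A" for W using that GL_inv(1) by blast
      show "w \<in> E'" if "w \<in> (\<lambda>W. \<theta> (lcoset W ?H)) ` ?A" for w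
        using that unfolding A by (auto simp: \<theta> intro!: JE \<phi>E)
      show "nbhd_on (LX sc) W (\<lambda>W. W \<in> ?A)" if "W \<in> ?A" for W using Aopen that by blast
      show "analytic_pt scb (LX sc) scb E' (\<lambda>W. \<theta> (lcoset W ?H)) W" if WA: "W \<in> ?A" for W
      proof (rule analytic_pt_cong)
        have W: "W \<in> GL sc" "act W p \<in> U" using WA unfolding A by auto
        show "analytic_pt scb (LX sc) scb E' (\<lambda>W. J (\<phi> (act W p))) W"
          using orbit_map[OF at(1) p W] \<phi>E[OF W(2)]
          by (intro analytic_pt_compose[OF LX_space scale E LX_space(1) E'(2)] Ja) auto
        show "nbhd_on (LX sc) W (\<lambda>W. J (\<phi> (act W p)) = \<theta> (lcoset W ?H))"
          by (rule nbhd_on_mono[OF GL_nbhd[OF W(1)]]) (simp add: \<theta>)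
      qed
    qed
    fix W assume W: "W \<in> GL sc" "lcoset W ?H \<in> X"
    \<comment> \<open>The section must pass through the given \<open>W\<close>, not just through its
      coset. So the local section of the action is taken at \<open>act W p\<close> and then
      multiplied by \<open>W\<close>.\<close>
    define q where "q = act W p"
    have q: "q \<in> U" "q \<in> P" using W mem act_closed[OF W(1) p] by (auto simp: q_def)
    obtain N g where N: "\<phi> q \<in> N" "N \<subseteq> \<phi> ` U" "g (\<phi> q) = id_blinfun"
      "analytic_between (mscale M) E scb (LX sc) N g"
      "\<forall>v\<in>N. g v \<in> GL sc \<and> act (g v) q = inv_into U \<phi> v"
      using local_section[OF at(1) q(1)] by blast
    note ND = analytic_betweenD[OF N(4)]
    define N' where "N' = {w \<in> E'. K w \<in> N}"
    define \<sigma> where "\<sigma> w = g (K w) o\<^sub>L W" for w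
    have \<sigma>: "\<sigma> w \<in> GL sc" "lcoset (\<sigma> w) ?H \<in> X" "\<theta> (lcoset (\<sigma> w) ?H) = w" if "w \<in> N'" for w
    proof -
      have w: "w \<in> E'" "K w \<in> N" using that by (auto simp: N'_def)
      then show G: "\<sigma> w \<in> GL sc" using N(5) W(1) by (auto simp: \<sigma>_def intro: GL_comp)
      have "act (\<sigma> w) p = inv_into U \<phi> (K w)"
        using N(5) W(1) w p by (simp add: \<sigma>_def act_comp q_def)
      moreover have "K w \<in> \<phi> ` U" using w N(2) by blast
      ultimately have "act (\<sigma> w) p \<in> U" "\<phi> (act (\<sigma> w) p) = K w"
        by (simp_all add: inv_into_into f_inv_into_f)
      then show "lcoset (\<sigma> w) ?H \<in> X" "\<theta> (lcoset (\<sigma> w) ?H) = w"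
        using mem[OF G] \<theta>[OF G] JK(2) w by auto
    qed
    have "\<theta> (lcoset W ?H) = J (\<phi> q)" using \<theta>[OF W(1)] by (simp add: q_def)
    moreover have KJ: "K (J (\<phi> q)) = \<phi> q" "J (\<phi> q) \<in> E'" using JK(1) \<phi>E[OF q(1)] JE by auto
    ultimately have "\<theta> (lcoset W ?H) \<in> N'" "\<sigma> (\<theta> (lcoset W ?H)) = W"
      using N(1,3) by (auto simp: N'_def \<sigma>_def)
    moreover have "N' \<subseteq> \<theta> ` X" using \<sigma> by (metis image_eqI subsetI)
    moreover have "analytic_between scb E' scb (LX sc) N' \<sigma>"
    proof (rule analytic_betweenI[OF LX_space(1) E'(2)])
      show "openin (top_of_set E') N'"
        unfolding N'_def by (rule K_open[OF analytic_between_open[OF scale E N(4)]])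
      fix w assume "w \<in> N'"
      then have w: "w \<in> E'" "K w \<in> N" and "\<sigma> w \<in> GL sc" using \<sigma> by (auto simp: N'_def)
      then show "\<sigma> w \<in> LX sc" using GL_inv(1) by blast
      show "analytic_pt scb E' scb (LX sc) \<sigma> w" unfolding \<sigma>_def
        by (intro analytic_pt_comp_op[OF LX_space(1) E'(2)] analytic_pt_const LX_space GL_inv(1)[OF W(1)]
            analytic_pt_compose[OF LX_space(1) E'(2) scale E LX_space] Ka ND w)
    qed
    ultimately show "\<exists>N \<sigma>. \<theta> (lcoset W ?H) \<in> N \<and> N \<subseteq> \<theta> ` X \<and> \<sigma> (\<theta> (lcoset W ?H)) = W \<and>
             analytic_between scb E' scb (LX sc) N \<sigma> \<and>
             (\<forall>v\<in>N. \<sigma> v \<in> GL sc \<and> lcoset (\<sigma> v) ?H \<in> X \<and> \<theta> (lcoset (\<sigma> v) ?H) = v)"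
      using \<sigma> by (intro exI[of _ N'] exI[of _ \<sigma>]) simp
  qed
  moreover have "lcoset W0 ?H \<in> X" using mem[OF W0] at(2) by simp
  ultimately show ?thesis by (intro bexI[of _ "(X, \<theta>, E')"]) simp
qed

text \<open>The Hausdorff property is pulled back from \<open>M\<close> along the continuous
  injective induced map.\<close>

lemma homogeneous_space_manifold:
  assumes p: "p \<in> P"
  shows "banach_manifold (homogeneous_space sc (Stab p))"
proof (rule homogeneous_manifold)
  show "Hausdorff_space (quotient_topology sc (Stab p))"
    using banach_manifoldD(1)[OF mfd] Sig_continuous[OF p]
    by (rule Hausdorff_space_injective_preimage) (simp add: topspace_quotient Sig_inj[OF p])
qed (rule homogeneous_chart_exists[OF p])

text \<open>Pulled back to GL(X), the induced map is the orbit map in a chart, hence analytic. Its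
  inverse is, near the coordinate of \<open>act W p\<close>, the coset of \<open>g v\<close> times
  \<open>W\<close>, again an analytic expression.\<close>

lemma Sig_bianalytic:
  assumes p: "p \<in> P"
  shows "bianalytic (homogeneous_space sc (Stab p)) (open_submanifold M (orbit sc act p)) (Sig p)"
proof -
  let ?H = "Stab p" and ?S = "orbit sc act p"
  let ?G = "homogeneous_space sc ?H" and ?N = "open_submanifold M ?S"
  have S: "openin (mtop M) ?S" by (rule openin_orbit[OF p])
  have SP: "?S \<subseteq> P" using S by (rule openin_subset)
  have N: "mtop ?N = subtopology (mtop M) ?S" "mscale ?N = mscale M" "topspace (mtop ?N) = ?S"
    using SP by (auto simp: open_submanifold_def)
  have atN: "\<exists>U. U' = U \<inter> ?S \<and> (U, \<psi>, E) \<in> atlas M" if "(U', \<psi>, E) \<in> atlas ?N" for U' \<psi> E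
    using that by (auto simp: open_submanifold_def)
  have G: "topspace (mtop ?G) = lcosets sc ?H" by (simp add: topspace_quotient)
  have mG: "banach_manifold ?G" by (rule homogeneous_space_manifold[OF p])
  have mN: "banach_manifold ?N" by (rule open_submanifold_manifold[OF mfd scale S])
  have bij: "bij_betw (Sig p) (lcosets sc ?H) ?S"
    unfolding bij_betw_def using Sig_inj[OF p] Sig_image[OF p] by simp
  define L where "L = inv_into (lcosets sc ?H) (Sig p)"
  have L: "L (act W p) = lcoset W ?H" if W: "W \<in> GL sc" for W
  proof -
    have "lcoset W ?H \<in> lcosets sc ?H" using W by (simp add: lcosets_def)
    from inv_into_f_f[OF Sig_inj[OF p] this] show ?thesis by (simp add: L_def Sig_lcoset[OF W p])
  qed
  have "analytic_map ?G ?N (Sig p)"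
    unfolding analytic_map_def
  proof (intro conjI mG mN)
    show "continuous_map (mtop ?G) (mtop ?N) (Sig p)"
      unfolding N using Sig_continuous[OF p] Sig_image[OF p]
      by (auto simp: continuous_map_in_subtopology topspace_quotient)
    have "analytic_between scb V (mscale M) E (\<phi> ` (U \<inter> Sig p -` (U' \<inter> ?S))) (\<psi> \<circ> Sig p \<circ> inv_into U \<phi>)"
      if c: "(U, \<phi>, V) \<in> atlas ?G" "(U', \<psi>, E) \<in> atlas M" for U \<phi> V U' \<psi> E
    proof (rule analytic_betweenI)
      note C = homogeneous_atlasD[OF c(1)]
      interpret D: banach_chart M U' \<psi> E by (rule chart) fact
      show "banach_space_over scb" "banach_subspace scb V" by (fact LX_space(1), fact C(2))
      have "U \<inter> Sig p -` (U' \<inter> ?S) = U \<inter> {C \<in> lcosets sc ?H. Sig p C \<in> U'}"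
        using C(6) Sig_image[OF p] by blast
      then have "openin (quotient_topology sc ?H) (U \<inter> Sig p -` (U' \<inter> ?S))"
        using openin_Sig_preimage[OF p D.chart_simps(1)] C(1) by (simp add: openin_Int)
      then show "openin (top_of_set V) (\<phi> ` (U \<inter> Sig p -` (U' \<inter> ?S)))"
        by (rule homogeneous_chart_open[OF c(1)]) simp
      fix v assume "v \<in> \<phi> ` (U \<inter> Sig p -` (U' \<inter> ?S))"
      then obtain C where C': "C \<in> U" "Sig p C \<in> U'" "v = \<phi> C" by blast
      then obtain W where W: "W \<in> GL sc" "C = lcoset W ?H" using C(6) unfolding lcosets_def by blast
      have aU: "act W p \<in> U'" using C'(2) W Sig_lcoset[OF W(1) p] by simp
      show "(\<psi> \<circ> Sig p \<circ> inv_into U \<phi>) v \<in> E"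
        using C' inv_into_f_f[OF C(4)] D.chart_simps(5) by auto
      have "analytic_pt scb (LX sc) (mscale M) E (\<lambda>W. (\<psi> \<circ> Sig p) (lcoset W ?H)) W"
      proof (rule analytic_pt_cong)
        show "analytic_pt scb (LX sc) (mscale M) E (\<lambda>W. \<psi> (act W p)) W"
          using orbit_map[OF c(2) p W(1) aU] by blast
        show "nbhd_on (LX sc) W (\<lambda>W. \<psi> (act W p) = (\<psi> \<circ> Sig p) (lcoset W ?H))"
          by (rule nbhd_on_mono[OF GL_nbhd[OF W(1)]]) (simp add: Sig_lcoset[OF _ p])
      qed
      then show "analytic_pt scb V (mscale M) E (\<psi> \<circ> Sig p \<circ> inv_into U \<phi>) v"
        unfolding C'(3) W(2)
        by (intro homogeneous_chart_local[OF c(1)]) (use W C' scale D.chart_simps(2) in auto)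
    qed
    then show "\<forall>(U, \<phi>, V)\<in>atlas ?G. \<forall>(U', \<psi>, V')\<in>atlas ?N.
       analytic_between (mscale ?G) V (mscale ?N) V' (\<phi> ` (U \<inter> Sig p -` U')) (\<psi> \<circ> Sig p \<circ> inv_into U \<phi>)"
      using atN unfolding N(2) homogeneous_space_simps by fast
  qed
  moreover have "analytic_map ?N ?G L"
    unfolding analytic_map_def
  proof (intro conjI mG mN)
    have pre: "{q \<in> ?S. L q \<in> U} = Sig p ` U" if UL: "U \<subseteq> lcosets sc ?H" for U
    proof (intro set_eqI iffI)
      fix q assume q: "q \<in> {q \<in> ?S. L q \<in> U}"
      then obtain W where "W \<in> GL sc" "q = act W p" by (auto simp: orbit_def)
      then show "q \<in> Sig p ` U" using q L Sig_lcoset[OF _ p] by (metis (no_types, lifting) image_eqI mem_Collect_eq)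
    next
      fix q assume "q \<in> Sig p ` U"
      then obtain W where "W \<in> GL sc" "q = Sig p (lcoset W ?H)" "lcoset W ?H \<in> U"
        using UL unfolding lcosets_def by blast
      then show "q \<in> {q \<in> ?S. L q \<in> U}" using L Sig_lcoset[OF _ p] by (auto simp: orbit_def)
    qed
    have pre_open: "openin (mtop M) (Sig p ` U)" if "openin (quotient_topology sc ?H) U" for U
      using that openin_quotient_iff[OF p] by blast
    show "continuous_map (mtop ?N) (mtop ?G) L"
      unfolding continuous_map N(3) G
    proof (intro conjI allI impI)
      show "L ` ?S \<subseteq> lcosets sc ?H" using L by (auto simp: orbit_def lcosets_def)
      fix U assume "openin (mtop ?G) U"
      then have U: "openin (quotient_topology sc ?H) U" by simp
      then have "U \<subseteq> lcosets sc ?H" using openin_subset topspace_quotient by metis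
      from pre[OF this] pre_open[OF U] show "openin (mtop ?N) {q \<in> ?S. L q \<in> U}"
        unfolding N(1) using S by (simp add: openin_open_subtopology) blast
    qed
    have "analytic_between (mscale M) E scb V (\<psi> ` ((U' \<inter> ?S) \<inter> L -` U)) (\<phi> \<circ> L \<circ> inv_into (U' \<inter> ?S) \<psi>)"
      if c: "(U, \<phi>, V) \<in> atlas ?G" "(U', \<psi>, E) \<in> atlas M" for U \<phi> V U' \<psi> E
    proof -
      note C = homogeneous_atlasD[OF c(1)]
      interpret D: banach_chart M U' \<psi> E by (rule chart) fact
      have eq: "(U' \<inter> ?S) \<inter> L -` U = U' \<inter> Sig p ` U" using pre[OF C(6)] by blast
      have inj: "inj_on \<psi> (U' \<inter> ?S)" using D.inj by (rule inj_on_subset) simp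
      show ?thesis
      proof (rule analytic_betweenI[OF scale D.chart_simps(2)])
        show op: "openin (top_of_set E) (\<psi> ` ((U' \<inter> ?S) \<inter> L -` U))"
          unfolding eq using pre_open[OF C(1)] D.chart_simps(1) by (intro D.openin_image openin_Int) auto
        fix v assume v: "v \<in> \<psi> ` ((U' \<inter> ?S) \<inter> L -` U)"
        then obtain q where q: "q \<in> U'" "q \<in> ?S" "L q \<in> U" "v = \<psi> q" by blast
        then obtain W where W: "W \<in> GL sc" "q = act W p" by (auto simp: orbit_def)
        show "(\<phi> \<circ> L \<circ> inv_into (U' \<inter> ?S) \<psi>) v \<in> V"
          using q inv_into_f_f[OF inj] C(7) by auto
        obtain N g where N: "\<psi> q \<in> N" "N \<subseteq> \<psi> ` U'" "g (\<psi> q) = id_blinfun"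
          "analytic_between (mscale M) E scb (LX sc) N g"
          "\<forall>v\<in>N. g v \<in> GL sc \<and> act (g v) q = inv_into U' \<psi> v"
          using local_section[OF c(2) q(1)] by blast
        note ND = analytic_betweenD[OF N(4)]
        have LW: "lcoset W ?H \<in> U" using q(3) L[OF W(1)] W(2) by simp
        show "analytic_pt (mscale M) E scb V (\<phi> \<circ> L \<circ> inv_into (U' \<inter> ?S) \<psi>) v"
        proof (rule analytic_pt_cong)
          have "analytic_pt (mscale M) E scb (LX sc) (\<lambda>v. g v o\<^sub>L W) v"
            unfolding q(4)
            by (intro analytic_pt_comp_op[OF scale D.chart_simps(2)] analytic_pt_const LX_space
                GL_inv(1)[OF W(1)] ND N(1))
          moreover have "analytic_pt scb (LX sc) scb V (\<lambda>W. \<phi> (lcoset W ?H)) (g v o\<^sub>L W)"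
            unfolding q(4) N(3) using analytic_betweenD(3)[OF C(8)] W(1) LW by simp
          ultimately show "analytic_pt (mscale M) E scb V (\<lambda>v. \<phi> (lcoset (g v o\<^sub>L W) ?H)) v"
            by (rule analytic_pt_compose[OF scale D.chart_simps(2) LX_space LX_space(1) C(2)])
          have "nbhd_on E v (\<lambda>w. w \<in> \<psi> ` ((U' \<inter> ?S) \<inter> L -` U))"
            using op v openin_iff_nbhd_on[OF scale D.chart_simps(2)] by blast
          moreover have "nbhd_on E v (\<lambda>w. w \<in> N)" unfolding q(4) by (rule ND(4)[OF N(1)])
          ultimately show "nbhd_on E v (\<lambda>v. \<phi> (lcoset (g v o\<^sub>L W) ?H) = (\<phi> \<circ> L \<circ> inv_into (U' \<inter> ?S) \<psi>) v)"
          proof (rule nbhd_on_mono[OF nbhd_on_conj])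
            fix h assume h: "v + h \<in> \<psi> ` ((U' \<inter> ?S) \<inter> L -` U) \<and> v + h \<in> N"
            then obtain r where r: "r \<in> U'" "r \<in> ?S" "v + h = \<psi> r" by blast
            have "act (g (v + h) o\<^sub>L W) p = inv_into U' \<psi> (v + h)"
              using h N(5) W p by (simp add: act_comp)
            also have "\<dots> = r" unfolding r(3) by (rule D.inv_chart[OF r(1)])
            finally have "lcoset (g (v + h) o\<^sub>L W) ?H = L r"
              using L[of "g (v + h) o\<^sub>L W"] N(5) h W(1) by (simp add: GL_comp)
            moreover have "inv_into (U' \<inter> ?S) \<psi> (v + h) = r"
              unfolding r(3) by (rule inv_into_f_f[OF inj]) (use r in blast)
            ultimately show "\<phi> (lcoset (g (v + h) o\<^sub>L W) ?H) = (\<phi> \<circ> L \<circ> inv_into (U' \<inter> ?S) \<psi>) (v + h)"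
              by simp
          qed
        qed
      qed
    qed
    then show "\<forall>(U', \<psi>, V')\<in>atlas ?N. \<forall>(U, \<phi>, V)\<in>atlas ?G.
       analytic_between (mscale ?N) V' (mscale ?G) V (\<psi> ` (U' \<inter> L -` U)) (\<phi> \<circ> L \<circ> inv_into U' \<psi>)"
      using atN unfolding N(2) homogeneous_space_simps by fast
  qed
  ultimately show ?thesis unfolding bianalytic_def G N(3) L_def using bij by blast
qed

lemma orbit_act_eq:
  assumes "p \<in> P" "q \<in> orbit sc act p"
  shows "orbit sc act q = orbit sc act p"
proof -
  obtain W where W: "W \<in> GL sc" "q = act W p" using assms(2) by (auto simp: orbit_def)
  show ?thesis
  proof (intro set_eqI iffI)
    fix r assume "r \<in> orbit sc act q"
    then obtain V where "V \<in> GL sc" "r = act V q" by (auto simp: orbit_def)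
    then have "r = act (V o\<^sub>L W) p" "V o\<^sub>L W \<in> GL sc" using W assms by (auto simp: act_comp GL_comp)
    then show "r \<in> orbit sc act p" by (auto simp: orbit_def)
  next
    fix r assume "r \<in> orbit sc act p"
    then obtain V where V: "V \<in> GL sc" "r = act V p" by (auto simp: orbit_def)
    have "act (V o\<^sub>L op_inv W) q = act ((V o\<^sub>L op_inv W) o\<^sub>L W) p"
      unfolding W(2) by (rule act_comp[symmetric]) (use W V assms GL_comp GL_inv in auto)
    also have "\<dots> = r" using W V by (simp add: blinfun_compose_assoc GL_inv)
    finally show "r \<in> orbit sc act q"
      unfolding orbit_def using W V GL_comp(1) GL_inv(3) by (metis image_eqI)
  qed
qed

lemma orbit_self: "p \<in> P \<Longrightarrow> p \<in> orbit sc act p"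
  unfolding orbit_def using GL_id(1) act_id by (metis image_eqI)

text \<open>All orbits are open and they partition the manifold, so the complement of an orbit is a
  union of open orbits. This is why each orbit is closed as well.\<close>

theorem identified_with_homogeneous_spaces:
  assumes R: "orbit_representatives sc act P R"
  shows "identified_with_disjoint_union M R (\<lambda>p. homogeneous_space sc (Stab p)) Sig (orbit sc act)"
  unfolding identified_with_disjoint_union_def
proof (intro conjI ballI mfd)
  have RP: "R \<subseteq> P" and ex: "\<And>p. p \<in> P \<Longrightarrow> \<exists>!r. r \<in> R \<and> r \<in> orbit sc act p"
    using R unfolding orbit_representatives_def by auto
  show cover: "(\<Union>r\<in>R. orbit sc act r) = P"
  proof
    show "(\<Union>r\<in>R. orbit sc act r) \<subseteq> P" using RP openin_subset[OF openin_orbit] by blast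
    show "P \<subseteq> (\<Union>r\<in>R. orbit sc act r)"
    proof
      fix p assume p: "p \<in> P"
      then obtain r where "r \<in> R" "r \<in> orbit sc act p" using ex by blast
      then show "p \<in> (\<Union>r\<in>R. orbit sc act r)" using orbit_act_eq[OF p] orbit_self[OF p] by blast
    qed
  qed
  show "disjoint_family_on (orbit sc act) R"
    unfolding disjoint_family_on_def
  proof (intro ballI impI)
    fix r s assume rs: "r \<in> R" "s \<in> R" "r \<noteq> s"
    show "orbit sc act r \<inter> orbit sc act s = {}"
    proof (rule ccontr)
      assume "orbit sc act r \<inter> orbit sc act s \<noteq> {}"
      then obtain q where "q \<in> orbit sc act r" "q \<in> orbit sc act s" by blast
      then have "orbit sc act r = orbit sc act s" using rs RP orbit_act_eq by blast
      then have "s \<in> orbit sc act r" using rs RP orbit_self by blast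
      moreover have "r \<in> orbit sc act r" using rs RP orbit_self by blast
      ultimately show False using ex[of r] rs RP by blast
    qed
  qed
  fix r assume r: "r \<in> R"
  then have rP: "r \<in> P" using RP by blast
  show "openin (mtop M) (orbit sc act r)" by (rule openin_orbit[OF rP])
  show "closedin (mtop M) (orbit sc act r)"
  proof -
    have "P - orbit sc act r = (\<Union>q\<in>P - orbit sc act r. orbit sc act q)"
    proof
      show "P - orbit sc act r \<subseteq> (\<Union>q\<in>P - orbit sc act r. orbit sc act q)" using orbit_self by blast
      show "(\<Union>q\<in>P - orbit sc act r. orbit sc act q) \<subseteq> P - orbit sc act r"
      proof
        fix s assume "s \<in> (\<Union>q\<in>P - orbit sc act r. orbit sc act q)"
        then obtain q where q: "q \<in> P" "q \<notin> orbit sc act r" "s \<in> orbit sc act q" by blast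
        have "s \<notin> orbit sc act r"
        proof
          assume "s \<in> orbit sc act r"
          then have "orbit sc act q = orbit sc act r" using orbit_act_eq q rP by metis
          then show False using q orbit_self by blast
        qed
        then show "s \<in> P - orbit sc act r" using q openin_subset[OF openin_orbit] by blast
      qed
    qed
    moreover have "openin (mtop M) (\<Union>q\<in>P - orbit sc act r. orbit sc act q)"
      by (rule openin_Union) (auto intro: openin_orbit)
    ultimately show ?thesis unfolding closedin_def using openin_subset[OF openin_orbit[OF rP]] by simp
  qed
  show "bianalytic (homogeneous_space sc (Stab r)) (open_submanifold M (orbit sc act r)) (Sig r)"
    by (rule Sig_bianalytic[OF rP])
qed

end

section \<open>The manifold of idempotents\<close>

context banach_space_over
begin

text \<open>Membership of the value in L(X) is carried along because products and inverses ask for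
  it. In this form the rules compose to any rational expression in operators.\<close>

definition analytic_op :: "('k \<Rightarrow> 'v \<Rightarrow> 'v) \<Rightarrow> 'v::banach set \<Rightarrow> ('v \<Rightarrow> 'x \<Rightarrow>\<^sub>L 'x) \<Rightarrow> 'v \<Rightarrow> bool" where
  "analytic_op s V f x \<longleftrightarrow> analytic_pt s V scb (LX sc) f x \<and> f x \<in> LX sc"

lemma analytic_op_intros:
  assumes "banach_space_over s" "banach_subspace s V"
  shows "analytic_op s V f x \<Longrightarrow> analytic_op s V g x \<Longrightarrow> analytic_op s V (\<lambda>x. f x o\<^sub>L g x) x"
    and "analytic_op s V f x \<Longrightarrow> analytic_op s V g x \<Longrightarrow> analytic_op s V (\<lambda>x. f x + g x) x"
    and "analytic_op s V f x \<Longrightarrow> analytic_op s V g x \<Longrightarrow> analytic_op s V (\<lambda>x. f x - g x) x"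
    and "T \<in> LX sc \<Longrightarrow> analytic_op s V (\<lambda>x. T) x"
    and "analytic_op s V f x \<Longrightarrow> f x \<in> GL sc \<Longrightarrow> analytic_op s V (\<lambda>x. op_inv (f x)) x"
proof -
  show comp: "analytic_op s V f x \<Longrightarrow> analytic_op s V g x \<Longrightarrow> analytic_op s V (\<lambda>x. f x o\<^sub>L g x) x" for f g
    unfolding analytic_op_def using analytic_pt_comp_op[OF assms] LX_comp by blast
  show add: "analytic_op s V f x \<Longrightarrow> analytic_op s V g x \<Longrightarrow> analytic_op s V (\<lambda>x. f x + g x) x" for f g
    unfolding analytic_op_def using analytic_pt_add[OF assms LX_space] LX_closed(2) by blast
  show const: "T \<in> LX sc \<Longrightarrow> analytic_op s V (\<lambda>x. T) x" for T
    unfolding analytic_op_def using analytic_pt_const[OF LX_space] by blast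
  show "analytic_op s V f x \<Longrightarrow> f x \<in> GL sc \<Longrightarrow> analytic_op s V (\<lambda>x. op_inv (f x)) x"
    unfolding analytic_op_def using analytic_pt_inv[OF assms] GL_inv(2) by blast
  \<comment> \<open>\<open>- g\<close> is the product with a constant operator, so differences
    follow from sums and products.\<close>
  have "- id_blinfun \<in> LX sc" by (intro LX_closed)
  from comp[OF const[OF this]]
  have "analytic_op s V g x \<Longrightarrow> analytic_op s V (\<lambda>x. - g x) x" by (simp add: blinfun_compose_algebra)
  from add[OF _ this]
  show "analytic_op s V f x \<Longrightarrow> analytic_op s V g x \<Longrightarrow> analytic_op s V (\<lambda>x. f x - g x) x" by simp
qed

lemmas analytic_op_LX = analytic_op_intros[OF LX_space]

lemma analytic_op_id: "T \<in> LX sc \<Longrightarrow> analytic_op scb (LX sc) (\<lambda>T. T) T"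
  unfolding analytic_op_def using analytic_pt_id[OF LX_space] by blast

end

section \<open>Split submanifolds of a Banach space\<close>

lemma nbhd_on_subset: "nbhd_on B x P \<Longrightarrow> V \<subseteq> B \<Longrightarrow> nbhd_on V x P"
  unfolding nbhd_on_def by blast

lemma analytic_between_continuous:
  fixes f :: "'v::banach \<Rightarrow> 'w::banach"
  assumes bs: "banach_space_over s" "banach_subspace s V" and f: "analytic_between s V s' V' U f"
  shows "continuous_on U f"
  unfolding continuous_on_iff
proof (intro ballI allI impI)
  interpret banach_space_over s by fact
  fix x and e :: real assume x: "x \<in> U" "0 < e"
  note D = analytic_betweenD[OF f]
  obtain d where d: "0 < d" "\<forall>h\<in>V. norm h < d \<longrightarrow> norm (f (x + h) - f x) < e"
    using analytic_pt_cont[OF bs D(3)[OF x(1)] x(2)] unfolding nbhd_on_def by blast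
  have "dist (f y) (f x) < e" if "y \<in> U" "dist y x < d" for y
    using d(2)[rule_format, of "y - x"] that x(1) D(1) subspaceD(7)[OF bs(2)] by (auto simp: dist_norm)
  with d(1) show "\<exists>d>0. \<forall>y\<in>U. dist y x < d \<longrightarrow> dist (f y) (f x) < e" by blast
qed

text \<open>A transition map is the restriction of a map that is analytic between open subsets of
  \<open>B\<close>. Restricting the source to \<open>V\<close> is free, and the complement of
  \<open>W\<close> takes care of the target. So for a given \<open>S\<close> only the existence of
  charts has to be checked.\<close>

lemma induced_submanifold_manifold:
  fixes s :: "'k::{real_normed_field,banach} \<Rightarrow> 'v::banach \<Rightarrow> 'v"
  assumes bs: "banach_space_over s" "banach_subspace s B" and S: "S \<subseteq> B"
    and cover: "\<And>x. x \<in> S \<Longrightarrow> \<exists>(U, \<phi>, V)\<in>atlas (induced_submanifold s B S). x \<in> U"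
  shows "banach_manifold (induced_submanifold s B S)"
proof -
  interpret banach_space_over s by fact
  let ?M = "induced_submanifold s B S"
  have simps: "mtop ?M = top_of_set S" "mscale ?M = s" by (auto simp: induced_submanifold_def)
  have atD: "\<exists>U V'. C = U \<inter> S \<and> inj_on \<phi> U \<and> analytic_between s B s B U \<phi> \<and>
        analytic_between s B s B (\<phi> ` U) (inv_into U \<phi>) \<and> banach_subspace s V \<and> V \<subseteq> B \<and>
        banach_subspace s V' \<and> V \<inter> V' = {0} \<and> {v + v' | v v'. v \<in> V \<and> v' \<in> V'} = B \<and>
        \<phi> ` (U \<inter> S) = \<phi> ` U \<inter> V"
    if at: "(C, \<phi>, V) \<in> atlas ?M" for C \<phi> V
  proof -
    obtain U V' where U: "C = U \<inter> S" "inj_on \<phi> U" "analytic_between s B s B U \<phi>"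
        "analytic_between s B s B (\<phi> ` U) (inv_into U \<phi>)" "banach_subspace s V"
        "banach_subspace s V'" "V \<inter> V' = {0}" "{v + v' | v v'. v \<in> V \<and> v' \<in> V'} = B"
        "\<phi> ` (U \<inter> S) = \<phi> ` U \<inter> V"
      using at unfolding induced_submanifold_def by auto
    have "V \<subseteq> B"
    proof
      fix v assume "v \<in> V"
      then have "v + 0 \<in> {v + v' | v v'. v \<in> V \<and> v' \<in> V'}" using subspaceD(1)[OF U(6)] by blast
      then show "v \<in> B" unfolding U(8) by simp
    qed
    with U show ?thesis by blast
  qed
  show ?thesis
  proof (rule banach_manifoldI; unfold simps)
    show "Hausdorff_space (top_of_set S)" by (intro Hausdorff_space_subtopology Hausdorff_space_euclidean)
    have "U \<subseteq> S" if "(U, \<phi>, V) \<in> atlas ?M" for U \<phi> V using atD[OF that] by blast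
    then show "(\<Union>(U, \<phi>, V)\<in>atlas ?M. U) = topspace (top_of_set S)" using cover by fastforce
  next
    fix C \<phi> V assume "(C, \<phi>, V) \<in> atlas ?M"
    from atD[OF this] obtain U where U: "C = U \<inter> S" "inj_on \<phi> U" "analytic_between s B s B U \<phi>"
        "analytic_between s B s B (\<phi> ` U) (inv_into U \<phi>)" "banach_subspace s V" "V \<subseteq> B"
        "\<phi> ` (U \<inter> S) = \<phi> ` U \<inter> V" by blast
    have "openin (top_of_set S) (U \<inter> S)"
      using analytic_between_open[OF bs U(3)] S by (auto simp: openin_open)
    moreover have "openin (top_of_set V) (\<phi> ` (U \<inter> S))"
      unfolding U(7) using analytic_between_open[OF bs U(4)] U(6) by (auto simp: openin_open)
    moreover have "homeomorphic_map (top_of_set (U \<inter> S)) (top_of_set (\<phi> ` (U \<inter> S))) \<phi>"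
      unfolding homeomorphic_map_maps homeomorphic_maps_def
    proof (intro exI conjI)
      show "continuous_map (top_of_set (U \<inter> S)) (top_of_set (\<phi> ` (U \<inter> S))) \<phi>"
        using analytic_between_continuous[OF bs U(3)] by (auto intro: continuous_on_subset)
      have "continuous_on (\<phi> ` (U \<inter> S)) (inv_into U \<phi>)"
        using analytic_between_continuous[OF bs U(4)] by (rule continuous_on_subset) blast
      then show "continuous_map (top_of_set (\<phi> ` (U \<inter> S))) (top_of_set (U \<inter> S)) (inv_into U \<phi>)"
        using U(2) by auto
    qed (use U(2) in auto)
    ultimately show "openin (top_of_set S) C \<and> banach_subspace s V \<and> openin (top_of_set V) (\<phi> ` C) \<and>
       homeomorphic_map (subtopology (top_of_set S) C) (top_of_set (\<phi> ` C)) \<phi>"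
      using U(5) by (simp add: U(1) subtopology_subtopology Int_absorb1 inf_commute inf_left_commute)
  next
    fix C \<phi> V D \<psi> W assume C: "(C, \<phi>, V) \<in> atlas ?M" and D: "(D, \<psi>, W) \<in> atlas ?M"
    from atD[OF C] obtain U where U: "C = U \<inter> S" "inj_on \<phi> U" "analytic_between s B s B U \<phi>"
        "analytic_between s B s B (\<phi> ` U) (inv_into U \<phi>)" "banach_subspace s V" "V \<subseteq> B"
        "\<phi> ` (U \<inter> S) = \<phi> ` U \<inter> V" by blast
    from atD[OF D] obtain U' W' where U': "D = U' \<inter> S" "analytic_between s B s B U' \<psi>"
        "banach_subspace s W" "banach_subspace s W'" "W \<inter> W' = {0}"
        "{v + v' | v v'. v \<in> W \<and> v' \<in> W'} = B" "\<psi> ` (U' \<inter> S) = \<psi> ` U' \<inter> W" by blast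
    note UD = analytic_betweenD[OF U(3)] and ID = analytic_betweenD[OF U(4)]
      and UD' = analytic_betweenD[OF U'(2)]
    have injC: "inj_on \<phi> C" using U(2) unfolding U(1) by (rule inj_on_subset) simp
    have inv: "inv_into C \<phi> (\<phi> x) = x" "inv_into U \<phi> (\<phi> x) = x" if "x \<in> C" for x
      using inv_into_f_f[OF injC that] inv_into_f_f[OF U(2), of x] that U(1) by auto
    \<comment> \<open>Near \<open>\<phi> x\<close> the ambient inverse chart lands in
      \<open>U'\<close> by continuity. Along \<open>V\<close> it lands in \<open>S\<close> too,
      because \<open>\<phi>\<close> maps \<open>U \<inter> S\<close> onto all of the part of its
      image that lies in \<open>V\<close>.\<close>
    have nb: "nbhd_on V (\<phi> x) (\<lambda>v. v \<in> \<phi> ` (C \<inter> D))" if x: "x \<in> C \<inter> D" for x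
    proof -
      have xU: "\<phi> x \<in> \<phi> ` U" and xU': "x \<in> U'" and xC: "x \<in> C" using x U(1) U'(1) by auto
      have "nbhd_on B (\<phi> x) (\<lambda>v. inv_into U \<phi> v \<in> U')"
      proof (rule analytic_pt_nbhd_open[OF bs bs ID(3)[OF xU]])
        show "inv_into U \<phi> (\<phi> x) \<in> U'" using inv(2)[OF xC] xU' by simp
        show "U' \<subseteq> B" by (rule UD'(1))
        show "nbhd_on B (inv_into U \<phi> (\<phi> x)) (\<lambda>y. y \<in> U')"
          unfolding inv(2)[OF xC] by (rule UD'(4)[OF xU'])
        show "nbhd_on B (\<phi> x) (\<lambda>y. inv_into U \<phi> y \<in> B)"
          by (rule nbhd_on_mono[OF ID(4)[OF xU]]) (rule ID(2))
      qed
      from nbhd_on_subset[OF nbhd_on_conj[OF ID(4)[OF xU] this] U(6)]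
      show ?thesis
      proof (rule nbhd_on_mono)
        fix h assume h: "h \<in> V" "\<phi> x + h \<in> \<phi> ` U \<and> inv_into U \<phi> (\<phi> x + h) \<in> U'"
        have "\<phi> x \<in> V" using U(1,7) xC by blast
        then have "\<phi> x + h \<in> \<phi> ` U \<inter> V" using h subspaceD(2)[OF U(5)] by blast
        then obtain y where y: "y \<in> U" "y \<in> S" "\<phi> x + h = \<phi> y" using U(7) by blast
        then have "y \<in> C" by (simp add: U(1))
        then have "y \<in> D" using h y inv(2)[of y] by (simp add: U'(1))
        then show "\<phi> x + h \<in> \<phi> ` (C \<inter> D)" using y \<open>y \<in> C\<close> by blast
      qed
    qed
    show "analytic_between s V s W (\<phi> ` (C \<inter> D)) (\<psi> \<circ> inv_into C \<phi>)"
      unfolding analytic_between_iff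
    proof (intro conjI ballI)
      show "\<phi> ` (C \<inter> D) \<subseteq> V" using U(1,7) by blast
      have val: "(\<psi> \<circ> inv_into C \<phi>) v \<in> W" if "v \<in> \<phi> ` (C \<inter> D)" for v
        using that inv(1) U'(1,7) by auto
      then show "(\<psi> \<circ> inv_into C \<phi>) ` \<phi> ` (C \<inter> D) \<subseteq> W" by blast
      fix v assume "v \<in> \<phi> ` (C \<inter> D)"
      then obtain x where x: "x \<in> C \<inter> D" "v = \<phi> x" by blast
      then have xU: "v \<in> \<phi> ` U" and xU': "x \<in> U'" and xC: "x \<in> C" using U(1) U'(1) by auto
      note nbx = nb[OF x(1), folded x(2)]
      then show "nbhd_on V v (\<lambda>v. v \<in> \<phi> ` (C \<inter> D))" .
      have eq: "\<psi> (inv_into U \<phi> w) = (\<psi> \<circ> inv_into C \<phi>) w" if "w \<in> \<phi> ` (C \<inter> D)" for w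
        using that inv by auto
      have "analytic_pt s B s B \<psi> (inv_into U \<phi> v)" using UD'(3)[OF xU'] inv(2)[OF xC] x(2) by simp
      from analytic_pt_compose[OF bs bs bs ID(3)[OF xU] this]
      have "analytic_pt s V s B (\<lambda>v. \<psi> (inv_into U \<phi> v)) v"
        by (rule analytic_pt_mono) (use U(6) in auto)
      then have an: "analytic_pt s V s B (\<psi> \<circ> inv_into C \<phi>) v"
        by (rule analytic_pt_cong) (rule nbhd_on_mono[OF nbx], rule eq)
      show "analytic_pt s V s W (\<psi> \<circ> inv_into C \<phi>) v"
      proof (rule analytic_pt_complemented[OF bs(1) U(5) bs U'(3-6) an])
        show "(\<psi> \<circ> inv_into C \<phi>) v \<in> B" using UD'(2)[OF xU'] inv(1)[OF xC] x(2) by simp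
        show "nbhd_on V v (\<lambda>y. (\<psi> \<circ> inv_into C \<phi>) y \<in> W)" by (rule nbhd_on_mono[OF nbx]) (rule val)
      qed
    qed
  qed
qed

text \<open>In products nested to the right a relation \<open>A B = C\<close> is hidden inside
  \<open>A (B X)\<close>; this version makes it applicable there.\<close>

lemma compose_left: "A o\<^sub>L B = C \<Longrightarrow> A o\<^sub>L (B o\<^sub>L X) = C o\<^sub>L X"
  by (simp flip: blinfun_compose_assoc)

section \<open>A rational chart of L(X) adapted to the idempotents near \<open>Q\<close>\<close>

text \<open>
  In the block decomposition of an operator \<open>A\<close> with respect to the range and the kernel of \<open>Q\<close>,
  with blocks \<open>a, b, c, d\<close> and \<open>a\<close> invertible, the chart \<open>straighten\<close> is
  \<open>(a + b t - 1, b, t, d - t b)\<close> with \<open>t = c a\<^sup>-\<^sup>1\<close> (the operator \<open>slope\<close>).  Its inverse is polynomial,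
  and \<open>A\<close> is idempotent iff both diagonal blocks of its image vanish.
\<close>

locale idempotent_chart = banach_space_over sc
  for sc :: "'k::{real_normed_field,banach} \<Rightarrow> 'x::banach \<Rightarrow> 'x" +
  fixes Q :: "'x \<Rightarrow>\<^sub>L 'x"
  assumes QL: "Q \<in> LX sc" and QQ: "Q o\<^sub>L Q = Q"
begin

text \<open>The block \<open>a\<close>, extended by 1 on the kernel of \<open>Q\<close>. Thus
  invertibility of \<open>a\<close> becomes invertibility in L(X), and \<open>op_inv\<close>
  provides the inverse of \<open>a\<close>.\<close>

definition pivot :: "('x \<Rightarrow>\<^sub>L 'x) \<Rightarrow> 'x \<Rightarrow>\<^sub>L 'x" where
  "pivot A = (Q o\<^sub>L A o\<^sub>L Q) + (id_blinfun - Q)"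

definition slope :: "('x \<Rightarrow>\<^sub>L 'x) \<Rightarrow> 'x \<Rightarrow>\<^sub>L 'x" where
  "slope A = ((A o\<^sub>L Q) - (Q o\<^sub>L A o\<^sub>L Q)) o\<^sub>L op_inv (pivot A)"

text \<open>The Schur complement \<open>d - c a^-1 b\<close>.\<close>

definition corner :: "('x \<Rightarrow>\<^sub>L 'x) \<Rightarrow> 'x \<Rightarrow>\<^sub>L 'x" where
  "corner A = (A - (Q o\<^sub>L A) - (A o\<^sub>L Q) + (Q o\<^sub>L A o\<^sub>L Q)) -
    ((slope A o\<^sub>L A) - (slope A o\<^sub>L A o\<^sub>L Q))"

definition straighten :: "('x \<Rightarrow>\<^sub>L 'x) \<Rightarrow> 'x \<Rightarrow>\<^sub>L 'x" where
  "straighten A = slope A + (Q o\<^sub>L A o\<^sub>L Q) + (Q o\<^sub>L A o\<^sub>L slope A) +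
    ((Q o\<^sub>L A) - (Q o\<^sub>L A o\<^sub>L Q)) + corner A - Q"

text \<open>Recovers the upper row of \<open>A\<close> from \<open>Z\<close>: the upper left block
  of \<open>Z\<close> is \<open>a + b t - 1\<close>, so adding \<open>Q\<close> and subtracting
  \<open>b t\<close> leaves \<open>a\<close>.\<close>

definition upper :: "('x \<Rightarrow>\<^sub>L 'x) \<Rightarrow> 'x \<Rightarrow>\<^sub>L 'x" where
  "upper Z = (Q o\<^sub>L Z) + Q - (((Q o\<^sub>L Z) - (Q o\<^sub>L Z o\<^sub>L Q)) o\<^sub>L ((Z o\<^sub>L Q) - (Q o\<^sub>L Z o\<^sub>L Q)))"

text \<open>Block elimination run backwards: the lower row of \<open>A\<close> is \<open>t\<close>
  times the upper row plus the Schur complement.\<close>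

definition curl :: "('x \<Rightarrow>\<^sub>L 'x) \<Rightarrow> 'x \<Rightarrow>\<^sub>L 'x" where
  "curl Z = upper Z + (((Z o\<^sub>L Q) - (Q o\<^sub>L Z o\<^sub>L Q)) o\<^sub>L upper Z) +
    (Z - (Q o\<^sub>L Z) - (Z o\<^sub>L Q) + (Q o\<^sub>L Z o\<^sub>L Q))"

text \<open>The second condition is aimed at idempotents: their Schur complement is idempotent, and
  an idempotent with \<open>1 - C\<close> invertible is 0.\<close>

definition dom :: "('x \<Rightarrow>\<^sub>L 'x) set" where
  "dom = {A \<in> LX sc. pivot A \<in> GL sc \<and> id_blinfun - corner A \<in> GL sc}"

text \<open>The two conditions of \<open>dom\<close> in terms of \<open>Z\<close>: the first
  operator is the pivot of \<open>curl Z\<close>, and the block subtracted in the second is its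
  \<open>corner\<close>.\<close>

definition cod :: "('x \<Rightarrow>\<^sub>L 'x) set" where
  "cod = {Z \<in> LX sc. (upper Z o\<^sub>L Q) + (id_blinfun - Q) \<in> GL sc \<and>
    id_blinfun - (Z - (Q o\<^sub>L Z) - (Z o\<^sub>L Q) + (Q o\<^sub>L Z o\<^sub>L Q)) \<in> GL sc}"

definition off_diagonal :: "('x \<Rightarrow>\<^sub>L 'x) set" where
  "off_diagonal = {Z \<in> LX sc. Q o\<^sub>L Z o\<^sub>L Q = 0 \<and> Z - (Q o\<^sub>L Z) - (Z o\<^sub>L Q) + (Q o\<^sub>L Z o\<^sub>L Q) = 0}"

text \<open>Commuting with \<open>Q\<close> says that both off-diagonal blocks vanish; this space is
  the complement of the model.\<close>

definition diagonal :: "('x \<Rightarrow>\<^sub>L 'x) set" where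
  "diagonal = {Z \<in> LX sc. Q o\<^sub>L Z = Z o\<^sub>L Q}"

lemmas Q_simps = QQ compose_left[OF QQ]

text \<open>\<open>pivot A\<close> commutes with \<open>Q\<close>, hence so does its inverse;
  moreover \<open>slope A\<close> times \<open>pivot A\<close> is the lower left block of
  \<open>A\<close>. The last equation is the third one inside a longer product.\<close>

lemma slope_simps:
  assumes A: "pivot A \<in> GL sc"
  shows "slope A o\<^sub>L Q = slope A" "Q o\<^sub>L slope A = 0"
    "slope A o\<^sub>L (A o\<^sub>L Q) = (A o\<^sub>L Q) - (Q o\<^sub>L (A o\<^sub>L Q))"
    "slope A o\<^sub>L (A o\<^sub>L (Q o\<^sub>L X)) = (A o\<^sub>L (Q o\<^sub>L X)) - (Q o\<^sub>L (A o\<^sub>L (Q o\<^sub>L X)))"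
proof -
  let ?u = "op_inv (pivot A)"
  note u = GL_inv[OF A]
  have com: "pivot A o\<^sub>L Q = Q o\<^sub>L pivot A"
    by (simp add: pivot_def blinfun_compose_algebra Q_simps)
  have "?u o\<^sub>L Q = ?u o\<^sub>L (Q o\<^sub>L pivot A) o\<^sub>L ?u"
    by (simp add: blinfun_compose_assoc u)
  also have "\<dots> = ?u o\<^sub>L (pivot A o\<^sub>L Q) o\<^sub>L ?u" by (simp only: com)
  also have "\<dots> = Q o\<^sub>L ?u" by (simp add: blinfun_compose_assoc u)
  finally have uQ: "?u o\<^sub>L Q = Q o\<^sub>L ?u" .
  show 1: "slope A o\<^sub>L Q = slope A"
    by (simp add: slope_def blinfun_compose_algebra uQ Q_simps)
  show 2: "Q o\<^sub>L slope A = 0"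
    by (simp add: slope_def blinfun_compose_algebra Q_simps)
  have "slope A o\<^sub>L pivot A = (A o\<^sub>L Q) - (Q o\<^sub>L (A o\<^sub>L Q))"
    by (simp add: slope_def blinfun_compose_assoc u(5))
  then show 3: "slope A o\<^sub>L (A o\<^sub>L Q) = (A o\<^sub>L Q) - (Q o\<^sub>L (A o\<^sub>L Q))"
    by (simp add: pivot_def blinfun_compose_algebra 1 compose_left[OF 1])
  from compose_left[OF 3, of X]
  show "slope A o\<^sub>L (A o\<^sub>L (Q o\<^sub>L X)) = (A o\<^sub>L (Q o\<^sub>L X)) - (Q o\<^sub>L (A o\<^sub>L (Q o\<^sub>L X)))"
    by (simp add: blinfun_compose_algebra)
qed

lemma straighten_blocks:
  assumes A: "pivot A \<in> GL sc"
  defines "Z \<equiv> straighten A"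
  shows "(Z o\<^sub>L Q) - (Q o\<^sub>L Z o\<^sub>L Q) = slope A"
    "Q o\<^sub>L Z o\<^sub>L Q = (Q o\<^sub>L A o\<^sub>L Q) + (Q o\<^sub>L A o\<^sub>L slope A) - Q"
    "(Q o\<^sub>L Z) - (Q o\<^sub>L Z o\<^sub>L Q) = (Q o\<^sub>L A) - (Q o\<^sub>L A o\<^sub>L Q)"
    "Z - (Q o\<^sub>L Z) - (Z o\<^sub>L Q) + (Q o\<^sub>L Z o\<^sub>L Q) = corner A"
    "upper Z o\<^sub>L Q = Q o\<^sub>L A o\<^sub>L Q" "upper Z = Q o\<^sub>L A"
proof -
  note s = slope_simps[OF A]
  note all = blinfun_compose_algebra Q_simps s compose_left[OF s(1)] compose_left[OF s(2)]
  show b: "(Z o\<^sub>L Q) - (Q o\<^sub>L Z o\<^sub>L Q) = slope A"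
    "Q o\<^sub>L Z o\<^sub>L Q = (Q o\<^sub>L A o\<^sub>L Q) + (Q o\<^sub>L A o\<^sub>L slope A) - Q"
    "(Q o\<^sub>L Z) - (Q o\<^sub>L Z o\<^sub>L Q) = (Q o\<^sub>L A) - (Q o\<^sub>L A o\<^sub>L Q)"
    "Z - (Q o\<^sub>L Z) - (Z o\<^sub>L Q) + (Q o\<^sub>L Z o\<^sub>L Q) = corner A"
    unfolding Z_def straighten_def corner_def by (simp_all add: all)
  have "Q o\<^sub>L Z = (Q o\<^sub>L A) + (Q o\<^sub>L A o\<^sub>L slope A) - Q"
  proof -
    have "Q o\<^sub>L Z = ((Q o\<^sub>L Z) - (Q o\<^sub>L Z o\<^sub>L Q)) + (Q o\<^sub>L Z o\<^sub>L Q)" by simp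
    also have "\<dots> = (Q o\<^sub>L A) + (Q o\<^sub>L A o\<^sub>L slope A) - Q" unfolding b(3) unfolding b(2) by simp
    finally show ?thesis .
  qed
  then show u: "upper Z = Q o\<^sub>L A"
    unfolding upper_def b(1,3) by (simp add: all)
  show "upper Z o\<^sub>L Q = Q o\<^sub>L A o\<^sub>L Q" by (simp add: u)
qed

lemma curl_straighten:
  assumes A: "pivot A \<in> GL sc"
  shows "curl (straighten A) = A"
proof -
  note s = slope_simps[OF A]
  note all = blinfun_compose_algebra Q_simps s compose_left[OF s(1)] compose_left[OF s(2)]
  show ?thesis unfolding curl_def straighten_blocks(1,4,6)[OF A] by (simp add: all corner_def)
qed

text \<open>The lower left block of \<open>curl Z\<close> is \<open>t\<close> times its pivot, so
  that \<open>slope\<close> returns \<open>t\<close>. The remaining equations are then polynomial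
  identities.\<close>

lemma curl_blocks:
  assumes Z: "Z \<in> cod"
  shows "pivot (curl Z) \<in> GL sc" "slope (curl Z) = (Z o\<^sub>L Q) - (Q o\<^sub>L Z o\<^sub>L Q)"
    "corner (curl Z) = Z - (Q o\<^sub>L Z) - (Z o\<^sub>L Q) + (Q o\<^sub>L Z o\<^sub>L Q)" "straighten (curl Z) = Z"
proof -
  let ?t = "(Z o\<^sub>L Q) - (Q o\<^sub>L Z o\<^sub>L Q)" and ?A = "curl Z"
  have "pivot ?A = (upper Z o\<^sub>L Q) + (id_blinfun - Q)"
    by (simp add: pivot_def curl_def upper_def blinfun_compose_algebra Q_simps)
  then show p: "pivot ?A \<in> GL sc" using Z by (simp add: cod_def)
  have "(?A o\<^sub>L Q) - (Q o\<^sub>L ?A o\<^sub>L Q) = ?t o\<^sub>L pivot ?A"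
    by (simp add: pivot_def curl_def upper_def blinfun_compose_algebra Q_simps)
  then show t: "slope ?A = ?t" unfolding slope_def by (simp add: blinfun_compose_assoc GL_inv[OF p])
  show c: "corner ?A = Z - (Q o\<^sub>L Z) - (Z o\<^sub>L Q) + (Q o\<^sub>L Z o\<^sub>L Q)"
    unfolding corner_def t by (simp add: curl_def upper_def blinfun_compose_algebra Q_simps)
  show "straighten ?A = Z"
    unfolding straighten_def t c by (simp add: curl_def upper_def blinfun_compose_algebra Q_simps)
qed

lemma LX_all: "A \<in> LX sc \<Longrightarrow> pivot A \<in> LX sc" "A \<in> LX sc \<Longrightarrow> upper A \<in> LX sc"
  "A \<in> LX sc \<Longrightarrow> curl A \<in> LX sc"
proof -
  show u: "A \<in> LX sc \<Longrightarrow> upper A \<in> LX sc" for A unfolding upper_def by (intro LX_closed QL)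
  show "A \<in> LX sc \<Longrightarrow> pivot A \<in> LX sc" unfolding pivot_def by (intro LX_closed QL)
  show "A \<in> LX sc \<Longrightarrow> curl A \<in> LX sc" unfolding curl_def by (intro LX_closed QL u)
qed

lemma LX_slope:
  assumes "A \<in> LX sc" "pivot A \<in> GL sc"
  shows "slope A \<in> LX sc" "corner A \<in> LX sc" "straighten A \<in> LX sc"
proof -
  show s: "slope A \<in> LX sc" unfolding slope_def by (intro LX_closed QL assms GL_inv)
  show c: "corner A \<in> LX sc" unfolding corner_def by (intro LX_closed QL assms s)
  show "straighten A \<in> LX sc" unfolding straighten_def by (intro LX_closed QL assms s c)
qed

lemma straighten_image: "straighten ` dom = cod"
proof
  show "straighten ` dom \<subseteq> cod"
  proof (intro subsetI, elim imageE)
    fix Z A assume A: "Z = straighten A" "A \<in> dom"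
    then show "Z \<in> cod"
      using straighten_blocks(4,5)[of A] LX_slope(3)[of A] by (simp add: cod_def dom_def pivot_def)
  qed
  show "cod \<subseteq> straighten ` dom"
  proof
    fix Z assume Z: "Z \<in> cod"
    then have "curl Z \<in> dom" using curl_blocks[OF Z] by (simp add: dom_def cod_def LX_all)
    then show "Z \<in> straighten ` dom" using curl_blocks(4)[OF Z] by (metis image_eqI)
  qed
qed

lemma straighten_inj: "inj_on straighten dom"
  by (rule inj_on_inverseI[where g = curl]) (simp add: curl_straighten dom_def)

lemma inv_straighten: "Z \<in> cod \<Longrightarrow> inv_into dom straighten Z = curl Z"
  using straighten_inj curl_blocks[of Z] by (intro inv_into_f_eq) (auto simp: dom_def cod_def LX_all)

lemma analytic_pivot: "A \<in> LX sc \<Longrightarrow> analytic_op scb (LX sc) pivot A"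
  unfolding pivot_def by (intro analytic_op_LX analytic_op_id QL LX_id)

lemma analytic_upper: "A \<in> LX sc \<Longrightarrow> analytic_op scb (LX sc) upper A"
  unfolding upper_def by (intro analytic_op_LX analytic_op_id QL)

lemma analytic_curl: "A \<in> LX sc \<Longrightarrow> analytic_op scb (LX sc) curl A"
  unfolding curl_def by (intro analytic_op_LX analytic_op_id analytic_upper QL)

lemma analytic_slope:
  "A \<in> LX sc \<Longrightarrow> pivot A \<in> GL sc \<Longrightarrow> analytic_op scb (LX sc) slope A"
  unfolding slope_def by (intro analytic_op_LX analytic_op_id QL analytic_pivot)

lemma analytic_corner:
  "A \<in> LX sc \<Longrightarrow> pivot A \<in> GL sc \<Longrightarrow> analytic_op scb (LX sc) corner A"
  unfolding corner_def by (intro analytic_op_LX analytic_op_id QL analytic_slope)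

lemma analytic_straighten:
  "A \<in> LX sc \<Longrightarrow> pivot A \<in> GL sc \<Longrightarrow> analytic_op scb (LX sc) straighten A"
  unfolding straighten_def by (intro analytic_op_LX analytic_op_id QL analytic_slope analytic_corner)

lemma LX_nbhd: "A \<in> LX sc \<Longrightarrow> nbhd_on (LX sc) A (\<lambda>B. B \<in> LX sc)"
  unfolding nbhd_on_def by (intro exI[of _ 1]) (simp add: LX_closed(2))

lemma analytic_op_nbhd_GL:
  assumes "analytic_op scb (LX sc) f A" "f A \<in> GL sc" "nbhd_on (LX sc) A (\<lambda>B. f B \<in> LX sc)"
  shows "nbhd_on (LX sc) A (\<lambda>B. f B \<in> GL sc)"
  using assms unfolding analytic_op_def by (intro analytic_pt_nbhd_GL[OF LX_space]) auto

text \<open>Openness of \<open>dom\<close> is obtained in two stages: \<open>corner\<close> is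
  analytic only where the pivot is invertible, so the second condition is tested inside a
  neighbourhood on which the first one holds.\<close>

lemma analytic_between_straighten: "analytic_between scb (LX sc) scb (LX sc) dom straighten"
  unfolding analytic_between_iff
proof (intro conjI ballI)
  show "dom \<subseteq> LX sc" by (auto simp: dom_def)
  show "straighten ` dom \<subseteq> LX sc" by (auto simp: dom_def LX_slope)
  fix A assume "A \<in> dom"
  then have A: "A \<in> LX sc" "pivot A \<in> GL sc" "id_blinfun - corner A \<in> GL sc" by (auto simp: dom_def)
  show "analytic_pt scb (LX sc) scb (LX sc) straighten A"
    using analytic_straighten[OF A(1,2)] by (simp add: analytic_op_def)
  have p: "nbhd_on (LX sc) A (\<lambda>B. pivot B \<in> GL sc)"
    by (intro analytic_op_nbhd_GL analytic_pivot A nbhd_on_mono[OF LX_nbhd[OF A(1)]] LX_all)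
  have "nbhd_on (LX sc) A (\<lambda>B. id_blinfun - corner B \<in> GL sc)"
  proof (rule analytic_op_nbhd_GL)
    show "id_blinfun - corner A \<in> GL sc" by (rule A(3))
    show "analytic_op scb (LX sc) (\<lambda>B. id_blinfun - corner B) A"
      by (intro analytic_op_LX analytic_corner A LX_id)
    show "nbhd_on (LX sc) A (\<lambda>B. id_blinfun - corner B \<in> LX sc)"
      by (rule nbhd_on_mono[OF nbhd_on_conj[OF LX_nbhd[OF A(1)] p]]) (simp add: LX_closed LX_slope)
  qed
  then show "nbhd_on (LX sc) A (\<lambda>B. B \<in> dom)"
    by (rule nbhd_on_mono[OF nbhd_on_conj[OF LX_nbhd[OF A(1)] nbhd_on_conj[OF p]]]) (simp add: dom_def)
qed

text \<open>\<open>curl\<close> is polynomial and so analytic on all of L(X); what remains is that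
  \<open>cod\<close> is open and that \<open>curl\<close> is the inverse on it.\<close>

lemma analytic_between_curl: "analytic_between scb (LX sc) scb (LX sc) cod (inv_into dom straighten)"
  unfolding analytic_between_iff
proof (intro conjI ballI)
  show "cod \<subseteq> LX sc" by (auto simp: cod_def)
  show "inv_into dom straighten ` cod \<subseteq> LX sc" by (auto simp: inv_straighten LX_all cod_def)
  fix Z assume Z: "Z \<in> cod"
  then have ZL: "Z \<in> LX sc" by (simp add: cod_def)
  let ?f = "\<lambda>Z. (upper Z o\<^sub>L Q) + (id_blinfun - Q)"
    and ?g = "\<lambda>Z. id_blinfun - (Z - (Q o\<^sub>L Z) - (Z o\<^sub>L Q) + (Q o\<^sub>L Z o\<^sub>L Q))"
  have "nbhd_on (LX sc) Z (\<lambda>Z. ?f Z \<in> GL sc)"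
  proof (rule analytic_op_nbhd_GL)
    show "analytic_op scb (LX sc) ?f Z" by (intro analytic_op_LX analytic_upper ZL QL LX_id)
    show "nbhd_on (LX sc) Z (\<lambda>Z. ?f Z \<in> LX sc)"
      by (rule nbhd_on_mono[OF LX_nbhd[OF ZL]]) (simp add: LX_closed LX_all QL)
  qed (use Z in \<open>simp add: cod_def\<close>)
  moreover have "nbhd_on (LX sc) Z (\<lambda>Z. ?g Z \<in> GL sc)"
  proof (rule analytic_op_nbhd_GL)
    show "analytic_op scb (LX sc) ?g Z" by (intro analytic_op_LX analytic_op_id ZL QL LX_id)
    show "nbhd_on (LX sc) Z (\<lambda>Z. ?g Z \<in> LX sc)"
      by (rule nbhd_on_mono[OF LX_nbhd[OF ZL]]) (simp add: LX_closed QL)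
  qed (use Z in \<open>simp add: cod_def\<close>)
  ultimately show nb: "nbhd_on (LX sc) Z (\<lambda>Z. Z \<in> cod)"
    by (rule nbhd_on_mono[OF nbhd_on_conj[OF LX_nbhd[OF ZL] nbhd_on_conj]]) (simp add: cod_def)
  have "analytic_pt scb (LX sc) scb (LX sc) curl Z"
    using analytic_curl[OF ZL] by (simp add: analytic_op_def)
  then show "analytic_pt scb (LX sc) scb (LX sc) (inv_into dom straighten) Z"
    by (rule analytic_pt_cong) (rule nbhd_on_mono[OF nb], simp add: inv_straighten)
qed

lemma GL_cancel: "W \<in> GL sc \<Longrightarrow> X o\<^sub>L W = Y o\<^sub>L W \<Longrightarrow> X = Y"
  using GL_inv(4) by (metis blinfun_compose_assoc blinfun_compose_id(2))

text \<open>Cancelling the pivot in \<open>A A = A\<close> gives \<open>a + b t = 1\<close> and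
  shows that \<open>A\<close> fixes the graph of \<open>t\<close> pointwise. With these relations
  the Schur complement is idempotent, and invertibility of 1 minus it leaves only 0.\<close>

lemma idempotent_straighten:
  assumes A: "A \<in> dom" and AA: "A o\<^sub>L A = A"
  shows "straighten A \<in> off_diagonal"
proof -
  have p: "pivot A \<in> GL sc" and AL: "A \<in> LX sc" and cG: "id_blinfun - corner A \<in> GL sc"
    using A by (auto simp: dom_def)
  note s = slope_simps[OF p]
  note AA' = AA compose_left[OF AA]
  note all = blinfun_compose_algebra Q_simps s compose_left[OF s(1)] compose_left[OF s(2)]
    AA'
  \<comment> \<open>This is the upper left block of \<open>A A = A\<close>, since
    \<open>slope A\<close> times the pivot is the block \<open>c\<close>.\<close>
  have "((Q o\<^sub>L A o\<^sub>L Q) + (Q o\<^sub>L A o\<^sub>L slope A)) o\<^sub>L pivot A = Q o\<^sub>L pivot A"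
    by (simp add: all pivot_def)
  then have a: "(Q o\<^sub>L A o\<^sub>L Q) + (Q o\<^sub>L A o\<^sub>L slope A) = Q" by (rule GL_cancel[OF p])
  \<comment> \<open>\<open>Q + slope A\<close> times the pivot is \<open>A Q\<close>, and
    \<open>A\<close> fixes \<open>A Q\<close>.\<close>
  have "(A o\<^sub>L (Q + slope A)) o\<^sub>L pivot A = (Q + slope A) o\<^sub>L pivot A"
    by (simp add: all pivot_def)
  then have "A o\<^sub>L (Q + slope A) = Q + slope A" by (rule GL_cancel[OF p])
  then have As: "A o\<^sub>L slope A = Q + slope A - (A o\<^sub>L Q)"
    by (simp add: blinfun_compose_algebra algebra_simps)
  have ss: "slope A o\<^sub>L slope A = 0"
    using compose_left[OF s(1), of "slope A"] by (simp add: s)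
  have "corner A o\<^sub>L corner A = corner A"
    by (simp add: corner_def all As compose_left[OF As] ss compose_left[OF ss])
  then have "corner A o\<^sub>L (id_blinfun - corner A) = 0 o\<^sub>L (id_blinfun - corner A)"
    by (simp add: blinfun_compose_algebra)
  then have "corner A = 0" by (rule GL_cancel[OF cG])
  then show ?thesis
    using straighten_blocks[OF p] a LX_slope(3)[OF AL p] by (simp add: off_diagonal_def)
qed

text \<open>For vanishing diagonal blocks \<open>curl Z\<close> equals
  \<open>(1 + t) (Q + b) (1 - t)\<close>, a conjugate of the idempotent \<open>Q + b\<close>. If it
  were 0, its pivot would be \<open>1 - Q\<close>, which is invertible only for
  \<open>Q = 0\<close>; if it were the identity, its Schur complement 0 would equal
  \<open>1 - Q\<close>.\<close>

lemma curl_idempotent: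
  assumes Z: "Z \<in> cod" "Z \<in> off_diagonal" and Q: "Q \<noteq> 0" "Q \<noteq> id_blinfun"
  shows "curl Z \<in> idempotents sc"
proof -
  let ?A = "curl Z"
  have ZL: "Z \<in> LX sc" using Z(1) by (simp add: cod_def)
  define b t where "b = Q o\<^sub>L Z" and "t = Z o\<^sub>L Q"
  have z: "Q o\<^sub>L (Z o\<^sub>L Q) = 0" using Z(2) by (simp add: off_diagonal_def blinfun_compose_assoc)
  have bt: "b o\<^sub>L Q = 0" "Q o\<^sub>L b = b" "t o\<^sub>L Q = t" "Q o\<^sub>L t = 0" "b o\<^sub>L b = 0" "t o\<^sub>L t = 0"
    using z compose_left[OF z] by (simp_all add: b_def t_def blinfun_compose_assoc Q_simps)
  have u: "upper Z = b + Q - (b o\<^sub>L t)"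
    using z by (simp add: upper_def b_def t_def blinfun_compose_assoc)
  have d: "Z - (Q o\<^sub>L Z) - (Z o\<^sub>L Q) + (Q o\<^sub>L Z o\<^sub>L Q) = 0" and q: "Q o\<^sub>L Z o\<^sub>L Q = 0"
    using Z(2) unfolding off_diagonal_def by blast+
  have c: "?A = upper Z + (t o\<^sub>L upper Z)"
    unfolding curl_def d unfolding q t_def by simp
  have "?A o\<^sub>L ?A = ?A" unfolding c u
    by (simp add: blinfun_compose_algebra Q_simps bt bt[THEN compose_left])
  moreover have "?A \<noteq> 0"
  proof
    assume "?A = 0"
    then have "id_blinfun - Q \<in> GL sc" using curl_blocks(1)[OF Z(1)] by (simp add: pivot_def)
    moreover have "Q o\<^sub>L (id_blinfun - Q) = 0 o\<^sub>L (id_blinfun - Q)" by (simp add: blinfun_compose_algebra QQ)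
    ultimately show False using GL_cancel Q(1) by blast
  qed
  moreover have "?A \<noteq> id_blinfun"
  proof
    assume A: "?A = id_blinfun"
    have "corner ?A = 0" unfolding curl_blocks(3)[OF Z(1)] by (rule d)
    moreover have "slope id_blinfun = 0" by (simp add: slope_def QQ)
    ultimately show False unfolding A using Q(2) by (simp add: corner_def QQ)
  qed
  ultimately show ?thesis using LX_all(3)[OF ZL] by (simp add: idempotents_def)
qed

lemma off_diagonal_complement:
  "banach_subspace scb off_diagonal" "banach_subspace scb diagonal"
  "off_diagonal \<inter> diagonal = {0}" "{v + v' | v v'. v \<in> off_diagonal \<and> v' \<in> diagonal} = LX sc"
proof -
  interpret op: banach_space_over "scb" by (rule LX_space)
  have sc_left: "A o\<^sub>L scb a T = scb a (A o\<^sub>L T)" if "A \<in> LX sc" for a A T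
    using that by (auto intro!: blinfun_eqI simp: LX_D)
  have sc_right: "scb a T o\<^sub>L A = scb a (T o\<^sub>L A)" for a A T
    by (auto intro!: blinfun_eqI)
  have cl: "closed {Z \<in> LX sc. f Z = g Z}" if "continuous_on UNIV f" "continuous_on UNIV g"
    for f g :: "('x \<Rightarrow>\<^sub>L 'x) \<Rightarrow> 'x \<Rightarrow>\<^sub>L 'x"
  proof -
    have "{Z \<in> LX sc. f Z = g Z} = LX sc \<inter> {Z. f Z = g Z}" by blast
    then show ?thesis using that LX_closed(4) by (simp add: closed_Int closed_Collect_eq)
  qed
  let ?f = "\<lambda>Z. Q o\<^sub>L Z o\<^sub>L Q" and ?g = "\<lambda>Z. Z - (Q o\<^sub>L Z) - (Z o\<^sub>L Q) + (Q o\<^sub>L Z o\<^sub>L Q)"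
  have off: "off_diagonal = {Z \<in> LX sc. ?f Z = 0} \<inter> {Z \<in> LX sc. ?g Z = 0}"
    by (auto simp: off_diagonal_def)
  have cont: "continuous_on UNIV (\<lambda>Z. Q o\<^sub>L Z)" "continuous_on UNIV (\<lambda>Z :: 'x \<Rightarrow>\<^sub>L 'x. Z o\<^sub>L Q)"
    by (intro bounded_bilinear.continuous_on[OF bounded_bilinear_blinfun_compose] continuous_intros)+
  have "continuous_on UNIV ?f" "continuous_on UNIV ?g"
    by (intro bounded_bilinear.continuous_on[OF bounded_bilinear_blinfun_compose] continuous_intros)+
  then have "closed off_diagonal" unfolding off by (intro closed_Int cl continuous_intros)
  then show "banach_subspace scb off_diagonal" unfolding op.subspace_iff
    by (auto simp: off_diagonal_def LX_closed blinfun_compose_algebra sc_left QL sc_right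
        simp flip: op.scale_right_distrib op.scale_right_diff_distrib) (simp_all add: algebra_simps)
  have "closed diagonal" unfolding diagonal_def by (intro cl cont)
  then show "banach_subspace scb diagonal" unfolding op.subspace_iff
    by (auto simp: diagonal_def LX_closed blinfun_compose_algebra sc_left QL sc_right)
  show "off_diagonal \<inter> diagonal = {0}"
  proof
    show "off_diagonal \<inter> diagonal \<subseteq> {0}"
    proof
      fix Z assume "Z \<in> off_diagonal \<inter> diagonal"
      then have Z: "Q o\<^sub>L Z o\<^sub>L Q = 0" "Z - (Q o\<^sub>L Z) - (Z o\<^sub>L Q) + (Q o\<^sub>L Z o\<^sub>L Q) = 0" "Q o\<^sub>L Z = Z o\<^sub>L Q"
        unfolding off_diagonal_def diagonal_def by blast+
      have "Z o\<^sub>L Q = 0" using Z(1) unfolding Z(3) by (simp add: blinfun_compose_assoc QQ)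
      then show "Z \<in> {0}" using Z(2,3) by simp
    qed
    show "{0} \<subseteq> off_diagonal \<inter> diagonal" by (simp add: off_diagonal_def diagonal_def LX_closed)
  qed
  show "{v + v' | v v'. v \<in> off_diagonal \<and> v' \<in> diagonal} = LX sc"
  proof
    show "{v + v' | v v'. v \<in> off_diagonal \<and> v' \<in> diagonal} \<subseteq> LX sc"
      by (auto simp: off_diagonal_def diagonal_def LX_closed)
    show "LX sc \<subseteq> {v + v' | v v'. v \<in> off_diagonal \<and> v' \<in> diagonal}"
    proof
      fix Z assume Z: "Z \<in> LX sc"
      \<comment> \<open>The sum of the two off-diagonal blocks of \<open>Z\<close>: the block
        \<open>Q Z Q\<close> is contained in both products and is removed twice.\<close>
      define v where "v = (Q o\<^sub>L Z) + (Z o\<^sub>L Q) - (Q o\<^sub>L Z o\<^sub>L Q) - (Q o\<^sub>L Z o\<^sub>L Q)"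
      have vL: "v \<in> LX sc" unfolding v_def by (intro LX_closed Z QL)
      have "v \<in> off_diagonal" unfolding off_diagonal_def mem_Collect_eq
        using vL by (simp add: v_def blinfun_compose_algebra Q_simps)
      moreover have "Z - v \<in> diagonal" unfolding diagonal_def mem_Collect_eq
        using vL Z by (simp add: v_def blinfun_compose_algebra Q_simps LX_closed)
      moreover have "Z = v + (Z - v)" by simp
      ultimately show "Z \<in> {v + v' | v v'. v \<in> off_diagonal \<and> v' \<in> diagonal}" by blast
    qed
  qed
qed

text \<open>At \<open>Q\<close> itself the pivot is the identity, and slope and Schur complement
  vanish, so every admissible \<open>Q\<close> lies in the domain of its own chart.\<close>

lemma straighten_chart:
  assumes Q: "Q \<noteq> 0" "Q \<noteq> id_blinfun"
  shows "(dom \<inter> idempotents sc, straighten, off_diagonal) \<in> atlas (idempotent_manifold sc)"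
    "Q \<in> dom \<inter> idempotents sc"
proof -
  have "straighten ` (dom \<inter> idempotents sc) = straighten ` dom \<inter> off_diagonal"
  proof
    show "straighten ` (dom \<inter> idempotents sc) \<subseteq> straighten ` dom \<inter> off_diagonal"
      using idempotent_straighten by (auto simp: idempotents_def)
    show "straighten ` dom \<inter> off_diagonal \<subseteq> straighten ` (dom \<inter> idempotents sc)"
    proof
      fix Z assume Z: "Z \<in> straighten ` dom \<inter> off_diagonal"
      then have cod: "Z \<in> cod" unfolding straighten_image by blast
      have "curl Z \<in> idempotents sc" using curl_idempotent[OF cod _ Q] Z by blast
      moreover have "curl Z \<in> dom" "straighten (curl Z) = Z"
        using curl_blocks[OF cod] cod by (auto simp: dom_def cod_def LX_all)
      ultimately show "Z \<in> straighten ` (dom \<inter> idempotents sc)" by (metis IntI image_eqI)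
    qed
  qed
  then show "(dom \<inter> idempotents sc, straighten, off_diagonal) \<in> atlas (idempotent_manifold sc)"
    unfolding idempotent_manifold_def induced_submanifold_def mfd.simps mem_Collect_eq
    using straighten_inj analytic_between_straighten analytic_between_curl[folded straighten_image]
      off_diagonal_complement by blast
  have "pivot Q = id_blinfun" by (simp add: pivot_def QQ)
  then have "slope Q = 0" by (simp add: slope_def QQ)
  then have "corner Q = 0" by (simp add: corner_def QQ)
  then show "Q \<in> dom \<inter> idempotents sc"
    using \<open>pivot Q = id_blinfun\<close> Q by (simp add: dom_def GL_id QL idempotents_def QQ)
qed

end

section \<open>Conjugation as an action on the manifold of idempotents\<close>

context banach_space_over
begin

lemma idempotentsD:
  assumes "Q \<in> idempotents sc"
  shows "Q \<in> LX sc" "Q o\<^sub>L Q = Q" "Q \<noteq> 0" "Q \<noteq> id_blinfun"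
  using assms by (auto simp: idempotents_def)

lemma idempotent_manifold_simps [simp]:
  "mtop (idempotent_manifold sc) = top_of_set (idempotents sc)"
  "mscale (idempotent_manifold sc) = scb"
  by (auto simp: idempotent_manifold_def induced_submanifold_def)

lemma idempotent_manifold: "banach_manifold (idempotent_manifold sc)"
  unfolding idempotent_manifold_def
proof (rule induced_submanifold_manifold[OF LX_space])
  show "idempotents sc \<subseteq> LX sc" using idempotentsD(1) by blast
  fix Q assume "Q \<in> idempotents sc"
  note Q = idempotentsD[OF this]
  interpret idempotent_chart sc Q by unfold_locales (fact Q)+
  show "\<exists>(U, \<phi>, V)\<in>atlas (induced_submanifold scb (LX sc) (idempotents sc)). Q \<in> U"
    using straighten_chart[OF Q(3,4)] unfolding idempotent_manifold_def
    by (intro bexI[of _ "(dom \<inter> idempotents sc, straighten, off_diagonal)"]) auto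
qed

lemma conj_act_idempotents:
  assumes W: "W \<in> GL sc" and Q: "Q \<in> idempotents sc"
  shows "conj_act W Q \<in> idempotents sc"
proof -
  note q = idempotentsD[OF Q]
  have *: "op_inv W o\<^sub>L conj_act W Q o\<^sub>L W = Q"
    by (simp add: conj_act_def blinfun_compose_assoc GL_inv[OF W])
  have "conj_act W Q \<in> LX sc" unfolding conj_act_def by (intro LX_comp q GL_inv W)
  moreover have "conj_act W Q o\<^sub>L conj_act W Q = conj_act W Q"
    by (simp add: conj_act_def blinfun_compose_assoc GL_inv[OF W] compose_left[OF q(2)])
  moreover have "conj_act W Q \<noteq> 0" using * q(3) by auto
  moreover have "conj_act W Q \<noteq> id_blinfun" using * q(4) GL_inv[OF W] by auto
  ultimately show ?thesis by (simp add: idempotents_def)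
qed

text \<open>\<open>A\<close> and \<open>B\<close> are conjugate by \<open>A B + (1 - A) (1 - B)\<close> as soon as this operator is invertible.\<close>

definition conjugator :: "('x \<Rightarrow>\<^sub>L 'x) \<Rightarrow> ('x \<Rightarrow>\<^sub>L 'x) \<Rightarrow> 'x \<Rightarrow>\<^sub>L 'x" where
  "conjugator B A = (A o\<^sub>L B) + ((id_blinfun - A) o\<^sub>L (id_blinfun - B))"

text \<open>\<open>conjugator B A\<close> followed by \<open>A\<close>, and preceded by
  \<open>B\<close>, both reduce to \<open>A B\<close>.\<close>

lemma conjugator_conj:
  assumes A: "A o\<^sub>L A = A" and B: "B o\<^sub>L B = B" and G: "conjugator B A \<in> GL sc"
  shows "conj_act (conjugator B A) B = A"
proof -
  have "conjugator B A o\<^sub>L B = A o\<^sub>L conjugator B A"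
    by (simp add: conjugator_def blinfun_compose_algebra A B compose_left[OF A])
  then show ?thesis unfolding conj_act_def by (simp add: blinfun_compose_assoc GL_inv[OF G])
qed

lemma conjugator_self: "B o\<^sub>L B = B \<Longrightarrow> conjugator B B = id_blinfun"
  by (simp add: conjugator_def blinfun_compose_algebra)

lemma idempotent_atlasD:
  assumes "(C, \<phi>, V) \<in> atlas (idempotent_manifold sc)"
  obtains U V' where "C = U \<inter> idempotents sc" "inj_on \<phi> U"
    "analytic_between scb (LX sc) scb (LX sc) U \<phi>"
    "analytic_between scb (LX sc) scb (LX sc) (\<phi> ` U) (inv_into U \<phi>)"
    "banach_subspace scb V" "banach_subspace scb V'" "V \<inter> V' = {0}"
    "{v + v' | v v'. v \<in> V \<and> v' \<in> V'} = LX sc" "\<phi> ` C = \<phi> ` U \<inter> V" "V \<subseteq> LX sc"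
proof -
  obtain U V' where U: "C = U \<inter> idempotents sc" "inj_on \<phi> U"
    "analytic_between scb (LX sc) scb (LX sc) U \<phi>"
    "analytic_between scb (LX sc) scb (LX sc) (\<phi> ` U) (inv_into U \<phi>)"
    "banach_subspace scb V" "banach_subspace scb V'" "V \<inter> V' = {0}"
    "{v + v' | v v'. v \<in> V \<and> v' \<in> V'} = LX sc" "\<phi> ` C = \<phi> ` U \<inter> V"
    using assms unfolding idempotent_manifold_def induced_submanifold_def by auto
  have "V \<subseteq> LX sc"
  proof
    fix v assume "v \<in> V"
    then have "v + 0 \<in> {v + v' | v v'. v \<in> V \<and> v' \<in> V'}"
      using banach_space_over.subspaceD(1)[OF LX_space(1) U(6)] by blast
    then show "v \<in> LX sc" unfolding U(8) by simp
  qed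
  with U that show ?thesis by blast
qed

lemma idempotent_action: "homogeneous_action sc (idempotent_manifold sc) conj_act"
proof (intro homogeneous_action.intro homogeneous_action_axioms.intro banach_space_over_axioms)
  show "banach_manifold (idempotent_manifold sc)" by (rule idempotent_manifold)
  show "banach_space_over (mscale (idempotent_manifold sc))" by (simp add: LX_space(1))
next
  fix W Q assume W: "W \<in> GL sc" and Q: "Q \<in> topspace (mtop (idempotent_manifold sc))"
  then show "conj_act W Q \<in> topspace (mtop (idempotent_manifold sc))"
    by (simp add: conj_act_idempotents)
next
  fix Q :: "'x \<Rightarrow>\<^sub>L 'x"
  show "conj_act id_blinfun Q = Q" by (simp add: conj_act_def GL_id)
next
  fix W V and Q :: "'x \<Rightarrow>\<^sub>L 'x" assume "W \<in> GL sc" "V \<in> GL sc"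
  then show "conj_act (W o\<^sub>L V) Q = conj_act W (conj_act V Q)"
    by (simp add: conj_act_def GL_comp blinfun_compose_assoc)
next
  fix C \<phi> V Q W
  assume at: "(C, \<phi>, V) \<in> atlas (idempotent_manifold sc)"
    and "Q \<in> topspace (mtop (idempotent_manifold sc))" and W: "W \<in> GL sc" "conj_act W Q \<in> C"
  then have Q: "Q \<in> idempotents sc" by simp
  obtain U V' where U: "C = U \<inter> idempotents sc" "inj_on \<phi> U"
    "analytic_between scb (LX sc) scb (LX sc) U \<phi>"
    "analytic_between scb (LX sc) scb (LX sc) (\<phi> ` U) (inv_into U \<phi>)"
    "banach_subspace scb V" "banach_subspace scb V'" "V \<inter> V' = {0}"
    "{v + v' | v v'. v \<in> V \<and> v' \<in> V'} = LX sc" "\<phi> ` C = \<phi> ` U \<inter> V" "V \<subseteq> LX sc"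
    using at by (rule idempotent_atlasD)
  note UD = analytic_betweenD[OF U(3)]
  have WU: "conj_act W Q \<in> U" using W(2) U(1) by blast
  have "analytic_op scb (LX sc) (\<lambda>W. conj_act W Q) W"
    unfolding conj_act_def
    by (intro analytic_op_LX analytic_op_id W(1) GL_inv(1)[OF W(1)] idempotentsD(1)[OF Q])
  then have an: "analytic_pt scb (LX sc) scb (LX sc) (\<lambda>W. conj_act W Q) W"
    by (simp add: analytic_op_def)
  have idem: "nbhd_on (LX sc) W (\<lambda>W. conj_act W Q \<in> idempotents sc)"
    by (rule nbhd_on_mono[OF GL_nbhd[OF W(1)]]) (rule conj_act_idempotents[OF _ Q])
  have "nbhd_on (LX sc) W (\<lambda>W. conj_act W Q \<in> U)"
    by (rule analytic_pt_nbhd_open[OF LX_space LX_space an WU UD(1) UD(4)[OF WU]])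
      (rule nbhd_on_mono[OF idem], rule idempotentsD(1))
  from nbhd_on_conj[OF this idem]
  have nb: "nbhd_on (LX sc) W (\<lambda>W. conj_act W Q \<in> C)" by (simp add: U(1))
  \<comment> \<open>The ambient chart is analytic with values in L(X). Conjugates of
    \<open>Q\<close> stay idempotent, so near \<open>W\<close> its values lie in \<open>V\<close>,
    and the complement of \<open>V\<close> brings the coefficients there.\<close>
  moreover have "analytic_pt scb (LX sc) scb V (\<lambda>W. \<phi> (conj_act W Q)) W"
  proof (rule analytic_pt_complemented[OF LX_space LX_space U(5-8)])
    show "analytic_pt scb (LX sc) scb (LX sc) (\<lambda>W. \<phi> (conj_act W Q)) W"
      by (rule analytic_pt_compose[OF LX_space LX_space LX_space an UD(3)[OF WU]])
    show "\<phi> (conj_act W Q) \<in> LX sc" by (rule UD(2)[OF WU])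
    show "nbhd_on (LX sc) W (\<lambda>W. \<phi> (conj_act W Q) \<in> V)"
      by (rule nbhd_on_mono[OF nb]) (use U(9) in blast)
  qed
  ultimately show "nbhd_on (LX sc) W (\<lambda>W. conj_act W Q \<in> C) \<and>
      analytic_pt scb (LX sc) (mscale (idempotent_manifold sc)) V (\<lambda>W. \<phi> (conj_act W Q)) W"
    by simp
next
  fix C \<phi> V Q
  assume at: "(C, \<phi>, V) \<in> atlas (idempotent_manifold sc)" and QC: "Q \<in> C"
  obtain U V' where U: "C = U \<inter> idempotents sc" "inj_on \<phi> U"
    "analytic_between scb (LX sc) scb (LX sc) U \<phi>"
    "analytic_between scb (LX sc) scb (LX sc) (\<phi> ` U) (inv_into U \<phi>)"
    "banach_subspace scb V" "banach_subspace scb V'" "V \<inter> V' = {0}"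
    "{v + v' | v v'. v \<in> V \<and> v' \<in> V'} = LX sc" "\<phi> ` C = \<phi> ` U \<inter> V" "V \<subseteq> LX sc"
    using at by (rule idempotent_atlasD)
  have Q: "Q \<in> idempotents sc" "Q \<in> U" using QC U(1) by auto
  note q = idempotentsD[OF Q(1)] and ID = analytic_betweenD[OF U(4)]
  have inv: "inv_into U \<phi> (\<phi> A) = A" "inv_into C \<phi> (\<phi> A) = A" if "A \<in> C" for A
  proof -
    have "inj_on \<phi> C" using U(2) unfolding U(1) by (rule inj_on_subset) simp
    then show "inv_into U \<phi> (\<phi> A) = A" "inv_into C \<phi> (\<phi> A) = A"
      using that U(1,2) by (auto simp: inv_into_f_f)
  qed
  \<comment> \<open>The inverse over \<open>U\<close> is used, as it is analytic on an open subset
    of L(X); on the image of \<open>C\<close> it agrees with the inverse over \<open>C\<close> that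
    the section has to refer to.\<close>
  define g where "g v = conjugator Q (inv_into U \<phi> v)" for v
  define N where "N = {v \<in> \<phi> ` C. g v \<in> GL sc}"
  have "N \<subseteq> \<phi> ` C" by (auto simp: N_def)
  have an: "analytic_op scb (LX sc) g v" if v: "v \<in> \<phi> ` U" for v
  proof -
    have "analytic_op scb (LX sc) (inv_into U \<phi>) v"
      using ID(2,3)[OF v] by (simp add: analytic_op_def)
    then show ?thesis unfolding g_def conjugator_def by (intro analytic_op_LX q LX_id)
  qed
  have "analytic_between scb V scb (LX sc) N g"
    unfolding analytic_between_iff
  proof (intro conjI ballI)
    show "N \<subseteq> V" using U(9) by (auto simp: N_def)
    show "g ` N \<subseteq> LX sc" using GL_inv(1) by (auto simp: N_def)
    fix v assume "v \<in> N"
    then have v: "v \<in> \<phi> ` U" "v \<in> V" "g v \<in> GL sc" using U(9) by (auto simp: N_def)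
    have anv: "analytic_pt scb (LX sc) scb (LX sc) g v" using an[OF v(1)] by (simp add: analytic_op_def)
    then show "analytic_pt scb V scb (LX sc) g v" by (rule analytic_pt_mono[OF _ U(10)]) simp
    have "nbhd_on (LX sc) v (\<lambda>v. g v \<in> GL sc)"
      by (rule analytic_pt_nbhd_GL[OF LX_space anv v(3)], rule nbhd_on_mono[OF ID(4)[OF v(1)]])
        (use an in \<open>simp add: analytic_op_def\<close>)
    from nbhd_on_subset[OF nbhd_on_conj[OF ID(4)[OF v(1)] this] U(10)]
    show "nbhd_on V v (\<lambda>v. v \<in> N)"
    proof (rule nbhd_on_mono)
      fix h assume h: "h \<in> V" "v + h \<in> \<phi> ` U \<and> g (v + h) \<in> GL sc"
      have "v + h \<in> V" using v(2) h(1) by (rule banach_space_over.subspaceD(2)[OF LX_space(1) U(5)])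
      then show "v + h \<in> N" using h(2) U(9) by (simp add: N_def)
    qed
  qed
  moreover have "g (\<phi> Q) = id_blinfun" by (simp add: g_def inv[OF QC] conjugator_self q)
  moreover have "\<phi> Q \<in> N" using QC by (simp add: N_def GL_id calculation(2))
  moreover have "g v \<in> GL sc \<and> conj_act (g v) Q = inv_into C \<phi> v" if v: "v \<in> N" for v
  proof -
    obtain A where A: "A \<in> C" "v = \<phi> A" "g v \<in> GL sc" using v by (auto simp: N_def)
    then have "A \<in> idempotents sc" by (simp add: U(1))
    then have "conj_act (g v) Q = A"
      using A idempotentsD(2) by (auto simp: g_def inv intro: conjugator_conj[OF _ q(2)])
    then show ?thesis using A inv(2)[OF A(1)] by simp
  qed
  ultimately show "\<exists>N g. \<phi> Q \<in> N \<and> N \<subseteq> \<phi> ` C \<and> g (\<phi> Q) = id_blinfun \<and>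
        analytic_between (mscale (idempotent_manifold sc)) V scb (LX sc) N g \<and>
        (\<forall>v\<in>N. g v \<in> GL sc \<and> conj_act (g v) Q = inv_into C \<phi> v)"
    unfolding idempotent_manifold_simps using \<open>N \<subseteq> \<phi> ` C\<close> by blast
next
  fix Q assume "Q \<in> topspace (mtop (idempotent_manifold sc))"
  then obtain C \<phi> V where at: "(C, \<phi>, V) \<in> atlas (idempotent_manifold sc)" "Q \<in> C"
    unfolding banach_manifoldD(2)[OF idempotent_manifold, symmetric] by auto
  obtain U V' where V: "banach_subspace scb V" "V \<subseteq> LX sc"
    using at(1) by (rule idempotent_atlasD)
  \<comment> \<open>The models of these charts already lie in L(X), so the identity serves both as
    \<open>J\<close> and as \<open>K\<close>.\<close>
  have "linear_between scb V scb V (\<lambda>v. v)"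
    unfolding linear_between_def by (auto intro: exI[of _ 1])
  with at V show "\<exists>U \<phi> E E' J K. (U, \<phi>, E) \<in> atlas (idempotent_manifold sc) \<and> Q \<in> U \<and>
      E' \<subseteq> LX sc \<and> banach_subspace scb E' \<and>
      linear_between (mscale (idempotent_manifold sc)) E scb E' J \<and>
      linear_between scb E' (mscale (idempotent_manifold sc)) E K \<and>
      (\<forall>v\<in>E. K (J v) = v) \<and> (\<forall>w\<in>E'. J (K w) = w)"
    by (intro exI[of _ C] exI[of _ \<phi>] exI[of _ V] exI[of _ "\<lambda>v. v"]) simp
qed

end

section \<open>The Grassmannian\<close>

lemma lbfun_apply_simps [simp]:
  fixes S T :: "('a::real_normed_vector, 'b::real_normed_vector) lbfun"
  shows "lbfun_apply (S + T) x = lbfun_apply S x + lbfun_apply T x"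
    "lbfun_apply (r *\<^sub>R T) x = r *\<^sub>R lbfun_apply T x" "lbfun_apply 0 x = 0"
  by (simp_all add: plus_lbfun.rep_eq scaleR_lbfun.rep_eq zero_lbfun.rep_eq)

lemma norm_lbfun_apply: "norm (lbfun_apply T x) \<le> norm T * norm x"
  by transfer (rule lbfun_onorm)

lemma norm_lbfun_le:
  assumes "0 \<le> C" "\<And>x. norm (lbfun_apply T x) \<le> C * norm x"
  shows "norm T \<le> C"
  unfolding norm_lbfun.rep_eq by (rule onorm_nonneg_le[OF assms])

lemma lbfun_eqI: "(\<And>x. lbfun_apply S x = lbfun_apply T x) \<Longrightarrow> S = T"
  by (metis ext lbfun_apply_inject)

lemma lbfun_apply_Lbfun:
  assumes "\<And>x. norm (f x) \<le> C * norm x"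
  shows "lbfun_apply (Lbfun f) = f"
  using assms by (intro Lbfun_inverse) blast

lemma bounded_linear_lbfun_apply:
  "bounded_linear (\<lambda>T :: ('a::real_normed_vector, 'b::real_normed_vector) lbfun. lbfun_apply T x)"
  by (rule bounded_linear_intro[where K = "norm x"]) (auto simp: norm_lbfun_apply)

section \<open>Graphs of operators, shears and the charts of the Grassmannian\<close>

context banach_space_over
begin

abbreviation scl :: "'k \<Rightarrow> ('x, 'x) lbfun \<Rightarrow> ('x, 'x) lbfun" where "scl \<equiv> scale_lbfun sc"

lemma scale_lbfun_apply [simp]: "lbfun_apply (scl a T) x = sc a (lbfun_apply T x)"
proof -
  have "norm (sc a (lbfun_apply T x)) \<le> (norm a * norm T) * norm x" for x
    using norm_lbfun_apply[of T x] by (simp add: norm_scale mult.assoc mult_left_mono)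
  then show ?thesis unfolding scale_lbfun_def by (subst lbfun_apply_Lbfun) auto
qed

lemma banach_space_over_lbfun: "banach_space_over scl"
proof
  fix a b and S T :: "('x, 'x) lbfun" and r
  show "scl a (S + T) = scl a S + scl a T" "scl (a + b) T = scl a T + scl b T"
    "scl a (scl b T) = scl (a * b) T" "scl 1 T = T" "scl (of_real r) T = r *\<^sub>R T"
    by (auto intro!: lbfun_eqI simp: scale_right_distrib scale_left_distrib scale_of_real)
  have le: "norm (scl a T) \<le> norm a * norm T" for a and T :: "('x, 'x) lbfun"
    using norm_lbfun_apply[of T]
    by (intro norm_lbfun_le) (simp_all add: norm_scale mult.assoc mult_left_mono)
  show "norm (scl a T) = norm a * norm T"
  proof (cases "a = 0")
    case False
    have "scl (inverse a) (scl a T) = T" using False by (auto intro!: lbfun_eqI)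
    then have "norm T \<le> norm (inverse a) * norm (scl a T)" using le[of "inverse a" "scl a T"] by simp
    then have "norm a * norm T \<le> norm a * (norm (inverse a) * norm (scl a T))"
      by (rule mult_left_mono) simp
    also have "\<dots> = norm (scl a T)" using False by (simp add: norm_inverse)
    finally have "norm a * norm T \<le> norm (scl a T)" .
    with le[of a T] show ?thesis by simp
  qed (use le[of 0 T] in simp)
qed

lemma Lop_subspace:
  assumes E: "banach_subspace sc E" and F: "banach_subspace sc F"
  shows "banach_subspace scl (Lop sc E F)"
proof -
  interpret op: banach_space_over scl by (rule banach_space_over_lbfun)
  note F = subspaceD[OF F] and E = subspaceD[OF E]
  have cont: "continuous_on UNIV (\<lambda>T :: ('x, 'x) lbfun. lbfun_apply T x)" for x
    by (rule linear_continuous_on) (rule bounded_linear_lbfun_apply)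
  have contsc: "continuous_on UNIV (\<lambda>T :: ('x, 'x) lbfun. sc a (lbfun_apply T x))" for a x
    by (intro bounded_linear.continuous_on[OF bounded_linear_scale] cont)
  have "Lop sc E F = (\<Inter>x\<in>E. (\<lambda>T. lbfun_apply T x) -` F) \<inter>
      (\<Inter>x\<in>E. \<Inter>y\<in>E. {T. lbfun_apply T (x + y) = lbfun_apply T x + lbfun_apply T y}) \<inter>
      (\<Inter>a. \<Inter>x\<in>E. {T. lbfun_apply T (sc a x) = sc a (lbfun_apply T x)}) \<inter>
      (\<Inter>x\<in>- E. {T. lbfun_apply T x = 0})"
    unfolding Lop_def by blast
  also have "closed \<dots>"
    by (intro closed_Int closed_INT ballI closed_vimage closed_Collect_eq cont contsc F
        continuous_intros)
  finally show ?thesis unfolding op.subspace_iff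
    by (auto simp: Lop_def F scale_right_distrib scale_left_commute algebra_simps)
qed

text \<open>Extends \<open>T\<close> by zero on the complement \<open>F\<close>, which gives an
  operator on the whole space. The extension by zero outside \<open>E\<close> used in
  \<open>lbfun\<close> is not additive in general; this one can be composed and inverted.\<close>

definition lift :: "'x set \<Rightarrow> 'x set \<Rightarrow> ('x, 'x) lbfun \<Rightarrow> 'x \<Rightarrow>\<^sub>L 'x" where
  "lift E F T = Blinfun (\<lambda>x. lbfun_apply T (proj E F x))"

text \<open>The component of \<open>S\<close> from \<open>E\<close> to \<open>F\<close>. Subtracting
  the part in \<open>E\<close> makes it land in \<open>F\<close> for every \<open>S\<close>, so it
  is linear on all of L(X) and not only on operators of the form \<open>lift E F T\<close>.\<close>

definition restr :: "'x set \<Rightarrow> 'x set \<Rightarrow> ('x \<Rightarrow>\<^sub>L 'x) \<Rightarrow> ('x, 'x) lbfun" where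
  "restr E F S = Lbfun (\<lambda>x. if x \<in> E then S x - proj E F (S x) else 0)"

lemma restr_apply: "lbfun_apply (restr E F S) x = (if x \<in> E then S x - proj E F (S x) else 0)"
proof -
  have bd: "norm (if x \<in> E then S x - proj E F (S x) else 0) \<le> (norm S + norm (proj E F) * norm S) * norm x" for x
  proof (cases "x \<in> E")
    case True
    have "norm (proj E F (S x)) \<le> norm (proj E F) * (norm S * norm x)"
      by (rule order_trans[OF norm_blinfun mult_left_mono[OF norm_blinfun]]) simp
    then show ?thesis using True norm_blinfun[of S x] norm_triangle_ineq4[of "S x" "proj E F (S x)"]
      by (simp add: distrib_right mult.assoc)
  qed simp
  show ?thesis unfolding restr_def by (simp only: lbfun_apply_Lbfun[OF bd])
qed

context
  fixes E F :: "'x set"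
  assumes E: "E \<in> complements sc F" and F: "banach_subspace sc F"
begin

lemma lift_apply:
  assumes T: "T \<in> Lop sc E F"
  shows "blinfun_apply (lift E F T) x = lbfun_apply T (proj E F x)"
proof -
  have "bounded_linear (\<lambda>x. lbfun_apply T (proj E F x))"
  proof (rule bounded_linear_intro[where K = "norm T * norm (proj E F)"])
    show "norm (lbfun_apply T (proj E F x)) \<le> norm x * (norm T * norm (proj E F))" for x
      using order_trans[OF norm_lbfun_apply mult_left_mono[OF norm_blinfun[of "proj E F" x], of "norm T"]]
      by (simp add: mult_ac)
    show "lbfun_apply T (proj E F (x + y)) = lbfun_apply T (proj E F x) + lbfun_apply T (proj E F y)" for x y
      using T proj(4)[OF E F] by (simp add: blinfun.bilinear_simps Lop_def)
    show "lbfun_apply T (proj E F (r *\<^sub>R x)) = r *\<^sub>R lbfun_apply T (proj E F x)" for r x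
      using T proj(4)[OF E F] LX_D[OF proj(1)[OF E F]]
      by (simp add: Lop_def flip: scale_of_real)
  qed
  then show ?thesis unfolding lift_def by (simp add: bounded_linear_Blinfun_apply)
qed

lemma lift_LX: "T \<in> Lop sc E F \<Longrightarrow> lift E F T \<in> LX sc"
  using proj[OF E F] by (auto simp: LX_def lift_apply Lop_def)

lemma lift_proj: "T \<in> Lop sc E F \<Longrightarrow> lift E F T o\<^sub>L proj E F = lift E F T"
  "T \<in> Lop sc E F \<Longrightarrow> proj E F o\<^sub>L lift E F T = 0"
proof -
  assume T: "T \<in> Lop sc E F"
  show "lift E F T o\<^sub>L proj E F = lift E F T"
    by (rule blinfun_eqI) (simp add: lift_apply[OF T] proj(2)[OF E F proj(4)[OF E F]])
  have "lbfun_apply T (proj E F x) \<in> F" for x using T proj(4)[OF E F] by (simp add: Lop_def)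
  then show "proj E F o\<^sub>L lift E F T = 0"
    by (intro blinfun_eqI) (simp add: lift_apply[OF T] proj(3)[OF E F])
qed

lemma lift_lift: "S \<in> Lop sc E F \<Longrightarrow> T \<in> Lop sc E F \<Longrightarrow> lift E F S o\<^sub>L lift E F T = 0"
  using compose_left[OF lift_proj(1), of S "lift E F T"] by (simp add: lift_proj(2))

lemma lift_linear: "linear_between scl (Lop sc E F) scb (LX sc) (lift E F)"
  unfolding linear_between_def
proof (intro conjI ballI allI exI)
  interpret op: banach_space_over scl by (rule banach_space_over_lbfun)
  note L = op.subspaceD[OF Lop_subspace[OF complementsD(1)[OF E] F]]
  fix S assume S: "S \<in> Lop sc E F"
  show "lift E F S \<in> LX sc" by (rule lift_LX[OF S])
  show "lift E F (S + T) = lift E F S + lift E F T" if "T \<in> Lop sc E F" for T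
    using S that L by (auto intro!: blinfun_eqI simp: lift_apply blinfun.bilinear_simps)
  show "lift E F (scl a S) = scb a (lift E F S)" for a
    using S L by (auto intro!: blinfun_eqI simp: lift_apply)
  show "norm (lift E F S) \<le> norm (proj E F) * norm S"
  proof (rule norm_blinfun_bound)
    fix x
    show "norm (blinfun_apply (lift E F S) x) \<le> norm (proj E F) * norm S * norm x"
      unfolding lift_apply[OF S]
      using order_trans[OF norm_lbfun_apply mult_left_mono[OF norm_blinfun[of "proj E F" x], of "norm S"]]
      by (simp add: mult_ac)
  qed simp
qed

lemma restr_Lop: "S \<in> LX sc \<Longrightarrow> restr E F S \<in> Lop sc E F"
  using subspaceD[OF complementsD(1)[OF E]] proj[OF E F]
  by (auto simp: Lop_def restr_apply blinfun.bilinear_simps LX_D scale_right_diff_distrib)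

lemma restr_linear: "linear_between scb (LX sc) scl (Lop sc E F) (restr E F)"
  unfolding linear_between_def
proof (intro conjI ballI allI exI)
  fix S assume S: "S \<in> LX sc"
  show "restr E F S \<in> Lop sc E F" by (rule restr_Lop[OF S])
  show "restr E F (S + T) = restr E F S + restr E F T" for T
    by (auto intro!: lbfun_eqI simp: restr_apply blinfun.bilinear_simps)
  show "restr E F (scb a S) = scl a (restr E F S)" for a
    using proj(1)[OF E F] by (auto intro!: lbfun_eqI simp: restr_apply LX_D scale_right_diff_distrib)
  show "norm (restr E F S) \<le> (1 + norm (proj E F)) * norm S"
  proof (rule norm_lbfun_le)
    fix x
    have "norm (proj E F (S x)) \<le> norm (proj E F) * (norm S * norm x)"
      by (rule order_trans[OF norm_blinfun mult_left_mono[OF norm_blinfun]]) simp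
    then have "norm (S x - proj E F (S x)) \<le> (1 + norm (proj E F)) * norm S * norm x"
      using norm_blinfun[of S x] norm_triangle_ineq4[of "S x" "proj E F (S x)"]
      by (simp add: distrib_right mult.assoc)
    then show "norm (lbfun_apply (restr E F S) x) \<le> (1 + norm (proj E F)) * norm S * norm x"
      by (simp add: restr_apply mult_nonneg_nonneg add_nonneg_nonneg)
  qed simp
qed

lemma restr_lift: "T \<in> Lop sc E F \<Longrightarrow> restr E F (lift E F T) = T"
proof (rule lbfun_eqI)
  fix x assume T: "T \<in> Lop sc E F"
  show "lbfun_apply (restr E F (lift E F T)) x = lbfun_apply T x"
    using T proj(2,3)[OF E F] by (simp add: restr_apply lift_apply) (simp add: Lop_def)
qed

lemma lift_restr:
  assumes "S \<in> LX sc" "S o\<^sub>L proj E F = S" "proj E F o\<^sub>L S = 0"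
  shows "lift E F (restr E F S) = S"
proof (rule blinfun_eqI)
  fix x
  have "S (proj E F x) = S x" "proj E F (S (proj E F x)) = 0"
    using assms(2,3) by (metis blinfun_apply_blinfun_compose zero_blinfun.rep_eq)+
  then show "blinfun_apply (lift E F (restr E F S)) x = S x"
    using proj(4)[OF E F] by (simp add: lift_apply[OF restr_Lop[OF assms(1)]] restr_apply)
qed

text \<open>\<open>lift E F T\<close> maps into \<open>F\<close> and vanishes on \<open>F\<close>,
  so its square is 0.\<close>

lemma shear_GL:
  assumes T: "T \<in> Lop sc E F"
  shows "id_blinfun + lift E F T \<in> GL sc" "op_inv (id_blinfun + lift E F T) = id_blinfun - lift E F T"
proof -
  have *: "(id_blinfun + lift E F T) o\<^sub>L (id_blinfun - lift E F T) = id_blinfun"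
    "(id_blinfun - lift E F T) o\<^sub>L (id_blinfun + lift E F T) = id_blinfun"
    by (simp_all add: blinfun_compose_algebra lift_lift[OF T T])
  then show "id_blinfun + lift E F T \<in> GL sc"
    by (intro GL_I[of _ "id_blinfun - lift E F T"] LX_closed lift_LX T)
  show "op_inv (id_blinfun + lift E F T) = id_blinfun - lift E F T" by (rule op_inv_eq) fact+
qed

text \<open>Turns charts into the action: a graph over \<open>E\<close> is the image of
  \<open>E\<close> under a shear, so statements on charts become statements on the orbit map of
  \<open>E\<close>.\<close>

lemma q_chart_eq:
  assumes T: "T \<in> Lop sc E F"
  shows "q_chart E T = image_act (id_blinfun + lift E F T) E"
  unfolding q_chart_def image_act_def
  by (rule image_cong) (simp_all add: blinfun.bilinear_simps lift_apply[OF T] proj(2)[OF E F])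

end

lemma image_act_comp: "image_act (W o\<^sub>L V) Y = image_act W (image_act V Y)"
  by (auto simp: image_act_def image_image)

lemma image_act_id: "image_act id_blinfun Y = Y"
  by (simp add: image_act_def)

text \<open>The image is also a preimage under the inverse operator, hence closed.\<close>

lemma image_act_subspace:
  assumes W: "W \<in> GL sc" and Y: "banach_subspace sc Y"
  shows "banach_subspace sc (image_act W Y)"
proof -
  note Y' = subspaceD[OF Y] and WL = GL_inv(1)[OF W]
  have "image_act W Y = blinfun_apply (op_inv W) -` Y"
  proof
    show "image_act W Y \<subseteq> blinfun_apply (op_inv W) -` Y"
      by (auto simp: image_act_def GL_apply[OF W])
    show "blinfun_apply (op_inv W) -` Y \<subseteq> image_act W Y"
    proof
      fix x assume "x \<in> blinfun_apply (op_inv W) -` Y"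
      then show "x \<in> image_act W Y"
        unfolding image_act_def using GL_apply(1)[OF W, of x] by (metis image_eqI vimageE)
    qed
  qed
  also have "closed \<dots>"
    by (intro closed_vimage Y'(4) linear_continuous_on blinfun.bounded_linear_right)
  finally have "closed (image_act W Y)" .
  moreover have "0 \<in> image_act W Y"
    unfolding image_act_def using Y'(1) by (metis blinfun.zero_right image_eqI)
  moreover have "x + y \<in> image_act W Y" if "x \<in> image_act W Y" "y \<in> image_act W Y" for x y
    using that Y'(2) unfolding image_act_def by (auto simp flip: blinfun.add_right)
  moreover have "sc a x \<in> image_act W Y" if "x \<in> image_act W Y" for a x
    using that Y'(3) unfolding image_act_def by (auto simp flip: LX_D[OF WL])
  ultimately show ?thesis unfolding subspace_iff by blast
qed

lemma image_act_complements:
  assumes W: "W \<in> GL sc" and E: "E \<in> complements sc F" and F: "banach_subspace sc F"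
  shows "image_act W E \<in> complements sc (image_act W F)"
proof (rule complementsI)
  show "banach_subspace sc (image_act W E)" by (rule image_act_subspace[OF W complementsD(1)[OF E]])
  have "inj (blinfun_apply W)" by (rule inj_on_inverseI[where g = "blinfun_apply (op_inv W)"]) (rule GL_apply[OF W])
  then have "image_act W E \<inter> image_act W F = blinfun_apply W ` (E \<inter> F)"
    unfolding image_act_def by (rule image_Int[symmetric])
  then show "image_act W E \<inter> image_act W F = {0}" using complementsD(2)[OF E] by simp
  fix x
  obtain e f where "e \<in> E" "f \<in> F" "op_inv W x = e + f" using complementsD(3)[OF E] by blast
  then have "x = W e + W f" using GL_apply(1)[OF W, of x] by (simp add: blinfun.add_right)
  then show "\<exists>e\<in>image_act W E. \<exists>f\<in>image_act W F. x = e + f"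
    unfolding image_act_def using \<open>e \<in> E\<close> \<open>f \<in> F\<close> by blast
qed

lemma image_act_grassmannian:
  assumes W: "W \<in> GL sc" and Y: "Y \<in> grassmannian sc"
  shows "image_act W Y \<in> grassmannian sc"
proof -
  note y = grassmannianD[OF Y]
  have inv: "image_act (op_inv W) (image_act W Y) = Y"
    by (simp add: GL_inv[OF W] image_act_id flip: image_act_comp)
  obtain F where F: "F \<in> complements sc Y" using y(4) by blast
  show ?thesis
  proof (rule grassmannianI)
    show "banach_subspace sc (image_act W Y)" by (rule image_act_subspace[OF W y(1)])
    show "image_act W F \<in> complements sc (image_act W Y)" by (rule image_act_complements[OF W F y(1)])
    show "image_act W Y \<noteq> {0}"
    proof
      assume "image_act W Y = {0}"
      with inv have "Y = {0}" by (simp add: image_act_def)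
      with y(2) show False by simp
    qed
    show "image_act W Y \<noteq> UNIV"
    proof
      assume "image_act W Y = UNIV"
      with inv have "Y = range (blinfun_apply (op_inv W))" by (simp add: image_act_def)
      moreover have "range (blinfun_apply (op_inv W)) = UNIV" using GL_apply(2)[OF W] by (rule surjI)
      ultimately show False using y(3) by simp
    qed
  qed
qed

lemma proj_unique:
  assumes E: "E \<in> complements sc F" and F: "banach_subspace sc F"
    and P: "\<And>x. x \<in> E \<Longrightarrow> blinfun_apply P x = x" "\<And>x. x \<in> F \<Longrightarrow> blinfun_apply P x = 0"
  shows "proj E F = P"
proof (rule blinfun_eqI)
  fix x
  obtain e f where "e \<in> E" "f \<in> F" "x = e + f" using complementsD(3)[OF E] by blast
  then show "proj E F x = P x" by (simp add: blinfun.add_right proj(2,3)[OF E F] P)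
qed

text \<open>For \<open>e\<close> in \<open>E\<close>, the projection of \<open>e\<close> onto
  \<open>Y\<close> along \<open>F\<close> differs from \<open>e\<close> by an element
  \<open>T e\<close> of \<open>F\<close>, and \<open>Y\<close> is the graph of this
  \<open>T\<close>. So the coordinate of \<open>Y\<close> is a component of that projection, a form
  in which its analytic dependence on \<open>Y\<close> can be computed.\<close>

lemma p_chart:
  assumes E: "E \<in> complements sc F" and F: "banach_subspace sc F"
  shows "T \<in> Lop sc E F \<Longrightarrow> q_chart E T \<in> complements sc F"
    and "T \<in> Lop sc E F \<Longrightarrow> p_chart sc E F (q_chart E T) = T"
    and "Y \<in> complements sc F \<Longrightarrow> p_chart sc E F Y = restr E F (proj Y F)"
    and "Y \<in> complements sc F \<Longrightarrow> p_chart sc E F Y \<in> Lop sc E F"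
    and "Y \<in> complements sc F \<Longrightarrow> q_chart E (p_chart sc E F Y) = Y"
proof -
  note pr = proj[OF E F]
  show q: "q_chart E T \<in> complements sc F" if T: "T \<in> Lop sc E F" for T
  proof -
    have "image_act (id_blinfun + lift E F T) F = (\<lambda>x. x) ` F"
      unfolding image_act_def
    proof (rule image_cong)
      fix x assume "x \<in> F"
      then have "lift E F T x = lbfun_apply T 0" by (simp add: lift_apply[OF E F T] pr(3))
      also have "\<dots> = 0" using norm_lbfun_apply[of T 0] by simp
      finally show "(id_blinfun + lift E F T) x = x" by (simp add: blinfun.bilinear_simps)
    qed simp
    then show ?thesis
      using image_act_complements[OF shear_GL(1)[OF E F T] E F] by (simp add: q_chart_eq[OF E F T])
  qed
  have inj: "inj_on (q_chart E) (Lop sc E F)"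
  proof (rule inj_onI)
    fix S T assume S: "S \<in> Lop sc E F" and T: "T \<in> Lop sc E F" and eq: "q_chart E S = q_chart E T"
    show "S = T"
    proof (rule lbfun_eqI)
      fix x
      show "lbfun_apply S x = lbfun_apply T x"
      proof (cases "x \<in> E")
        case True
        then have "x + lbfun_apply S x \<in> q_chart E S" unfolding q_chart_def by blast
        then have "x + lbfun_apply S x \<in> q_chart E T" by (simp only: eq)
        then obtain y where y: "y \<in> E" "x + lbfun_apply S x = y + lbfun_apply T y"
          unfolding q_chart_def by blast
        \<comment> \<open>The projection onto \<open>E\<close> along \<open>F\<close> recovers the
          base point from a point of the graph.\<close>
        have "proj E F (x + lbfun_apply S x) = x" "proj E F (y + lbfun_apply T y) = y"
          using True y(1) S T by (simp_all add: blinfun.add_right pr Lop_def)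
        then have "x = y" using y(2) by simp
        then show ?thesis using y(2) by simp
      next
        case False
        then show ?thesis using S T by (simp add: Lop_def)
      qed
    qed
  qed
  then show pq: "p_chart sc E F (q_chart E T) = T" if "T \<in> Lop sc E F" for T
    unfolding p_chart_def using that by (rule inv_into_f_f)
  have onto: "restr E F (proj Y F) \<in> Lop sc E F" "q_chart E (restr E F (proj Y F)) = Y"
    if Y: "Y \<in> complements sc F" for Y
  proof -
    note py = proj[OF Y F]
    show R: "restr E F (proj Y F) \<in> Lop sc E F" by (rule restr_Lop[OF E F py(1)])
    \<comment> \<open>\<open>e\<close> and its projection onto \<open>Y\<close> along
      \<open>F\<close> differ by an element of \<open>F\<close>, which \<open>proj E F\<close>
      kills.\<close>
    have RP: "proj E F (proj Y F e) = e" if "e \<in> E" for e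
    proof -
      have "proj E F (e - proj Y F e) = 0" using py(5)[of e] by (rule pr(3))
      then show ?thesis using that by (simp add: blinfun.diff_right pr(2))
    qed
    have *: "e + lbfun_apply (restr E F (proj Y F)) e = proj Y F e" if "e \<in> E" for e
      using that RP by (simp add: restr_apply)
    show "q_chart E (restr E F (proj Y F)) = Y"
    proof
      show "q_chart E (restr E F (proj Y F)) \<subseteq> Y" unfolding q_chart_def using * py(4) by auto
      show "Y \<subseteq> q_chart E (restr E F (proj Y F))"
      proof
        fix y assume y: "y \<in> Y"
        have "proj Y F (y - proj E F y) = 0" using pr(5) by (rule py(3))
        then have "y = proj Y F (proj E F y)" using py(2)[OF y] by (simp add: blinfun.diff_right)
        then have "y = proj E F y + lbfun_apply (restr E F (proj Y F)) (proj E F y)" using *[OF pr(4)] by simp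
        then show "y \<in> q_chart E (restr E F (proj Y F))" unfolding q_chart_def using pr(4) by blast
      qed
    qed
  qed
  fix Y assume Y: "Y \<in> complements sc F"
  show "p_chart sc E F Y = restr E F (proj Y F)" using pq[OF onto(1)[OF Y]] onto(2)[OF Y] by simp
  then show "p_chart sc E F Y \<in> Lop sc E F" "q_chart E (p_chart sc E F Y) = Y" using onto[OF Y] by simp_all
qed

text \<open>
  With \<open>P\<close> the projection onto \<open>W\<^sub>0 Y\<close> along \<open>F\<close>, the operator \<open>G = W W\<^sub>0\<^sup>-\<^sup>1 P + 1 - P\<close> fixes \<open>F\<close> pointwise
  and maps \<open>W\<^sub>0 Y\<close> to \<open>W Y\<close>, so that the projection onto \<open>W Y\<close> along \<open>F\<close> is \<open>G P G\<^sup>-\<^sup>1\<close>.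
\<close>

lemma image_act_analytic:
  assumes W0: "W0 \<in> GL sc" and Y: "image_act W0 Y \<in> complements sc F"
    and E: "E \<in> complements sc F" and F: "banach_subspace sc F"
  shows "nbhd_on (LX sc) W0 (\<lambda>W. image_act W Y \<in> complements sc F)"
    "analytic_pt scb (LX sc) scl (Lop sc E F) (\<lambda>W. p_chart sc E F (image_act W Y)) W0"
proof -
  define P where "P = proj (image_act W0 Y) F"
  note p = proj[OF Y F, folded P_def]
  define G where "G W = (W o\<^sub>L op_inv W0 o\<^sub>L P) + (id_blinfun - P)" for W
  have G0: "G W0 = id_blinfun" by (simp add: G_def GL_inv[OF W0])
  have Gan: "analytic_op scb (LX sc) G W0"
    unfolding G_def by (intro analytic_op_LX analytic_op_id GL_inv(1,2)[OF W0] p(1) LX_id)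
  have W0L: "nbhd_on (LX sc) W0 (\<lambda>W. W \<in> LX sc)"
    by (rule nbhd_on_mono[OF GL_nbhd[OF W0]]) (rule GL_inv(1))
  have nb: "nbhd_on (LX sc) W0 (\<lambda>W. G W \<in> GL sc)"
  proof (rule analytic_pt_nbhd_GL[OF LX_space])
    show "analytic_pt scb (LX sc) scb (LX sc) G W0" using Gan by (simp add: analytic_op_def)
    show "G W0 \<in> GL sc" by (simp add: G0 GL_id)
    show "nbhd_on (LX sc) W0 (\<lambda>W. G W \<in> LX sc)"
      by (rule nbhd_on_mono[OF W0L]) (simp add: G_def LX_closed GL_inv[OF W0] p)
  qed
  have *: "image_act W Y \<in> complements sc F \<and>
      p_chart sc E F (image_act W Y) = restr E F (G W o\<^sub>L P o\<^sub>L op_inv (G W))"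
    if W: "G W \<in> GL sc" for W
  proof -
    have GF: "G W x = x" if "x \<in> F" for x
      using that by (simp add: G_def blinfun.bilinear_simps p(3))
    have GY: "G W (W0 y) = W y" if "y \<in> Y" for y
    proof -
      have "W0 y \<in> image_act W0 Y" using that by (simp add: image_act_def)
      from p(2)[OF this] show ?thesis
        by (simp add: G_def blinfun.bilinear_simps GL_apply[OF W0])
    qed
    have "image_act (G W) F = (\<lambda>x. x) ` F" unfolding image_act_def by (rule image_cong) (auto simp: GF)
    moreover have GY': "image_act (G W) (image_act W0 Y) = image_act W Y"
      unfolding image_act_def image_image by (rule image_cong) (auto simp: GY)
    ultimately have c: "image_act W Y \<in> complements sc F" using image_act_complements[OF W Y F] by simp
    have "proj (image_act W Y) F = G W o\<^sub>L P o\<^sub>L op_inv (G W)"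
    proof (rule proj_unique[OF c F])
      fix x assume "x \<in> F"
      then have "op_inv (G W) x = x" using GF GL_apply(2)[OF W, of x] by simp
      then show "(G W o\<^sub>L P o\<^sub>L op_inv (G W)) x = 0" using p(3)[OF \<open>x \<in> F\<close>] by simp
    next
      fix x assume "x \<in> image_act W Y"
      then have "x \<in> image_act (G W) (image_act W0 Y)" by (simp only: GY')
      then obtain y where y: "y \<in> image_act W0 Y" "x = G W y"
        unfolding image_act_def[of "G W"] by (elim imageE) simp
      then show "(G W o\<^sub>L P o\<^sub>L op_inv (G W)) x = x" using p(2)[OF y(1)] by (simp add: GL_apply[OF W])
    qed
    then show ?thesis using c p_chart(3)[OF E F c] by simp
  qed
  show "nbhd_on (LX sc) W0 (\<lambda>W. image_act W Y \<in> complements sc F)"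
    by (rule nbhd_on_mono[OF nb]) (use * in blast)
  have Lop: "banach_subspace scl (Lop sc E F)" by (rule Lop_subspace[OF complementsD(1)[OF E] F])
  have op: "analytic_op scb (LX sc) (\<lambda>W. G W o\<^sub>L P o\<^sub>L op_inv (G W)) W0"
    by (intro analytic_op_LX Gan p(1)) (simp add: G0 GL_id)
  have "analytic_pt scb (LX sc) scl (Lop sc E F) (\<lambda>W. restr E F (G W o\<^sub>L P o\<^sub>L op_inv (G W))) W0"
  proof (rule analytic_pt_compose[OF LX_space LX_space banach_space_over_lbfun Lop])
    show "analytic_pt scb (LX sc) scb (LX sc) (\<lambda>W. G W o\<^sub>L P o\<^sub>L op_inv (G W)) W0"
      using op by (simp add: analytic_op_def)
    show "analytic_pt scb (LX sc) scl (Lop sc E F) (restr E F) (G W0 o\<^sub>L P o\<^sub>L op_inv (G W0))"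
      by (rule linear_between_analytic[OF banach_space_over_lbfun Lop restr_linear[OF E F]])
        (use op in \<open>simp add: analytic_op_def\<close>)
  qed
  then show "analytic_pt scb (LX sc) scl (Lop sc E F) (\<lambda>W. p_chart sc E F (image_act W Y)) W0"
    by (rule analytic_pt_cong) (rule nbhd_on_mono[OF nb], use * in simp)
qed

end

section \<open>The topology and the manifold structure of the Grassmannian\<close>

lemma infdist_image_le:
  fixes D :: "'x::real_normed_vector \<Rightarrow>\<^sub>L 'x"
  assumes "0 \<in> Y"
  shows "infdist x (blinfun_apply D ` Y) \<le> infdist x Y + 2 * norm (D - id_blinfun) * norm x"
proof -
  have Y: "Y \<noteq> {}" and 0: "0 \<in> blinfun_apply D ` Y"
    using assms blinfun.zero_right[of D] by (auto simp: image_iff intro!: bexI[of _ 0])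
  \<comment> \<open>A point \<open>y\<close> of norm above \<open>2 * norm x\<close> is at least as
    far from \<open>x\<close> as 0 is, and 0 lies in the image as well. Any other \<open>y\<close>
    is moved by \<open>D\<close> by at most \<open>norm (D - id_blinfun) * (2 * norm x)\<close>;
    hence the factor 2.\<close>
  have "infdist x (blinfun_apply D ` Y) - 2 * norm (D - id_blinfun) * norm x \<le> dist x y" if y: "y \<in> Y" for y
  proof (cases "norm y \<le> 2 * norm x")
    case True
    have "infdist x (blinfun_apply D ` Y) \<le> dist x (D y)" using y by (intro infdist_le) simp
    also have "\<dots> \<le> dist x y + norm ((D - id_blinfun) y)"
      using dist_triangle[of x "D y" y] by (simp add: dist_norm blinfun.diff_left norm_minus_commute)
    also have "norm ((D - id_blinfun) y) \<le> norm (D - id_blinfun) * (2 * norm x)"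
      by (rule order_trans[OF norm_blinfun mult_left_mono[OF True]]) simp
    finally show ?thesis by simp
  next
    case False
    have "infdist x (blinfun_apply D ` Y) \<le> dist x 0" using 0 by (rule infdist_le)
    also have "\<dots> \<le> dist x y" using False norm_triangle_ineq2[of y x] by (simp add: dist_norm norm_minus_commute)
    also have "\<dots> \<le> dist x y + 2 * norm (D - id_blinfun) * norm x" by simp
    finally show ?thesis by simp
  qed
  then have "infdist x (blinfun_apply D ` Y) - 2 * norm (D - id_blinfun) * norm x \<le> infdist x Y"
    unfolding infdist_notempty[OF Y] using Y by (intro cINF_greatest)
  then show ?thesis by simp
qed

context banach_space_over
begin

lemma grassmannian_topspace: "topspace (grassmannian_topology sc) = grassmannian sc"
proof
  have "{T \<in> Lop sc E F. q_chart E T \<in> grassmannian sc} = Lop sc E F"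
    if F: "F \<in> grassmannian sc" and E: "E \<in> complements sc F" for E F
    using p_chart(1)[OF E grassmannianD(1)[OF F]] complements_grassmannian[OF F] by blast
  then have "openin (grassmannian_topology sc) (grassmannian sc)"
    unfolding openin_grassmannian_topology by simp
  then show "grassmannian sc \<subseteq> topspace (grassmannian_topology sc)" by (rule openin_subset)
  show "topspace (grassmannian_topology sc) \<subseteq> grassmannian sc"
    using openin_grassmannian_topology[of sc "topspace (grassmannian_topology sc)"] by simp
qed

lemma grassmannian_manifold_simps [simp]:
  "mtop (grassmannian_manifold sc) = grassmannian_topology sc"
  "mscale (grassmannian_manifold sc) = scl"
  by (auto simp: grassmannian_manifold_def)

lemma grassmannian_atlas:
  "(C, \<phi>, V) \<in> atlas (grassmannian_manifold sc) \<longleftrightarrow> (\<exists>E F. C = complements sc F \<and>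
    \<phi> = p_chart sc E F \<and> V = Lop sc E F \<and> F \<in> grassmannian sc \<and> E \<in> complements sc F)"
  by (auto simp: grassmannian_manifold_def)

context
  fixes E F :: "'x set"
  assumes F: "F \<in> grassmannian sc" and E: "E \<in> complements sc F"
begin

lemmas Fs = grassmannianD(1)[OF F]
lemmas LopEF = banach_space_over_lbfun Lop_subspace[OF complementsD(1)[OF E] Fs]
lemmas pc = p_chart[OF E Fs]

lemma p_chart_image: "p_chart sc E F ` complements sc F = Lop sc E F"
proof
  show "p_chart sc E F ` complements sc F \<subseteq> Lop sc E F" using pc(4) by blast
  show "Lop sc E F \<subseteq> p_chart sc E F ` complements sc F"
    using pc(1,2) by (metis image_eqI subsetI)
qed

lemma p_chart_inj: "inj_on (p_chart sc E F) (complements sc F)"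
  by (rule inj_on_inverseI) (rule pc(5))

lemma inv_p_chart: "T \<in> Lop sc E F \<Longrightarrow> inv_into (complements sc F) (p_chart sc E F) T = q_chart E T"
  using pc(1,2) by (intro inv_into_f_eq[OF p_chart_inj])

lemma Lop_nbhd: "T \<in> Lop sc E F \<Longrightarrow> nbhd_on (Lop sc E F) T (\<lambda>S. S \<in> Lop sc E F)"
  unfolding nbhd_on_def using banach_space_over.subspaceD(2)[OF LopEF] by (intro exI[of _ 1]) simp

lemma analytic_lift:
  assumes "T \<in> Lop sc E F"
  shows "analytic_op scl (Lop sc E F) (lift E F) T"
  using linear_between_analytic[OF LX_space lift_linear[OF E Fs] assms] lift_LX[OF E Fs assms]
  by (simp add: analytic_op_def)

lemma analytic_shear:
  assumes "T \<in> Lop sc E F"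
  shows "analytic_op scl (Lop sc E F) (\<lambda>T. id_blinfun + lift E F T) T"
  by (intro analytic_op_intros[OF LopEF] analytic_lift assms LX_id)

text \<open>\<open>q_chart E T\<close> is the image of \<open>E\<close> under
  \<open>id_blinfun + lift E F T\<close>, which is affine in \<open>T\<close>. A change of charts is
  therefore the orbit map of \<open>E\<close> in the second chart, composed with an affine
  map.\<close>

lemma chart_change:
  assumes T: "T \<in> Lop sc E F" and F': "F' \<in> grassmannian sc" and E': "E' \<in> complements sc F'"
    and q: "q_chart E T \<in> complements sc F'"
  shows "nbhd_on (Lop sc E F) T (\<lambda>T. q_chart E T \<in> complements sc F')"
    "analytic_pt scl (Lop sc E F) scl (Lop sc E' F') (\<lambda>T. p_chart sc E' F' (q_chart E T)) T"
proof -
  let ?W = "\<lambda>T. id_blinfun + lift E F T"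
  have W: "?W T \<in> GL sc" by (rule shear_GL[OF E Fs T])
  have F's: "banach_subspace sc F'" by (rule grassmannianD(1)[OF F'])
  have q': "image_act (?W T) E \<in> complements sc F'" using q q_chart_eq[OF E Fs T] by simp
  have an: "analytic_pt scl (Lop sc E F) scb (LX sc) ?W T"
    using analytic_shear[OF T] by (simp add: analytic_op_def)
  note img = image_act_analytic[OF W q' E' F's]
  obtain e where e: "0 < e"
    "\<forall>h\<in>LX sc. norm h < e \<longrightarrow> image_act (?W T + h) E \<in> complements sc F'"
    using img(1) unfolding nbhd_on_def by blast
  show "nbhd_on (Lop sc E F) T (\<lambda>T. q_chart E T \<in> complements sc F')"
  proof (rule nbhd_on_mono[OF nbhd_on_conj[OF analytic_pt_cont[OF LopEF an e(1)] Lop_nbhd[OF T]]])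
    fix h assume h: "norm (?W (T + h) - ?W T) < e \<and> T + h \<in> Lop sc E F"
    then have "?W (T + h) - ?W T \<in> LX sc"
      using T by (intro LX_closed LX_id lift_LX[OF E Fs]) auto
    then have "image_act (?W T + (?W (T + h) - ?W T)) E \<in> complements sc F'" using e(2) h by blast
    then show "q_chart E (T + h) \<in> complements sc F'" using h q_chart_eq[OF E Fs] by simp
  qed
  have L': "banach_subspace scl (Lop sc E' F')" by (rule Lop_subspace[OF complementsD(1)[OF E'] F's])
  have "analytic_pt scl (Lop sc E F) scl (Lop sc E' F') (\<lambda>T. p_chart sc E' F' (image_act (?W T) E)) T"
    by (rule analytic_pt_compose[OF LopEF LX_space banach_space_over_lbfun L' an img(2)])
  then show "analytic_pt scl (Lop sc E F) scl (Lop sc E' F') (\<lambda>T. p_chart sc E' F' (q_chart E T)) T"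
    by (rule analytic_pt_cong)
      (rule nbhd_on_mono[OF Lop_nbhd[OF T]], simp add: q_chart_eq[OF E Fs])
qed

text \<open>\<open>?D S\<close> carries the graph of \<open>T\<close> onto that of \<open>S\<close>
  and tends to the identity as \<open>S\<close> tends to \<open>T\<close>; \<open>?D' S\<close>
  leads back. Both are used because \<open>infdist_image_le\<close> is one-sided.\<close>

lemma infdist_q_chart:
  assumes T: "T \<in> Lop sc E F" and e: "0 < e"
  shows "nbhd_on (Lop sc E F) T (\<lambda>S. \<bar>infdist x (q_chart E S) - infdist x (q_chart E T)\<bar> < e)"
proof -
  let ?D = "\<lambda>S. (id_blinfun + lift E F S) o\<^sub>L (id_blinfun - lift E F T)"
    and ?D' = "\<lambda>S. (id_blinfun + lift E F T) o\<^sub>L (id_blinfun - lift E F S)"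
  \<comment> \<open>Chosen so that \<open>2 * d * norm x < e\<close>, also when
    \<open>norm x\<close> is 0.\<close>
  define d where "d = e / (2 * norm x + 1)"
  have d: "0 < d" using e by (simp add: d_def add_nonneg_pos)
  have TL: "lift E F T \<in> LX sc" by (rule lift_LX[OF E Fs T])
  have DT: "?D T = id_blinfun" "?D' T = id_blinfun"
    by (simp_all add: blinfun_compose_algebra lift_lift[OF E Fs T T])
  have cont: "nbhd_on (Lop sc E F) T (\<lambda>S. norm (f S - f T) < d)"
    if "analytic_op scl (Lop sc E F) f T" for f :: "('x, 'x) lbfun \<Rightarrow> 'x \<Rightarrow>\<^sub>L 'x"
    using that unfolding analytic_op_def by (elim conjE) (rule analytic_pt_cont[OF LopEF _ d])
  have "analytic_op scl (Lop sc E F) ?D T" "analytic_op scl (Lop sc E F) ?D' T"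
    by (intro analytic_op_intros[OF LopEF] analytic_lift T LX_id TL)+
  from nbhd_on_conj[OF Lop_nbhd[OF T] nbhd_on_conj[OF cont[OF this(1)] cont[OF this(2)]]]
  show ?thesis unfolding DT
  proof (rule nbhd_on_mono)
    fix h assume h: "T + h \<in> Lop sc E F \<and> norm (?D (T + h) - id_blinfun) < d \<and> norm (?D' (T + h) - id_blinfun) < d"
    define S where "S = T + h"
    have S: "S \<in> Lop sc E F" "norm (?D S - id_blinfun) < d" "norm (?D' S - id_blinfun) < d"
      using h by (auto simp: S_def)
    note z = lift_lift[OF E Fs]
    have eq: "image_act (?D S) (q_chart E T) = q_chart E S" "image_act (?D' S) (q_chart E S) = q_chart E T"
      unfolding q_chart_eq[OF E Fs T] q_chart_eq[OF E Fs S(1)] image_act_comp[symmetric]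
      by (simp_all add: blinfun_compose_algebra z[OF T T] z[OF S(1) S(1)])
    have 0: "0 \<in> q_chart E T" "0 \<in> q_chart E S"
      using pc(1)[OF T] pc(1)[OF S(1)] subspaceD(1)[OF complementsD(1)] by auto
    have "2 * r * norm x < e" if "r < d" "0 \<le> r" for r
    proof -
      have "2 * r * norm x = r * (2 * norm x)" by simp
      also have "\<dots> \<le> r * (2 * norm x + 1)" using that by (intro mult_left_mono) auto
      also have "\<dots> < d * (2 * norm x + 1)" using that by (intro mult_strict_right_mono) (auto simp: add_nonneg_pos)
      also have "\<dots> = e" by (simp add: d_def add_nonneg_pos less_imp_neq[symmetric])
      finally show ?thesis .
    qed
    note small = this[OF S(2) norm_ge_zero] this[OF S(3) norm_ge_zero]
    have "infdist x (q_chart E S) \<le> infdist x (q_chart E T) + 2 * norm (?D S - id_blinfun) * norm x"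
      using infdist_image_le[OF 0(1), of x "?D S"] eq(1) by (simp add: image_act_def)
    moreover have "infdist x (q_chart E T) \<le> infdist x (q_chart E S) + 2 * norm (?D' S - id_blinfun) * norm x"
      using infdist_image_le[OF 0(2), of x "?D' S"] eq(2) by (simp add: image_act_def)
    ultimately show "\<bar>infdist x (q_chart E (T + h)) - infdist x (q_chart E T)\<bar> < e"
      using small unfolding S_def by linarith
  qed
qed

end

text \<open>The topology is final for the maps \<open>q_chart\<close>, so openness is tested in
  every \<open>Lop sc E F\<close>, where the distance is continuous.\<close>

lemma openin_infdist:
  assumes "open A"
  shows "openin (grassmannian_topology sc) {Y \<in> grassmannian sc. infdist x Y \<in> A}"
  unfolding openin_grassmannian_topology
proof (intro conjI ballI)
  fix F E assume FE: "F \<in> grassmannian sc" "E \<in> complements sc F"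
  note L = LopEF[OF FE]
  show "openin (top_of_set (Lop sc E F)) {T \<in> Lop sc E F. q_chart E T \<in> {Y \<in> grassmannian sc. infdist x Y \<in> A}}"
    unfolding openin_iff_nbhd_on[OF L]
  proof (intro conjI ballI)
    fix T assume "T \<in> {T \<in> Lop sc E F. q_chart E T \<in> {Y \<in> grassmannian sc. infdist x Y \<in> A}}"
    then have T: "T \<in> Lop sc E F" "infdist x (q_chart E T) \<in> A" by auto
    obtain e where e: "0 < e" "\<forall>y. dist y (infdist x (q_chart E T)) < e \<longrightarrow> y \<in> A"
      using assms T(2) unfolding open_dist by blast
    show "nbhd_on (Lop sc E F) T (\<lambda>T. T \<in> {T \<in> Lop sc E F. q_chart E T \<in> {Y \<in> grassmannian sc. infdist x Y \<in> A}})"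
    proof (rule nbhd_on_mono[OF nbhd_on_conj[OF Lop_nbhd[OF FE T(1)] infdist_q_chart[OF FE T(1) e(1)]]])
      fix h assume h: "T + h \<in> Lop sc E F \<and> \<bar>infdist x (q_chart E (T + h)) - infdist x (q_chart E T)\<bar> < e"
      then have "q_chart E (T + h) \<in> grassmannian sc"
        using pc(1)[OF FE] complements_grassmannian[OF FE(1)] by blast
      then show "T + h \<in> {T \<in> Lop sc E F. q_chart E T \<in> {Y \<in> grassmannian sc. infdist x Y \<in> A}}"
        using h e(2) by (simp add: dist_real_def)
    qed
  qed auto
qed auto

text \<open>Two points may have no chart in common, for instance subspaces of different finite
  dimension, so a global invariant is used: for \<open>x\<close> in \<open>Y\<close> but not in the
  closed subspace \<open>Z\<close>, the distance of \<open>x\<close> is 0 to \<open>Y\<close> and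
  positive to \<open>Z\<close>. Half of the latter separates them.\<close>

lemma grassmannian_Hausdorff: "Hausdorff_space (grassmannian_topology sc)"
  unfolding Hausdorff_space_def grassmannian_topspace
proof (intro allI impI)
  let ?X = "grassmannian_topology sc"
  have sep: "\<exists>U V. openin ?X U \<and> openin ?X V \<and> Y \<in> U \<and> Z \<in> V \<and> disjnt U V"
    if YZ: "Y \<in> grassmannian sc" "Z \<in> grassmannian sc" "x \<in> Y" "x \<notin> Z" for x Y Z
  proof -
    have "closed Z" "Z \<noteq> {}" using subspaceD(1,4)[OF grassmannianD(1)[OF YZ(2)]] by auto
    then have "infdist x Z \<noteq> 0" using YZ(4) in_closed_iff_infdist_zero by blast
    then have d: "0 < infdist x Z" using infdist_nonneg[of x Z] by simp
    let ?U = "{Y \<in> grassmannian sc. infdist x Y \<in> {..<infdist x Z / 2}}"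
      and ?V = "{Y \<in> grassmannian sc. infdist x Y \<in> {infdist x Z / 2<..}}"
    have "openin ?X ?U" "openin ?X ?V" by (intro openin_infdist open_lessThan open_greaterThan)+
    moreover have "Y \<in> ?U" "Z \<in> ?V" using YZ d by simp_all
    moreover have "disjnt ?U ?V" by (auto simp: disjnt_def)
    ultimately show ?thesis by blast
  qed
  fix Y Z assume YZ: "Y \<in> grassmannian sc \<and> Z \<in> grassmannian sc \<and> Y \<noteq> Z"
  show "\<exists>U V. openin ?X U \<and> openin ?X V \<and> Y \<in> U \<and> Z \<in> V \<and> disjnt U V"
  proof (cases "Y \<subseteq> Z")
    case False
    then show ?thesis using sep YZ by blast
  next
    case True
    then obtain x where "x \<in> Z" "x \<notin> Y" using YZ by blast
    then obtain U V where "openin ?X U" "openin ?X V" "Z \<in> U" "Y \<in> V" "disjnt U V"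
      using sep[of Z Y x] YZ by blast
    then show ?thesis using disjnt_sym by blast
  qed
qed

text \<open>The final topology has to be tested in all other charts too. There the set is a preimage
  of \<open>A\<close> under a change of charts, which is continuous on an open domain.\<close>

lemma openin_chart_preimage:
  assumes F: "F \<in> grassmannian sc" and E: "E \<in> complements sc F"
    and A: "openin (top_of_set (Lop sc E F)) A"
  shows "openin (grassmannian_topology sc) {Y \<in> complements sc F. p_chart sc E F Y \<in> A}"
  unfolding openin_grassmannian_topology
proof (intro conjI ballI)
  let ?S = "{Y \<in> complements sc F. p_chart sc E F Y \<in> A}"
  show "?S \<subseteq> grassmannian sc" using complements_grassmannian[OF F] by blast
  fix F' E' assume FE': "F' \<in> grassmannian sc" "E' \<in> complements sc F'"
  note L = LopEF[OF F E] and L' = LopEF[OF FE']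
  show "openin (top_of_set (Lop sc E' F')) {T \<in> Lop sc E' F'. q_chart E' T \<in> ?S}"
    unfolding openin_iff_nbhd_on[OF L']
  proof (intro conjI ballI)
    fix T assume "T \<in> {T \<in> Lop sc E' F'. q_chart E' T \<in> ?S}"
    then have T: "T \<in> Lop sc E' F'" "q_chart E' T \<in> complements sc F" "p_chart sc E F (q_chart E' T) \<in> A" by auto
    note cc = chart_change[OF FE' T(1) F E T(2)]
    have "nbhd_on (Lop sc E' F') T (\<lambda>T. p_chart sc E F (q_chart E' T) \<in> A)"
    proof (rule analytic_pt_nbhd_open[OF L' L cc(2) T(3)])
      show "A \<subseteq> Lop sc E F" using A by (rule openin_imp_subset)
      show "nbhd_on (Lop sc E F) (p_chart sc E F (q_chart E' T)) (\<lambda>S. S \<in> A)"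
        using A T(3) unfolding openin_iff_nbhd_on[OF L] by blast
      show "nbhd_on (Lop sc E' F') T (\<lambda>T. p_chart sc E F (q_chart E' T) \<in> Lop sc E F)"
        by (rule nbhd_on_mono[OF cc(1)]) (rule pc(4)[OF F E])
    qed
    from nbhd_on_conj[OF Lop_nbhd[OF FE' T(1)] nbhd_on_conj[OF cc(1) this]]
    show "nbhd_on (Lop sc E' F') T (\<lambda>T. T \<in> {T \<in> Lop sc E' F'. q_chart E' T \<in> ?S})"
      by (rule nbhd_on_mono) simp
  qed auto
qed

lemma p_chart_image_eq:
  assumes F: "F \<in> grassmannian sc" and E: "E \<in> complements sc F" and S: "S \<subseteq> complements sc F"
  shows "p_chart sc E F ` S = {T \<in> Lop sc E F. q_chart E T \<in> S}"
proof
  show "p_chart sc E F ` S \<subseteq> {T \<in> Lop sc E F. q_chart E T \<in> S}"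
  proof (rule image_subsetI)
    fix Y assume Y: "Y \<in> S"
    then have "Y \<in> complements sc F" using S by blast
    then show "p_chart sc E F Y \<in> {T \<in> Lop sc E F. q_chart E T \<in> S}" using pc(4,5)[OF F E] Y by simp
  qed
  show "{T \<in> Lop sc E F. q_chart E T \<in> S} \<subseteq> p_chart sc E F ` S"
  proof
    fix T assume "T \<in> {T \<in> Lop sc E F. q_chart E T \<in> S}"
    then show "T \<in> p_chart sc E F ` S" using pc(2)[OF F E, of T] by (metis (no_types, lifting) image_eqI mem_Collect_eq)
  qed
qed

lemma openin_chart_image:
  assumes F: "F \<in> grassmannian sc" and E: "E \<in> complements sc F"
    and S: "openin (grassmannian_topology sc) S" "S \<subseteq> complements sc F"
  shows "openin (top_of_set (Lop sc E F)) (p_chart sc E F ` S)"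
  unfolding p_chart_image_eq[OF F E S(2)] using S(1) F E unfolding openin_grassmannian_topology by blast

lemma openin_complements:
  assumes F: "F \<in> grassmannian sc"
  shows "openin (grassmannian_topology sc) (complements sc F)"
proof -
  obtain E where E: "E \<in> complements sc F" using grassmannianD(4)[OF F] by blast
  have "openin (grassmannian_topology sc) {Y \<in> complements sc F. p_chart sc E F Y \<in> Lop sc E F}"
    by (rule openin_chart_preimage[OF F E]) simp
  moreover have "{Y \<in> complements sc F. p_chart sc E F Y \<in> Lop sc E F} = complements sc F"
    using pc(4)[OF F E] by blast
  ultimately show ?thesis by simp
qed

lemma grassmannian_manifold: "banach_manifold (grassmannian_manifold sc)"
proof (rule banach_manifoldI; unfold grassmannian_manifold_simps)
  show "Hausdorff_space (grassmannian_topology sc)" by (rule grassmannian_Hausdorff)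
  show "(\<Union>(U, \<phi>, V)\<in>atlas (grassmannian_manifold sc). U) = topspace (grassmannian_topology sc)"
    unfolding grassmannian_topspace
  proof
    show "(\<Union>(U, \<phi>, V)\<in>atlas (grassmannian_manifold sc). U) \<subseteq> grassmannian sc"
      using complements_grassmannian by (auto simp: grassmannian_atlas)
    show "grassmannian sc \<subseteq> (\<Union>(U, \<phi>, V)\<in>atlas (grassmannian_manifold sc). U)"
    proof
      fix Y assume Y: "Y \<in> grassmannian sc"
      then obtain F where F: "F \<in> complements sc Y" using grassmannianD(4) by blast
      have "F \<in> grassmannian sc" by (rule complements_grassmannian[OF Y F])
      moreover have YF: "Y \<in> complements sc F" by (rule complements_commute[OF grassmannianD(1)[OF Y] F])
      \<comment> \<open>\<open>Y\<close> itself serves as the base space of a chart around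
        \<open>Y\<close>.\<close>
      ultimately have "(complements sc F, p_chart sc Y F, Lop sc Y F) \<in> atlas (grassmannian_manifold sc)"
        unfolding grassmannian_atlas by blast
      then show "Y \<in> (\<Union>(U, \<phi>, V)\<in>atlas (grassmannian_manifold sc). U)"
        using YF by (intro UN_I[of "(complements sc F, p_chart sc Y F, Lop sc Y F)"]) auto
    qed
  qed
next
  fix C \<phi> V assume "(C, \<phi>, V) \<in> atlas (grassmannian_manifold sc)"
  then obtain E F where c: "C = complements sc F" "\<phi> = p_chart sc E F" "V = Lop sc E F"
    and F: "F \<in> grassmannian sc" and E: "E \<in> complements sc F"
    unfolding grassmannian_atlas by blast
  have "homeomorphic_map (subtopology (grassmannian_topology sc) (complements sc F))
      (top_of_set (p_chart sc E F ` complements sc F)) (p_chart sc E F)"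
    by (rule homeomorphic_chart[where V = "Lop sc E F", OF openin_complements[OF F] p_chart_inj[OF F E]])
      (use p_chart_image[OF F E] openin_chart_preimage[OF F E] openin_chart_image[OF F E] in auto)
  then show "openin (grassmannian_topology sc) C \<and> banach_subspace scl V \<and> openin (top_of_set V) (\<phi> ` C) \<and>
       homeomorphic_map (subtopology (grassmannian_topology sc) C) (top_of_set (\<phi> ` C)) \<phi>"
    unfolding c using openin_complements[OF F] LopEF(2)[OF F E]
    by (simp add: p_chart_image[OF F E])
next
  fix C \<phi> V C' \<psi> V'
  assume "(C, \<phi>, V) \<in> atlas (grassmannian_manifold sc)" "(C', \<psi>, V') \<in> atlas (grassmannian_manifold sc)"
  then obtain E F E' F' where c: "C = complements sc F" "\<phi> = p_chart sc E F" "V = Lop sc E F"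
    "C' = complements sc F'" "\<psi> = p_chart sc E' F'" "V' = Lop sc E' F'"
    and F: "F \<in> grassmannian sc" and E: "E \<in> complements sc F"
    and F': "F' \<in> grassmannian sc" and E': "E' \<in> complements sc F'"
    unfolding grassmannian_atlas by blast
  have eq: "\<phi> ` (C \<inter> C') = {T \<in> Lop sc E F. q_chart E T \<in> complements sc F \<inter> complements sc F'}"
    unfolding c by (rule p_chart_image_eq[OF F E]) simp
  show "analytic_between scl V scl V' (\<phi> ` (C \<inter> C')) (\<psi> \<circ> inv_into C \<phi>)"
  proof (rule analytic_betweenI)
    show "banach_space_over scl" "banach_subspace scl V" unfolding c by (rule LopEF[OF F E])+
    show "openin (top_of_set V) (\<phi> ` (C \<inter> C'))"
      unfolding c by (intro openin_chart_image[OF F E] openin_Int openin_complements F F') simp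
    fix T assume "T \<in> \<phi> ` (C \<inter> C')"
    then have T: "T \<in> Lop sc E F" "q_chart E T \<in> complements sc F'" unfolding eq by auto
    show "(\<psi> \<circ> inv_into C \<phi>) T \<in> V'"
      unfolding c using T pc(4)[OF F' E'] by (simp add: inv_p_chart[OF F E])
    show "analytic_pt scl V scl V' (\<psi> \<circ> inv_into C \<phi>) T"
      unfolding c using chart_change(2)[OF F E T(1) F' E' T(2)]
      by (rule analytic_pt_cong) (rule nbhd_on_mono[OF Lop_nbhd[OF F E T(1)]], simp add: inv_p_chart[OF F E])
  qed
qed

text \<open>\<open>B\<close> consists of the operators that vanish on \<open>F\<close> and map into
  \<open>F\<close>. It is a copy of \<open>Lop sc E F\<close> inside L(X), where the charts of a
  homogeneous space take their values.\<close>

lemma operator_model: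
  assumes E: "E \<in> complements sc F" and F: "banach_subspace sc F"
  defines "B \<equiv> {S \<in> LX sc. S o\<^sub>L proj E F = S \<and> proj E F o\<^sub>L S = 0}"
  shows "banach_subspace scb B" "linear_between scl (Lop sc E F) scb B (lift E F)"
    "linear_between scb B scl (Lop sc E F) (restr E F)"
proof -
  interpret op: banach_space_over scb by (rule LX_space)
  have "B = LX sc \<inter> {S. S o\<^sub>L proj E F = S} \<inter> {S. proj E F o\<^sub>L S = 0}" by (auto simp: B_def)
  also have "closed \<dots>"
    by (intro closed_Int LX_closed(4) closed_Collect_eq continuous_intros
        bounded_bilinear.continuous_on[OF bounded_bilinear_blinfun_compose])
  finally have "closed B" .
  moreover have "scb a S o\<^sub>L proj E F = scb a (S o\<^sub>L proj E F)"
    "proj E F o\<^sub>L scb a S = scb a (proj E F o\<^sub>L S)" for a S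
    using proj(1)[OF E F] by (auto intro!: blinfun_eqI simp: LX_D)
  ultimately show "banach_subspace scb B"
    unfolding op.subspace_iff by (auto simp: B_def LX_closed blinfun_compose_algebra)
  show "linear_between scl (Lop sc E F) scb B (lift E F)"
    using lift_linear[OF E F] lift_proj[OF E F] unfolding linear_between_def B_def by blast
  show "linear_between scb B scl (Lop sc E F) (restr E F)"
    using restr_linear[OF E F] unfolding linear_between_def B_def by blast
qed

section \<open>The action of GL(X) on the Grassmannian\<close>

lemma grassmannian_action: "homogeneous_action sc (grassmannian_manifold sc) image_act"
proof (intro homogeneous_action.intro homogeneous_action_axioms.intro banach_space_over_axioms,
    unfold grassmannian_manifold_simps grassmannian_topspace)
  show "banach_manifold (grassmannian_manifold sc)" by (rule grassmannian_manifold)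
  show "banach_space_over scl" by (rule banach_space_over_lbfun)
  show "image_act W Y \<in> grassmannian sc" if "W \<in> GL sc" "Y \<in> grassmannian sc" for W Y
    using that by (rule image_act_grassmannian)
  show "image_act id_blinfun Y = Y" for Y :: "'x set" by (rule image_act_id)
  show "image_act (W o\<^sub>L V) Y = image_act W (image_act V Y)" for W V and Y :: "'x set"
    by (rule image_act_comp)
next
  fix C \<phi> V Y W
  assume "(C, \<phi>, V) \<in> atlas (grassmannian_manifold sc)" and W: "W \<in> GL sc" "image_act W Y \<in> C"
  then obtain E F where c: "C = complements sc F" "\<phi> = p_chart sc E F" "V = Lop sc E F"
    and F: "F \<in> grassmannian sc" and E: "E \<in> complements sc F"
    unfolding grassmannian_atlas by blast
  show "nbhd_on (LX sc) W (\<lambda>W. image_act W Y \<in> C) \<and>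
      analytic_pt scb (LX sc) scl V (\<lambda>W. \<phi> (image_act W Y)) W"
    unfolding c using image_act_analytic[OF W(1) W(2)[unfolded c] E grassmannianD(1)[OF F]] by blast
next
  fix C \<phi> V Y
  assume "(C, \<phi>, V) \<in> atlas (grassmannian_manifold sc)" and Y: "Y \<in> C"
  then obtain E F where c: "C = complements sc F" "\<phi> = p_chart sc E F" "V = Lop sc E F"
    and F: "F \<in> grassmannian sc" and E: "E \<in> complements sc F"
    unfolding grassmannian_atlas by blast
  note Fs' = grassmannianD(1)[OF F]
  define T0 where "T0 = p_chart sc E F Y"
  have T0: "T0 \<in> Lop sc E F" "q_chart E T0 = Y" using pc(4,5)[OF F E] Y by (auto simp: T0_def c)
  note g0 = shear_GL[OF E Fs' T0(1)]
  \<comment> \<open>\<open>id_blinfun - lift E F T0\<close> is the inverse of the shear with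
    \<open>T0\<close>, so \<open>g T\<close> carries \<open>Y\<close> back to \<open>E\<close> and
    then to the graph of \<open>T\<close>. Being affine in \<open>T\<close>, it is a section over
    the whole chart.\<close>
  define g where "g T = (id_blinfun + lift E F T) o\<^sub>L (id_blinfun - lift E F T0)" for T
  have an: "analytic_op scl (Lop sc E F) g T" if "T \<in> Lop sc E F" for T
    unfolding g_def
    by (intro analytic_op_intros[OF LopEF[OF F E]] analytic_lift[OF F E] that LX_id lift_LX[OF E Fs' T0(1)])
  have "analytic_between scl V scb (LX sc) (\<phi> ` C) g"
    unfolding c p_chart_image[OF F E]
    by (rule analytic_betweenI[OF LopEF[OF F E]]) (use an in \<open>auto simp: analytic_op_def\<close>)
  moreover have "g (\<phi> Y) = id_blinfun"
    by (simp add: g_def c T0_def[symmetric] blinfun_compose_algebra lift_lift[OF E Fs' T0(1) T0(1)])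
  moreover have "g T \<in> GL sc \<and> image_act (g T) Y = inv_into C \<phi> T" if T: "T \<in> \<phi> ` C" for T
  proof -
    have T: "T \<in> Lop sc E F" using T unfolding c p_chart_image[OF F E] .
    have gT: "g T = (id_blinfun + lift E F T) o\<^sub>L op_inv (id_blinfun + lift E F T0)"
      by (simp add: g_def g0(2))
    have "image_act (op_inv (id_blinfun + lift E F T0)) Y = E"
      unfolding T0(2)[symmetric] q_chart_eq[OF E Fs' T0(1)]
      by (simp add: GL_inv[OF g0(1)] image_act_id flip: image_act_comp)
    then have "image_act (g T) Y = q_chart E T"
      unfolding gT by (simp add: image_act_comp q_chart_eq[OF E Fs' T])
    then show ?thesis unfolding c inv_p_chart[OF F E T]
      using GL_comp(1)[OF shear_GL(1)[OF E Fs' T] GL_inv(3)[OF g0(1)]] by (simp add: gT)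
  qed
  ultimately show "\<exists>N g. \<phi> Y \<in> N \<and> N \<subseteq> \<phi> ` C \<and> g (\<phi> Y) = id_blinfun \<and>
        analytic_between scl V scb (LX sc) N g \<and>
        (\<forall>v\<in>N. g v \<in> GL sc \<and> image_act (g v) Y = inv_into C \<phi> v)"
    using Y by (intro exI[of _ "\<phi> ` C"] exI[of _ g] conjI ballI) auto
next
  fix Y assume Y: "Y \<in> grassmannian sc"
  then obtain F where F': "F \<in> complements sc Y" using grassmannianD(4) by blast
  have F: "F \<in> grassmannian sc" by (rule complements_grassmannian[OF Y F'])
  have YF: "Y \<in> complements sc F" by (rule complements_commute[OF grassmannianD(1)[OF Y] F'])
  note Fs' = grassmannianD(1)[OF F]
  let ?B = "{S \<in> LX sc. S o\<^sub>L proj Y F = S \<and> proj Y F o\<^sub>L S = 0}"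
  have "(complements sc F, p_chart sc Y F, Lop sc Y F) \<in> atlas (grassmannian_manifold sc)"
    unfolding grassmannian_atlas using F YF by blast
  moreover have "\<forall>v\<in>Lop sc Y F. restr Y F (lift Y F v) = v" by (simp add: restr_lift[OF YF Fs'])
  moreover have "\<forall>w\<in>?B. lift Y F (restr Y F w) = w" by (simp add: lift_restr[OF YF Fs'])
  moreover have "?B \<subseteq> LX sc" by blast
  ultimately show "\<exists>U \<phi> E E' J K. (U, \<phi>, E) \<in> atlas (grassmannian_manifold sc) \<and> Y \<in> U \<and>
      E' \<subseteq> LX sc \<and> banach_subspace scb E' \<and> linear_between scl E scb E' J \<and>
      linear_between scb E' scl E K \<and> (\<forall>v\<in>E. K (J v) = v) \<and> (\<forall>w\<in>E'. J (K w) = w)"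
    using YF operator_model[OF YF Fs'] by blast
qed

section \<open>Maps between homogeneous spaces and the range map \<open>kappa\<close>\<close>

lemma analytic_map_lcosets:
  assumes mfd: "banach_manifold (homogeneous_space sc H)" "banach_manifold (homogeneous_space sc H')"
    and f: "\<And>W. W \<in> GL sc \<Longrightarrow> f (lcoset W H) = lcoset W H'"
  shows "analytic_map (homogeneous_space sc H) (homogeneous_space sc H') f"
  unfolding analytic_map_def homogeneous_space_simps
proof (intro conjI mfd)
  have pre: "openin (quotient_topology sc H) {C \<in> lcosets sc H. f C \<in> U}"
    if U: "openin (quotient_topology sc H') U" for U
  proof -
    have "{W \<in> GL sc. lcoset W H \<in> {C \<in> lcosets sc H. f C \<in> U}} = {W \<in> GL sc. lcoset W H' \<in> U}"
      by (auto simp: f lcosets_def)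
    then show ?thesis using U unfolding openin_quotient_topology by auto
  qed
  show "continuous_map (quotient_topology sc H) (quotient_topology sc H') f"
    unfolding continuous_map topspace_quotient
  proof (intro conjI allI impI pre)
    show "f ` lcosets sc H \<subseteq> lcosets sc H'" by (auto simp: f lcosets_def)
  qed
  have "analytic_between scb V scb V' (\<phi> ` (U \<inter> f -` U')) (\<psi> \<circ> f \<circ> inv_into U \<phi>)"
    if c: "(U, \<phi>, V) \<in> atlas (homogeneous_space sc H)" "(U', \<psi>, V') \<in> atlas (homogeneous_space sc H')"
    for U \<phi> V U' \<psi> V'
  proof (rule analytic_betweenI)
    note C = homogeneous_atlasD[OF c(1)] and C' = homogeneous_atlasD[OF c(2)]
    show "banach_space_over scb" "banach_subspace scb V" by (fact LX_space(1), fact C(2))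
    have "U \<inter> f -` U' = U \<inter> {C \<in> lcosets sc H. f C \<in> U'}" using C(6) by blast
    then have "openin (quotient_topology sc H) (U \<inter> f -` U')"
      using pre[OF C'(1)] C(1) by (simp add: openin_Int)
    then show "openin (top_of_set V) (\<phi> ` (U \<inter> f -` U'))"
      by (rule homogeneous_chart_open[OF c(1)]) simp
    fix v assume "v \<in> \<phi> ` (U \<inter> f -` U')"
    then obtain C where C0: "C \<in> U" "f C \<in> U'" "v = \<phi> C" by blast
    then obtain W where W: "W \<in> GL sc" "C = lcoset W H" using C(6) unfolding lcosets_def by blast
    have fW: "lcoset W H' \<in> U'" using C0(2) W f by simp
    show "(\<psi> \<circ> f \<circ> inv_into U \<phi>) v \<in> V'" using C0 inv_into_f_f[OF C(4)] C'(7) by auto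
    \<comment> \<open>Pulled back to GL(X), the map sends \<open>W\<close> to the coordinate of its
      coset modulo \<open>H'\<close>, which is analytic by the definition of a chart of that
      quotient; \<open>homogeneous_chart_local\<close> then descends to the cosets of
      \<open>H\<close>.\<close>
    have "analytic_pt scb (LX sc) scb V' (\<lambda>W. (\<psi> \<circ> f) (lcoset W H)) W"
    proof (rule analytic_pt_cong)
      show "analytic_pt scb (LX sc) scb V' (\<lambda>W. \<psi> (lcoset W H')) W"
        using analytic_betweenD(3)[OF C'(8)] W(1) fW by simp
      show "nbhd_on (LX sc) W (\<lambda>W. \<psi> (lcoset W H') = (\<psi> \<circ> f) (lcoset W H))"
        by (rule nbhd_on_mono[OF GL_nbhd[OF W(1)]]) (simp add: f)
    qed
    then show "analytic_pt scb V scb V' (\<psi> \<circ> f \<circ> inv_into U \<phi>) v"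
      unfolding C0(3) W(2)
      by (rule homogeneous_chart_local[OF c(1) W(1) C0(1)[unfolded W(2)] LX_space(1) C'(2)])
  qed
  then show "\<forall>(U, \<phi>, V)\<in>atlas (homogeneous_space sc H). \<forall>(U', \<psi>, V')\<in>atlas (homogeneous_space sc H').
       analytic_between scb V scb V' (\<phi> ` (U \<inter> f -` U')) (\<psi> \<circ> f \<circ> inv_into U \<phi>)"
    by fast
qed

text \<open>The range of an idempotent is its fixed space, hence closed, and its kernel is a closed
  complement.\<close>

lemma kappa_grassmannian:
  assumes "Q \<in> idempotents sc"
  shows "kappa Q \<in> grassmannian sc"
proof -
  note Q = idempotentsD[OF assms]
  have QQ: "blinfun_apply Q (Q x) = Q x" for x using Q(2) by (metis blinfun_apply_blinfun_compose)
  have range: "kappa Q = {x. Q x = x}" unfolding kappa_def using QQ by (auto intro: rangeI) (metis rangeI)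
  have sub: "banach_subspace sc {x. Q x = x}" "banach_subspace sc {x. Q x = 0}"
    unfolding subspace_iff using LX_D[OF Q(1)]
    by (auto simp: blinfun.bilinear_simps
        intro!: closed_Collect_eq linear_continuous_on blinfun.bounded_linear_right continuous_intros)
  show ?thesis unfolding range
  proof (rule grassmannianI[OF sub(1)])
    show "{x. Q x = x} \<noteq> {0}"
    proof
      assume "{x. Q x = x} = {0}"
      then have "Q x = 0" for x using QQ[of x] by blast
      then have "Q = 0" by (intro blinfun_eqI) simp
      with Q(3) show False ..
    qed
    show "{x. Q x = x} \<noteq> UNIV"
    proof
      assume "{x. Q x = x} = UNIV"
      then have "Q = id_blinfun" by (intro blinfun_eqI) auto
      with Q(4) show False ..
    qed
    show "{x. Q x = 0} \<in> complements sc {x. Q x = x}"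
    proof (rule complementsI[OF sub(2)])
      show "{x. Q x = 0} \<inter> {x. Q x = x} = {0}" by auto
      show "\<exists>e\<in>{x. Q x = 0}. \<exists>f\<in>{x. Q x = x}. x = e + f" for x
        using QQ by (intro bexI[of _ "x - Q x"] bexI[of _ "Q x"]) (auto simp: blinfun.diff_right)
    qed
  qed
qed

text \<open>\<open>op_inv W\<close> is onto, so as innermost factor it does not affect the range.
  This equivariance of \<open>kappa\<close> yields both that \<open>upsilon0\<close> is well defined
  and that the square commutes.\<close>

lemma kappa_conj_act:
  assumes "W \<in> GL sc"
  shows "kappa (conj_act W Q) = image_act W (kappa Q)"
proof -
  have "range (blinfun_apply (op_inv W)) = UNIV" using GL_apply(2)[OF assms] by (rule surjI)
  then have "(\<lambda>x. W (Q (op_inv W x))) ` UNIV = (\<lambda>x. W (Q x)) ` UNIV" by (metis image_image)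
  then show ?thesis by (simp add: kappa_def conj_act_def image_act_def image_image)
qed

end

theorem corollary5p3:
  fixes sc :: "'k::{real_normed_field,banach} \<Rightarrow> 'x::banach \<Rightarrow> 'x"
  assumes "banach_space_over sc"
    and dim_gt_1: "\<exists>x y. x \<noteq> y \<and> \<not> module.dependent sc {x, y}"
  shows
    "((\<forall>Q\<in>idempotents sc. \<forall>W\<in>GL sc.
         Sigma_op Q (lcoset W (GL_fix_op sc Q)) = W o\<^sub>L Q o\<^sub>L op_inv W) \<and>
      (\<forall>R. orbit_representatives sc conj_act (idempotents sc) R \<longrightarrow>
         identified_with_disjoint_union (idempotent_manifold sc) R
           (\<lambda>Q. homogeneous_space sc (GL_fix_op sc Q)) Sigma_op (orbit sc conj_act)))
     \<and>
     ((\<forall>E\<in>grassmannian sc. \<forall>W\<in>GL sc.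
         Sigma_sp E (lcoset W (GL_fix_sp sc E)) = blinfun_apply W ` E) \<and>
      (\<forall>R. orbit_representatives sc image_act (grassmannian sc) R \<longrightarrow>
         identified_with_disjoint_union (grassmannian_manifold sc) R
           (\<lambda>E. homogeneous_space sc (GL_fix_sp sc E)) Sigma_sp (orbit sc image_act)))
     \<and>
     (\<forall>Q\<in>idempotents sc.
        (\<forall>W\<in>GL sc. upsilon0 sc Q (lcoset W (GL_fix_op sc Q)) =
           lcoset W (GL_fix_sp sc (kappa Q))) \<and>
        analytic_map (homogeneous_space sc (GL_fix_op sc Q))
          (homogeneous_space sc (GL_fix_sp sc (kappa Q))) (upsilon0 sc Q) \<and>
        (\<forall>C\<in>lcosets sc (GL_fix_op sc Q).
           kappa (Sigma_op Q C) = Sigma_sp (kappa Q) (upsilon0 sc Q C)))"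
proof -
  interpret banach_space_over sc by fact
  interpret I: homogeneous_action sc "idempotent_manifold sc" conj_act by (rule idempotent_action)
  interpret G: homogeneous_action sc "grassmannian_manifold sc" image_act by (rule grassmannian_action)
  have topI: "topspace (mtop (idempotent_manifold sc)) = idempotents sc" by simp
  have topG: "topspace (mtop (grassmannian_manifold sc)) = grassmannian sc"
    by (simp add: grassmannian_topspace)
  have SI: "Sigma_op = (\<lambda>Q. induced (\<lambda>W. conj_act W Q))" by (rule ext) (simp add: Sigma_op_def)
  have SG: "Sigma_sp = (\<lambda>E. induced (\<lambda>W. image_act W E))" by (rule ext) (simp add: Sigma_sp_def)
  have a: "Sigma_op Q (lcoset W (GL_fix_op sc Q)) = conj_act W Q"
    if "Q \<in> idempotents sc" "W \<in> GL sc" for Q W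
    unfolding SI using that I.Sig_lcoset by simp
  have b: "Sigma_sp E (lcoset W (GL_fix_sp sc E)) = image_act W E"
    if "E \<in> grassmannian sc" "W \<in> GL sc" for E W
    unfolding SG using that G.Sig_lcoset[unfolded topG] by simp
  have c: "upsilon0 sc Q (lcoset W (GL_fix_op sc Q)) = lcoset W (GL_fix_sp sc (kappa Q))"
    if Q: "Q \<in> idempotents sc" and W: "W \<in> GL sc" for Q W
  proof -
    note k = kappa_grassmannian[OF Q]
    have L: "lcoset W (GL_fix_op sc Q) = {W' \<in> GL sc. conj_act W' Q = conj_act W Q}"
      using I.lcoset_stabilizer[unfolded topI] Q W by simp
    \<comment> \<open>If \<open>V\<close> and \<open>W\<close> conjugate \<open>Q\<close> to the
      same idempotent, they carry its range to the same subspace. Hence each coset modulo the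
      stabilizer of \<open>Q\<close> lies in one coset modulo the stabilizer of its range.\<close>
    have "lcoset V (GL_fix_sp sc (kappa Q)) = lcoset W (GL_fix_sp sc (kappa Q))"
      if V: "V \<in> GL sc" "conj_act V Q = conj_act W Q" for V
    proof -
      have "image_act V (kappa Q) = image_act W (kappa Q)"
        using V kappa_conj_act[OF V(1), of Q] kappa_conj_act[OF W, of Q] by simp
      then show ?thesis using G.lcoset_eq_iff[unfolded topG, OF V(1) W k] by simp
    qed
    then have "(\<lambda>V. lcoset V (GL_fix_sp sc (kappa Q))) ` lcoset W (GL_fix_op sc Q) =
        {lcoset W (GL_fix_sp sc (kappa Q))}"
      unfolding L using W by blast
    then show ?thesis by (simp add: upsilon0_def induced_def)
  qed
  show ?thesis
  proof (intro conjI ballI allI impI)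
    show "Sigma_op Q (lcoset W (GL_fix_op sc Q)) = W o\<^sub>L Q o\<^sub>L op_inv W"
      if "Q \<in> idempotents sc" "W \<in> GL sc" for Q W
      using a[OF that] by (simp add: conj_act_def)
    show "identified_with_disjoint_union (idempotent_manifold sc) R
           (\<lambda>Q. homogeneous_space sc (GL_fix_op sc Q)) Sigma_op (orbit sc conj_act)"
      if "orbit_representatives sc conj_act (idempotents sc) R" for R
      unfolding SI by (rule I.identified_with_homogeneous_spaces[unfolded topI, OF that])
    show "Sigma_sp E (lcoset W (GL_fix_sp sc E)) = blinfun_apply W ` E"
      if "E \<in> grassmannian sc" "W \<in> GL sc" for E W
      using b[OF that] by (simp add: image_act_def)
    show "identified_with_disjoint_union (grassmannian_manifold sc) R
           (\<lambda>E. homogeneous_space sc (GL_fix_sp sc E)) Sigma_sp (orbit sc image_act)"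
      if "orbit_representatives sc image_act (grassmannian sc) R" for R
      unfolding SG by (rule G.identified_with_homogeneous_spaces[unfolded topG, OF that])
  next
    fix Q assume Q: "Q \<in> idempotents sc"
    note k = kappa_grassmannian[OF Q]
    show "upsilon0 sc Q (lcoset W (GL_fix_op sc Q)) = lcoset W (GL_fix_sp sc (kappa Q))"
      if "W \<in> GL sc" for W by (rule c[OF Q that])
    show "analytic_map (homogeneous_space sc (GL_fix_op sc Q))
          (homogeneous_space sc (GL_fix_sp sc (kappa Q))) (upsilon0 sc Q)"
      by (rule analytic_map_lcosets[OF I.homogeneous_space_manifold[unfolded topI, OF Q]
            G.homogeneous_space_manifold[unfolded topG, OF k] c[OF Q]])
    fix C assume "C \<in> lcosets sc (GL_fix_op sc Q)"
    then obtain W where W: "W \<in> GL sc" "C = lcoset W (GL_fix_op sc Q)" by (auto simp: lcosets_def)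
    show "kappa (Sigma_op Q C) = Sigma_sp (kappa Q) (upsilon0 sc Q C)"
      unfolding W(2) a[OF Q W(1)] c[OF Q W(1)] b[OF k W(1)] by (rule kappa_conj_act[OF W(1)])
  qed
qed

end
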